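(* Let $H$ be a finite-dimensional hereditary algebra over a field, let $\overline T$ be an almost complete basic tilting object in the cluster category $\mathcal C=D^b(H)/F$, and let $M$ be a complement of $\overline T$. Let $f:B\to M$ be a minimal right $\operatorname{add}\overline T$-approximation and $u:M\to B'$ a minimal left $\operatorname{add}\overline T$-approximation of $M$ in $\mathcal C$, and complete them to triangles $$M^{\ast}\to B\xrightarrow{f}M\to M^{\ast}[1],\qquad M\xrightarrow{u}B'\to M^{\ast\ast}\to M[1]$$ in $\mathcal C$. Then $M^{\ast}\simeq M^{\ast\ast}$, and this object is the unique (up to isomorphism) complement of $\overline T$ other than $M$.
   Context: Let $\mathcal D=D^b(H)$ be the bounded derived category of finitely generated $H$-modules, with shift $[1]$ and Auslander–Reiten translation $\tau$ (an autoequivalence), and let $F=\tau^{-1}[1]$. The cluster category $\mathcal C=\mathcal D/F$ has as objects the $F$-orbits $\widetilde X$ of objects $X$ of $\mathcal D$, and $\operatorname{Hom}_{\mathcal C}(\widetilde X,\widetilde Y)=\coprod_{i\in\mathbb Z}\operatorname{Hom}_{\mathcal D}(F^iX,Y)$. It is a Krull–Schmidt triangulated category, with shift induced by $[1]$, and $\mathcal D\to\mathcal C$ is a triangle functor. Put $\operatorname{Ext}^1_{\mathcal C}(U,V)=\operatorname{Hom}_{\mathcal C}(U,V[1])$. An object $T$ of $\mathcal C$ is exceptional if $\operatorname{Ext}^1_{\mathcal C}(T,T)=0$, and a tilting object if it is exceptional and has a maximal number of non-isomorphic indecomposable direct summands; it is basic if its indecomposable summands are pairwise non-isomorphic. Maximality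 is understood so that a basic object is a tilting object if and only if the set of its indecomposable summands is maximal (under inclusion) among sets of non-isomorphic indecomposables with pairwise (including self) vanishing $\operatorname{Ext}^1_{\mathcal C}$. A basic exceptional object $\overline T$ is an almost complete basic tilting object if there is an indecomposable $M$ with $\overline T\coprod M$ a basic tilting object; any such $M$ is called a complement of $\overline T$. A right $\operatorname{add}\overline T$-approximation of $M$ is a map $f:B\to M$ with $B\in\operatorname{add}\overline T$ such that $\operatorname{Hom}_{\mathcal C}(X,B)\to\operatorname{Hom}_{\mathcal C}(X,M)$ is surjective for all $X\in\operatorname{add}\overline T$; it is minimal if every $g:B\to B$ with $fg=f$ is an isomorphism. Minimal left approximations are defined dually. *)

theory Defs
  imports "HOL-Algebra.Module" "HOL-Algebra.AbelCoset"
begin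

section \<open>Linear categories and functors\<close>

text \<open>
  Hom-spaces carry the record type of modules; its ring fields \<open>mult\<close> and \<open>one\<close> play no role.
  Different hom-spaces may overlap as sets, so composition and the action of a functor on
  morphisms take the objects as arguments: for \<open>f\<close> from \<open>X\<close> to \<open>Y\<close> and \<open>g\<close> from \<open>Y\<close> to \<open>Z\<close>,
  the composite is \<open>cmp C X Y Z g f\<close>.
\<close>

record ('k, 'o, 'm) lincat =
  Ob :: "'o set"
  Mor :: "'o \<Rightarrow> 'o \<Rightarrow> ('k, 'm) module"
  idm :: "'o \<Rightarrow> 'm"
  cmp :: "'o \<Rightarrow> 'o \<Rightarrow> 'o \<Rightarrow> 'm \<Rightarrow> 'm \<Rightarrow> 'm"

abbreviation mors :: "('k, 'o, 'm) lincat \<Rightarrow> 'o \<Rightarrow> 'o \<Rightarrow> 'm set" where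
  "mors C X Y \<equiv> carrier (Mor C X Y)"

definition lin_space :: "'m set \<Rightarrow> 'm \<Rightarrow> ('m \<Rightarrow> 'm \<Rightarrow> 'm) \<Rightarrow> ('k \<Rightarrow> 'm \<Rightarrow> 'm) \<Rightarrow> ('k, 'm) module" where
  "lin_space A z p s =
     \<lparr>carrier = A, mult = undefined, one = undefined, zero = z, add = p, smult = s\<rparr>"

locale linear_category =
  fixes K :: "'k ring" and C :: "('k, 'o, 'm) lincat"
  assumes K_field: "field K"
    and mor_module: "\<lbrakk>X \<in> Ob C; Y \<in> Ob C\<rbrakk> \<Longrightarrow> module K (Mor C X Y)"
    and idm_closed: "X \<in> Ob C \<Longrightarrow> idm C X \<in> mors C X X"
    and cmp_closed: "\<lbrakk>X \<in> Ob C; Y \<in> Ob C; Z \<in> Ob C; f \<in> mors C X Y; g \<in> mors C Y Z\<rbrakk>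
      \<Longrightarrow> cmp C X Y Z g f \<in> mors C X Z"
    and cmp_assoc: "\<lbrakk>W \<in> Ob C; X \<in> Ob C; Y \<in> Ob C; Z \<in> Ob C;
        f \<in> mors C W X; g \<in> mors C X Y; h \<in> mors C Y Z\<rbrakk>
      \<Longrightarrow> cmp C W X Z (cmp C X Y Z h g) f = cmp C W Y Z h (cmp C W X Y g f)"
    and cmp_id_left: "\<lbrakk>X \<in> Ob C; Y \<in> Ob C; f \<in> mors C X Y\<rbrakk> \<Longrightarrow> cmp C X Y Y (idm C Y) f = f"
    and cmp_id_right: "\<lbrakk>X \<in> Ob C; Y \<in> Ob C; f \<in> mors C X Y\<rbrakk> \<Longrightarrow> cmp C X X Y f (idm C X) = f"
    and cmp_add_left: "\<lbrakk>X \<in> Ob C; Y \<in> Ob C; Z \<in> Ob C; f \<in> mors C X Y; g \<in> mors C Y Z; h \<in> mors C Y Z\<rbrakk>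
      \<Longrightarrow> cmp C X Y Z (g \<oplus>\<^bsub>Mor C Y Z\<^esub> h) f = cmp C X Y Z g f \<oplus>\<^bsub>Mor C X Z\<^esub> cmp C X Y Z h f"
    and cmp_add_right: "\<lbrakk>X \<in> Ob C; Y \<in> Ob C; Z \<in> Ob C; f \<in> mors C X Y; g \<in> mors C X Y; h \<in> mors C Y Z\<rbrakk>
      \<Longrightarrow> cmp C X Y Z h (f \<oplus>\<^bsub>Mor C X Y\<^esub> g) = cmp C X Y Z h f \<oplus>\<^bsub>Mor C X Z\<^esub> cmp C X Y Z h g"
    and cmp_smult_left: "\<lbrakk>X \<in> Ob C; Y \<in> Ob C; Z \<in> Ob C; a \<in> carrier K; f \<in> mors C X Y; g \<in> mors C Y Z\<rbrakk>
      \<Longrightarrow> cmp C X Y Z (a \<odot>\<^bsub>Mor C Y Z\<^esub> g) f = a \<odot>\<^bsub>Mor C X Z\<^esub> cmp C X Y Z g f"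
    and cmp_smult_right: "\<lbrakk>X \<in> Ob C; Y \<in> Ob C; Z \<in> Ob C; a \<in> carrier K; f \<in> mors C X Y; g \<in> mors C Y Z\<rbrakk>
      \<Longrightarrow> cmp C X Y Z g (a \<odot>\<^bsub>Mor C X Y\<^esub> f) = a \<odot>\<^bsub>Mor C X Z\<^esub> cmp C X Y Z g f"

definition is_inverse :: "('k, 'o, 'm) lincat \<Rightarrow> 'o \<Rightarrow> 'o \<Rightarrow> 'm \<Rightarrow> 'm \<Rightarrow> bool" where
  "is_inverse C X Y f g \<longleftrightarrow> f \<in> mors C X Y \<and> g \<in> mors C Y X \<and>
     cmp C X Y X g f = idm C X \<and> cmp C Y X Y f g = idm C Y"

definition is_iso :: "('k, 'o, 'm) lincat \<Rightarrow> 'o \<Rightarrow> 'o \<Rightarrow> 'm \<Rightarrow> bool" where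
  "is_iso C X Y f \<longleftrightarrow> (\<exists>g. is_inverse C X Y f g)"

definition inverse_mor :: "('k, 'o, 'm) lincat \<Rightarrow> 'o \<Rightarrow> 'o \<Rightarrow> 'm \<Rightarrow> 'm" where
  "inverse_mor C X Y f = (THE g. is_inverse C X Y f g)"

definition isomorphic :: "('k, 'o, 'm) lincat \<Rightarrow> 'o \<Rightarrow> 'o \<Rightarrow> bool" where
  "isomorphic C X Y \<longleftrightarrow> X \<in> Ob C \<and> Y \<in> Ob C \<and> (\<exists>f. is_iso C X Y f)"

definition zero_object :: "('k, 'o, 'm) lincat \<Rightarrow> 'o \<Rightarrow> bool" where
  "zero_object C Z \<longleftrightarrow> Z \<in> Ob C \<and> idm C Z = \<zero>\<^bsub>Mor C Z Z\<^esub>"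

definition biproduct ::
  "('k, 'o, 'm) lincat \<Rightarrow> 'o \<Rightarrow> 'i set \<Rightarrow> ('i \<Rightarrow> 'o) \<Rightarrow> ('i \<Rightarrow> 'm) \<Rightarrow> ('i \<Rightarrow> 'm) \<Rightarrow> bool" where
  "biproduct C Z I X j p \<longleftrightarrow> finite I \<and> Z \<in> Ob C \<and>
     (\<forall>i\<in>I. X i \<in> Ob C \<and> j i \<in> mors C (X i) Z \<and> p i \<in> mors C Z (X i)) \<and>
     (\<forall>i\<in>I. \<forall>l\<in>I. cmp C (X i) Z (X l) (p l) (j i) =
        (if i = l then idm C (X i) else \<zero>\<^bsub>Mor C (X i) (X l)\<^esub>)) \<and>
     (\<Oplus>\<^bsub>Mor C Z Z\<^esub>i\<in>I. cmp C Z (X i) Z (j i) (p i)) = idm C Z"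

definition direct_sum :: "('k, 'o, 'm) lincat \<Rightarrow> 'o \<Rightarrow> 'i set \<Rightarrow> ('i \<Rightarrow> 'o) \<Rightarrow> bool" where
  "direct_sum C Z I X \<longleftrightarrow> (\<exists>j p. biproduct C Z I X j p)"

abbreviation pair_fam :: "'o \<Rightarrow> 'o \<Rightarrow> bool \<Rightarrow> 'o" where
  "pair_fam X Y \<equiv> \<lambda>b. if b then X else Y"

definition direct_sum2 :: "('k, 'o, 'm) lincat \<Rightarrow> 'o \<Rightarrow> 'o \<Rightarrow> 'o \<Rightarrow> bool" where
  "direct_sum2 C Z X Y \<longleftrightarrow> direct_sum C Z UNIV (pair_fam X Y)"

definition additive_category :: "'k ring \<Rightarrow> ('k, 'o, 'm) lincat \<Rightarrow> bool" where
  "additive_category K C \<longleftrightarrow> linear_category K C \<and> (\<exists>Z. zero_object C Z) \<and>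
     (\<forall>X\<in>Ob C. \<forall>Y\<in>Ob C. \<exists>Z. direct_sum2 C Z X Y)"

record ('o, 'm, 'p, 'n) cfunctor =
  fob :: "'o \<Rightarrow> 'p"
  fmor :: "'o \<Rightarrow> 'o \<Rightarrow> 'm \<Rightarrow> 'n"

definition fid :: "('o, 'm, 'o, 'm) cfunctor" where
  "fid = \<lparr>fob = (\<lambda>X. X), fmor = (\<lambda>X Y f. f)\<rparr>"

definition fcomp ::
  "('p, 'n, 'q, 'r) cfunctor \<Rightarrow> ('o, 'm, 'p, 'n) cfunctor \<Rightarrow> ('o, 'm, 'q, 'r) cfunctor" where
  "fcomp G F = \<lparr>fob = (\<lambda>X. fob G (fob F X)),
                fmor = (\<lambda>X Y f. fmor G (fob F X) (fob F Y) (fmor F X Y f))\<rparr>"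

locale linear_functor =
  fixes K :: "'k ring" and C :: "('k, 'o, 'm) lincat" and C' :: "('k, 'p, 'n) lincat"
    and F :: "('o, 'm, 'p, 'n) cfunctor"
  assumes fob_closed: "X \<in> Ob C \<Longrightarrow> fob F X \<in> Ob C'"
    and fmor_closed: "\<lbrakk>X \<in> Ob C; Y \<in> Ob C; f \<in> mors C X Y\<rbrakk>
      \<Longrightarrow> fmor F X Y f \<in> mors C' (fob F X) (fob F Y)"
    and fmor_id: "X \<in> Ob C \<Longrightarrow> fmor F X X (idm C X) = idm C' (fob F X)"
    and fmor_cmp: "\<lbrakk>X \<in> Ob C; Y \<in> Ob C; Z \<in> Ob C; f \<in> mors C X Y; g \<in> mors C Y Z\<rbrakk>
      \<Longrightarrow> fmor F X Z (cmp C X Y Z g f) =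
          cmp C' (fob F X) (fob F Y) (fob F Z) (fmor F Y Z g) (fmor F X Y f)"
    and fmor_add: "\<lbrakk>X \<in> Ob C; Y \<in> Ob C; f \<in> mors C X Y; g \<in> mors C X Y\<rbrakk>
      \<Longrightarrow> fmor F X Y (f \<oplus>\<^bsub>Mor C X Y\<^esub> g) =
          fmor F X Y f \<oplus>\<^bsub>Mor C' (fob F X) (fob F Y)\<^esub> fmor F X Y g"
    and fmor_smult: "\<lbrakk>X \<in> Ob C; Y \<in> Ob C; a \<in> carrier K; f \<in> mors C X Y\<rbrakk>
      \<Longrightarrow> fmor F X Y (a \<odot>\<^bsub>Mor C X Y\<^esub> f) = a \<odot>\<^bsub>Mor C' (fob F X) (fob F Y)\<^esub> fmor F X Y f"

definition fully_faithful ::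
  "('k, 'o, 'm) lincat \<Rightarrow> ('k, 'p, 'n) lincat \<Rightarrow> ('o, 'm, 'p, 'n) cfunctor \<Rightarrow> bool" where
  "fully_faithful C C' F \<longleftrightarrow> (\<forall>X\<in>Ob C. \<forall>Y\<in>Ob C.
     bij_betw (fmor F X Y) (mors C X Y) (mors C' (fob F X) (fob F Y)))"

definition equivalence ::
  "'k ring \<Rightarrow> ('k, 'o, 'm) lincat \<Rightarrow> ('k, 'p, 'n) lincat \<Rightarrow> ('o, 'm, 'p, 'n) cfunctor \<Rightarrow> bool" where
  "equivalence K C C' F \<longleftrightarrow> linear_functor K C C' F \<and> fully_faithful C C' F \<and>
     (\<forall>Y\<in>Ob C'. \<exists>X\<in>Ob C. isomorphic C' (fob F X) Y)"

definition automorphism :: "'k ring \<Rightarrow> ('k, 'o, 'm) lincat \<Rightarrow> ('o, 'm, 'o, 'm) cfunctor \<Rightarrow> bool" where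
  "automorphism K C F \<longleftrightarrow> linear_functor K C C F \<and> fully_faithful C C F \<and>
     bij_betw (fob F) (Ob C) (Ob C)"

definition finv :: "('k, 'o, 'm) lincat \<Rightarrow> ('o, 'm, 'o, 'm) cfunctor \<Rightarrow> ('o, 'm, 'o, 'm) cfunctor" where
  "finv C F = (let G = inv_into (Ob C) (fob F) in
     \<lparr>fob = G, fmor = (\<lambda>X Y. inv_into (mors C (G X) (G Y)) (fmor F (G X) (G Y)))\<rparr>)"

primrec fiter :: "('o, 'm, 'o, 'm) cfunctor \<Rightarrow> nat \<Rightarrow> ('o, 'm, 'o, 'm) cfunctor" where
  "fiter F 0 = fid"
| "fiter F (Suc n) = fcomp F (fiter F n)"

definition fpow ::
  "('k, 'o, 'm) lincat \<Rightarrow> ('o, 'm, 'o, 'm) cfunctor \<Rightarrow> int \<Rightarrow> ('o, 'm, 'o, 'm) cfunctor" where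
  "fpow C F i = (if 0 \<le> i then fiter F (nat i) else fiter (finv C F) (nat (- i)))"

definition natural_iso ::
  "('k, 'o, 'm) lincat \<Rightarrow> ('k, 'p, 'n) lincat \<Rightarrow> ('o, 'm, 'p, 'n) cfunctor \<Rightarrow>
   ('o, 'm, 'p, 'n) cfunctor \<Rightarrow> ('o \<Rightarrow> 'n) \<Rightarrow> bool" where
  "natural_iso C C' F G \<eta> \<longleftrightarrow>
     (\<forall>X\<in>Ob C. is_iso C' (fob F X) (fob G X) (\<eta> X)) \<and>
     (\<forall>X\<in>Ob C. \<forall>Y\<in>Ob C. \<forall>f\<in>mors C X Y.
        cmp C' (fob F X) (fob F Y) (fob G Y) (\<eta> Y) (fmor F X Y f) =
        cmp C' (fob F X) (fob G X) (fob G Y) (fmor G X Y f) (\<eta> X))"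


section \<open>Triangulated categories\<close>

text \<open>\<open>(X, Y, Z, u, v, w)\<close> stands for \<open>X \<rightarrow> Y \<rightarrow> Z \<rightarrow> \<Sigma>X\<close> with maps \<open>u\<close>, \<open>v\<close>, \<open>w\<close>.\<close>

type_synonym ('o, 'm) tri = "'o \<times> 'o \<times> 'o \<times> 'm \<times> 'm \<times> 'm"

definition candidate_triangle ::
  "('k, 'o, 'm) lincat \<Rightarrow> ('o, 'm, 'o, 'm) cfunctor \<Rightarrow> ('o, 'm) tri \<Rightarrow> bool" where
  "candidate_triangle C \<Sigma> = (\<lambda>(X, Y, Z, u, v, w). X \<in> Ob C \<and> Y \<in> Ob C \<and> Z \<in> Ob C \<and>
     u \<in> mors C X Y \<and> v \<in> mors C Y Z \<and> w \<in> mors C Z (fob \<Sigma> X))"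

definition triangle_map ::
  "('k, 'o, 'm) lincat \<Rightarrow> ('o, 'm, 'o, 'm) cfunctor \<Rightarrow> ('o, 'm) tri \<Rightarrow> ('o, 'm) tri
   \<Rightarrow> 'm \<Rightarrow> 'm \<Rightarrow> 'm \<Rightarrow> bool" where
  "triangle_map C \<Sigma> = (\<lambda>(X, Y, Z, u, v, w) (X', Y', Z', u', v', w') a b c.
     a \<in> mors C X X' \<and> b \<in> mors C Y Y' \<and> c \<in> mors C Z Z' \<and>
     cmp C X Y Y' b u = cmp C X X' Y' u' a \<and>
     cmp C Y Z Z' c v = cmp C Y Y' Z' v' b \<and>
     cmp C Z (fob \<Sigma> X) (fob \<Sigma> X') (fmor \<Sigma> X X' a) w = cmp C Z Z' (fob \<Sigma> X') w' c)"

definition triangle_iso ::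
  "('k, 'o, 'm) lincat \<Rightarrow> ('o, 'm, 'o, 'm) cfunctor \<Rightarrow> ('o, 'm) tri \<Rightarrow> ('o, 'm) tri \<Rightarrow> bool" where
  "triangle_iso C \<Sigma> = (\<lambda>(X, Y, Z, u, v, w) (X', Y', Z', u', v', w').
     \<exists>a b c. triangle_map C \<Sigma> (X, Y, Z, u, v, w) (X', Y', Z', u', v', w') a b c \<and>
       is_iso C X X' a \<and> is_iso C Y Y' b \<and> is_iso C Z Z' c)"

locale triangulated_category =
  fixes K :: "'k ring" and C :: "('k, 'o, 'm) lincat"
    and \<Sigma> :: "('o, 'm, 'o, 'm) cfunctor" and \<Delta> :: "('o, 'm) tri set"
  assumes additive: "additive_category K C"
    and shift_automorphism: "automorphism K C \<Sigma>"
    and triangle_candidate: "t \<in> \<Delta> \<Longrightarrow> candidate_triangle C \<Sigma> t"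
    and TR1_iso: "\<lbrakk>t \<in> \<Delta>; candidate_triangle C \<Sigma> t'; triangle_iso C \<Sigma> t t'\<rbrakk> \<Longrightarrow> t' \<in> \<Delta>"
    and TR1_id: "\<lbrakk>X \<in> Ob C; zero_object C Z\<rbrakk>
      \<Longrightarrow> (X, X, Z, idm C X, \<zero>\<^bsub>Mor C X Z\<^esub>, \<zero>\<^bsub>Mor C Z (fob \<Sigma> X)\<^esub>) \<in> \<Delta>"
    and TR1_complete: "\<lbrakk>X \<in> Ob C; Y \<in> Ob C; u \<in> mors C X Y\<rbrakk> \<Longrightarrow> \<exists>Z v w. (X, Y, Z, u, v, w) \<in> \<Delta>"
    and TR2: "candidate_triangle C \<Sigma> (X, Y, Z, u, v, w)
      \<Longrightarrow> (X, Y, Z, u, v, w) \<in> \<Delta> \<longleftrightarrow>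
          (Y, Z, fob \<Sigma> X, v, w, \<ominus>\<^bsub>Mor C (fob \<Sigma> X) (fob \<Sigma> Y)\<^esub> fmor \<Sigma> X Y u) \<in> \<Delta>"
    and TR3: "\<lbrakk>(X, Y, Z, u, v, w) \<in> \<Delta>; (X', Y', Z', u', v', w') \<in> \<Delta>;
        a \<in> mors C X X'; b \<in> mors C Y Y'; cmp C X Y Y' b u = cmp C X X' Y' u' a\<rbrakk>
      \<Longrightarrow> \<exists>c. triangle_map C \<Sigma> (X, Y, Z, u, v, w) (X', Y', Z', u', v', w') a b c"
    and TR4: "\<lbrakk>(X, Y, Z', u, j, k) \<in> \<Delta>; (Y, Z, X', v, l, m) \<in> \<Delta>;
        (X, Z, Y', cmp C X Y Z v u, n, q) \<in> \<Delta>\<rbrakk>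
      \<Longrightarrow> \<exists>f g. (Z', Y', X', f, g, cmp C X' (fob \<Sigma> Y) (fob \<Sigma> Z') (fmor \<Sigma> Y Z' j) m) \<in> \<Delta> \<and>
            cmp C Y Z' Y' f j = cmp C Y Z Y' n v \<and>
            cmp C Z' Y' (fob \<Sigma> X) q f = k \<and>
            cmp C Z Y' X' g n = l \<and>
            cmp C Y' X' (fob \<Sigma> Y) m g = cmp C Y' (fob \<Sigma> X) (fob \<Sigma> Y) (fmor \<Sigma> X Y u) q"

text \<open>A triangle functor is a pair \<open>(F, \<eta>)\<close> with \<open>\<eta>\<close> from \<open>F\<Sigma>\<close> to \<open>\<Sigma>'F\<close>.\<close>

definition triangle_functor ::
  "'k ring \<Rightarrow> ('k, 'o, 'm) lincat \<Rightarrow> ('o, 'm, 'o, 'm) cfunctor \<Rightarrow> ('o, 'm) tri set \<Rightarrow>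
   ('k, 'p, 'n) lincat \<Rightarrow> ('p, 'n, 'p, 'n) cfunctor \<Rightarrow> ('p, 'n) tri set \<Rightarrow>
   ('o, 'm, 'p, 'n) cfunctor \<Rightarrow> ('o \<Rightarrow> 'n) \<Rightarrow> bool" where
  "triangle_functor K C \<Sigma> \<Delta> C' \<Sigma>' \<Delta>' F \<eta> \<longleftrightarrow> linear_functor K C C' F \<and>
     natural_iso C C' (fcomp F \<Sigma>) (fcomp \<Sigma>' F) \<eta> \<and>
     (\<forall>X Y Z u v w. (X, Y, Z, u, v, w) \<in> \<Delta> \<longrightarrow>
        (fob F X, fob F Y, fob F Z, fmor F X Y u, fmor F Y Z v,
         cmp C' (fob F Z) (fob F (fob \<Sigma> X)) (fob \<Sigma>' (fob F X)) (\<eta> X) (fmor F Z (fob \<Sigma> X) w)) \<in> \<Delta>')"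


section \<open>Finite-dimensional hereditary algebras and their modules\<close>

text \<open>
  The locale \<open>module\<close> of the library needs a commutative ring of scalars, so left modules over
  an arbitrary ring are introduced here; the notion \<open>submodule\<close> is the library's.
\<close>

locale left_module = H?: ring H + M?: abelian_group M for H (structure) and M (structure) +
  assumes act_closed: "\<lbrakk>a \<in> carrier H; x \<in> carrier M\<rbrakk> \<Longrightarrow> a \<odot>\<^bsub>M\<^esub> x \<in> carrier M"
    and act_l_distr: "\<lbrakk>a \<in> carrier H; b \<in> carrier H; x \<in> carrier M\<rbrakk>
      \<Longrightarrow> (a \<oplus>\<^bsub>H\<^esub> b) \<odot>\<^bsub>M\<^esub> x = a \<odot>\<^bsub>M\<^esub> x \<oplus>\<^bsub>M\<^esub> b \<odot>\<^bsub>M\<^esub> x"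
    and act_r_distr: "\<lbrakk>a \<in> carrier H; x \<in> carrier M; y \<in> carrier M\<rbrakk>
      \<Longrightarrow> a \<odot>\<^bsub>M\<^esub> (x \<oplus>\<^bsub>M\<^esub> y) = a \<odot>\<^bsub>M\<^esub> x \<oplus>\<^bsub>M\<^esub> a \<odot>\<^bsub>M\<^esub> y"
    and act_assoc: "\<lbrakk>a \<in> carrier H; b \<in> carrier H; x \<in> carrier M\<rbrakk>
      \<Longrightarrow> (a \<otimes>\<^bsub>H\<^esub> b) \<odot>\<^bsub>M\<^esub> x = a \<odot>\<^bsub>M\<^esub> (b \<odot>\<^bsub>M\<^esub> x)"
    and act_one: "x \<in> carrier M \<Longrightarrow> \<one>\<^bsub>H\<^esub> \<odot>\<^bsub>M\<^esub> x = x"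

definition fin_generated :: "('r, 'a) ring_scheme \<Rightarrow> ('r, 'b, 'c) module_scheme \<Rightarrow> bool" where
  "fin_generated R M \<longleftrightarrow> (\<exists>A. finite A \<and> A \<subseteq> carrier M \<and>
     (\<forall>N. submodule N R M \<and> A \<subseteq> N \<longrightarrow> N = carrier M))"

text \<open>An algebra \<open>H\<close> over \<open>K\<close> is a single record: its ring fields and its scalar action by \<open>K\<close>.\<close>

definition fd_algebra :: "'k ring \<Rightarrow> ('k, 'h) module \<Rightarrow> bool" where
  "fd_algebra K H \<longleftrightarrow> field K \<and> ring H \<and> module K H \<and> fin_generated K H \<and>
     (\<forall>a\<in>carrier K. \<forall>x\<in>carrier H. \<forall>y\<in>carrier H.
        (a \<odot>\<^bsub>H\<^esub> x) \<otimes>\<^bsub>H\<^esub> y = a \<odot>\<^bsub>H\<^esub> (x \<otimes>\<^bsub>H\<^esub> y) \<and>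
        x \<otimes>\<^bsub>H\<^esub> (a \<odot>\<^bsub>H\<^esub> y) = a \<odot>\<^bsub>H\<^esub> (x \<otimes>\<^bsub>H\<^esub> y))"

text \<open>
  Carriers of modules are taken among the subsets of one fixed type. It is large enough: a
  finitely generated module is isomorphic to some quotient of a power of \<open>H\<close>, whose elements
  are cosets, that is, sets of functions from \<open>nat\<close> to \<open>'h\<close>.
\<close>

type_synonym 'h elt = "(nat \<Rightarrow> 'h) set"
type_synonym 'h hmodule = "('h, 'h elt) module"
type_synonym 'h hmap = "'h elt \<Rightarrow> 'h elt"

definition module_maps :: "('k, 'h) module \<Rightarrow> 'h hmodule \<Rightarrow> 'h hmodule \<Rightarrow> 'h hmap set" where
  "module_maps H M N = {f \<in> carrier M \<rightarrow>\<^sub>E carrier N.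
     (\<forall>x\<in>carrier M. \<forall>y\<in>carrier M. f (x \<oplus>\<^bsub>M\<^esub> y) = f x \<oplus>\<^bsub>N\<^esub> f y) \<and>
     (\<forall>a\<in>carrier H. \<forall>x\<in>carrier M. f (a \<odot>\<^bsub>M\<^esub> x) = a \<odot>\<^bsub>N\<^esub> f x)}"

text \<open>A scalar \<open>c\<close> of \<open>K\<close> acts on modules as the element \<open>c \<odot> 1\<close> of \<open>H\<close>.\<close>

definition fgmod :: "('k, 'h) module \<Rightarrow> ('k, 'h hmodule, 'h hmap) lincat" where
  "fgmod H = \<lparr>
     Ob = {M. left_module H M \<and> fin_generated H M},
     Mor = (\<lambda>M N. lin_space (module_maps H M N)
        (\<lambda>x\<in>carrier M. \<zero>\<^bsub>N\<^esub>)
        (\<lambda>f g. \<lambda>x\<in>carrier M. f x \<oplus>\<^bsub>N\<^esub> g x)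
        (\<lambda>c f. \<lambda>x\<in>carrier M. (c \<odot>\<^bsub>H\<^esub> \<one>\<^bsub>H\<^esub>) \<odot>\<^bsub>N\<^esub> f x)),
     idm = (\<lambda>M. \<lambda>x\<in>carrier M. x),
     cmp = (\<lambda>L M N g f. \<lambda>x\<in>carrier L. g (f x))\<rparr>"

definition projective_module :: "('k, 'h) module \<Rightarrow> 'h hmodule \<Rightarrow> bool" where
  "projective_module H P \<longleftrightarrow> P \<in> Ob (fgmod H) \<and>
     (\<forall>M\<in>Ob (fgmod H). \<forall>N\<in>Ob (fgmod H). \<forall>g\<in>module_maps H M N. \<forall>f\<in>module_maps H P N.
        g ` carrier M = carrier N \<longrightarrow>
        (\<exists>h\<in>module_maps H P M. cmp (fgmod H) P M N g h = f))"

definition hereditary :: "('k, 'h) module \<Rightarrow> bool" where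
  "hereditary H \<longleftrightarrow> (\<forall>P N. projective_module H P \<and> submodule N H P \<longrightarrow>
     projective_module H (P\<lparr>carrier := N\<rparr>))"


section \<open>Complexes and the bounded homotopy category\<close>

text \<open>Complexes are cohomological: the differential \<open>dif X i\<close> goes from \<open>cob X i\<close> to \<open>cob X (i + 1)\<close>.\<close>

record ('o, 'm) cpx =
  cob :: "int \<Rightarrow> 'o"
  dif :: "int \<Rightarrow> 'm"

definition bounded_complexes :: "('k, 'o, 'm) lincat \<Rightarrow> ('o, 'm) cpx set" where
  "bounded_complexes A = {X.
     (\<forall>i. cob X i \<in> Ob A \<and> dif X i \<in> mors A (cob X i) (cob X (i + 1)) \<and>
        cmp A (cob X i) (cob X (i + 1)) (cob X (i + 2)) (dif X (i + 1)) (dif X i) =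
        \<zero>\<^bsub>Mor A (cob X i) (cob X (i + 2))\<^esub>) \<and>
     finite {i. \<not> zero_object A (cob X i)}}"

definition chain_maps ::
  "('k, 'o, 'm) lincat \<Rightarrow> ('o, 'm) cpx \<Rightarrow> ('o, 'm) cpx \<Rightarrow> (int \<Rightarrow> 'm) set" where
  "chain_maps A X Y = {f. \<forall>i. f i \<in> mors A (cob X i) (cob Y i) \<and>
     cmp A (cob X i) (cob X (i + 1)) (cob Y (i + 1)) (f (i + 1)) (dif X i) =
     cmp A (cob X i) (cob Y i) (cob Y (i + 1)) (dif Y i) (f i)}"

definition complex_category ::
  "('k, 'o, 'm) lincat \<Rightarrow> ('k, ('o, 'm) cpx, int \<Rightarrow> 'm) lincat" where
  "complex_category A = \<lparr>
     Ob = bounded_complexes A,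
     Mor = (\<lambda>X Y. lin_space (chain_maps A X Y)
        (\<lambda>i. \<zero>\<^bsub>Mor A (cob X i) (cob Y i)\<^esub>)
        (\<lambda>f g i. f i \<oplus>\<^bsub>Mor A (cob X i) (cob Y i)\<^esub> g i)
        (\<lambda>c f i. c \<odot>\<^bsub>Mor A (cob X i) (cob Y i)\<^esub> f i)),
     idm = (\<lambda>X i. idm A (cob X i)),
     cmp = (\<lambda>X Y Z g f i. cmp A (cob X i) (cob Y i) (cob Z i) (g i) (f i))\<rparr>"

definition null_homotopic ::
  "('k, 'o, 'm) lincat \<Rightarrow> ('o, 'm) cpx \<Rightarrow> ('o, 'm) cpx \<Rightarrow> (int \<Rightarrow> 'm) set" where
  "null_homotopic A X Y = {f \<in> chain_maps A X Y.
     \<exists>h. (\<forall>i. h i \<in> mors A (cob X i) (cob Y (i - 1))) \<and>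
       (\<forall>i. f i =
          cmp A (cob X i) (cob Y (i - 1)) (cob Y i) (dif Y (i - 1)) (h i)
          \<oplus>\<^bsub>Mor A (cob X i) (cob Y i)\<^esub>
          cmp A (cob X i) (cob X (i + 1)) (cob Y i) (h (i + 1)) (dif X i))}"

definition quotient_category ::
  "('k, 'o, 'm) lincat \<Rightarrow> ('o \<Rightarrow> 'o \<Rightarrow> 'm set) \<Rightarrow> ('k, 'o, 'm set) lincat" where
  "quotient_category C N = \<lparr>
     Ob = Ob C,
     Mor = (\<lambda>X Y. lin_space (a_rcosets\<^bsub>Mor C X Y\<^esub> (N X Y))
        (N X Y)
        (\<lambda>\<alpha> \<beta>. \<alpha> <+>\<^bsub>Mor C X Y\<^esub> \<beta>)
        (\<lambda>c \<alpha>. \<Union>f\<in>\<alpha>. N X Y +>\<^bsub>Mor C X Y\<^esub> (c \<odot>\<^bsub>Mor C X Y\<^esub> f))),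
     idm = (\<lambda>X. N X X +>\<^bsub>Mor C X X\<^esub> idm C X),
     cmp = (\<lambda>X Y Z \<beta> \<alpha>. \<Union>g\<in>\<beta>. \<Union>f\<in>\<alpha>. N X Z +>\<^bsub>Mor C X Z\<^esub> cmp C X Y Z g f)\<rparr>"

definition homotopy_category ::
  "('k, 'o, 'm) lincat \<Rightarrow> ('k, ('o, 'm) cpx, (int \<Rightarrow> 'm) set) lincat" where
  "homotopy_category A = quotient_category (complex_category A) (null_homotopic A)"

definition homotopy_class ::
  "('k, 'o, 'm) lincat \<Rightarrow> ('o, 'm) cpx \<Rightarrow> ('o, 'm) cpx \<Rightarrow> (int \<Rightarrow> 'm) \<Rightarrow> (int \<Rightarrow> 'm) set" where
  "homotopy_class A X Y f = null_homotopic A X Y +>\<^bsub>Mor (complex_category A) X Y\<^esub> f"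

definition shift_complex :: "('k, 'o, 'm) lincat \<Rightarrow> ('o, 'm) cpx \<Rightarrow> ('o, 'm) cpx" where
  "shift_complex A X = \<lparr>cob = (\<lambda>i. cob X (i + 1)),
     dif = (\<lambda>i. \<ominus>\<^bsub>Mor A (cob X (i + 1)) (cob X (i + 2))\<^esub> dif X (i + 1))\<rparr>"

definition homotopy_shift ::
  "('k, 'o, 'm) lincat \<Rightarrow>
   (('o, 'm) cpx, (int \<Rightarrow> 'm) set, ('o, 'm) cpx, (int \<Rightarrow> 'm) set) cfunctor" where
  "homotopy_shift A = \<lparr>fob = shift_complex A,
     fmor = (\<lambda>X Y \<alpha>. \<Union>f\<in>\<alpha>. homotopy_class A (shift_complex A X) (shift_complex A Y) (\<lambda>i. f (i + 1)))\<rparr>"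

text \<open>
  \<open>mapping_cone A X Y f Z v w\<close>: in degree \<open>i\<close> the complex \<open>Z\<close> is the direct sum of \<open>X\<^bsup>i+1\<^esup>\<close>
  (index \<open>True\<close>) and \<open>Y\<^bsup>i\<^esup>\<close> (index \<open>False\<close>), with differential \<open>(x, y) \<mapsto> (- d x, f x + d y)\<close>;
  \<open>v\<close> is the inclusion of \<open>Y\<close>, and \<open>w\<close> the projection to the shift of \<open>X\<close>.
\<close>

definition mapping_cone ::
  "('k, 'o, 'm) lincat \<Rightarrow> ('o, 'm) cpx \<Rightarrow> ('o, 'm) cpx \<Rightarrow> (int \<Rightarrow> 'm) \<Rightarrow>
   ('o, 'm) cpx \<Rightarrow> (int \<Rightarrow> 'm) \<Rightarrow> (int \<Rightarrow> 'm) \<Rightarrow> bool" where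
  "mapping_cone A X Y f Z v w \<longleftrightarrow>
     X \<in> bounded_complexes A \<and> Y \<in> bounded_complexes A \<and> Z \<in> bounded_complexes A \<and>
     f \<in> chain_maps A X Y \<and>
     (\<exists>j p. (\<forall>i. biproduct A (cob Z i) UNIV (pair_fam (cob X (i + 1)) (cob Y i)) (j i) (p i)) \<and>
        (\<forall>i. dif Z i =
           (\<ominus>\<^bsub>Mor A (cob Z i) (cob Z (i + 1))\<^esub>
             cmp A (cob Z i) (cob X (i + 2)) (cob Z (i + 1)) (j (i + 1) True)
               (cmp A (cob Z i) (cob X (i + 1)) (cob X (i + 2)) (dif X (i + 1)) (p i True)))
           \<oplus>\<^bsub>Mor A (cob Z i) (cob Z (i + 1))\<^esub>
             cmp A (cob Z i) (cob Y (i + 1)) (cob Z (i + 1)) (j (i + 1) False)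
               (cmp A (cob Z i) (cob X (i + 1)) (cob Y (i + 1)) (f (i + 1)) (p i True)
                \<oplus>\<^bsub>Mor A (cob Z i) (cob Y (i + 1))\<^esub>
                cmp A (cob Z i) (cob Y i) (cob Y (i + 1)) (dif Y i) (p i False))) \<and>
        (\<forall>i. v i = j i False) \<and> (\<forall>i. w i = p i True))"


section \<open>The bounded derived category\<close>

text \<open>
  Localisation of \<open>C\<close> at \<open>S\<close> by roofs \<open>X \<leftarrow> U \<rightarrow> Y\<close>, written \<open>(U, s, f)\<close> with \<open>s\<close> in \<open>S\<close>;
  a morphism is an equivalence class of roofs. In \<open>cmp\<close> and \<open>add\<close> the classes do not depend on the
  choices when \<open>S\<close> admits a calculus of right fractions.
\<close>

definition roofs ::
  "('k, 'o, 'm) lincat \<Rightarrow> ('o \<Rightarrow> 'o \<Rightarrow> 'm set) \<Rightarrow> 'o \<Rightarrow> 'o \<Rightarrow> ('o \<times> 'm \<times> 'm) set" where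
  "roofs C S X Y = {(U, s, f). U \<in> Ob C \<and> s \<in> mors C U X \<and> s \<in> S U X \<and> f \<in> mors C U Y}"

definition roof_equiv ::
  "('k, 'o, 'm) lincat \<Rightarrow> ('o \<Rightarrow> 'o \<Rightarrow> 'm set) \<Rightarrow> 'o \<Rightarrow> 'o \<Rightarrow>
   'o \<times> 'm \<times> 'm \<Rightarrow> 'o \<times> 'm \<times> 'm \<Rightarrow> bool" where
  "roof_equiv C S X Y = (\<lambda>(U, s, f) (V, t, g).
     \<exists>W a b. W \<in> Ob C \<and> a \<in> mors C W U \<and> b \<in> mors C W V \<and>
       cmp C W U X s a = cmp C W V X t b \<and> cmp C W U X s a \<in> S W X \<and>
       cmp C W U Y f a = cmp C W V Y g b)"

definition roof_class ::
  "('k, 'o, 'm) lincat \<Rightarrow> ('o \<Rightarrow> 'o \<Rightarrow> 'm set) \<Rightarrow> 'o \<Rightarrow> 'o \<Rightarrow>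
   'o \<times> 'm \<times> 'm \<Rightarrow> ('o \<times> 'm \<times> 'm) set" where
  "roof_class C S X Y r = {r' \<in> roofs C S X Y. roof_equiv C S X Y r r'}"

definition localisation ::
  "('k, 'o, 'm) lincat \<Rightarrow> ('o \<Rightarrow> 'o \<Rightarrow> 'm set) \<Rightarrow> ('k, 'o, ('o \<times> 'm \<times> 'm) set) lincat" where
  "localisation C S = \<lparr>
     Ob = Ob C,
     Mor = (\<lambda>X Y. lin_space (roof_class C S X Y ` roofs C S X Y)
        (roof_class C S X Y (X, idm C X, \<zero>\<^bsub>Mor C X Y\<^esub>))
        (\<lambda>\<alpha> \<beta>. \<Union>{roof_class C S X Y (U, s, f \<oplus>\<^bsub>Mor C U Y\<^esub> g) | U s f g.
           (U, s, f) \<in> \<alpha> \<and> (U, s, g) \<in> \<beta>})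
        (\<lambda>c \<alpha>. \<Union>{roof_class C S X Y (U, s, c \<odot>\<^bsub>Mor C U Y\<^esub> f) | U s f. (U, s, f) \<in> \<alpha>})),
     idm = (\<lambda>X. roof_class C S X X (X, idm C X, idm C X)),
     cmp = (\<lambda>X Y Z \<beta> \<alpha>. \<Union>{roof_class C S X Z (W, cmp C W U X s a, cmp C W V Z g b)
        | U s f V t g W a b.
           (U, s, f) \<in> \<alpha> \<and> (V, t, g) \<in> \<beta> \<and> W \<in> Ob C \<and> a \<in> mors C W U \<and> a \<in> S W U \<and>
           b \<in> mors C W V \<and> cmp C W U Y f a = cmp C W V Y t b})\<rparr>"

definition localise ::
  "('k, 'o, 'm) lincat \<Rightarrow> ('o \<Rightarrow> 'o \<Rightarrow> 'm set) \<Rightarrow> 'o \<Rightarrow> 'o \<Rightarrow> 'm \<Rightarrow> ('o \<times> 'm \<times> 'm) set" where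
  "localise C S X Y f = roof_class C S X Y (X, idm C X, f)"

definition localised_functor ::
  "('k, 'o, 'm) lincat \<Rightarrow> ('o \<Rightarrow> 'o \<Rightarrow> 'm set) \<Rightarrow> ('o, 'm, 'o, 'm) cfunctor \<Rightarrow>
   ('o, ('o \<times> 'm \<times> 'm) set, 'o, ('o \<times> 'm \<times> 'm) set) cfunctor" where
  "localised_functor C S T = \<lparr>fob = fob T,
     fmor = (\<lambda>X Y \<alpha>. \<Union>(U, s, f)\<in>\<alpha>.
        roof_class C S (fob T X) (fob T Y) (fob T U, fmor T U X s, fmor T U Y f))\<rparr>"

definition cocycles :: "('h hmodule, 'h hmap) cpx \<Rightarrow> int \<Rightarrow> 'h elt set" where
  "cocycles X i = {x \<in> carrier (cob X i). dif X i x = \<zero>\<^bsub>cob X (i + 1)\<^esub>}"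

definition coboundaries :: "('h hmodule, 'h hmap) cpx \<Rightarrow> int \<Rightarrow> 'h elt set" where
  "coboundaries X i = dif X (i - 1) ` carrier (cob X (i - 1))"

definition cohomology :: "('h hmodule, 'h hmap) cpx \<Rightarrow> int \<Rightarrow> 'h elt set set" where
  "cohomology X i = (\<lambda>x. coboundaries X i +>\<^bsub>cob X i\<^esub> x) ` cocycles X i"

definition quasi_isomorphism ::
  "('h hmodule, 'h hmap) cpx \<Rightarrow> ('h hmodule, 'h hmap) cpx \<Rightarrow> (int \<Rightarrow> 'h hmap) \<Rightarrow> bool" where
  "quasi_isomorphism X Y f \<longleftrightarrow> (\<forall>i. bij_betw
     (\<lambda>\<xi>. \<Union>x\<in>\<xi>. coboundaries Y i +>\<^bsub>cob Y i\<^esub> f i x) (cohomology X i) (cohomology Y i))"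

definition quasi_isos ::
  "('k, 'h) module \<Rightarrow> ('h hmodule, 'h hmap) cpx \<Rightarrow> ('h hmodule, 'h hmap) cpx \<Rightarrow>
   (int \<Rightarrow> 'h hmap) set set" where
  "quasi_isos H X Y =
     homotopy_class (fgmod H) X Y ` {f \<in> chain_maps (fgmod H) X Y. quasi_isomorphism X Y f}"

type_synonym 'h cplx = "('h hmodule, 'h hmap) cpx"
type_synonym 'h dmor = "('h cplx \<times> (int \<Rightarrow> 'h hmap) set \<times> (int \<Rightarrow> 'h hmap) set) set"

definition derived_category :: "('k, 'h) module \<Rightarrow> ('k, 'h cplx, 'h dmor) lincat" where
  "derived_category H = localisation (homotopy_category (fgmod H)) (quasi_isos H)"

definition derived_shift :: "('k, 'h) module \<Rightarrow> ('h cplx, 'h dmor, 'h cplx, 'h dmor) cfunctor" where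
  "derived_shift H =
     localised_functor (homotopy_category (fgmod H)) (quasi_isos H) (homotopy_shift (fgmod H))"

definition derived_map ::
  "('k, 'h) module \<Rightarrow> 'h cplx \<Rightarrow> 'h cplx \<Rightarrow> (int \<Rightarrow> 'h hmap) \<Rightarrow> 'h dmor" where
  "derived_map H X Y f =
     localise (homotopy_category (fgmod H)) (quasi_isos H) X Y (homotopy_class (fgmod H) X Y f)"

definition derived_triangles :: "('k, 'h) module \<Rightarrow> ('h cplx, 'h dmor) tri set" where
  "derived_triangles H = {t. candidate_triangle (derived_category H) (derived_shift H) t \<and>
     (\<exists>X Y Z f v w. mapping_cone (fgmod H) X Y f Z v w \<and>
        triangle_iso (derived_category H) (derived_shift H)
          (X, Y, Z, derived_map H X Y f, derived_map H Y Z v,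
           derived_map H Z (shift_complex (fgmod H) X) w) t)}"

text \<open>
  The orbit category needs an automorphism where \<open>D\<^sup>b(H)\<close> itself carries an
  autoequivalence. As usual one passes to an equivalent category (a skeleton, say); so \<open>D\<close> is
  any triangulated category that is triangle equivalent to \<open>D\<^sup>b(H)\<close>.
\<close>

definition bounded_derived_category ::
  "'k ring \<Rightarrow> ('k, 'h) module \<Rightarrow> ('k, 'o, 'm) lincat \<Rightarrow> ('o, 'm, 'o, 'm) cfunctor \<Rightarrow>
   ('o, 'm) tri set \<Rightarrow> bool" where
  "bounded_derived_category K H D \<Sigma> \<Delta> \<longleftrightarrow> triangulated_category K D \<Sigma> \<Delta> \<and>
     (\<exists>E \<eta>. triangle_functor K D \<Sigma> \<Delta>
               (derived_category H) (derived_shift H) (derived_triangles H) E \<eta> \<and>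
            equivalence K D (derived_category H) E)"


section \<open>Auslander--Reiten translation\<close>

definition linear_forms :: "'k ring \<Rightarrow> ('k, 'm) module \<Rightarrow> ('m \<Rightarrow> 'k) set" where
  "linear_forms K V = {\<phi> \<in> carrier V \<rightarrow>\<^sub>E carrier K.
     (\<forall>x\<in>carrier V. \<forall>y\<in>carrier V. \<phi> (x \<oplus>\<^bsub>V\<^esub> y) = \<phi> x \<oplus>\<^bsub>K\<^esub> \<phi> y) \<and>
     (\<forall>a\<in>carrier K. \<forall>x\<in>carrier V. \<phi> (a \<odot>\<^bsub>V\<^esub> x) = a \<otimes>\<^bsub>K\<^esub> \<phi> x)}"

text \<open>
  \<open>\<theta> X Y\<close> is the Serre duality isomorphism from \<open>Hom(X, Y)\<close> to the \<open>K\<close>-dual of \<open>Hom(Y, S X)\<close>; the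
  last two conditions are naturality in \<open>X\<close> and in \<open>Y\<close>.
\<close>

definition serre_duality ::
  "'k ring \<Rightarrow> ('k, 'o, 'm) lincat \<Rightarrow> ('o, 'm, 'o, 'm) cfunctor \<Rightarrow>
   ('o \<Rightarrow> 'o \<Rightarrow> 'm \<Rightarrow> 'm \<Rightarrow> 'k) \<Rightarrow> bool" where
  "serre_duality K D S \<theta> \<longleftrightarrow>
     (\<forall>X\<in>Ob D. \<forall>Y\<in>Ob D.
        bij_betw (\<theta> X Y) (mors D X Y) (linear_forms K (Mor D Y (fob S X))) \<and>
        (\<forall>f\<in>mors D X Y. \<forall>f'\<in>mors D X Y. \<forall>g\<in>mors D Y (fob S X).
           \<theta> X Y (f \<oplus>\<^bsub>Mor D X Y\<^esub> f') g = \<theta> X Y f g \<oplus>\<^bsub>K\<^esub> \<theta> X Y f' g) \<and>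
        (\<forall>a\<in>carrier K. \<forall>f\<in>mors D X Y. \<forall>g\<in>mors D Y (fob S X).
           \<theta> X Y (a \<odot>\<^bsub>Mor D X Y\<^esub> f) g = a \<otimes>\<^bsub>K\<^esub> \<theta> X Y f g)) \<and>
     (\<forall>X'\<in>Ob D. \<forall>X\<in>Ob D. \<forall>Y\<in>Ob D.
        \<forall>a\<in>mors D X' X. \<forall>f\<in>mors D X Y. \<forall>g\<in>mors D Y (fob S X').
          \<theta> X' Y (cmp D X' X Y f a) g =
          \<theta> X Y f (cmp D Y (fob S X') (fob S X) (fmor S X' X a) g)) \<and>
     (\<forall>X\<in>Ob D. \<forall>Y\<in>Ob D. \<forall>Y'\<in>Ob D.
        \<forall>b\<in>mors D Y Y'. \<forall>f\<in>mors D X Y. \<forall>g\<in>mors D Y' (fob S X).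
          \<theta> X Y' (cmp D X Y Y' b f) g = \<theta> X Y f (cmp D Y Y' (fob S X) g b))"

definition serre_functor ::
  "'k ring \<Rightarrow> ('k, 'o, 'm) lincat \<Rightarrow> ('o, 'm, 'o, 'm) cfunctor \<Rightarrow> bool" where
  "serre_functor K D S \<longleftrightarrow> equivalence K D D S \<and> (\<exists>\<theta>. serre_duality K D S \<theta>)"

text \<open>
  The translation \<open>\<tau>\<close> is characterised up to isomorphism by \<open>\<tau>[1]\<close> being a Serre functor, which is the
  Auslander--Reiten formula \<open>Hom(X, Y[1]) \<cong> D Hom(Y, \<tau> X)\<close>.
\<close>

definition ar_translation ::
  "'k ring \<Rightarrow> ('k, 'o, 'm) lincat \<Rightarrow> ('o, 'm, 'o, 'm) cfunctor \<Rightarrow> ('o, 'm, 'o, 'm) cfunctor \<Rightarrow> bool" where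
  "ar_translation K D \<Sigma> \<tau> \<longleftrightarrow> automorphism K D \<tau> \<and> serre_functor K D (fcomp \<Sigma> \<tau>)"

definition cluster_functor ::
  "('k, 'o, 'm) lincat \<Rightarrow> ('o, 'm, 'o, 'm) cfunctor \<Rightarrow> ('o, 'm, 'o, 'm) cfunctor \<Rightarrow>
   ('o, 'm, 'o, 'm) cfunctor" where
  "cluster_functor D \<Sigma> \<tau> = fcomp (finv D \<tau>) \<Sigma>"


section \<open>Orbit categories\<close>

text \<open>
  The orbit of \<open>X\<close> is represented by \<open>X\<close> itself, so that all members of an orbit occur as
  (canonically isomorphic) objects. A morphism from \<open>X\<close> to \<open>Y\<close> is a finitely supported family of
  components in \<open>Hom(F\<^sup>i X, Y)\<close>; the composite of \<open>f\<close> in degree \<open>i\<close> and \<open>g\<close> in degree \<open>j\<close> is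
  \<open>g \<circ> F\<^sup>j f\<close> in degree \<open>i + j\<close>.
\<close>

definition orbit_category ::
  "('k, 'o, 'm) lincat \<Rightarrow> ('o, 'm, 'o, 'm) cfunctor \<Rightarrow> ('k, 'o, int \<Rightarrow> 'm) lincat" where
  "orbit_category D F = \<lparr>
     Ob = Ob D,
     Mor = (\<lambda>X Y. lin_space
        {f. (\<forall>i. f i \<in> mors D (fob (fpow D F i) X) Y) \<and>
            finite {i. f i \<noteq> \<zero>\<^bsub>Mor D (fob (fpow D F i) X) Y\<^esub>}}
        (\<lambda>i. \<zero>\<^bsub>Mor D (fob (fpow D F i) X) Y\<^esub>)
        (\<lambda>f g i. f i \<oplus>\<^bsub>Mor D (fob (fpow D F i) X) Y\<^esub> g i)
        (\<lambda>c f i. c \<odot>\<^bsub>Mor D (fob (fpow D F i) X) Y\<^esub> f i)),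
     idm = (\<lambda>X i. if i = 0 then idm D X else \<zero>\<^bsub>Mor D (fob (fpow D F i) X) X\<^esub>),
     cmp = (\<lambda>X Y Z g f n.
        \<Oplus>\<^bsub>Mor D (fob (fpow D F n) X) Z\<^esub>
          i\<in>{i. f i \<noteq> \<zero>\<^bsub>Mor D (fob (fpow D F i) X) Y\<^esub>}.
            cmp D (fob (fpow D F n) X) (fob (fpow D F (n - i)) Y) Z (g (n - i))
              (fmor (fpow D F (n - i)) (fob (fpow D F i) X) Y (f i)))\<rparr>"

definition orbit_projection ::
  "('k, 'o, 'm) lincat \<Rightarrow> ('o, 'm, 'o, 'm) cfunctor \<Rightarrow> ('o, 'm, 'o, int \<Rightarrow> 'm) cfunctor" where
  "orbit_projection D F = \<lparr>fob = (\<lambda>X. X),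
     fmor = (\<lambda>X Y f i. if i = 0 then f else \<zero>\<^bsub>Mor D (fob (fpow D F i) X) Y\<^esub>)\<rparr>"

text \<open>
  Given \<open>\<phi>\<close> from \<open>F\<Sigma>\<close> to \<open>\<Sigma>F\<close>, the induced isomorphisms from \<open>F\<^sup>i\<Sigma>\<close> to \<open>\<Sigma>F\<^sup>i\<close>, first for \<open>i \<ge> 0\<close>, and then for all
  integers, using the isomorphism from \<open>F\<^sup>-\<^sup>1\<Sigma>\<close> to \<open>\<Sigma>F\<^sup>-\<^sup>1\<close> that is inverse to \<open>F\<^sup>-\<^sup>1\<phi>F\<^sup>-\<^sup>1\<close>.
\<close>

primrec iterate_comm ::
  "('k, 'o, 'm) lincat \<Rightarrow> ('o, 'm, 'o, 'm) cfunctor \<Rightarrow> ('o, 'm, 'o, 'm) cfunctor \<Rightarrow>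
   ('o \<Rightarrow> 'm) \<Rightarrow> nat \<Rightarrow> 'o \<Rightarrow> 'm" where
  "iterate_comm D \<Sigma> F \<phi> 0 X = idm D (fob \<Sigma> X)"
| "iterate_comm D \<Sigma> F \<phi> (Suc n) X =
     cmp D (fob (fiter F (Suc n)) (fob \<Sigma> X)) (fob F (fob \<Sigma> (fob (fiter F n) X)))
       (fob \<Sigma> (fob (fiter F (Suc n)) X))
       (\<phi> (fob (fiter F n) X))
       (fmor F (fob (fiter F n) (fob \<Sigma> X)) (fob \<Sigma> (fob (fiter F n) X)) (iterate_comm D \<Sigma> F \<phi> n X))"

definition inverse_comm ::
  "('k, 'o, 'm) lincat \<Rightarrow> ('o, 'm, 'o, 'm) cfunctor \<Rightarrow> ('o, 'm, 'o, 'm) cfunctor \<Rightarrow>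
   ('o \<Rightarrow> 'm) \<Rightarrow> 'o \<Rightarrow> 'm" where
  "inverse_comm D \<Sigma> F \<phi> X = (let G = finv D F in
     inverse_mor D (fob \<Sigma> (fob G X)) (fob G (fob \<Sigma> X))
       (fmor G (fob F (fob \<Sigma> (fob G X))) (fob \<Sigma> X) (\<phi> (fob G X))))"

definition power_comm ::
  "('k, 'o, 'm) lincat \<Rightarrow> ('o, 'm, 'o, 'm) cfunctor \<Rightarrow> ('o, 'm, 'o, 'm) cfunctor \<Rightarrow>
   ('o \<Rightarrow> 'm) \<Rightarrow> int \<Rightarrow> 'o \<Rightarrow> 'm" where
  "power_comm D \<Sigma> F \<phi> i X =
     (if 0 \<le> i then iterate_comm D \<Sigma> F \<phi> (nat i) X
      else iterate_comm D \<Sigma> (finv D F) (inverse_comm D \<Sigma> F \<phi>) (nat (- i)) X)"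

definition orbit_shift ::
  "('k, 'o, 'm) lincat \<Rightarrow> ('o, 'm, 'o, 'm) cfunctor \<Rightarrow> ('o, 'm, 'o, 'm) cfunctor \<Rightarrow>
   ('o \<Rightarrow> 'm) \<Rightarrow> ('o, int \<Rightarrow> 'm, 'o, int \<Rightarrow> 'm) cfunctor" where
  "orbit_shift D \<Sigma> F \<phi> = \<lparr>fob = fob \<Sigma>,
     fmor = (\<lambda>X Y f i.
        cmp D (fob (fpow D F i) (fob \<Sigma> X)) (fob \<Sigma> (fob (fpow D F i) X)) (fob \<Sigma> Y)
          (fmor \<Sigma> (fob (fpow D F i) X) Y (f i)) (power_comm D \<Sigma> F \<phi> i X))\<rparr>"


section \<open>Tilting objects, complements and approximations\<close>

definition summand :: "('k, 'o, 'm) lincat \<Rightarrow> 'o \<Rightarrow> 'o \<Rightarrow> bool" where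
  "summand C X Z \<longleftrightarrow> (\<exists>Y. direct_sum2 C Z X Y)"

definition indecomposable :: "('k, 'o, 'm) lincat \<Rightarrow> 'o \<Rightarrow> bool" where
  "indecomposable C X \<longleftrightarrow> X \<in> Ob C \<and> \<not> zero_object C X \<and>
     (\<forall>Y Z. direct_sum2 C X Y Z \<longrightarrow> zero_object C Y \<or> zero_object C Z)"

definition ext1_vanishes :: "('k, 'o, 'm) lincat \<Rightarrow> ('o, 'm, 'o, 'm) cfunctor \<Rightarrow> 'o \<Rightarrow> 'o \<Rightarrow> bool" where
  "ext1_vanishes C \<Sigma> U V \<longleftrightarrow> mors C U (fob \<Sigma> V) = {\<zero>\<^bsub>Mor C U (fob \<Sigma> V)\<^esub>}"

definition exceptional :: "('k, 'o, 'm) lincat \<Rightarrow> ('o, 'm, 'o, 'm) cfunctor \<Rightarrow> 'o \<Rightarrow> bool" where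
  "exceptional C \<Sigma> T \<longleftrightarrow> T \<in> Ob C \<and> ext1_vanishes C \<Sigma> T T"

definition nonisomorphic_indecomposables :: "('k, 'o, 'm) lincat \<Rightarrow> 'o set \<Rightarrow> bool" where
  "nonisomorphic_indecomposables C S \<longleftrightarrow>
     (\<forall>X\<in>S. indecomposable C X) \<and> (\<forall>X\<in>S. \<forall>Y\<in>S. isomorphic C X Y \<longrightarrow> X = Y)"

definition rigid_set :: "('k, 'o, 'm) lincat \<Rightarrow> ('o, 'm, 'o, 'm) cfunctor \<Rightarrow> 'o set \<Rightarrow> bool" where
  "rigid_set C \<Sigma> S \<longleftrightarrow> nonisomorphic_indecomposables C S \<and> (\<forall>X\<in>S. \<forall>Y\<in>S. ext1_vanishes C \<Sigma> X Y)"

text \<open>\<open>S\<close> contains exactly one object from each isomorphism class of indecomposable summands of \<open>T\<close>.\<close>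

definition indecomposable_summands :: "('k, 'o, 'm) lincat \<Rightarrow> 'o \<Rightarrow> 'o set \<Rightarrow> bool" where
  "indecomposable_summands C T S \<longleftrightarrow> nonisomorphic_indecomposables C S \<and>
     (\<forall>X\<in>S. summand C X T) \<and>
     (\<forall>X. indecomposable C X \<and> summand C X T \<longrightarrow> (\<exists>Y\<in>S. isomorphic C X Y))"

definition basic :: "('k, 'o, 'm) lincat \<Rightarrow> 'o \<Rightarrow> bool" where
  "basic C T \<longleftrightarrow> (\<exists>S. nonisomorphic_indecomposables C S \<and> direct_sum C T S (\<lambda>X. X))"

definition tilting :: "('k, 'o, 'm) lincat \<Rightarrow> ('o, 'm, 'o, 'm) cfunctor \<Rightarrow> 'o \<Rightarrow> bool" where
  "tilting C \<Sigma> T \<longleftrightarrow> exceptional C \<Sigma> T \<and>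
     (\<exists>S. indecomposable_summands C T S \<and> rigid_set C \<Sigma> S \<and>
        (\<forall>S'. rigid_set C \<Sigma> S' \<and> S \<subseteq> S' \<longrightarrow> S' = S))"

definition complement :: "('k, 'o, 'm) lincat \<Rightarrow> ('o, 'm, 'o, 'm) cfunctor \<Rightarrow> 'o \<Rightarrow> 'o \<Rightarrow> bool" where
  "complement C \<Sigma> T M \<longleftrightarrow> indecomposable C M \<and>
     (\<exists>Z. direct_sum2 C Z T M \<and> basic C Z \<and> tilting C \<Sigma> Z)"

definition almost_complete_tilting ::
  "('k, 'o, 'm) lincat \<Rightarrow> ('o, 'm, 'o, 'm) cfunctor \<Rightarrow> 'o \<Rightarrow> bool" where
  "almost_complete_tilting C \<Sigma> T \<longleftrightarrow>
     basic C T \<and> exceptional C \<Sigma> T \<and> (\<exists>M. complement C \<Sigma> T M)"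

definition add_closure :: "('k, 'o, 'm) lincat \<Rightarrow> 'o \<Rightarrow> 'o set" where
  "add_closure C T = {X. \<exists>n Z. direct_sum C Z {..<n::nat} (\<lambda>_. T) \<and> summand C X Z}"

definition right_approximation ::
  "('k, 'o, 'm) lincat \<Rightarrow> 'o set \<Rightarrow> 'o \<Rightarrow> 'o \<Rightarrow> 'm \<Rightarrow> bool" where
  "right_approximation C A B M f \<longleftrightarrow> B \<in> A \<and> f \<in> mors C B M \<and>
     (\<forall>X\<in>A. cmp C X B M f ` mors C X B = mors C X M)"

definition minimal_right_approximation ::
  "('k, 'o, 'm) lincat \<Rightarrow> 'o set \<Rightarrow> 'o \<Rightarrow> 'o \<Rightarrow> 'm \<Rightarrow> bool" where
  "minimal_right_approximation C A B M f \<longleftrightarrow> right_approximation C A B M f \<and>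
     (\<forall>g\<in>mors C B B. cmp C B B M f g = f \<longrightarrow> is_iso C B B g)"

definition left_approximation ::
  "('k, 'o, 'm) lincat \<Rightarrow> 'o set \<Rightarrow> 'o \<Rightarrow> 'o \<Rightarrow> 'm \<Rightarrow> bool" where
  "left_approximation C A M B u \<longleftrightarrow> B \<in> A \<and> u \<in> mors C M B \<and>
     (\<forall>X\<in>A. (\<lambda>g. cmp C M B X g u) ` mors C B X = mors C M X)"

definition minimal_left_approximation ::
  "('k, 'o, 'm) lincat \<Rightarrow> 'o set \<Rightarrow> 'o \<Rightarrow> 'o \<Rightarrow> 'm \<Rightarrow> bool" where
  "minimal_left_approximation C A M B u \<longleftrightarrow> left_approximation C A M B u \<and>
     (\<forall>g\<in>mors C B B. cmp C M B B g u = u \<longrightarrow> is_iso C B B g)"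

end

theory Submission
 imports Defs
begin

text \<open>
 Let \<open>S\<close> be the Serre functor of the derived category. Since \<open>S F\<close> is the square of the shift,
 vanishing of extensions is symmetric in the orbit category. By heredity every object of the derived
 category is obtained by triangles from objects with projective cohomology in one degree; this gives
 finite-dimensional morphism spaces and local endomorphism rings, first there and then, by grading
 with the powers of \<open>F\<close>, in the orbit category.

 These properties suffice for mutation. Let \<open>N\<close> be rigid, indecomposable, compatible with \<open>T\<close> and not
 in \<open>add T\<close>, and let \<open>R1 \<rightarrow> R0 \<rightarrow> N\<close> be the triangle of a minimal right \<open>add (T + M)\<close>-approximation. By
 maximality \<open>R1\<close> also lies in \<open>add (T + M)\<close>, and by rigidity of \<open>N\<close> not both \<open>R0\<close> and \<open>R1\<close> contain \<open>M\<close>.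
 If \<open>R1\<close> does not, then \<open>N \<simeq> M\<close>; if \<open>R0\<close> does not, then \<open>N\<close> is a summand of the cone of a left
 \<open>add T\<close>-approximation of \<open>M\<close>, that is, \<open>N \<simeq> M\<^sub>2\<close>. Applied to \<open>N = M\<^sub>1\<close> this yields \<open>M\<^sub>1 \<simeq> M\<^sub>2\<close>.
\<close>

text \<open>Only vanishing of morphism spaces enters, never the dimension of an Ext space: Serre
  duality is used solely as Hom(X, Y) = 0 iff Hom(Y, S X) = 0, and length over \<open>K\<close>
  provides finite spanning sets and termination, nothing finer. No calculus of fractions is verified
  for the localisation by roofs. Its composites are known to be morphisms because they come from
  \<open>D\<close> through the equivalence \<open>E\<close>, and morphisms are read off from the
  relation they induce on cocycles. That relation determines a morphism once the source has
  projective cohomology in a single degree, which is why such objects carry the whole analysis; maps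
  from fixed objects \<open>P n\<close> of \<open>D\<close> then express the cohomology of every
  object. The obstacle in the orbit category is that degrees of both signs occur, so an endomorphism
  without invertible degree-zero part is not nilpotent for reasons of degree. Its homogeneous
  components strictly shrink left ideals, and finite length takes the place of a degree
  bound.\<close>

abbreviation zr where "zr == ring.zero"

abbreviation un where "un == monoid.one"

abbreviation Der where "Der == derived_category"

abbreviation plus_in ("(_ +[_]/ _)" [65, 0, 66] 65) where "x +[R] y == add R x y"

abbreviation minus_in ("(_ -[_]/ _)" [65, 0, 66] 65) where "x -[R] y == a_minus R x y"

abbreviation neg_in ("(-[_]/ _)" [0, 81] 80) where "-[R] x == a_inv R x"

abbreviation smult_in ("(_ *[_]/ _)" [70, 0, 71] 70) where "a *[M] x == smult M a x"

abbreviation scal where "scal H c == c *[H] un H"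

abbreviation mult_in ("(_ **[_]/ _)" [70, 0, 71] 70) where "x **[R] y == monoid.mult R x y"

abbreviation pow_in ("(_ ^[_]/ _)" [75, 0, 75] 75) where "x ^[R] k == pow R x k"

section \<open>Finite length over a field\<close>

definition lin_map :: "('k, 'c) ring_scheme => ('k, 'v) module => ('k, 'w) module => ('v => 'w) => bool" where
 "lin_map K V V' ph \<longleftrightarrow> ph : carrier V \<rightarrow> carrier V' &
   (ALL x:carrier V. ALL y:carrier V. ph (x +[V] y) = ph x +[V'] ph y) &
   (ALL a:carrier K. ALL x:carrier V. ph (a *[V] x) = a *[V'] ph x)"

lemma lin_mapD:
 assumes "lin_map K V V' ph"
 shows lin_map_closed: "x : carrier V ==> ph x : carrier V'"
  and lin_map_add: "[|x : carrier V; y : carrier V|] ==> ph (x +[V] y) = ph x +[V'] ph y"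
  and lin_map_smult: "[|a : carrier K; x : carrier V|] ==> ph (a *[V] x) = a *[V'] ph x"
 using assms by (auto simp: lin_map_def)

lemma submodule_iff:
 assumes "module K V"
 shows "submodule W K V \<longleftrightarrow> W <= carrier V & zr V : W &
  (ALL x:W. ALL y:W. x +[V] y : W) & (ALL a:carrier K. ALL x:W. a *[V] x : W)"
  (is "_ \<longleftrightarrow> ?R")
proof
 interpret module K V by fact
 assume W: "submodule W K V"
 show ?R
  using submoduleE[OF W] subgroup.one_closed[OF submodule.axioms(1)[OF W]] by auto
next
 interpret module K V by fact
 assume R: ?R
 show "submodule W K V"
 proof (rule submoduleI)
  fix a assume a: "a : W"
  then have "-[V] a = (-[K] un K) *[V] a"
   using R smult_l_minus[of "un K" a] by auto
  then show "-[V] a : W" using R a by auto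
 qed (use R in auto)
qed

context
 fixes K :: "('k, 'c) ring_scheme" and V :: "('k, 'v) module" and V' :: "('k, 'w) module" and ph
 assumes V: "module K V" and V': "module K V'" and ph: "lin_map K V V' ph"
begin

interpretation V: module K V by (fact V)
interpretation V': module K V' by (fact V')

lemma lin_map_zero: "ph (zr V) = zr V'"
proof -
 have "ph (zr V) = ph (zr K *[V] zr V)" by simp
 also have "... = zr K *[V'] ph (zr V)" by (rule lin_map_smult[OF ph]) auto
 also have "... = zr V'" using lin_map_closed[OF ph, of "zr V"] by simp
 finally show ?thesis .
qed

lemma lin_map_neg: "x : carrier V ==> ph (-[V] x) = -[V'] ph x"
 using V.smult_l_minus[of "un K" x] V'.smult_l_minus[of "un K" "ph x"]
  lin_map_closed[OF ph, of x] lin_map_smult[OF ph, of "-[K] un K" x] by simp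

lemma lin_map_image:
 assumes W: "submodule W K V" shows "submodule (ph ` W) K V'"
proof -
 have W: "W <= carrier V" "zr V : W" "!!x y. x : W ==> y : W ==> x +[V] y : W"
  "!!a x. a : carrier K ==> x : W ==> a *[V] x : W"
  using W submodule_iff[OF V] by auto
 show ?thesis unfolding submodule_iff[OF V']
 proof (intro conjI ballI)
  show "ph ` W <= carrier V'" using W(1) lin_map_closed[OF ph] by auto
  show "zr V' : ph ` W" using W(2) lin_map_zero by (metis imageI)
 next
  fix x y assume "x : ph ` W" "y : ph ` W"
  then obtain a b where ab: "a : W" "b : W" "x = ph a" "y = ph b" by auto
  then have "x +[V'] y = ph (a +[V] b)" using lin_map_add[OF ph, of a b] W(1) by (simp add: subset_iff)
  then show "x +[V'] y : ph ` W" using W(3)[OF ab(1,2)] by auto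
 next
  fix a x assume "a : carrier K" "x : ph ` W"
  then obtain b where ab: "b : W" "x = ph b" by auto
  then have "a *[V'] x = ph (a *[V] b)" using lin_map_smult[OF ph, of a b] W(1) \<open>a : carrier K\<close> by auto
  then show "a *[V'] x : ph ` W" using W(4)[OF \<open>a : carrier K\<close> ab(1)] by auto
 qed
qed

lemma lin_map_vimage:
 assumes W: "submodule W K V'" shows "submodule {x : carrier V. ph x : W} K V"
proof -
 have W: "zr V' : W" "!!x y. x : W ==> y : W ==> x +[V'] y : W"
  "!!a x. a : carrier K ==> x : W ==> a *[V'] x : W"
  using W submodule_iff[OF V'] by auto
 show ?thesis unfolding submodule_iff[OF V]
  using W lin_map_zero lin_map_add[OF ph] lin_map_smult[OF ph] by auto
qed

end

lemma submodule_zero: "module K V ==> submodule {zr V} K V"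
 unfolding submodule_iff
 by (auto simp: module.smult_r_null abelian_monoid.zero_closed abelian_monoid.l_zero
   module_def abelian_group_def)

lemma submodule_carrier: "module K V ==> submodule (carrier V) K V"
 by (rule module.carrier_is_submodule)

lemma submodule_Int:
 assumes "module K V" "submodule W K V" "submodule W' K V" shows "submodule (W Int W') K V"
 using assms(2,3) unfolding submodule_iff[OF assms(1)] by auto

section \<open>Chains of subspaces and length\<close>

definition subspace_chain :: "('k, 'c) ring_scheme => ('k, 'v) module => 'v set => nat => (nat => 'v set) => bool" where
 "subspace_chain K V W m c \<longleftrightarrow>
   (ALL i<=m. submodule (c i) K V) & (ALL i<m. c i < c (Suc i)) & c m <= W"

text \<open>Length of the lattice of subspaces stands in for dimension. All that is needed is a
  bounded integer that grows strictly along proper inclusions, so no bases are chosen.\<close>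

definition finlen :: "('k, 'c) ring_scheme => ('k, 'v) module => 'v set => bool" where
 "finlen K V W \<longleftrightarrow> (EX n. ALL m c. subspace_chain K V W m c --> m <= n)"

definition len :: "('k, 'c) ring_scheme => ('k, 'v) module => 'v set => nat" where
 "len K V W = (GREATEST m. EX c. subspace_chain K V W m c)"

abbreviation fl :: "('k, 'c) ring_scheme => ('k, 'v) module => bool" where
 "fl K V == finlen K V (carrier V)"

lemma len_ge: "[|finlen K V W; subspace_chain K V W m c|] ==> m <= len K V W"
 unfolding finlen_def len_def
 by (rule Greatest_le_nat[where b = "SOME n. ALL m c. subspace_chain K V W m c --> m <= n"])
  (auto intro: someI2_ex)

lemma len_chain:
 assumes "finlen K V W" "submodule W K V"
 obtains c where "subspace_chain K V W (len K V W) c"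
proof -
 have 0: "EX c. subspace_chain K V W 0 c"
  by (rule exI[of _ "%_. W"]) (use assms in \<open>auto simp: subspace_chain_def\<close>)
 obtain n where "ALL m c. subspace_chain K V W m c --> m <= n" using assms(1) by (auto simp: finlen_def)
 then have "EX c. subspace_chain K V W (len K V W) c"
  unfolding len_def by (intro GreatestI_nat[where P = "%m. EX c. subspace_chain K V W m c", OF 0]) auto
 then show thesis using that by auto
qed

lemma subspace_chain_mono: "[|subspace_chain K V W m c; W <= W'|] ==> subspace_chain K V W' m c"
 unfolding subspace_chain_def by (elim conjE) (intro conjI; assumption?; rule subset_trans)

lemma finlen_mono: "[|finlen K V W'; W <= W'|] ==> finlen K V W"
 unfolding finlen_def using subspace_chain_mono by metis

lemma len_mono:
 assumes "finlen K V W'" "W <= W'" "submodule W K V" shows "len K V W <= len K V W'"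
proof -
 obtain c where "subspace_chain K V W (len K V W) c"
  using len_chain finlen_mono assms by metis
 then show ?thesis by (intro len_ge[OF assms(1)] subspace_chain_mono[OF _ assms(2)])
qed

lemma len_strict:
 assumes "finlen K V W'" "W < W'" "submodule W K V" "submodule W' K V"
 shows "len K V W < len K V W'"
proof -
 obtain c where c: "subspace_chain K V W (len K V W) c"
  using len_chain finlen_mono assms by (metis psubset_imp_subset)
 have "subspace_chain K V W' (Suc (len K V W)) (%i. if i = Suc (len K V W) then W' else c i)"
  using c assms by (auto simp: subspace_chain_def)
 from len_ge[OF assms(1) this] show ?thesis by simp
qed

text \<open>A strictly increasing function has value at least i at the i-th member of a chain, so a
  bound on it bounds the chain. The finiteness proofs below only choose such a function.\<close>

lemma finlenI:
 fixes mu :: "'v set => nat"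
 assumes mono: "!!U U'. [|submodule U K V; submodule U' K V; U < U'; U' <= W|] ==> mu U < mu U'"
  and bound: "!!U. [|submodule U K V; U <= W|] ==> mu U <= n"
 shows "finlen K V W"
 unfolding finlen_def
proof (intro exI[of _ n] allI impI)
 fix m c assume c: "subspace_chain K V W m c"
 have sub: "i <= m ==> c i <= W" for i
 proof (induction "m - i" arbitrary: i)
  case 0 then show ?case using c by (auto simp: subspace_chain_def)
 next
  case (Suc k)
  then have "c (Suc i) <= W" by auto
  moreover have "c i < c (Suc i)" using c Suc(2) by (simp add: subspace_chain_def)
  ultimately show ?case by blast
 qed
 have "i <= m ==> i <= mu (c i)" for i
 proof (induction i)
  case (Suc i)
  then have "mu (c i) < mu (c (Suc i))"
   using c sub[of "Suc i"] by (intro mono) (auto simp: subspace_chain_def)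
  then show ?case using Suc by auto
 qed auto
 from this[of m] bound[of "c m"] sub[of m] c show "m <= n" by (force simp: subspace_chain_def)
qed

text \<open>Rank and nullity: the measure adds the length of the image to that of the kernel part,
  and an inclusion with equal images and equal kernel parts is an equality.\<close>

lemma finlen_lin_map:
 assumes V: "module K V" and V': "module K V'" and ph: "lin_map K V V' ph"
  and fl: "fl K V'" and ker: "finlen K V {x : W. ph x = zr V'}" and W: "W <= carrier V"
 shows "finlen K V W"
proof -
 let ?k = "%U. {x : U. ph x = zr V'}"
 interpret V: module K V by fact
 interpret V': module K V' by fact
 have k: "submodule (?k U) K V" if "submodule U K V" for U
  using that lin_map_zero[OF V V' ph] lin_map_add[OF ph] lin_map_smult[OF ph]
  unfolding submodule_iff[OF V] by (auto simp: subset_iff)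
 have k': "?k U <= ?k W" if "U <= W" for U using that by auto
 have im: "ph ` U <= carrier V'" if "U <= W" for U using that W lin_map_closed[OF ph] by auto
 show ?thesis
 proof (rule finlenI[where mu = "%U. len K V' (ph ` U) + len K V (?k U)"])
  fix U U' assume U: "submodule U K V" "submodule U' K V" "U < U'" "U' <= W"
  have le: "len K V' (ph ` U) <= len K V' (ph ` U')"
   by (rule len_mono[OF finlen_mono[OF fl im[OF U(4)]]])
    (use U in \<open>auto intro: lin_map_image[OF V V' ph]\<close>)
  have lek: "len K V (?k U) <= len K V (?k U')"
   by (rule len_mono[OF finlen_mono[OF ker k'[OF U(4)]]]) (use U k in auto)
  show "len K V' (ph ` U) + len K V (?k U) < len K V' (ph ` U') + len K V (?k U')"
  proof (cases "ph ` U = ph ` U'")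
   case False
   then have "len K V' (ph ` U) < len K V' (ph ` U')"
    by (intro len_strict[OF finlen_mono[OF fl im[OF U(4)]]])
     (use U in \<open>auto intro: lin_map_image[OF V V' ph]\<close>)
   then show ?thesis using lek by simp
  next
   case True
   have "?k U ~= ?k U'"
   proof
    assume eq: "?k U = ?k U'"
    \<comment> \<open>Subtracting from \<open>y\<close> an \<open>x\<close> in \<open>U\<close> with
      the same image moves it into the kernel part without bringing it into
      \<open>U\<close>.\<close>
    obtain y where y: "y : U'" "y ~: U" using U by auto
    then obtain x where x: "x : U" "ph y = ph x" using True by blast
    have c: "x : carrier V" "y : carrier V" using x y U W by auto
    have "y +[V] -[V] x : U'"
     using U x y V.submoduleE(3,5)[OF U(2)] by blast
    moreover have "ph (y +[V] -[V] x) = zr V'"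
     using lin_map_add[OF ph, of y "-[V] x"] lin_map_neg[OF V V' ph, of x] x c
      lin_map_closed[OF ph, of x] by (simp add: V'.r_neg)
    ultimately have "y +[V] -[V] x : U" using eq by auto
    then have "(y +[V] -[V] x) +[V] x : U" using V.submoduleE(5)[OF U(1)] x by auto
    then show False using y c by (simp add: V.a_assoc V.l_neg)
   qed
   then have "?k U < ?k U'" using U by auto
   then have "len K V (?k U) < len K V (?k U')"
    by (intro len_strict[OF finlen_mono[OF ker k'[OF U(4)]]]) (use U k in auto)
   then show ?thesis using le by simp
  qed
 next
  fix U assume U: "submodule U K V" "U <= W"
  have "len K V' (ph ` U) <= len K V' (carrier V')"
   by (rule len_mono[OF fl im[OF U(2)]]) (use U in \<open>auto intro: lin_map_image[OF V V' ph]\<close>)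
  moreover have "len K V (?k U) <= len K V (?k W)"
   by (rule len_mono[OF ker k'[OF U(2)]]) (use U k in auto)
  ultimately show "len K V' (ph ` U) + len K V (?k U) <= len K V' (carrier V') + len K V (?k W)"
   by simp
 qed
qed

lemma finlen_zero: "module K V ==> finlen K V {zr V}"
 by (rule finlenI[where mu = "%_. 0" and n = 0]) (auto simp: submodule_iff)

text \<open>The maps are released one at a time: \<open>J\<close> collects those allowed to be
  nonzero, and each new member costs one application of rank and nullity. With \<open>J\<close>
  empty only zero is left.\<close>

lemma finlen_separated:
 fixes V :: "('k, 'v) module" and V' :: "'i => ('k, 'w) module"
 assumes V: "module K V" and fin: "finite I"
  and I: "!!i. i : I ==> module K (V' i)" "!!i. i : I ==> lin_map K V (V' i) (ph i)" "!!i. i : I ==> fl K (V' i)"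
  and sep: "!!x. [|x : carrier V; !!i. i : I ==> ph i x = zr (V' i)|] ==> x = zr V"
 shows "fl K V"
proof -
 have "finlen K V {x : carrier V. ALL i:I - J. ph i x = zr (V' i)}" if "finite J" "J <= I" for J
  using that
 proof (induction J rule: finite_induct)
  case empty
  show ?case by (rule finlen_mono[OF finlen_zero[OF V]]) (use sep in auto)
 next
  case (insert j J)
  let ?W = "{x : carrier V. ALL i:I - insert j J. ph i x = zr (V' i)}"
  have eq: "{x : ?W. ph j x = zr (V' j)} = {x : carrier V. ALL i:I - J. ph i x = zr (V' i)}"
   using insert by auto
  have j: "j : I" using insert by auto
  show ?case
   by (rule finlen_lin_map[OF V I(1)[OF j] I(2)[OF j] I(3)[OF j]]) (use insert eq in auto)
 qed
 from this[OF fin subset_refl] show ?thesis by simp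
qed

lemma finlen_surj:
 assumes V: "module K V" and V': "module K V'" and ph: "lin_map K V V' ph"
  and fl: "finlen K V W" and sub: "W' <= ph ` W" and W: "submodule W K V"
 shows "finlen K V' W'"
proof (rule finlenI[where mu = "%U. len K V {x : W. ph x : U}"])
 have s: "submodule {x : W. ph x : U} K V" if "submodule U K V'" for U
 proof -
  have "{x : W. ph x : U} = W Int {x : carrier V. ph x : U}"
   using W submodule_iff[OF V] by auto
  then show ?thesis using submodule_Int[OF V W lin_map_vimage[OF V V' ph that]] by simp
 qed
 fix U U' assume U: "submodule U K V'" "submodule U' K V'" "U < U'" "U' <= W'"
 obtain y where y: "y : U'" "y ~: U" using U by auto
 then obtain x where x: "x : W" "ph x = y" using sub U by blast
 have "{x : W. ph x : U} < {x : W. ph x : U'}" using U x y by auto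
 then show "len K V {x : W. ph x : U} < len K V {x : W. ph x : U'}"
  by (intro len_strict) (use s U in \<open>auto intro: finlen_mono[OF fl]\<close>)
next
 fix U assume U: "submodule U K V'"
 have "submodule {x : W. ph x : U} K V"
 proof -
  have "{x : W. ph x : U} = W Int {x : carrier V. ph x : U}"
   using W submodule_iff[OF V] by auto
  then show ?thesis using submodule_Int[OF V W lin_map_vimage[OF V V' ph U]] by simp
 qed
 then show "len K V {x : W. ph x : U} <= len K V W"
  by (intro len_mono[OF fl]) auto
qed

lemma finlen_exact:
 assumes V1: "module K V1" and V2: "module K V2" and V3: "module K V3"
  and al: "lin_map K V1 V2 al" and be: "lin_map K V2 V3 be"
  and fl: "fl K V1" "fl K V3"
  and ker: "!!x. [|x : carrier V2; be x = zr V3|] ==> x : al ` carrier V1"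
 shows "fl K V2"
proof (rule finlen_lin_map[OF V2 V3 be fl(2)])
 show "finlen K V2 {x : carrier V2. be x = zr V3}"
  by (rule finlen_surj[OF V1 V2 al fl(1) _ submodule_carrier[OF V1]]) (use ker in auto)
qed auto

lemma fl_inj:
 assumes V1: "module K V1" and V2: "module K V2" and be: "lin_map K V1 V2 be"
  and fl: "fl K V2" and ker: "!!x. [|x : carrier V1; be x = zr V2|] ==> x = zr V1"
 shows "fl K V1"
proof (rule finlen_lin_map[OF V1 V2 be fl])
 show "finlen K V1 {x : carrier V1. be x = zr V2}"
  by (rule finlen_mono[OF finlen_zero[OF V1]]) (use ker in auto)
qed auto

text \<open>A longest chain is carried over by the injection, and the whole target adds one more
  step above it.\<close>

lemma len_inj_less:
 assumes V1: "module K V1" and V2: "module K V2" and be: "lin_map K V1 V2 be"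
  and fl: "fl K V2" and inj: "inj_on be (carrier V1)" and ne: "be ` carrier V1 ~= carrier V2"
 shows "len K V1 (carrier V1) < len K V2 (carrier V2)"
proof -
 have fl1: "fl K V1"
  by (rule fl_inj[OF V1 V2 be fl])
   (metis inj inj_onD lin_map_zero[OF V1 V2 be] submodule_iff[OF V1] submodule_carrier[OF V1])
 have sub: "be ` carrier V1 < carrier V2" using ne lin_map_closed[OF be] by auto
 obtain c where c: "subspace_chain K V1 (carrier V1) (len K V1 (carrier V1)) c"
  using len_chain[OF fl1 submodule_carrier[OF V1]] by auto
 let ?m = "len K V1 (carrier V1)"
 have "subspace_chain K V2 (be ` carrier V1) ?m (%i. be ` c i)"
  unfolding subspace_chain_def
 proof (intro conjI allI impI)
  fix i assume "i <= ?m" then show "submodule (be ` c i) K V2"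
   using c by (auto simp: subspace_chain_def intro: lin_map_image[OF V1 V2 be])
 next
  fix i assume i: "i < ?m"
  then have ci: "c i < c (Suc i)" "c (Suc i) <= carrier V1"
   using c by (auto simp: subspace_chain_def submodule_iff[OF V1])
  then show "be ` c i < be ` c (Suc i)"
   using inj by (metis image_strict_mono inj_on_subset)
 qed (use c in \<open>auto simp: subspace_chain_def\<close>)
 then have "?m <= len K V2 (be ` carrier V1)"
  by (rule len_ge[OF finlen_mono[OF fl], rotated]) (use sub in auto)
 also have "... < len K V2 (carrier V2)"
  by (rule len_strict[OF fl sub lin_map_image[OF V1 V2 be submodule_carrier[OF V1]] submodule_carrier[OF V2]])
 finally show ?thesis .
qed

section \<open>Adjoining a vector, and finitely generated subspaces\<close>

definition adjoin :: "('k, 'c) ring_scheme => ('k, 'v) module => 'v set => 'v => 'v set" where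
 "adjoin K V W a = {w +[V] k *[V] a | w k. w : W & k : carrier K}"

lemma adjoin:
 assumes V: "module K V" and W: "submodule W K V" and a: "a : carrier V"
 shows adjoin_submodule: "submodule (adjoin K V W a) K V"
  and adjoin_sub: "W <= adjoin K V W a" and adjoin_mem: "a : adjoin K V W a"
  and adjoin_least: "[|submodule N K V; W <= N; a : N|] ==> adjoin K V W a <= N"
proof -
 interpret V: module K V by fact
 have Wc: "W <= carrier V" "zr V : W" "!!x y. x : W ==> y : W ==> x +[V] y : W"
  "!!c x. c : carrier K ==> x : W ==> c *[V] x : W"
  using W submodule_iff[OF V] by auto
 show sub: "W <= adjoin K V W a"
 proof
  fix w assume w: "w : W"
  then have "w = w +[V] zr K *[V] a" using Wc a by auto
  then show "w : adjoin K V W a" using w unfolding adjoin_def by blast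
 qed
 have "a = zr V +[V] un K *[V] a" using a by auto
 then show "a : adjoin K V W a" using Wc unfolding adjoin_def by blast
 show "submodule (adjoin K V W a) K V"
  unfolding submodule_iff[OF V]
 proof (intro conjI ballI)
  show "adjoin K V W a <= carrier V" using Wc a by (auto simp: adjoin_def)
  show "zr V : adjoin K V W a" using sub Wc by auto
 next
  fix x y assume "x : adjoin K V W a" "y : adjoin K V W a"
  then obtain w k w' k' where xy: "w : W" "w' : W" "k : carrier K" "k' : carrier K"
   "x = w +[V] k *[V] a" "y = w' +[V] k' *[V] a" by (auto simp: adjoin_def)
  have c: "w : carrier V" "w' : carrier V" using xy Wc by auto
  have "x +[V] y = (w +[V] w') +[V] (k +[K] k') *[V] a"
   using xy c a by (simp add: V.smult_l_distr V.a_ac)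
  moreover have "w +[V] w' : W" "k +[K] k' : carrier K" using xy Wc by auto
  ultimately show "x +[V] y : adjoin K V W a" unfolding adjoin_def by blast
 next
  fix c x assume c: "c : carrier K" and "x : adjoin K V W a"
  then obtain w k where x: "w : W" "k : carrier K" "x = w +[V] k *[V] a" by (auto simp: adjoin_def)
  have w: "w : carrier V" using x Wc by auto
  have "c *[V] x = c *[V] w +[V] (c **[K] k) *[V] a"
   using x w a c by (simp add: V.smult_r_distr V.smult_assoc1)
  moreover have "c *[V] w : W" "c **[K] k : carrier K" using x Wc c by auto
  ultimately show "c *[V] x : adjoin K V W a" unfolding adjoin_def by blast
 qed
 show "adjoin K V W a <= N" if "submodule N K V" "W <= N" "a : N"
  using that unfolding submodule_iff[OF V] by (auto simp: adjoin_def subset_iff)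
qed

text \<open>One extra dimension: the measure counts the part inside \<open>W\<close> and adds one as
  soon as the subspace leaves \<open>W\<close>. That it can leave only once is where scalars must be
  invertible.\<close>

lemma finlen_adjoin:
 assumes K: "field K" and V: "module K V" and W: "submodule W K V" and a: "a : carrier V"
  and fl: "finlen K V W"
 shows "finlen K V (adjoin K V W a)"
proof -
 interpret V: module K V by fact
 interpret field K by fact
 have Wc: "W <= carrier V" using W submodule_iff[OF V] by auto
 let ?mu = "%U. len K V (U Int W) + (if U <= W then 0 else 1)"
 show ?thesis
 proof (rule finlenI[where mu = ?mu])
  fix U U' assume U: "submodule U K V" "submodule U' K V" "U < U'" "U' <= adjoin K V W a"
  have flU: "finlen K V (U' Int W)" by (rule finlen_mono[OF fl]) auto
  have le: "len K V (U Int W) <= len K V (U' Int W)"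
   by (rule len_mono[OF flU]) (use U submodule_Int[OF V _ W] in auto)
  show "?mu U < ?mu U'"
  proof (cases "U Int W = U' Int W")
   case False
   then have "len K V (U Int W) < len K V (U' Int W)"
    using U by (intro len_strict[OF flU]) (use U submodule_Int[OF V _ W] in auto)
   then show ?thesis using U by auto
  next
   case True
   have "U <= W"
   proof (rule ccontr)
    assume "~ U <= W"
    then obtain x where x: "x : U" "x ~: W" by auto
    obtain y where y: "y : U'" "y ~: U" using U by auto
    obtain w k where xw: "w : W" "k : carrier K" "x = w +[V] k *[V] a"
     using x(1) U(3,4) unfolding adjoin_def by blast
    obtain w' k' where yw: "w' : W" "k' : carrier K" "y = w' +[V] k' *[V] a"
     using y(1) U(4) unfolding adjoin_def by blast
    have c: "w : carrier V" "w' : carrier V" using xw yw Wc by auto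
    have "k ~= zr K" using x xw a c by auto
    then have k: "inv\<^bsub>K\<^esub> k : carrier K" "k **[K] inv\<^bsub>K\<^esub> k = un K"
     using xw by (auto simp: field_Units)
    \<comment> \<open>The multiplier that cancels the \<open>a\<close>-component of \<open>y\<close>
      against that of \<open>x\<close>; then \<open>y + l x\<close> falls into \<open>W\<close>,
      where the two subspaces agree.\<close>
    let ?l = "-[K] (k' **[K] inv\<^bsub>K\<^esub> k)"
    have l: "?l : carrier K" using yw k by auto
    have lk: "?l **[K] k = -[K] k'"
     using yw k xw by (simp add: V.R.l_minus V.R.m_assoc V.R.m_comm[of "inv\<^bsub>K\<^esub> k" k])
    have "y +[V] ?l *[V] x = (w' +[V] ?l *[V] w) +[V] (k' *[V] a +[V] ?l *[V] (k *[V] a))"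
     unfolding xw(3) yw(3) using c a xw(2) yw(2) l by (simp add: V.smult_r_distr V.a_ac)
    also have "?l *[V] (k *[V] a) = -[V] (k' *[V] a)"
     using l xw(2) yw(2) a lk V.smult_assoc1[of ?l k a] V.smult_l_minus[of k' a] by simp
    finally have "y +[V] ?l *[V] x = w' +[V] ?l *[V] w"
     using c a xw(2) yw(2) l by (simp add: V.r_neg)
    moreover have "w' +[V] ?l *[V] w : W"
     using V.submoduleE(4,5)[OF W] l xw yw by auto
    moreover have "y +[V] ?l *[V] x : U'"
     using V.submoduleE(4,5)[OF U(2)] l x y U by auto
    ultimately have "y +[V] ?l *[V] x : U" using True by auto
    moreover have "?l *[V] x : U" using V.submoduleE(4)[OF U(1)] l x by auto
    ultimately have "(y +[V] ?l *[V] x) +[V] -[V] (?l *[V] x) : U"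
     using V.submoduleE(3,5)[OF U(1)] by auto
    moreover have "y : carrier V" "?l *[V] x : carrier V"
     using U y x l submodule_iff[OF V] by auto
    ultimately show False using y by (simp add: V.a_assoc V.r_neg)
   qed
   moreover have "~ U' <= W" using True U \<open>U <= W\<close> by auto
   ultimately show ?thesis using le by auto
  qed
 next
  fix U assume U: "submodule U K V"
  have "len K V (U Int W) <= len K V W"
   by (rule len_mono[OF fl]) (use U submodule_Int[OF V _ W] in auto)
  then show "?mu U <= len K V W + 1" by auto
 qed
qed

lemma finite_span:
 assumes K: "field K" and V: "module K V" and A: "finite A" "A <= carrier V"
 shows "EX W. submodule W K V & A <= W & finlen K V W & (ALL N. submodule N K V & A <= N --> W <= N)"
 using A
proof (induction A rule: finite_induct)
 case empty
 show ?case
  by (rule exI[of _ "{zr V}"])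
   (use submodule_zero[OF V] finlen_zero[OF V] in \<open>auto simp: submodule_iff[OF V]\<close>)
next
 case (insert a A)
 then obtain W where W: "submodule W K V" "A <= W" "finlen K V W"
  "!!N. submodule N K V ==> A <= N ==> W <= N" by auto
 have a: "a : carrier V" using insert by auto
 show ?case
  by (rule exI[of _ "adjoin K V W a"])
   (use adjoin[OF V W(1) a] finlen_adjoin[OF K V W(1) a W(3)] W(2,4) in auto)
qed

lemma fin_generated_imp_fl:
 assumes K: "field K" and V: "module K V" and fg: "fin_generated K V"
 shows "fl K V"
proof -
 obtain A where A: "finite A" "A <= carrier V" "!!N. submodule N K V ==> A <= N ==> N = carrier V"
  using fg by (auto simp: fin_generated_def)
 obtain W where "submodule W K V" "A <= W" "finlen K V W"
  using finite_span[OF K V A(1,2)] by auto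
 then show ?thesis using A(3) by metis
qed

text \<open>A finitely generated subspace of greatest length inside \<open>W\<close> is all of
  \<open>W\<close>, as adjoining a missing vector would lengthen it.\<close>

lemma finlen_finite_span:
 assumes K: "field K" and V: "module K V" and W: "submodule W K V" and fl: "finlen K V W"
 shows "EX A. finite A & A <= W & (ALL N. submodule N K V & A <= N --> W <= N)"
proof -
 define Q where "Q U \<longleftrightarrow> submodule U K V & U <= W &
  (EX A. finite A & A <= W & (ALL N. submodule N K V & A <= N --> U <= N))" for U
 have Wc: "W <= carrier V" "zr V : W" using W submodule_iff[OF V] by auto
 have "Q {zr V}"
  unfolding Q_def using submodule_zero[OF V] Wc by (auto intro!: exI[of _ "{}"] simp: submodule_iff[OF V])
 moreover have "ALL U. Q U --> len K V U < Suc (len K V W)"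
  using len_mono[OF fl] by (auto simp: Q_def less_Suc_eq_le)
 ultimately obtain U where U: "Q U" "!!U'. Q U' ==> len K V U' <= len K V U"
  using ex_has_greatest_nat[of Q _ "len K V" "Suc (len K V W)"] by blast
 have "U = W"
 proof (rule ccontr)
  assume "U ~= W"
  then obtain a where a: "a : W" "a ~: U" using U(1) by (auto simp: Q_def)
  then have ac: "a : carrier V" using Wc by auto
  from U(1) obtain A where A: "submodule U K V" "U <= W" "finite A" "A <= W"
   "!!N. submodule N K V ==> A <= N ==> U <= N" by (auto simp: Q_def)
  note adj = adjoin[OF V A(1) ac]
  have "Q (adjoin K V U a)"
   unfolding Q_def
   using adj(1) adj(4)[OF W A(2) a(1)]
   by (intro conjI exI[of _ "insert a A"]) (use A a adj(4) in auto)
  moreover have "len K V U < len K V (adjoin K V U a)"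
   by (rule len_strict) (use adj A a finlen_mono[OF fl] adj(4)[OF W A(2) a(1)] in auto)
  ultimately show False using U(2) by fastforce
 qed
 then show ?thesis using U(1) by (auto simp: Q_def)
qed

section \<open>Rings in which every element is a unit or nilpotent\<close>

text \<open>A local ring whose radical is nil, phrased elementwise. Finite-dimensional local
  algebras have this form, and nilpotency replaces appeals to the radical by computations with
  powers.\<close>

definition unit_or_nilpotent :: "('a, 'b) ring_scheme => bool" where
 "unit_or_nilpotent R \<longleftrightarrow> un R ~= zr R &
   (ALL x:carrier R. x : Units R \<or> (EX n::nat. x ^[R] n = zr R))"

context ring
begin

text \<open>The witness \<open>s\<close> is the partial geometric series, a two-sided inverse up to
  the error \<open>f^k\<close>.\<close>

lemma one_minus_nilpotent_Unit:
 assumes f: "f : carrier R" and n: "f [^] (n::nat) = \<zero>"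
 shows "\<one> \<ominus> f : Units R"
proof -
 have "EX s:carrier R. (\<one> \<ominus> f) \<otimes> s = \<one> \<ominus> f [^] k & s \<otimes> (\<one> \<ominus> f) = \<one> \<ominus> f [^] k" for k :: nat
 proof (induction k)
  case 0
  show ?case by (rule bexI[of _ \<zero>]) (use f in \<open>simp_all add: minus_eq r_neg\<close>)
 next
  case (Suc k)
  then obtain s where s: "s : carrier R" "(\<one> \<ominus> f) \<otimes> s = \<one> \<ominus> f [^] k"
   "s \<otimes> (\<one> \<ominus> f) = \<one> \<ominus> f [^] k" by auto
  have fk: "f [^] k : carrier R" "f \<otimes> f [^] k = f [^] k \<otimes> f"
   using f by (auto simp: nat_pow_comm[of f 1 k, simplified])
  have "(\<one> \<ominus> f) \<otimes> (s \<oplus> f [^] k) = (\<one> \<ominus> f [^] k) \<oplus> (\<one> \<ominus> f) \<otimes> f [^] k"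
   using f s fk by (simp add: r_distr)
  also have "... = \<one> \<ominus> f [^] Suc k"
   using f fk by (simp add: minus_eq l_distr l_minus a_assoc r_neg2 r_neg1 a_lcomm)
  finally have 1: "(\<one> \<ominus> f) \<otimes> (s \<oplus> f [^] k) = \<one> \<ominus> f [^] Suc k" .
  have "(s \<oplus> f [^] k) \<otimes> (\<one> \<ominus> f) = (\<one> \<ominus> f [^] k) \<oplus> f [^] k \<otimes> (\<one> \<ominus> f)"
   using f s fk by (simp add: l_distr)
  also have "... = \<one> \<ominus> f [^] Suc k"
   using f fk by (simp add: minus_eq r_distr r_minus a_assoc r_neg2 r_neg1 a_lcomm)
  finally have 2: "(s \<oplus> f [^] k) \<otimes> (\<one> \<ominus> f) = \<one> \<ominus> f [^] Suc k" .
  from 1 2 show ?case by (intro bexI[of _ "s \<oplus> f [^] k"]) (use s fk in auto)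
 qed
 from this[of n] obtain s where "s : carrier R" "(\<one> \<ominus> f) \<otimes> s = \<one>" "s \<otimes> (\<one> \<ominus> f) = \<one>"
  using n by (auto simp: minus_eq)
 then show ?thesis using f unfolding Units_def by auto
qed

lemma right_inverse_not_nilpotent:
 assumes "f : carrier R" "g : carrier R" "f \<otimes> g = \<one>" "f [^] (n::nat) = \<zero>"
 shows "\<one> = \<zero>"
proof -
 have "f [^] k \<otimes> g [^] k = \<one>" for k :: nat
 proof (induction k)
  case (Suc k)
  have "f [^] Suc k \<otimes> g [^] Suc k = f [^] k \<otimes> (f \<otimes> (g \<otimes> g [^] k))"
   using assms(1,2) nat_pow_Suc2[of g k] by (simp add: m_assoc del: nat_pow_Suc)
  also have "... = f [^] k \<otimes> ((f \<otimes> g) \<otimes> g [^] k)" using assms(1,2) by (simp add: m_assoc)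
  finally show ?case using Suc assms by simp
 qed simp
 from this[of n] show ?thesis using assms by simp
qed

lemma left_inverse_not_nilpotent:
 assumes "f : carrier R" "g : carrier R" "g \<otimes> f = \<one>" "f [^] (n::nat) = \<zero>"
 shows "\<one> = \<zero>"
proof -
 have "g [^] k \<otimes> f [^] k = \<one>" for k :: nat
 proof (induction k)
  case (Suc k)
  have "g [^] Suc k \<otimes> f [^] Suc k = g [^] k \<otimes> (g \<otimes> (f \<otimes> f [^] k))"
   using assms(1,2) nat_pow_Suc2[of f k] by (simp add: m_assoc del: nat_pow_Suc)
  also have "... = g [^] k \<otimes> ((g \<otimes> f) \<otimes> f [^] k)" using assms(1,2) by (simp add: m_assoc)
  finally show ?case using Suc assms by simp
 qed simp
 from this[of n] show ?thesis using assms by simp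
qed

context
 assumes loc: "unit_or_nilpotent R"
begin

text \<open>A one-sided inverse already excludes nilpotency, hence leaves only the unit
  alternative.\<close>

lemma Unit_factors:
 assumes "f : carrier R" "g : carrier R" "f \<otimes> g : Units R"
 shows "f : Units R" "g : Units R"
proof -
 let ?u = "inv (f \<otimes> g)"
 have u: "?u : carrier R" using assms by auto
 have "f \<otimes> (g \<otimes> ?u) = \<one>" using assms u by (metis Units_r_inv m_assoc)
 then show "f : Units R"
  using loc right_inverse_not_nilpotent[of f "g \<otimes> ?u"] assms u
  unfolding unit_or_nilpotent_def by auto
 have "(?u \<otimes> f) \<otimes> g = \<one>" using assms u by (metis Units_l_inv m_assoc)
 then show "g : Units R"
  using loc left_inverse_not_nilpotent[of g "?u \<otimes> f"] assms u
  unfolding unit_or_nilpotent_def by auto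
qed

text \<open>After scaling the sum to 1, a non-unit summand is nilpotent and the other one is 1 minus
  it.\<close>

lemma Unit_sum:
 assumes "x : carrier R" "y : carrier R" "x \<oplus> y : Units R"
 shows "x : Units R \<or> y : Units R"
proof (rule disjCI)
 assume y: "y ~: Units R"
 let ?u = "inv (x \<oplus> y)"
 have u: "?u : carrier R" using assms by auto
 have "?u \<otimes> y ~: Units R" using Unit_factors(2) u assms y by blast
 then obtain n :: nat where n: "(?u \<otimes> y) [^] n = \<zero>"
  using loc u assms unfolding unit_or_nilpotent_def by (metis m_closed)
 have "?u \<otimes> x \<oplus> ?u \<otimes> y = \<one>" using u assms by (metis Units_l_inv r_distr)
 moreover have "?u \<otimes> x = (?u \<otimes> x \<oplus> ?u \<otimes> y) \<ominus> ?u \<otimes> y"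
  using u assms by (simp add: minus_eq a_assoc r_neg)
 ultimately have "?u \<otimes> x = \<one> \<ominus> ?u \<otimes> y" by simp
 then have "?u \<otimes> x : Units R" using one_minus_nilpotent_Unit[OF _ n] u assms by auto
 then show "x : Units R" using Unit_factors(2) u assms by blast
qed

lemma idempotent_trivial:
 assumes e: "e : carrier R" "e \<otimes> e = e" shows "e = \<zero> \<or> e = \<one>"
proof (cases "e : Units R")
 case True
 then show ?thesis using e by (metis Units_l_cancel one_closed r_one)
next
 case False
 then obtain n :: nat where n: "e [^] n = \<zero>" using e loc unfolding unit_or_nilpotent_def by auto
 have "e [^] Suc k = e" for k :: nat by (induction k) (use e in auto)
 then show ?thesis using n e loc unfolding unit_or_nilpotent_def
  by (cases n) auto
qed

end

end

text \<open>
 The subspaces \<open>r\<^sup>k A\<close> descend, so they become stationary; \<open>r\<^sup>k = r\<^sup>k\<^sup>+\<^sup>1 s\<close> with \<open>s\<close> commuting with \<open>r\<close>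
 makes \<open>r\<^sup>k s\<^sup>k\<close> idempotent.
\<close>

lemma (in ring) fitting:
 assumes mod: "module K V" and V: "carrier V = carrier R" "!!x y. x +[V] y = x +[R] y"
  and sm: "!!a x. [|a : carrier K; x : carrier R|] ==> r \<otimes> (a *[V] x) = a *[V] (r \<otimes> x)"
  and fl: "fl K V"
  and A: "submodule A K V" "\<one> : A" "!!s t. [|s : A; t : A|] ==> s \<otimes> t : A"
  and r: "r : A" "!!s. s : A ==> r \<otimes> s = s \<otimes> r"
 obtains k s where "k >= (1::nat)" "s : A" "r [^] k = r [^] k \<otimes> r [^] k \<otimes> s [^] k"
  "(r [^] k \<otimes> s [^] k) \<otimes> (r [^] k \<otimes> s [^] k) = r [^] k \<otimes> s [^] k" "r [^] k = r [^] Suc k \<otimes> s"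
proof -
 have Ac: "A <= carrier R" using A(1) submodule_iff[OF mod] V by auto
 have rc: "r : carrier R" using r Ac by auto
 have lin: "lin_map K V V (%x. r [^] k \<otimes> x)" for k :: nat
  unfolding lin_map_def
 proof (intro conjI ballI)
  show "(\<otimes>) (r [^] k) : carrier V \<rightarrow> carrier V" using V rc by auto
  fix a x assume a: "a : carrier K" and x: "x : carrier V"
  show "r [^] k \<otimes> (a *[V] x) = a *[V] (r [^] k \<otimes> x)"
  proof (induction k)
   case 0
   have "a *[V] x : carrier R" using module.smult_closed[OF mod a x] V by auto
   then show ?case using V x by auto
  next
   case (Suc k)
   have c: "a *[V] x : carrier R" using module.smult_closed[OF mod a x] V by auto
   have "r [^] Suc k \<otimes> (a *[V] x) = r \<otimes> (r [^] k \<otimes> (a *[V] x))"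
    using rc c by (simp only: nat_pow_Suc2 m_assoc nat_pow_closed)
   also have "... = a *[V] (r \<otimes> (r [^] k \<otimes> x))" using Suc sm[OF a] V x rc by simp
   finally show ?case using V x rc by (simp only: nat_pow_Suc2 m_assoc nat_pow_closed)
  qed
 qed (use V rc in \<open>auto simp: r_distr\<close>)
 define W where "W k = (%x. r [^] k \<otimes> x) ` A" for k :: nat
 have W: "submodule (W k) K V" for k
  unfolding W_def by (rule lin_map_image[OF mod mod lin A(1)])
 have pA: "s [^] k : A" if "s : A" for s and k :: nat
  by (induction k) (use that A in auto)
 have dec: "W (Suc k) <= W k" for k
 proof
  fix x assume "x : W (Suc k)"
  then obtain s where s: "s : A" "x = r [^] Suc k \<otimes> s" by (auto simp: W_def)
  then have "x = r [^] k \<otimes> (r \<otimes> s)" using rc Ac by (auto simp: m_assoc)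
  then show "x : W k" using A(3)[OF r(1) s(1)] by (auto simp: W_def)
 qed
 \<comment> \<open>Stationarity is sought from \<open>k = 1\<close> on: an intertwining relation of
   \<open>r\<close> with an idempotent passes to \<open>r^k\<close> only for positive
   exponents.\<close>
 obtain k where k: "k >= 1" "W (Suc k) = W k"
 proof (rule ccontr)
  assume "~ thesis"
  then have ne: "W (Suc k) ~= W k" if "k >= 1" for k using that \<open>!!k. 1 <= k ==> W (Suc k) = W k ==> thesis\<close> by auto
  have "len K V (W (Suc k)) + k <= len K V (W 1)" for k
  proof (induction k)
   case (Suc k)
   have "W (Suc (Suc k)) < W (Suc k)" using dec[of "Suc k"] ne[of "Suc k"] by auto
   moreover have "W (Suc k) <= carrier V" using module.submoduleE(1)[OF mod W] .
   ultimately have "len K V (W (Suc (Suc k))) < len K V (W (Suc k))"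
    by (intro len_strict[OF finlen_mono[OF fl]] W)
   then show ?case using Suc by simp
  qed simp
  from this[of "Suc (len K V (W 1))"] show False by simp
 qed
 have "r [^] k : W k" using rc A(2) unfolding W_def by (metis imageI nat_pow_closed r_one)
 then obtain s where s: "s : A" "r [^] k = r [^] Suc k \<otimes> s" using k by (auto simp: W_def)
 have sc: "s : carrier R" using s Ac by auto
 have comm: "r [^] i \<otimes> s [^] j = s [^] j \<otimes> r [^] i" for i j :: nat
 proof (induction i)
  case (Suc i)
  have "r [^] Suc i \<otimes> s [^] j = r \<otimes> (r [^] i \<otimes> s [^] j)"
   using rc sc by (simp only: nat_pow_Suc2 m_assoc nat_pow_closed)
  also have "... = (r \<otimes> s [^] j) \<otimes> r [^] i" using Suc rc sc by (simp add: m_assoc)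
  also have "... = s [^] j \<otimes> r [^] Suc i"
   using r(2)[OF pA[OF s(1)]] rc sc by (simp only: nat_pow_Suc2 m_assoc nat_pow_closed)
  finally show ?case .
 qed (use sc in auto)
 have step: "r [^] k = r [^] (k + i) \<otimes> s [^] i" for i
 proof (induction i)
  case (Suc i)
  have "r [^] (k + i) = r [^] i \<otimes> r [^] k" using rc by (simp add: nat_pow_mult add.commute)
  also have "... = r [^] i \<otimes> (r [^] Suc k \<otimes> s)" using s by simp
  also have "... = r [^] (k + Suc i) \<otimes> s"
   using rc sc nat_pow_mult[OF rc, of i "Suc k"] m_assoc[of "r [^] i" "r [^] Suc k" s]
   by (simp add: add.commute del: nat_pow_Suc)
  finally have "r [^] k = (r [^] (k + Suc i) \<otimes> s) \<otimes> s [^] i" using Suc by simp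
  then show ?case using rc sc
   by (simp add: m_assoc nat_pow_Suc2[symmetric] del: nat_pow_Suc)
 qed (use rc in auto)
 have idem: "r [^] k = r [^] k \<otimes> r [^] k \<otimes> s [^] k" using step[of k] nat_pow_mult[OF rc, of k k] by metis
 have "(r [^] k \<otimes> s [^] k) \<otimes> (r [^] k \<otimes> s [^] k) = (r [^] k \<otimes> r [^] k \<otimes> s [^] k) \<otimes> s [^] k"
  using comm[of k k] rc sc by (metis m_assoc m_closed nat_pow_closed)
 also have "... = r [^] k \<otimes> s [^] k" using idem by simp
 finally show thesis using that[OF k(1) s(1) idem _ s(2)] by simp
qed

section \<open>Retracts and local objects in linear categories\<close>

definition End :: "('k, 'o, 'm) lincat => 'o => 'm ring" where
 "End C X = (|carrier = mors C X X, mult = cmp C X X X, one = idm C X,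
   zero = zr (Mor C X X), add = add (Mor C X X)|)"

lemma End_simps [simp]:
 "carrier (End C X) = mors C X X" "x **[End C X] y = cmp C X X X x y"
 "un (End C X) = idm C X" "zr (End C X) = zr (Mor C X X)"
 "x +[End C X] y = x +[Mor C X X] y"
 by (simp_all add: End_def)

definition local_object :: "('k, 'o, 'm) lincat => 'o => bool" where
 "local_object C X \<longleftrightarrow> X : Ob C & unit_or_nilpotent (End C X)"

definition retraction :: "('k, 'o, 'm) lincat => 'o => 'o => 'm => 'm => bool" where
 "retraction C X Z j p \<longleftrightarrow> X : Ob C & Z : Ob C & j : mors C X Z & p : mors C Z X &
   cmp C X Z X p j = idm C X"

text \<open>A summand without its complement. In a linear category the complementary idempotent need
  not split; in a triangulated one it does, see \<open>retract_summand\<close>.\<close>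

definition retract :: "('k, 'o, 'm) lincat => 'o => 'o => bool" where
 "retract C X Z \<longleftrightarrow> (EX j p. retraction C X Z j p)"

definition hom_zero :: "('k, 'o, 'm) lincat => 'o => 'o => bool" where
 "hom_zero C X Y \<longleftrightarrow> mors C X Y = {zr (Mor C X Y)}"

text \<open>The ideal of morphisms that factor through finite direct sums of objects of
  \<open>S\<close>, generated from single factorisations so that no direct sum has to be
  formed.\<close>

inductive_set thru :: "('k, 'o, 'm) lincat => 'o set => 'o => 'o => 'm set"
 for C S X Y where
  thru_zero: "zr (Mor C X Y) : thru C S X Y"
 | thru_cmp: "[|W : S; b : mors C X W; a : mors C W Y|] ==> cmp C X W Y a b : thru C S X Y"
 | thru_add: "[|f : thru C S X Y; g : thru C S X Y|] ==> f +[Mor C X Y] g : thru C S X Y"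

text \<open>The working form of membership in an add closure: \<open>X\<close> is a retract of a
  finite direct sum of objects of \<open>S\<close>, but the sum is never exhibited, and properties
  are proved by induction over \<open>thru\<close>.\<close>

definition in_add :: "('k, 'o, 'm) lincat => 'o set => 'o => bool" where
 "in_add C S X \<longleftrightarrow> X : Ob C & idm C X : thru C S X X"

lemma thru_mono: "[|f : thru C S X Y; S <= S'|] ==> f : thru C S' X Y"
 by (induction rule: thru.induct) (auto intro: thru.intros)

context linear_category
begin

lemma hom_group: "[|X : Ob C; Y : Ob C|] ==> abelian_group (Mor C X Y)"
 using mor_module module.axioms(2) by blast

lemma hom_monoid: "[|X : Ob C; Y : Ob C|] ==> abelian_monoid (Mor C X Y)"
 using hom_group abelian_group.axioms(1) by blast

declare idm_closed [simp, intro] cmp_closed [simp, intro] cmp_id_left [simp] cmp_id_right [simp]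

context
 fixes X Y assumes X: "X : Ob C" and Y: "Y : Ob C"
begin

interpretation G: abelian_group "Mor C X Y" by (rule hom_group[OF X Y])

lemma hom_simps:
 shows hom_zero_closed: "zr (Mor C X Y) : mors C X Y"
  and hom_add_closed: "[|f : mors C X Y; g : mors C X Y|] ==> f +[Mor C X Y] g : mors C X Y"
  and hom_neg_closed: "f : mors C X Y ==> -[Mor C X Y] f : mors C X Y"
  and hom_minus_closed: "[|f : mors C X Y; g : mors C X Y|] ==> f -[Mor C X Y] g : mors C X Y"
  and hom_l_zero: "f : mors C X Y ==> zr (Mor C X Y) +[Mor C X Y] f = f"
  and hom_r_zero: "f : mors C X Y ==> f +[Mor C X Y] zr (Mor C X Y) = f"
  and hom_l_neg: "f : mors C X Y ==> -[Mor C X Y] f +[Mor C X Y] f = zr (Mor C X Y)"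
  and hom_r_neg: "f : mors C X Y ==> f +[Mor C X Y] -[Mor C X Y] f = zr (Mor C X Y)"
  and hom_minus_minus: "f : mors C X Y ==> -[Mor C X Y] (-[Mor C X Y] f) = f"
  and hom_minus_zero: "-[Mor C X Y] zr (Mor C X Y) = zr (Mor C X Y)"
  and hom_diff_self: "f : mors C X Y ==> f -[Mor C X Y] f = zr (Mor C X Y)"
 by (simp_all add: G.l_neg G.r_neg G.minus_eq)

lemma hom_assoc: "[|f : mors C X Y; g : mors C X Y; h : mors C X Y|] ==>
  (f +[Mor C X Y] g) +[Mor C X Y] h = f +[Mor C X Y] (g +[Mor C X Y] h)"
 by (rule G.a_assoc)

lemma hom_comm: "[|f : mors C X Y; g : mors C X Y|] ==>
  f +[Mor C X Y] g = g +[Mor C X Y] f"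
 by (rule G.a_comm)

lemma hom_diff_zero: "[|f : mors C X Y; g : mors C X Y|] ==>
  f -[Mor C X Y] g = zr (Mor C X Y) \<longleftrightarrow> f = g"
 using G.minus_equality[of f "-[Mor C X Y] g"] by (auto simp: G.minus_eq G.r_neg)

lemma hom_add_diff: "[|f : mors C X Y; g : mors C X Y|] ==>
  g +[Mor C X Y] (f -[Mor C X Y] g) = f"
 by (simp add: G.minus_eq G.a_lcomm G.r_neg)

lemma hom_neg_unique: "[|f : mors C X Y; g : mors C X Y; f +[Mor C X Y] g = zr (Mor C X Y)|] ==>
  f = -[Mor C X Y] g"
 by (simp add: G.minus_equality)

lemma hom_idem_zero: "[|f : mors C X Y; f +[Mor C X Y] f = f|] ==> f = zr (Mor C X Y)"
 using G.add.l_cancel_one' by metis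

end

declare hom_simps [simp]

lemma cmp_zero_left [simp]:
 assumes "X : Ob C" "Y : Ob C" "Z : Ob C" "f : mors C X Y"
 shows "cmp C X Y Z (zr (Mor C Y Z)) f = zr (Mor C X Z)"
 using cmp_add_left[of X Y Z f "zr (Mor C Y Z)" "zr (Mor C Y Z)"] assms
 by (intro hom_idem_zero) simp_all

lemma cmp_zero_right [simp]:
 assumes "X : Ob C" "Y : Ob C" "Z : Ob C" "g : mors C Y Z"
 shows "cmp C X Y Z g (zr (Mor C X Y)) = zr (Mor C X Z)"
 using cmp_add_right[of X Y Z "zr (Mor C X Y)" "zr (Mor C X Y)" g] assms
 by (intro hom_idem_zero) simp_all

lemma cmp_neg_left:
 assumes "X : Ob C" "Y : Ob C" "Z : Ob C" "f : mors C X Y" "g : mors C Y Z"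
 shows "cmp C X Y Z (-[Mor C Y Z] g) f = -[Mor C X Z] cmp C X Y Z g f"
 using cmp_add_left[of X Y Z f "-[Mor C Y Z] g" g] assms
 by (intro hom_neg_unique) simp_all

lemma cmp_neg_right:
 assumes "X : Ob C" "Y : Ob C" "Z : Ob C" "f : mors C X Y" "g : mors C Y Z"
 shows "cmp C X Y Z g (-[Mor C X Y] f) = -[Mor C X Z] cmp C X Y Z g f"
 using cmp_add_right[of X Y Z "-[Mor C X Y] f" f g] assms
 by (intro hom_neg_unique) simp_all

lemma cmp_diff_left:
 assumes "X : Ob C" "Y : Ob C" "Z : Ob C" "f : mors C X Y" "g : mors C Y Z" "h : mors C Y Z"
 shows "cmp C X Y Z (g -[Mor C Y Z] h) f = cmp C X Y Z g f -[Mor C X Z] cmp C X Y Z h f"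
 using assms by (simp add: a_minus_def cmp_add_left cmp_neg_left)

lemma cmp_diff_right:
 assumes "X : Ob C" "Y : Ob C" "Z : Ob C" "f : mors C X Y" "h : mors C X Y" "g : mors C Y Z"
 shows "cmp C X Y Z g (f -[Mor C X Y] h) = cmp C X Y Z g f -[Mor C X Z] cmp C X Y Z g h"
 using assms by (simp add: a_minus_def cmp_add_right cmp_neg_right)

lemmas cmp_linear = cmp_add_left cmp_add_right cmp_neg_left cmp_neg_right cmp_diff_left cmp_diff_right

lemma cmp_finsum_left:
 assumes "X : Ob C" "Y : Ob C" "Z : Ob C" "f : mors C X Y" "finite I"
  "!!i. i : I ==> g i : mors C Y Z"
 shows "cmp C X Y Z (\<Oplus>\<^bsub>Mor C Y Z\<^esub>i\<in>I. g i) f = (\<Oplus>\<^bsub>Mor C X Z\<^esub>i\<in>I. cmp C X Y Z (g i) f)"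
proof -
 interpret G: abelian_group "Mor C Y Z" by (rule hom_group) fact+
 interpret G': abelian_group "Mor C X Z" by (rule hom_group) fact+
 show ?thesis using assms(5,6)
  by (induction I rule: finite_induct) (use assms(1-4) in \<open>auto simp: Pi_def cmp_add_left\<close>)
qed

lemma cmp_finsum_right:
 assumes "X : Ob C" "Y : Ob C" "Z : Ob C" "g : mors C Y Z" "finite I"
  "!!i. i : I ==> f i : mors C X Y"
 shows "cmp C X Y Z g (\<Oplus>\<^bsub>Mor C X Y\<^esub>i\<in>I. f i) = (\<Oplus>\<^bsub>Mor C X Z\<^esub>i\<in>I. cmp C X Y Z g (f i))"
proof -
 interpret G: abelian_group "Mor C X Y" by (rule hom_group) fact+
 interpret G': abelian_group "Mor C X Z" by (rule hom_group) fact+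
 show ?thesis using assms(5,6)
  by (induction I rule: finite_induct) (use assms(1-4) in \<open>auto simp: Pi_def cmp_add_right\<close>)
qed

lemma End: assumes X: "X : Ob C" shows "ring (End C X)"
proof (rule ringI)
 interpret G: abelian_group "Mor C X X" by (rule hom_group[OF X X])
 show "abelian_group (End C X)"
  by (rule abelian_groupI) (use X in \<open>auto simp: G.a_ac intro!: bexI[of _ "-[Mor C X X] x" for x]\<close>)
 show "Group.monoid (End C X)"
  by unfold_locales (use X in \<open>auto simp: cmp_assoc\<close>)
qed (use X in \<open>auto simp: cmp_add_left cmp_add_right\<close>)

lemma End_neg: assumes X: "X : Ob C" and f: "f : mors C X X"
 shows "-[End C X] f = -[Mor C X X] f"
proof -
 interpret R: ring "End C X" by (rule End[OF X])
 show ?thesis using R.minus_equality[of "-[Mor C X X] f" f] X f by simp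
qed

lemma End_minus: assumes X: "X : Ob C" and "f : mors C X X" "g : mors C X X"
 shows "f -[End C X] g = f -[Mor C X X] g"
 using assms End_neg by (simp add: a_minus_def)

lemma lin_map_cmp_left:
 "[|X : Ob C; Y : Ob C; Z : Ob C; g : mors C Y Z|] ==> lin_map K (Mor C X Y) (Mor C X Z) (cmp C X Y Z g)"
 unfolding lin_map_def by (auto simp: cmp_add_right cmp_smult_right)

lemma lin_map_cmp_right:
 "[|X : Ob C; Y : Ob C; Z : Ob C; f : mors C X Y|] ==>
  lin_map K (Mor C Y Z) (Mor C X Z) (%g. cmp C X Y Z g f)"
 unfolding lin_map_def by (auto simp: cmp_add_left cmp_smult_left)

lemma isomorphicI: "[|X : Ob C; Y : Ob C; f : mors C X Y; g : mors C Y X;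
  cmp C X Y X g f = idm C X; cmp C Y X Y f g = idm C Y|] ==> isomorphic C X Y"
 by (auto simp: isomorphic_def is_iso_def is_inverse_def)

lemma isomorphicE:
 assumes "isomorphic C X Y"
 obtains f g where "X : Ob C" "Y : Ob C" "f : mors C X Y" "g : mors C Y X"
  "cmp C X Y X g f = idm C X" "cmp C Y X Y f g = idm C Y"
 using assms by (auto simp: isomorphic_def is_iso_def is_inverse_def)

lemma isomorphic_refl: "X : Ob C ==> isomorphic C X X"
 by (rule isomorphicI[where f = "idm C X" and g = "idm C X"]) auto

lemma isomorphic_sym: "isomorphic C X Y ==> isomorphic C Y X"
 by (elim isomorphicE) (rule isomorphicI)

lemma cmp_cancel:
 assumes "W : Ob C" "X : Ob C" "Y : Ob C" "f : mors C X Y" "g : mors C Y X"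
  "cmp C X Y X g f = idm C X" "h : mors C W X"
 shows "cmp C W Y X g (cmp C W X Y f h) = h"
 using assms by (simp add: cmp_assoc[symmetric])

lemma is_iso_cmp:
 assumes "X : Ob C" "Y : Ob C" "Z : Ob C" "is_iso C X Y f" "is_iso C Y Z g"
 shows "is_iso C X Z (cmp C X Y Z g f)"
proof -
 obtain f' where f: "f : mors C X Y" "f' : mors C Y X" "cmp C X Y X f' f = idm C X" "cmp C Y X Y f f' = idm C Y"
  using assms by (auto simp: is_iso_def is_inverse_def)
 obtain g' where g: "g : mors C Y Z" "g' : mors C Z Y" "cmp C Y Z Y g' g = idm C Y" "cmp C Z Y Z g g' = idm C Z"
  using assms by (auto simp: is_iso_def is_inverse_def)
 have "is_inverse C X Z (cmp C X Y Z g f) (cmp C Z Y X f' g')"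
  using f g assms(1-3) unfolding is_inverse_def
  by (simp add: cmp_assoc cmp_cancel[of X Y Z g g' f] cmp_cancel[of Z Y X f' f g'])
 then show ?thesis by (auto simp: is_iso_def)
qed

lemma isomorphic_trans: "[|isomorphic C X Y; isomorphic C Y Z|] ==> isomorphic C X Z"
 unfolding isomorphic_def using is_iso_cmp by blast

lemma Units_End: assumes X: "X : Ob C" shows "f : Units (End C X) \<longleftrightarrow> is_iso C X X f"
 by (auto simp: Units_def is_iso_def is_inverse_def)

lemma retractionD:
 assumes "retraction C X Z j p"
 shows "X : Ob C" "Z : Ob C" "j : mors C X Z" "p : mors C Z X" "cmp C X Z X p j = idm C X"
 using assms by (auto simp: retraction_def)

lemma retraction_cmp:
 assumes "retraction C X Y j p" "retraction C Y Z j' p'"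
 shows "retraction C X Z (cmp C X Y Z j' j) (cmp C Z Y X p p')"
 using assms unfolding retraction_def by (auto simp: cmp_assoc cmp_cancel[of X Y Z j' p' j])

lemma retract_trans: "[|retract C X Y; retract C Y Z|] ==> retract C X Z"
 unfolding retract_def using retraction_cmp by blast

lemma isomorphic_retract: "isomorphic C X Y ==> retract C X Y"
 by (elim isomorphicE) (auto simp: retract_def retraction_def)

lemma retract_Ob: "retract C X Y ==> X : Ob C" "retract C X Y ==> Y : Ob C"
 by (auto simp: retract_def retraction_def)

lemma zero_object_hom:
 assumes "zero_object C Z" "X : Ob C"
 shows "f : mors C Z X ==> f = zr (Mor C Z X)" "f : mors C X Z ==> f = zr (Mor C X Z)"
proof -
 have Z: "Z : Ob C" "idm C Z = zr (Mor C Z Z)" using assms by (auto simp: zero_object_def)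
 show "f = zr (Mor C Z X)" if "f : mors C Z X"
  using cmp_id_right[OF Z(1) assms(2) that] Z assms(2) that by simp
 show "f = zr (Mor C X Z)" if "f : mors C X Z"
  using cmp_id_left[OF assms(2) Z(1) that] Z assms(2) that by simp
qed

lemma retract_zero: assumes "retract C X Z" "zero_object C Z" shows "zero_object C X"
proof -
 obtain j p where r: "retraction C X Z j p" using assms by (auto simp: retract_def)
 note r = retractionD[OF r]
 have "p = zr (Mor C Z X)" using zero_object_hom[OF assms(2) r(1)] r by auto
 then show ?thesis using r by (auto simp: zero_object_def)
qed

lemma hom_zeroI: "[|X : Ob C; Y : Ob C; !!f. f : mors C X Y ==> f = zr (Mor C X Y)|] ==> hom_zero C X Y"
 using hom_zero_closed by (auto simp: hom_zero_def)

lemma hom_zeroD: "[|hom_zero C X Y; f : mors C X Y|] ==> f = zr (Mor C X Y)"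
 by (auto simp: hom_zero_def)

lemma hom_zero_left:
 assumes "hom_zero C X V" "retract C Y X" "V : Ob C" shows "hom_zero C Y V"
proof -
 obtain j p where r: "retraction C Y X j p" using assms by (auto simp: retract_def)
 note r = retractionD[OF r]
 show ?thesis
 proof (rule hom_zeroI[OF r(1) assms(3)])
  fix f assume f: "f : mors C Y V"
  have "f = cmp C Y X V (cmp C X Y V f p) j" using f r assms(3) by (simp add: cmp_assoc)
  also have "cmp C X Y V f p = zr (Mor C X V)" using hom_zeroD[OF assms(1)] f r assms(3) by simp
  finally show "f = zr (Mor C Y V)" using r assms(3) by simp
 qed
qed

lemma hom_zero_right:
 assumes "hom_zero C V X" "retract C Y X" "V : Ob C" shows "hom_zero C V Y"
proof -
 obtain j p where r: "retraction C Y X j p" using assms by (auto simp: retract_def)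
 note r = retractionD[OF r]
 show ?thesis
 proof (rule hom_zeroI[OF assms(3) r(1)])
  fix f assume f: "f : mors C V Y"
  have "f = cmp C V X Y p (cmp C V Y X j f)" using f r assms(3) by (simp add: cmp_assoc[symmetric])
  also have "cmp C V Y X j f = zr (Mor C V X)" using hom_zeroD[OF assms(1)] f r assms(3) by simp
  finally show "f = zr (Mor C V Y)" using r assms(3) by simp
 qed
qed

section \<open>The ideal of morphisms through a class of objects\<close>

context
 fixes S assumes S: "S <= Ob C"
begin

lemma thru_closed: "[|f : thru C S X Y; X : Ob C; Y : Ob C|] ==> f : mors C X Y"
 by (induction rule: thru.induct) (use S in auto)

lemma thru_cmp_left:
 assumes f: "f : thru C S X Y" and g: "g : mors C Y Z" and Ob: "X : Ob C" "Y : Ob C" "Z : Ob C"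
 shows "cmp C X Y Z g f : thru C S X Z"
 using f
proof (induction rule: thru.induct)
 case (thru_cmp W b a)
 have "cmp C X Y Z g (cmp C X W Y a b) = cmp C X W Z (cmp C W Y Z g a) b"
  using thru_cmp g Ob S by (auto simp: cmp_assoc)
 then show ?case using thru_cmp g Ob S by (auto intro!: thru.thru_cmp)
next
 case (thru_add f f')
 then show ?case using thru_closed Ob g by (auto simp: cmp_add_right intro: thru.thru_add)
qed (use g Ob in \<open>auto intro: thru_zero\<close>)

lemma thru_cmp_right:
 assumes f: "f : thru C S Y Z" and g: "g : mors C X Y" and Ob: "X : Ob C" "Y : Ob C" "Z : Ob C"
 shows "cmp C X Y Z f g : thru C S X Z"
 using f
proof (induction rule: thru.induct)
 case (thru_cmp W b a)
 have "cmp C X Y Z (cmp C Y W Z a b) g = cmp C X W Z a (cmp C X Y W b g)"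
  using thru_cmp g Ob S by (auto simp: cmp_assoc)
 then show ?case using thru_cmp g Ob S by (auto intro!: thru.thru_cmp)
next
 case (thru_add f f')
 then show ?case using thru_closed Ob g by (auto simp: cmp_add_left intro: thru.thru_add)
qed (use g Ob in \<open>auto intro: thru_zero\<close>)

lemma thru_finsum:
 assumes Ob: "X : Ob C" "Y : Ob C" and "finite I" "!!i. i : I ==> f i : thru C S X Y"
 shows "(\<Oplus>\<^bsub>Mor C X Y\<^esub>i\<in>I. f i) : thru C S X Y"
proof -
 interpret G: abelian_group "Mor C X Y" by (rule hom_group[OF Ob])
 show ?thesis using assms(3,4)
  by (induction I rule: finite_induct)
   (use Ob thru_closed in \<open>auto simp: Pi_def intro!: thru_zero thru_add\<close>)
qed

lemma in_add_self: "X : S ==> in_add C S X"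
 using thru_cmp[of X S "idm C X" C X "idm C X" X] S unfolding in_add_def by auto

lemma in_add_hom: assumes "in_add C S X" "f : mors C X Y" "Y : Ob C" shows "f : thru C S X Y"
 using thru_cmp_left[of "idm C X" X X f Y] assms by (auto simp: in_add_def)

lemma in_add_hom': assumes "in_add C S Y" "f : mors C X Y" "X : Ob C" shows "f : thru C S X Y"
 using thru_cmp_right[of "idm C Y" Y Y f X] assms by (auto simp: in_add_def)

lemma in_add_retract: assumes "in_add C S Y" "retract C X Y" shows "in_add C S X"
proof -
 obtain j p where r: "retraction C X Y j p" using assms by (auto simp: retract_def)
 note r = retractionD[OF r]
 have "p : thru C S Y X" using in_add_hom[OF assms(1) r(4,1)] .
 then show ?thesis using thru_cmp_right[of p Y X j X] r by (auto simp: in_add_def)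
qed

lemma thru_hom_zero_left:
 assumes "f : thru C S X Y" "!!W. W : S ==> hom_zero C W Y" and Ob: "X : Ob C" "Y : Ob C"
 shows "f = zr (Mor C X Y)"
 using assms(1)
proof (induction rule: thru.induct)
 case (thru_cmp W b a)
 then show ?case using hom_zeroD[OF assms(2), of W a] Ob S by auto
qed (use Ob in auto)

lemma in_add_hom_zero_left:
 "[|in_add C S X; !!W. W : S ==> hom_zero C W Y; Y : Ob C|] ==> hom_zero C X Y"
 by (rule hom_zeroI, simp add: in_add_def, assumption, rule thru_hom_zero_left[OF in_add_hom])
  (auto simp: in_add_def)

text \<open>In a local ring a sum is a unit only if a summand is, so one single factorisation
  \<open>X -> W -> X\<close> is a unit, and this splits \<open>X\<close> off from
  \<open>W\<close>.\<close>

lemma local_thru_retract: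
 assumes X: "local_object C X" and f: "f : thru C S X X" and u: "f : Units (End C X)"
 shows "EX W:S. retract C X W"
proof (rule ccontr)
 assume no: "~ ?thesis"
 have Xo: "X : Ob C" and loc: "unit_or_nilpotent (End C X)" using X by (auto simp: local_object_def)
 interpret R: ring "End C X" by (rule End[OF Xo])
 have "f ~: Units (End C X)" using f
 proof (induction rule: thru.induct)
  case thru_zero
  show ?case using R.Unit_factors[OF loc, of "zr (Mor C X X)"] loc Xo
   by (metis End_simps(4) R.Units_r_inv R.Units_inv_closed R.l_null unit_or_nilpotent_def)
 next
  case (thru_cmp W b a)
  have Wo: "W : Ob C" using thru_cmp S by auto
  show ?case
  proof
   assume "cmp C X W X a b : Units (End C X)"
   then obtain g where g: "g : mors C X X" "cmp C X X X g (cmp C X W X a b) = idm C X"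
    by (auto simp: Units_def)
   have "retraction C X W b (cmp C W X X g a)"
    using thru_cmp g Wo Xo by (auto simp: retraction_def cmp_assoc)
   then show False using no thru_cmp by (auto simp: retract_def)
  qed
 next
  case (thru_add f g)
  have "f : mors C X X" "g : mors C X X" using thru_closed[OF _ Xo Xo] thru_add by auto
  then show ?case using R.Unit_sum[OF loc, of f g] thru_add by auto
 qed
 then show False using u by simp
qed

lemma local_in_add_retract:
 assumes X: "local_object C X" and "in_add C S X"
 shows "EX W:S. retract C X W"
proof -
 have Xo: "X : Ob C" using X by (auto simp: local_object_def)
 interpret R: ring "End C X" by (rule End[OF Xo])
 show ?thesis using local_thru_retract[OF X, of "idm C X"] assms(2) R.Units_one_closed
  by (auto simp: in_add_def)
qed

end

lemma in_add_trans:
 assumes "in_add C S X" "!!W. W : S ==> in_add C S' W" "S <= Ob C" "S' <= Ob C"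
 shows "in_add C S' X"
proof -
 have X: "X : Ob C" using assms by (auto simp: in_add_def)
 have "f : thru C S' X X" if "f : thru C S X X" for f
  using that
 proof (induction rule: thru.induct)
  case (thru_cmp W b a)
  have "b : thru C S' X W" using in_add_hom'[OF assms(4) assms(2)[OF thru_cmp(1)] thru_cmp(2) X] .
  then show ?case using thru_cmp_left[OF assms(4) _ thru_cmp(3)] X assms(3) thru_cmp(1) by auto
 qed (auto intro: thru_zero thru_add)
 then show ?thesis using assms(1) by (auto simp: in_add_def)
qed

lemma local_not_zero: "local_object C X ==> ~ zero_object C X"
 by (auto simp: local_object_def unit_or_nilpotent_def zero_object_def)

text \<open>The idempotent \<open>j p\<close> of a local ring is 0 or 1, and 0 would annihilate
  \<open>X\<close>.\<close>

lemma retract_local_iso: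
 assumes r: "retract C X Y" and Y: "local_object C Y" and X: "~ zero_object C X"
 shows "isomorphic C X Y"
proof -
 obtain j p where r: "retraction C X Y j p" using assms by (auto simp: retract_def)
 note r = retractionD[OF r]
 interpret R: ring "End C Y" by (rule End[OF r(2)])
 have loc: "unit_or_nilpotent (End C Y)" using Y by (auto simp: local_object_def)
 let ?e = "cmp C Y X Y j p"
 have "cmp C Y Y Y ?e ?e = ?e" using r by (simp add: cmp_assoc cmp_cancel[of Y X Y j p p])
 then consider "?e = zr (Mor C Y Y)" | "?e = idm C Y"
  using R.idempotent_trivial[OF loc, of ?e] r by auto
 then show ?thesis
 proof cases
  case 1
  have "idm C X = cmp C X Y X (cmp C Y Y X p ?e) j"
   using r by (simp add: cmp_assoc cmp_cancel)
  then have "zero_object C X" using r 1 by (simp add: zero_object_def)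
  then show ?thesis using X by simp
 next
  case 2
  then show ?thesis using r by (intro isomorphicI[of X Y j p]) auto
 qed
qed

section \<open>Biproducts and local objects\<close>

lemma biproduct_in_add:
 assumes "biproduct C Z I X j p" shows "in_add C (X ` I) Z"
proof -
 have S: "X ` I <= Ob C" and Z: "Z : Ob C" and I: "finite I" using assms by (auto simp: biproduct_def)
 have "cmp C Z (X i) Z (j i) (p i) : thru C (X ` I) Z Z" if "i : I" for i
  using that assms by (intro thru_cmp) (auto simp: biproduct_def)
 then have "(\<Oplus>\<^bsub>Mor C Z Z\<^esub>i\<in>I. cmp C Z (X i) Z (j i) (p i)) : thru C (X ` I) Z Z"
  using thru_finsum[OF S Z Z I] by auto
 then show ?thesis using assms by (auto simp: biproduct_def in_add_def)
qed

lemma biproduct_retraction: "[|biproduct C Z I X j p; i : I|] ==> retraction C (X i) Z (j i) (p i)"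
 by (auto simp: biproduct_def retraction_def)

lemma direct_sum2E:
 assumes "direct_sum2 C Z X Y"
 obtains j1 p1 j2 p2 where "Z : Ob C" "X : Ob C" "Y : Ob C"
  "j1 : mors C X Z" "p1 : mors C Z X" "j2 : mors C Y Z" "p2 : mors C Z Y"
  "cmp C X Z X p1 j1 = idm C X" "cmp C Y Z Y p2 j2 = idm C Y"
  "cmp C X Z Y p2 j1 = zr (Mor C X Y)" "cmp C Y Z X p1 j2 = zr (Mor C Y X)"
  "cmp C Z X Z j1 p1 +[Mor C Z Z] cmp C Z Y Z j2 p2 = idm C Z"
proof -
 obtain j p where b: "biproduct C Z UNIV (pair_fam X Y) j p"
  using assms by (auto simp: direct_sum2_def direct_sum_def)
 have Ob: "Z : Ob C" "X : Ob C" "Y : Ob C"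
  using b by (auto simp: biproduct_def UNIV_bool)
 interpret G: abelian_group "Mor C Z Z" by (rule hom_group[OF Ob(1,1)])
 have m: "j True : mors C X Z" "p True : mors C Z X" "j False : mors C Y Z" "p False : mors C Z Y"
  using b by (auto simp: biproduct_def UNIV_bool)
 have "(\<Oplus>\<^bsub>Mor C Z Z\<^esub>i\<in>UNIV. cmp C Z (pair_fam X Y i) Z (j i) (p i)) =
   cmp C Z X Z (j True) (p True) +[Mor C Z Z] cmp C Z Y Z (j False) (p False)"
  using m Ob by (simp add: UNIV_bool G.a_comm)
 then show thesis
  using that[OF Ob m] b by (auto simp: biproduct_def UNIV_bool)
qed

lemma direct_sum2I:
 assumes Ob: "Z : Ob C" "X : Ob C" "Y : Ob C"
  and m: "j1 : mors C X Z" "p1 : mors C Z X" "j2 : mors C Y Z" "p2 : mors C Z Y"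
  and e: "cmp C X Z X p1 j1 = idm C X" "cmp C Y Z Y p2 j2 = idm C Y"
  "cmp C X Z Y p2 j1 = zr (Mor C X Y)" "cmp C Y Z X p1 j2 = zr (Mor C Y X)"
  "cmp C Z X Z j1 p1 +[Mor C Z Z] cmp C Z Y Z j2 p2 = idm C Z"
 shows "direct_sum2 C Z X Y"
proof -
 interpret G: abelian_group "Mor C Z Z" by (rule hom_group[OF Ob(1,1)])
 have "biproduct C Z UNIV (pair_fam X Y) (%b. if b then j1 else j2) (%b. if b then p1 else p2)"
  using assms by (auto simp: biproduct_def UNIV_bool G.a_comm)
 then show ?thesis by (auto simp: direct_sum2_def direct_sum_def)
qed

lemma direct_sum2_in_add: assumes "direct_sum2 C Z X Y" shows "in_add C {X, Y} Z"
proof -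
 obtain j p where b: "biproduct C Z UNIV (pair_fam X Y) j p"
  using assms by (auto simp: direct_sum2_def direct_sum_def)
 then show ?thesis using biproduct_in_add[OF b] by (simp add: UNIV_bool insert_commute)
qed

lemma direct_sum2_retract:
 assumes "direct_sum2 C Z X Y" shows "retract C X Z" "retract C Y Z"
 using assms by (auto elim!: direct_sum2E simp: retract_def retraction_def)

lemma summand_retract: "summand C X Z ==> retract C X Z"
 using direct_sum2_retract by (auto simp: summand_def)

lemma local_indecomposable: assumes X: "local_object C X" shows "indecomposable C X"
 unfolding indecomposable_def
proof (intro conjI allI impI)
 show Xo: "X : Ob C" using X by (simp add: local_object_def)
 show "~ zero_object C X" by (rule local_not_zero[OF X])
 fix Y Z assume "direct_sum2 C X Y Z"
 then obtain j1 p1 j2 p2 where d: "X : Ob C" "Y : Ob C" "Z : Ob C"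
  "j1 : mors C Y X" "p1 : mors C X Y" "j2 : mors C Z X" "p2 : mors C X Z"
  "cmp C Y X Y p1 j1 = idm C Y" "cmp C Z X Z p2 j2 = idm C Z"
  "cmp C Y X Z p2 j1 = zr (Mor C Y Z)" "cmp C Z X Y p1 j2 = zr (Mor C Z Y)"
  by (rule direct_sum2E) blast
 interpret R: ring "End C X" by (rule End[OF Xo])
 have loc: "unit_or_nilpotent (End C X)" using X by (auto simp: local_object_def)
 let ?e = "cmp C X Y X j1 p1"
 have "cmp C X X X ?e ?e = ?e" using d by (simp add: cmp_assoc cmp_cancel)
 then consider "?e = zr (Mor C X X)" | "?e = idm C X"
  using R.idempotent_trivial[OF loc, of ?e] d by auto
 then show "zero_object C Y \<or> zero_object C Z"
 proof cases
  case 1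
  have "idm C Y = cmp C Y X Y (cmp C X X Y p1 ?e) j1" using d by (simp add: cmp_assoc cmp_cancel)
  then show ?thesis using d 1 by (simp add: zero_object_def)
 next
  case 2
  have "idm C Z = cmp C Z X Z (cmp C X X Z p2 ?e) j2" using d 2 by simp
  also have "... = zr (Mor C Z Z)" using d by (simp add: cmp_assoc)
  finally show ?thesis using d by (simp add: zero_object_def)
 qed
qed

text \<open>
 A local object occurs at most once in a biproduct of pairwise non-isomorphic local objects:
 two occurrences would give an invertible matrix of rank one modulo the radical.
\<close>

lemma biproduct_multiplicity_free:
 assumes Z: "biproduct C Z S (%X. X) j p" and S: "nonisomorphic_indecomposables C S"
  "!!Y. Y : S ==> local_object C Y"
  and X: "local_object C X" and r1: "retraction C X Z j1 p1" and r2: "retraction C X Z j2 p2"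
  and 0: "cmp C X Z X p1 j2 = zr (Mor C X X)"
 shows False
proof -
 have SO: "S <= Ob C" and Zo: "Z : Ob C" and fS: "finite S" using Z by (auto simp: biproduct_def)
 note r1 = retractionD[OF r1] and r2 = retractionD[OF r2]
 have Xo: "X : Ob C" and loc: "unit_or_nilpotent (End C X)" using X by (auto simp: local_object_def)
 interpret R: ring "End C X" by (rule End[OF Xo])
 interpret G: abelian_group "Mor C Z Z" by (rule hom_group[OF Zo Zo])
 have "in_add C S Z" using biproduct_in_add[OF Z] by simp
 then have "in_add C S X"
  by (rule in_add_retract[OF SO]) (use r1 in \<open>auto simp: retract_def retraction_def\<close>)
 then obtain Y where Y: "Y : S" "retract C X Y" using local_in_add_retract[OF SO X] by auto
 have iso: "isomorphic C X W" if "W : S" "retract C X W" for W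
  using retract_local_iso that S local_not_zero[OF X] by blast
 obtain h h' where h: "Y : Ob C" "h : mors C X Y" "h' : mors C Y X"
  "cmp C X Y X h' h = idm C X" "cmp C Y X Y h h' = idm C Y"
  using iso[OF Y] by (elim isomorphicE)
 \<comment> \<open>The part of the identity of \<open>Z\<close> that avoids \<open>Y\<close>. An
   endomorphism of \<open>X\<close> passing through it is a non-unit, since no other member of
   \<open>S\<close> is isomorphic to \<open>X\<close>.\<close>
 define g where "g = (\<Oplus>\<^bsub>Mor C Z Z\<^esub>W\<in>S - {Y}. cmp C Z W Z (j W) (p W))"
 have jp: "j W : mors C W Z" "p W : mors C Z W" if "W : S" for W
  using Z that by (auto simp: biproduct_def)
 have gt: "g : thru C (S - {Y}) Z Z" unfolding g_def
  by (rule thru_finsum) (use SO Zo fS jp in \<open>auto intro: thru_cmp\<close>)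
 have gm: "g : mors C Z Z" by (rule thru_closed[OF _ gt Zo Zo]) (use SO in auto)
 have "idm C Z = (\<Oplus>\<^bsub>Mor C Z Z\<^esub>W\<in>insert Y (S - {Y}). cmp C Z W Z (j W) (p W))"
  using Z Y by (simp add: biproduct_def insert_absorb)
 also have "... = cmp C Z Y Z (j Y) (p Y) +[Mor C Z Z] g"
  unfolding g_def by (rule G.finsum_insert) (use fS jp SO Zo Y in \<open>auto simp: Pi_def subset_iff\<close>)
 finally have id: "idm C Z = cmp C Z Y Z (j Y) (p Y) +[Mor C Z Z] g" .
 have nonunit: "cmp C X Z X q (cmp C X Z Z g i) ~: Units (End C X)"
  if "q : mors C Z X" "i : mors C X Z" for q i
 proof
  assume u: "cmp C X Z X q (cmp C X Z Z g i) : Units (End C X)"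
  have S': "S - {Y} <= Ob C" using SO by auto
  have "cmp C X Z X q (cmp C X Z Z g i) : thru C (S - {Y}) X X"
   using thru_cmp_left[OF S' thru_cmp_right[OF S' gt that(2) Xo Zo Zo] that(1) Xo Zo Xo] .
  from local_thru_retract[OF S' X this u] obtain W where W: "W : S" "W ~= Y" "retract C X W" by auto
  then have "isomorphic C Y W" using iso isomorphic_sym isomorphic_trans Y by blast
  then show False using W Y S unfolding nonisomorphic_indecomposables_def by blast
 qed
 \<comment> \<open>Row and column coordinates along the single copy of \<open>Y\<close>, transported
   to \<open>X\<close> by \<open>h\<close> and \<open>h'\<close>: up to a non-unit,
   \<open>q i\<close> is the product of \<open>al q\<close> and \<open>be i\<close>.\<close>
 define al where "al q = cmp C X Z X q (cmp C X Y Z (j Y) h)" for q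
 define be where "be i = cmp C X Y X h' (cmp C X Z Y (p Y) i)" for i
 have ab: "al q : mors C X X" "be i : mors C X X" if "q : mors C Z X" "i : mors C X Z" for q i
  using that jp[OF Y(1)] h Xo Zo by (auto simp: al_def be_def)
 have split: "cmp C X Z X q i = cmp C X X X (al q) (be i) +[Mor C X X] cmp C X Z X q (cmp C X Z Z g i)"
  if qi: "q : mors C Z X" "i : mors C X Z" for q i
 proof -
  have "cmp C X Z X q i = cmp C X Z X q (cmp C X Z Z (idm C Z) i)" using qi Xo Zo by simp
  also have "... = cmp C X Z X q (cmp C X Z Z (cmp C Z Y Z (j Y) (p Y)) i) +[Mor C X X] cmp C X Z X q (cmp C X Z Z g i)"
   unfolding id using qi Xo Zo gm jp[OF Y(1)] h by (simp add: cmp_linear)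
  also have "cmp C X Z X q (cmp C X Z Z (cmp C Z Y Z (j Y) (p Y)) i) = cmp C X X X (al q) (be i)"
   unfolding al_def be_def using qi Xo Zo jp[OF Y(1)] h
   by (simp add: cmp_assoc cmp_cancel[of X Y X h' h])
  finally show ?thesis .
 qed
 have uu: "al q : Units (End C X)" "be i : Units (End C X)"
  if qi: "q : mors C Z X" "i : mors C X Z" and 1: "cmp C X Z X q i = idm C X" for q i
 proof -
  have "cmp C X X X (al q) (be i) : Units (End C X)"
   using R.Unit_sum[OF loc, of "cmp C X X X (al q) (be i)" "cmp C X Z X q (cmp C X Z Z g i)"]
    nonunit[OF qi] split[OF qi] 1 ab[OF qi] Xo Zo qi gm R.Units_one_closed by auto
  then show "al q : Units (End C X)" "be i : Units (End C X)"
   using R.Unit_factors[OF loc, of "al q" "be i"] ab[OF qi] by auto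
 qed
 \<comment> \<open>\<open>p1\<close> and \<open>j2\<close> belong to different retractions, yet
   \<open>al p1\<close> and \<open>be j2\<close> are both units; so \<open>p1 j2\<close> is a unit
   plus a non-unit and cannot vanish.\<close>
 have u: "cmp C X X X (al p1) (be j2) : Units (End C X)"
  using R.Units_m_closed[OF uu(1)[OF r1(4,3,5)] uu(2)[OF r2(4,3,5)]] by simp
 let ?n = "cmp C X Z X p1 (cmp C X Z Z g j2)"
 have nm: "?n : mors C X X" using r1 r2 gm by simp
 have "cmp C X X X (al p1) (be j2) +[Mor C X X] ?n = zr (Mor C X X)"
  using split[OF r1(4) r2(3)] 0 by simp
 then have eq: "?n = -[End C X] (cmp C X X X (al p1) (be j2))"
  using ab[OF r1(4) r2(3)] nm Xo
  by (intro R.minus_equality[symmetric]) (auto simp: hom_comm)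
 have "?n : Units (End C X)"
  using R.Units_m_closed[OF R.Units_minus_one_closed u] ab[OF r1(4) r2(3)] Xo
   R.l_minus[of "idm C X" "cmp C X X X (al p1) (be j2)"] unfolding eq by simp
 then show False using nonunit[OF r1(4) r2(3)] by simp
qed

end

lemma (in ring) one_minus_one_minus: "h : carrier R ==> \<one> \<ominus> (\<one> \<ominus> h) = h"
 by (simp add: minus_eq minus_add r_neg2)

context linear_category
begin

lemma hom_neg_inject:
 assumes "X : Ob C" "Y : Ob C" "f : mors C X Y" "g : mors C X Y"
 shows "-[Mor C X Y] f = -[Mor C X Y] g \<longleftrightarrow> f = g"
 using assms hom_minus_minus by metis

lemma biproduct_insert:
 assumes b: "biproduct C Z I X j p" and d: "direct_sum2 C Z' Z (X i)" and i: "i ~: I"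
 shows "EX j' p'. biproduct C Z' (insert i I) X j' p'"
proof -
 obtain j1 p1 j2 p2 where d: "Z' : Ob C" "Z : Ob C" "X i : Ob C"
  "j1 : mors C Z Z'" "p1 : mors C Z' Z" "j2 : mors C (X i) Z'" "p2 : mors C Z' (X i)"
  "cmp C Z Z' Z p1 j1 = idm C Z" "cmp C (X i) Z' (X i) p2 j2 = idm C (X i)"
  "cmp C Z Z' (X i) p2 j1 = zr (Mor C Z (X i))" "cmp C (X i) Z' Z p1 j2 = zr (Mor C (X i) Z)"
  "cmp C Z' Z Z' j1 p1 +[Mor C Z' Z'] cmp C Z' (X i) Z' j2 p2 = idm C Z'"
  using d by (rule direct_sum2E) blast
 have B: "finite I" "!!k. k : I ==> X k : Ob C" "!!k. k : I ==> j k : mors C (X k) Z" "!!k. k : I ==> p k : mors C Z (X k)"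
  "!!k l. [|k : I; l : I|] ==> cmp C (X k) Z (X l) (p l) (j k) = (if k = l then idm C (X k) else zr (Mor C (X k) (X l)))"
  "(\<Oplus>\<^bsub>Mor C Z Z\<^esub>k\<in>I. cmp C Z (X k) Z (j k) (p k)) = idm C Z"
  using b by (auto simp: biproduct_def)
 let ?j = "%k. if k = i then j2 else cmp C (X k) Z Z' j1 (j k)"
 let ?p = "%k. if k = i then p2 else cmp C Z' Z (X k) (p k) p1"
 interpret G: abelian_group "Mor C Z' Z'" by (rule hom_group[OF d(1,1)])
 have m: "?j k : mors C (X k) Z'" "?p k : mors C Z' (X k)" "X k : Ob C" if "k : insert i I" for k
  using that B d by auto
 have "cmp C Z' Z Z' j1 p1 = cmp C Z' Z Z' (cmp C Z Z Z' j1 (\<Oplus>\<^bsub>Mor C Z Z\<^esub>k\<in>I. cmp C Z (X k) Z (j k) (p k))) p1"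
  using d B(6) by simp
 also have "... = cmp C Z' Z Z' (\<Oplus>\<^bsub>Mor C Z Z'\<^esub>k\<in>I. cmp C Z Z Z' j1 (cmp C Z (X k) Z (j k) (p k))) p1"
  using d B by (subst cmp_finsum_right) auto
 also have "... = (\<Oplus>\<^bsub>Mor C Z' Z'\<^esub>k\<in>I. cmp C Z' Z Z' (cmp C Z Z Z' j1 (cmp C Z (X k) Z (j k) (p k))) p1)"
  using d B by (subst cmp_finsum_left) auto
 also have "... = (\<Oplus>\<^bsub>Mor C Z' Z'\<^esub>k\<in>I. cmp C Z' (X k) Z' (?j k) (?p k))"
  by (rule G.finsum_cong') (use d B i in \<open>auto simp: cmp_assoc\<close>)
 finally have s: "cmp C Z' Z Z' j1 p1 = (\<Oplus>\<^bsub>Mor C Z' Z'\<^esub>k\<in>I. cmp C Z' (X k) Z' (?j k) (?p k))" .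
 have "(\<Oplus>\<^bsub>Mor C Z' Z'\<^esub>k\<in>insert i I. cmp C Z' (X k) Z' (?j k) (?p k)) =
   cmp C Z' (X i) Z' (?j i) (?p i) +[Mor C Z' Z'] (\<Oplus>\<^bsub>Mor C Z' Z'\<^esub>k\<in>I. cmp C Z' (X k) Z' (?j k) (?p k))"
  by (rule G.finsum_insert) (use d B i m in \<open>auto simp: Pi_def\<close>)
 then have sum: "(\<Oplus>\<^bsub>Mor C Z' Z'\<^esub>k\<in>insert i I. cmp C Z' (X k) Z' (?j k) (?p k)) = idm C Z'"
  using d s[symmetric] by (simp add: G.a_comm)
 have pj: "cmp C (X k) Z' (X l) (?p l) (?j k) = (if k = l then idm C (X k) else zr (Mor C (X k) (X l)))"
  if kl: "k : insert i I" "l : insert i I" for k l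
 proof -
  consider "k = i" "l = i" | "k = i" "l ~= i" "l : I" | "k ~= i" "l = i" "k : I" | "k ~= i" "l ~= i" "k : I" "l : I"
   using kl by auto
  then show ?thesis
  proof cases
   case 1 then show ?thesis using d by simp
  next
   case 2 then show ?thesis using d B by (simp add: cmp_assoc)
  next
   case 3
   then show ?thesis using d B by (simp add: cmp_assoc[symmetric])
  next
   case 4
   have "cmp C (X k) Z' (X l) (cmp C Z' Z (X l) (p l) p1) (cmp C (X k) Z Z' j1 (j k)) =
     cmp C (X k) Z (X l) (p l) (cmp C (X k) Z' Z p1 (cmp C (X k) Z Z' j1 (j k)))"
    using 4 d B by (simp add: cmp_assoc)
   also have "... = cmp C (X k) Z (X l) (p l) (j k)" using 4 d B by (simp add: cmp_cancel)
   finally show ?thesis using 4 B by simp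
  qed
 qed
 have "biproduct C Z' (insert i I) X ?j ?p"
  unfolding biproduct_def using d(1) B(1) m pj sum by (intro conjI ballI) auto
 then show ?thesis by blast
qed

lemma biproduct_empty: "zero_object C Z ==> biproduct C Z {} X j p"
 by (auto simp: biproduct_def zero_object_def abelian_monoid.finsum_empty[OF hom_monoid])

lemma direct_sum_exists:
 assumes add: "additive_category K C" and I: "finite I" "!!i. i : I ==> X i : Ob C"
 shows "EX Z j p. biproduct C Z I X j p"
 using I
proof (induction I rule: finite_induct)
 case empty
 obtain Z where "zero_object C Z" using add by (auto simp: additive_category_def)
 then show ?case using biproduct_empty by blast
next
 case (insert i I)
 then obtain Z j p where b: "biproduct C Z I X j p" by auto
 then have "Z : Ob C" "X i : Ob C" using insert by (auto simp: biproduct_def)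
 then obtain Z' where "direct_sum2 C Z' Z (X i)" using add by (auto simp: additive_category_def)
 then show ?case using biproduct_insert[OF b] insert by blast
qed

text \<open>The evaluation map from one copy of \<open>T\<close> for each member of a finite
  spanning set of Hom(T, N): its image is a subspace and contains the spanning set.\<close>

lemma approximation_exists:
 assumes add: "additive_category K C" and T: "T : Ob C" and N: "N : Ob C" and fl: "fl K (Mor C T N)"
 obtains R s where "in_add C {T} R" "s : mors C R N"
  "!!f. f : mors C T N ==> EX g:mors C T R. f = cmp C T R N s g"
proof -
 note V = mor_module[OF T N]
 interpret V: abelian_group "Mor C T N" by (rule hom_group[OF T N])
 obtain A where A: "finite A" "A <= mors C T N" "!!W. submodule W K (Mor C T N) ==> A <= W ==> mors C T N <= W"
  using finlen_finite_span[OF K_field V submodule_carrier[OF V] fl] by auto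
 obtain R j p where b: "biproduct C R A (%_. T) j p"
  using direct_sum_exists[OF add A(1), of "%_. T"] T by auto
 have R: "R : Ob C" using b by (auto simp: biproduct_def)
 have jp: "j a : mors C T R" "p a : mors C R T" if "a : A" for a using b that by (auto simp: biproduct_def)
 define s where "s = (\<Oplus>\<^bsub>Mor C R N\<^esub>a\<in>A. cmp C R T N a (p a))"
 interpret G: abelian_group "Mor C R N" by (rule hom_group[OF R N])
 have s: "s : mors C R N" unfolding s_def
  by (rule G.finsum_closed) (use A jp R T N in auto)
 have sj: "cmp C T R N s (j a) = a" if a: "a : A" for a
 proof -
  have "cmp C T R N s (j a) = (\<Oplus>\<^bsub>Mor C T N\<^esub>i\<in>A. cmp C T R N (cmp C R T N i (p i)) (j a))"
   unfolding s_def by (rule cmp_finsum_left) (use A jp R T N a in auto)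
  also have "... = (\<Oplus>\<^bsub>Mor C T N\<^esub>i\<in>A. if a = i then i else zr (Mor C T N))"
  proof (rule V.finsum_cong'[OF refl])
   fix i assume i: "i : A"
   have "cmp C T R T (p i) (j a) = (if a = i then idm C T else zr (Mor C T T))"
    using b a i by (auto simp: biproduct_def)
   then show "cmp C T R N (cmp C R T N i (p i)) (j a) = (if a = i then i else zr (Mor C T N))"
    using A jp R T N a i by (auto simp: cmp_assoc subset_iff)
  qed (use A T N in auto)
  also have "... = a" by (rule V.finsum_singleton) (use A a in auto)
  finally show ?thesis .
 qed
 have "mors C T N <= cmp C T R N s ` mors C T R"
 proof (rule A(3))
  show "submodule (cmp C T R N s ` mors C T R) K (Mor C T N)"
   by (rule lin_map_image[OF mor_module[OF T R] V lin_map_cmp_left submodule_carrier[OF mor_module[OF T R]]])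
    (use T R N s in auto)
  show "A <= cmp C T R N s ` mors C T R" using sj jp by (metis image_eqI subsetI)
 qed
 moreover have "in_add C {T} R"
 \<comment> \<open>For empty \<open>A\<close> the index image is empty rather than
   \<open>{T}\<close>, and \<open>R\<close> is a zero object.\<close>
 proof (cases "A = {}")
  case False
  then have "(%_. T) ` A = {T}" by auto
  then show ?thesis using biproduct_in_add[OF b] by simp
 next
  case True
  have "in_add C {} R" using biproduct_in_add[OF b] True by simp
  then show ?thesis by (auto simp: in_add_def intro: thru_mono)
 qed
 ultimately show thesis using that[of R s] s by (auto simp: image_def)
qed

end

section \<open>Triangulated categories\<close>

lemma linear_functor_zero:
 assumes "linear_functor K C C' F" "linear_category K C" "linear_category K C'" "X : Ob C" "Y : Ob C"
 shows "fmor F X Y (zr (Mor C X Y)) = zr (Mor C' (fob F X) (fob F Y))"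
proof -
 interpret F: linear_functor K C C' F by fact
 interpret C: linear_category K C by fact
 interpret C': linear_category K C' by fact
 have "fmor F X Y (zr (Mor C X Y) +[Mor C X Y] zr (Mor C X Y)) =
   fmor F X Y (zr (Mor C X Y)) +[Mor C' (fob F X) (fob F Y)] fmor F X Y (zr (Mor C X Y))"
  using assms by (intro F.fmor_add) auto
 then show ?thesis using assms F.fob_closed F.fmor_closed by (intro C'.hom_idem_zero) auto
qed

lemma linear_functor_neg:
 assumes "linear_functor K C C' F" "linear_category K C" "linear_category K C'" "X : Ob C" "Y : Ob C" "f : mors C X Y"
 shows "fmor F X Y (-[Mor C X Y] f) = -[Mor C' (fob F X) (fob F Y)] fmor F X Y f"
proof -
 interpret F: linear_functor K C C' F by fact
 interpret C: linear_category K C by fact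
 interpret C': linear_category K C' by fact
 have "fmor F X Y (-[Mor C X Y] f +[Mor C X Y] f) =
   fmor F X Y (-[Mor C X Y] f) +[Mor C' (fob F X) (fob F Y)] fmor F X Y f"
  using assms by (intro F.fmor_add) auto
 then show ?thesis
  using assms F.fob_closed F.fmor_closed linear_functor_zero[OF assms(1-5)]
  by (intro C'.hom_neg_unique) auto
qed

lemma (in triangulated_category) is_linear_category: "linear_category K C"
 using additive by (simp add: additive_category_def)

sublocale triangulated_category < linear_category K C
 by (rule is_linear_category)

context triangulated_category
begin

abbreviation sh where "sh == fob \<Sigma>"

abbreviation shm where "shm == fmor \<Sigma>"

lemma sh_functor: "linear_functor K C C \<Sigma>"
 and sh_ff: "fully_faithful C C \<Sigma>" and sh_bij: "bij_betw sh (Ob C) (Ob C)"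
 using shift_automorphism by (auto simp: automorphism_def)

lemma sh_ob [simp]: "X : Ob C ==> sh X : Ob C"
 by (rule linear_functor.fob_closed[OF sh_functor])

lemma sh_mor [simp]: "[|X : Ob C; Y : Ob C; f : mors C X Y|] ==> shm X Y f : mors C (sh X) (sh Y)"
 by (rule linear_functor.fmor_closed[OF sh_functor])

lemma sh_id [simp]: "X : Ob C ==> shm X X (idm C X) = idm C (sh X)"
 by (rule linear_functor.fmor_id[OF sh_functor])

lemma sh_zero [simp]: "[|X : Ob C; Y : Ob C|] ==> shm X Y (zr (Mor C X Y)) = zr (Mor C (sh X) (sh Y))"
 by (rule linear_functor_zero[OF sh_functor is_linear_category is_linear_category])

lemmas sh_cmp = linear_functor.fmor_cmp[OF sh_functor]

lemmas sh_add = linear_functor.fmor_add[OF sh_functor]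

lemma sh_full:
 assumes "X : Ob C" "Y : Ob C" "g : mors C (sh X) (sh Y)"
 obtains f where "f : mors C X Y" "g = shm X Y f"
 using sh_ff assms unfolding fully_faithful_def bij_betw_def by blast

lemma sh_faithful:
 assumes "X : Ob C" "Y : Ob C" "f : mors C X Y" "g : mors C X Y" "shm X Y f = shm X Y g"
 shows "f = g"
 using sh_ff assms unfolding fully_faithful_def bij_betw_def inj_on_def by blast

lemma hom_zero_sh:
 assumes "X : Ob C" "Y : Ob C"
 shows "hom_zero C (sh X) (sh Y) \<longleftrightarrow> hom_zero C X Y"
proof
 assume h: "hom_zero C (sh X) (sh Y)"
 show "hom_zero C X Y"
 proof (rule hom_zeroI[OF assms])
  fix f assume "f : mors C X Y"
  then show "f = zr (Mor C X Y)"
   using hom_zeroD[OF h, of "shm X Y f"] sh_faithful[of X Y f "zr (Mor C X Y)"] assms by simp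
 qed
next
 assume h: "hom_zero C X Y"
 show "hom_zero C (sh X) (sh Y)"
 proof (rule hom_zeroI)
  fix g assume "g : mors C (sh X) (sh Y)"
  then obtain f where "f : mors C X Y" "g = shm X Y f" using sh_full assms by blast
  then show "g = zr (Mor C (sh X) (sh Y))" using hom_zeroD[OF h, of f] assms by simp
 qed (use assms in auto)
qed

lemma sh_preimage: assumes "Y : Ob C" obtains X where "X : Ob C" "Y = sh X"
 using sh_bij assms unfolding bij_betw_def by blast

lemma zero_object_exists: obtains Z where "zero_object C Z"
 using additive by (auto simp: additive_category_def)

lemma zero_object_sh: "zero_object C Z ==> zero_object C (sh Z)"
 unfolding zero_object_def using sh_zero[of Z Z] sh_id[of Z] by auto

lemma triD:
 assumes "(X, Y, Z, u, v, w) : \<Delta>"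
 shows "X : Ob C" "Y : Ob C" "Z : Ob C" "u : mors C X Y" "v : mors C Y Z" "w : mors C Z (sh X)"
 using triangle_candidate[OF assms] by (auto simp: candidate_triangle_def)

lemma tri_rotate:
 assumes "(X, Y, Z, u, v, w) : \<Delta>"
 shows "(Y, Z, sh X, v, w, -[Mor C (sh X) (sh Y)] shm X Y u) : \<Delta>"
 using TR2[OF triangle_candidate[OF assms]] assms by simp

lemma TR3E:
 assumes "(X, Y, Z, u, v, w) : \<Delta>" "(X', Y', Z', u', v', w') : \<Delta>"
  "a : mors C X X'" "b : mors C Y Y'" "cmp C X Y Y' b u = cmp C X X' Y' u' a"
 obtains c where "c : mors C Z Z'" "cmp C Y Z Z' c v = cmp C Y Y' Z' v' b"
  "cmp C Z (sh X) (sh X') (shm X X' a) w = cmp C Z Z' (sh X') w' c"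
 using TR3[OF assms] that by (auto simp: triangle_map_def)

lemma tri_zero:
 assumes t: "(X, Y, Z, u, v, w) : \<Delta>"
 shows tri_vu: "cmp C X Y Z v u = zr (Mor C X Z)"
  and tri_wv: "cmp C Y Z (sh X) w v = zr (Mor C Y (sh X))"
  and tri_uw: "cmp C Z (sh X) (sh Y) (shm X Y u) w = zr (Mor C Z (sh Y))"
proof -
 have vu: "cmp C X Y Z v u = zr (Mor C X Z)" if t: "(X, Y, Z, u, v, w) : \<Delta>" for X Y Z u v w
 proof -
  note t' = triD[OF t]
  obtain Z0 where Z0: "zero_object C Z0" by (rule zero_object_exists)
  then have Oo: "Z0 : Ob C" by (simp add: zero_object_def)
  \<comment> \<open>The triangle on the identity of \<open>X\<close> maps to the given one, and its
    third object is zero.\<close>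
  obtain c where "c : mors C Z0 Z" "cmp C X Z0 Z c (zr (Mor C X Z0)) = cmp C X Y Z v u"
   by (rule TR3E[OF TR1_id[OF t'(1) Z0] t, of "idm C X" u]) (use t' in auto)
  then show ?thesis using t' Oo by simp
 qed
 note t' = triD[OF t]
 show "cmp C X Y Z v u = zr (Mor C X Z)" by (rule vu[OF t])
 show "cmp C Y Z (sh X) w v = zr (Mor C Y (sh X))" by (rule vu[OF tri_rotate[OF t]])
 have "cmp C Z (sh X) (sh Y) (-[Mor C (sh X) (sh Y)] shm X Y u) w = zr (Mor C Z (sh Y))"
  by (rule vu[OF tri_rotate[OF tri_rotate[OF t]]])
 then have "-[Mor C Z (sh Y)] cmp C Z (sh X) (sh Y) (shm X Y u) w = zr (Mor C Z (sh Y))"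
  using t' by (simp add: cmp_neg_left)
 then show "cmp C Z (sh X) (sh Y) (shm X Y u) w = zr (Mor C Z (sh Y))"
  using t' hom_minus_minus[of Z "sh Y" "cmp C Z (sh X) (sh Y) (shm X Y u) w"] by simp
qed

text \<open>Exactness of Hom(W, -) at \<open>Y\<close>. TR3 completes only the third arrow of a map
  of triangles, so both triangles are rotated until the wanted \<open>h\<close> stands there in
  shifted form; fullness of the shift brings it back.\<close>

lemma tri_lift:
 assumes t: "(X, Y, Z, u, v, w) : \<Delta>" and W: "W : Ob C" and g: "g : mors C W Y"
  and 0: "cmp C W Y Z v g = zr (Mor C W Z)"
 obtains h where "h : mors C W X" "g = cmp C W X Y u h"
proof -
 note t' = triD[OF t]
 obtain Z0 where Z0: "zero_object C Z0" by (rule zero_object_exists)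
 then have Oo: "Z0 : Ob C" by (simp add: zero_object_def)
 obtain c where c: "c : mors C (sh W) (sh X)"
  "cmp C (sh W) (sh W) (sh Y) (shm W Y g) (-[Mor C (sh W) (sh W)] shm W W (idm C W)) =
   cmp C (sh W) (sh X) (sh Y) (-[Mor C (sh X) (sh Y)] shm X Y u) c"
  by (rule TR3E[OF tri_rotate[OF TR1_id[OF W Z0]] tri_rotate[OF t] g, of "zr (Mor C Z0 Z)"])
   (use t' W Oo 0 in auto)
 obtain h where h: "h : mors C W X" "c = shm W X h" using sh_full[OF W t'(1) c(1)] .
 have "-[Mor C (sh W) (sh Y)] shm W Y g = -[Mor C (sh W) (sh Y)] shm W Y (cmp C W X Y u h)"
  using c(2) t' h W g by (simp add: cmp_neg_left cmp_neg_right sh_cmp)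
 then have "shm W Y g = shm W Y (cmp C W X Y u h)"
  using t' h W g by (simp add: hom_neg_inject)
 then have "g = cmp C W X Y u h" using t' h W g sh_faithful[of W Y g "cmp C W X Y u h"] by simp
 then show thesis using that h by auto
qed

lemma tri_zero_left:
 assumes W: "W : Ob C" and Z0: "zero_object C Z0"
 shows "(Z0, W, W, zr (Mor C Z0 W), idm C W, zr (Mor C W (sh Z0))) : \<Delta>"
proof -
 have Oo: "Z0 : Ob C" using Z0 by (simp add: zero_object_def)
 have "candidate_triangle C \<Sigma> (Z0, W, W, zr (Mor C Z0 W), idm C W, zr (Mor C W (sh Z0)))"
  using Oo W by (simp add: candidate_triangle_def)
 moreover have "(W, W, sh Z0, idm C W, zr (Mor C W (sh Z0)), -[Mor C (sh Z0) (sh W)] shm Z0 W (zr (Mor C Z0 W))) : \<Delta>"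
  using TR1_id[OF W zero_object_sh[OF Z0]] Oo W by (simp add: hom_minus_zero)
 ultimately show ?thesis by (simp add: TR2)
qed

text \<open>Exactness of Hom(-, W), by comparison with the triangle
  \<open>0 -> W -> W\<close>.\<close>

lemma tri_extend:
 assumes t: "(X, Y, Z, u, v, w) : \<Delta>" and W: "W : Ob C" and g: "g : mors C Y W"
  and 0: "cmp C X Y W g u = zr (Mor C X W)"
 obtains h where "h : mors C Z W" "g = cmp C Y Z W h v"
proof -
 note t' = triD[OF t]
 obtain Z0 where Z0: "zero_object C Z0" by (rule zero_object_exists)
 then have Oo: "Z0 : Ob C" by (simp add: zero_object_def)
 obtain c where "c : mors C Z W" "cmp C Y Z W c v = cmp C Y W W (idm C W) g"
  by (rule TR3E[OF t tri_zero_left[OF W Z0], of "zr (Mor C X Z0)" g]) (use t' W Oo g 0 in auto)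
 then show thesis using that t' W g by simp
qed

lemma tri_lift_w:
 assumes t: "(X, Y, Z, u, v, w) : \<Delta>" and W: "W : Ob C" and g: "g : mors C W Z"
  and 0: "cmp C W Z (sh X) w g = zr (Mor C W (sh X))"
 obtains h where "h : mors C W Y" "g = cmp C W Y Z v h"
 using tri_lift[OF tri_rotate[OF t] W g 0] .

lemma tri_extend_w:
 assumes t: "(X, Y, Z, u, v, w) : \<Delta>" and W: "W : Ob C" and g: "g : mors C Z W"
  and 0: "cmp C Y Z W g v = zr (Mor C Y W)"
 obtains h where "h : mors C (sh X) W" "g = cmp C Z (sh X) W h w"
 using tri_extend[OF tri_rotate[OF t] W g 0] .

text \<open>Exactness at a further spot of the long sequence. The signs of rotated triangles are
  absorbed here and in the companion lemmas, so that later arguments see none.\<close>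

lemma tri_lift_sh:
 assumes t: "(X, Y, Z, u, v, w) : \<Delta>" and W: "W : Ob C" and g: "g : mors C W (sh X)"
  and 0: "cmp C W (sh X) (sh Y) (shm X Y u) g = zr (Mor C W (sh Y))"
 obtains h where "h : mors C W Z" "g = cmp C W Z (sh X) w h"
 by (rule tri_lift[OF tri_rotate[OF tri_rotate[OF t]] W g])
  (use 0 triD[OF t] W g that in \<open>auto simp: cmp_neg_left hom_minus_zero\<close>)

lemma tri_extend_sh:
 assumes t: "(X, Y, Z, u, v, w) : \<Delta>" and W: "W : Ob C" and g: "g : mors C X W"
  and 0: "cmp C Z (sh X) (sh W) (shm X W g) w = zr (Mor C Z (sh W))"
 obtains h where "h : mors C Y W" "g = cmp C X Y W h u"
proof -
 note t' = triD[OF t]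
 obtain k where k: "k : mors C (sh Y) (sh W)"
  "shm X W g = cmp C (sh X) (sh Y) (sh W) k (-[Mor C (sh X) (sh Y)] shm X Y u)"
  using tri_extend[OF tri_rotate[OF tri_rotate[OF t]] _ _ 0] t' W g by auto
 let ?k = "-[Mor C (sh Y) (sh W)] k"
 obtain h where h: "h : mors C Y W" "?k = shm Y W h" using sh_full[of Y W ?k] t' W k by auto
 have "shm X W g = cmp C (sh X) (sh Y) (sh W) ?k (shm X Y u)"
  using k t' W by (simp add: cmp_neg_left cmp_neg_right)
 also have "... = shm X W (cmp C X Y W h u)" using h t' W by (simp add: sh_cmp)
 finally have "g = cmp C X Y W h u" using h t' W g sh_faithful[of X W g "cmp C X Y W h u"] by simp
 then show thesis using that h by auto
qed

text \<open>After one rotation the third place belongs to the shifted first object, where TR3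
  applies.\<close>

lemma TR3_backE:
 assumes t: "(X, Y, Z, u, v, w) : \<Delta>" and s: "(X', Y', Z', u', v', w') : \<Delta>"
  and b: "b : mors C Y Y'" and c: "c : mors C Z Z'" and e: "cmp C Y Z Z' c v = cmp C Y Y' Z' v' b"
 obtains a where "a : mors C X X'" "cmp C X Y Y' b u = cmp C X X' Y' u' a"
  "cmp C Z (sh X) (sh X') (shm X X' a) w = cmp C Z Z' (sh X') w' c"
proof -
 note t' = triD[OF t] and s' = triD[OF s]
 obtain k where k: "k : mors C (sh X) (sh X')"
  "cmp C Z (sh X) (sh X') k w = cmp C Z Z' (sh X') w' c"
  "cmp C (sh X) (sh Y) (sh Y') (shm Y Y' b) (-[Mor C (sh X) (sh Y)] shm X Y u) =
   cmp C (sh X) (sh X') (sh Y') (-[Mor C (sh X') (sh Y')] shm X' Y' u') k"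
  using TR3E[OF tri_rotate[OF t] tri_rotate[OF s] b c e] by blast
 obtain a where a: "a : mors C X X'" "k = shm X X' a" using sh_full[OF t'(1) s'(1) k(1)] .
 have "-[Mor C (sh X) (sh Y')] shm X Y' (cmp C X Y Y' b u) =
    -[Mor C (sh X) (sh Y')] shm X Y' (cmp C X X' Y' u' a)"
  using k(3) a t' s' b by (simp add: sh_cmp cmp_neg_left cmp_neg_right)
 then have "shm X Y' (cmp C X Y Y' b u) = shm X Y' (cmp C X X' Y' u' a)"
  using t' s' a b by (simp add: hom_neg_inject)
 then have "cmp C X Y Y' b u = cmp C X X' Y' u' a"
  using t' s' a b sh_faithful[of X Y' "cmp C X Y Y' b u" "cmp C X X' Y' u' a"] by simp
 then show thesis using that[OF a(1)] k(2) a(2) by simp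
qed

lemma tri_w_zero_retract:
 assumes t: "(X, Y, Z, u, v, w) : \<Delta>" and w: "w = zr (Mor C Z (sh X))"
 shows "retract C Z Y"
proof -
 note t' = triD[OF t]
 obtain h where "h : mors C Z Y" "idm C Z = cmp C Z Y Z v h"
  using tri_lift_w[OF t t'(3), of "idm C Z"] w t' by auto
 then show ?thesis using t' unfolding retract_def retraction_def by metis
qed

lemma endo_square_zero_iso:
 assumes X: "X : Ob C" and h: "h : mors C X X"
  and sq: "cmp C X X X (idm C X -[Mor C X X] h) (idm C X -[Mor C X X] h) = zr (Mor C X X)"
 shows "is_iso C X X h"
proof -
 interpret R: ring "End C X" by (rule End[OF X])
 let ?f = "idm C X -[Mor C X X] h"
 have "?f ^[End C X] (2::nat) = zr (End C X)"
  using X h sq by (simp add: numeral_2_eq_2)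
 then have "un (End C X) -[End C X] ?f : Units (End C X)"
  using X h by (intro R.one_minus_nilpotent_Unit) auto
 moreover have "un (End C X) -[End C X] (un (End C X) -[End C X] h) = h"
  using h by (intro R.one_minus_one_minus) simp
 ultimately show ?thesis using Units_End[OF X] X h by (simp add: End_minus)
qed

text \<open>\<open>1 - h\<close> kills \<open>u\<close> and hence factors through \<open>v\<close>,
  while \<open>v\<close> kills it in turn; so its square is zero.\<close>

lemma tri_unipotent_iso:
 assumes t: "(X, Y, Z, u, v, w) : \<Delta>" and h: "h : mors C Y Y"
  and hu: "cmp C X Y Y h u = u" and vh: "cmp C Y Y Z v h = v"
 shows "is_iso C Y Y h"
proof -
 note t' = triD[OF t]
 let ?f = "idm C Y -[Mor C Y Y] h"
 have "cmp C X Y Y ?f u = zr (Mor C X Y)" using t' h hu by (simp add: cmp_linear hom_diff_zero)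
 then obtain m where m: "m : mors C Z Y" "?f = cmp C Y Z Y m v"
  using tri_extend[OF t t'(2), of ?f] t' h by auto
 have vf: "cmp C Y Y Z v ?f = zr (Mor C Y Z)" using t' h vh by (simp add: cmp_linear hom_diff_zero)
 have "cmp C Y Y Y ?f ?f = cmp C Y Z Y m (cmp C Y Y Z v ?f)"
  using m t' h by (metis cmp_assoc hom_minus_closed idm_closed)
 then have "cmp C Y Y Y ?f ?f = zr (Mor C Y Y)" using vf m t' by simp
 then show ?thesis using t' h by (intro endo_square_zero_iso) auto
qed

text \<open>The complement is the third object of the triangle on \<open>j\<close>: since
  \<open>p\<close> splits \<open>j\<close>, the connecting map vanishes and \<open>v\<close> has a
  section.\<close>

lemma retraction_complement:
 assumes r: "retraction C X Z j p"
 obtains Y k v where "Y : Ob C" "k : mors C Y Z" "v : mors C Z Y" "cmp C Y Z Y v k = idm C Y"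
  "cmp C X Z Y v j = zr (Mor C X Y)" "cmp C Y Z X p k = zr (Mor C Y X)"
  "cmp C Z X Z j p +[Mor C Z Z] cmp C Z Y Z k v = idm C Z"
proof -
 note r = retractionD[OF r]
 obtain Y v w where t: "(X, Z, Y, j, v, w) : \<Delta>" using TR1_complete r by blast
 note t' = triD[OF t]
 have "w = cmp C Y (sh X) (sh X) (shm X X (cmp C X Z X p j)) w" using r t' by simp
 also have "... = cmp C Y (sh Z) (sh X) (shm Z X p) (cmp C Y (sh X) (sh Z) (shm X Z j) w)"
  using r(1-4) t' by (simp add: sh_cmp cmp_assoc)
 finally have w: "w = zr (Mor C Y (sh X))" using tri_uw[OF t] r t' by simp
 obtain h where h: "h : mors C Y Z" "idm C Y = cmp C Y Z Y v h"
  using tri_lift_w[OF t t'(3), of "idm C Y"] w t' by auto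
 \<comment> \<open>The section is corrected by \<open>j p h\<close> so that \<open>p\<close>
   annihilates it.\<close>
 define k where "k = h -[Mor C Y Z] cmp C Y X Z j (cmp C Y Z X p h)"
 have km: "k : mors C Y Z" using h r t' by (simp add: k_def)
 have vj: "cmp C X Z Y v j = zr (Mor C X Y)" by (rule tri_vu[OF t])
 have vjx: "cmp C W Z Y v (cmp C W X Z j x) = zr (Mor C W Y)" if "x : mors C W X" "W : Ob C" for x W
  using that r t' vj by (simp add: cmp_assoc[symmetric])
 have vk: "cmp C Y Z Y v k = idm C Y"
  using h r t' vjx by (simp add: k_def cmp_linear a_minus_def hom_minus_zero)
 have pk: "cmp C Y Z X p k = zr (Mor C Y X)"
  using h r t' by (simp add: k_def cmp_linear cmp_cancel)
 \<comment> \<open>The defect of the biproduct relation. It kills \<open>j\<close>, hence equals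
   some \<open>m v\<close>, and evaluating it on \<open>k\<close> gives
   \<open>m = 0\<close>.\<close>
 define q where "q = idm C Z -[Mor C Z Z] (cmp C Z X Z j p +[Mor C Z Z] cmp C Z Y Z k v)"
 have qm: "q : mors C Z Z" using km r t' by (simp add: q_def)
 have "cmp C X Z Z q j = zr (Mor C X Z)"
  using km r t' vj by (simp add: q_def cmp_linear cmp_assoc)
 then obtain m where m: "m : mors C Y Z" "q = cmp C Z Y Z m v" using tri_extend[OF t r(2) qm] by auto
 have "cmp C Y Z Z q k = zr (Mor C Y Z)"
  using km r t' pk vk by (simp add: q_def cmp_linear cmp_assoc)
 moreover have "cmp C Y Z Z q k = m" using m km t' vk by (simp add: cmp_assoc)
 ultimately have "m = zr (Mor C Y Z)" by simp
 then have "q = zr (Mor C Z Z)" using m t' by simp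
 then have "idm C Z = cmp C Z X Z j p +[Mor C Z Z] cmp C Z Y Z k v"
  using hom_diff_zero[of Z Z "idm C Z"] km r t' by (simp add: q_def)
 then show thesis using that[OF t'(3) km t'(5) vk vj pk] by simp
qed

lemma retract_summand: "retract C X Z \<longleftrightarrow> summand C X Z"
proof
 assume "retract C X Z"
 then obtain j p where r: "retraction C X Z j p" by (auto simp: retract_def)
 then obtain Y k v where Y: "Y : Ob C" "k : mors C Y Z" "v : mors C Z Y" "cmp C Y Z Y v k = idm C Y"
  "cmp C X Z Y v j = zr (Mor C X Y)" "cmp C Y Z X p k = zr (Mor C Y X)"
  "cmp C Z X Z j p +[Mor C Z Z] cmp C Z Y Z k v = idm C Z"
  by (rule retraction_complement) blast
 note r = retractionD[OF r]
 have "direct_sum2 C Z X Y" using r Y by (intro direct_sum2I[of Z X Y j p k v]) auto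
 then show "summand C X Z" by (auto simp: summand_def)
qed (rule summand_retract)

text \<open>Every object is a shift on the nose and the shift is full, so the triangle on
  \<open>v\<close> can be rotated back; the sign goes into \<open>u\<close>.\<close>

lemma tri_complete_right:
 assumes "Y : Ob C" "Z : Ob C" "v : mors C Y Z"
 obtains X u w where "(X, Y, Z, u, v, w) : \<Delta>"
proof -
 obtain V l m where t: "(Y, Z, V, v, l, m) : \<Delta>" using TR1_complete assms by blast
 note t' = triD[OF t]
 obtain X where X: "X : Ob C" "V = sh X" using sh_preimage[OF t'(3)] .
 obtain n where n: "n : mors C X Y" "m = shm X Y n" using sh_full[OF X(1) t'(1)] t'(6) X(2) by auto
 let ?u = "-[Mor C X Y] n"
 have "shm X Y ?u = -[Mor C (sh X) (sh Y)] m"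
  using linear_functor_neg[OF sh_functor is_linear_category is_linear_category] n X t' by simp
 then have "-[Mor C (sh X) (sh Y)] shm X Y ?u = m" using n X t' by simp
 moreover have "candidate_triangle C \<Sigma> (X, Y, Z, ?u, v, l)"
  using X t' n by (simp add: candidate_triangle_def)
 ultimately have "(X, Y, Z, ?u, v, l) : \<Delta>" using t X by (simp add: TR2)
 then show thesis using that by blast
qed

lemma tri_lift_shv:
 assumes t: "(X, Y, Z, u, v, w) : \<Delta>" and W: "W : Ob C" and g: "g : mors C W (sh Y)"
  and 0: "cmp C W (sh Y) (sh Z) (shm Y Z v) g = zr (Mor C W (sh Z))"
 obtains h where "h : mors C W (sh X)" "g = cmp C W (sh X) (sh Y) (shm X Y u) h"
proof -
 note t' = triD[OF t]
 obtain k where k: "k : mors C W (sh X)"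
  "g = cmp C W (sh X) (sh Y) (-[Mor C (sh X) (sh Y)] shm X Y u) k"
  by (rule tri_lift[OF tri_rotate[OF tri_rotate[OF tri_rotate[OF t]]] W g])
   (use 0 t' W g in \<open>auto simp: cmp_neg_left hom_minus_zero\<close>)
 then show thesis using that[of "-[Mor C W (sh X)] k"] t' W by (simp add: cmp_neg_left cmp_neg_right)
qed

lemma retract_sh: assumes "retract C X Y" shows "retract C (sh X) (sh Y)"
proof -
 obtain j p where r: "retraction C X Y j p" using assms by (auto simp: retract_def)
 note r = retractionD[OF r]
 have "retraction C (sh X) (sh Y) (shm X Y j) (shm Y X p)"
  using r by (simp add: retraction_def sh_cmp[symmetric])
 then show ?thesis by (auto simp: retract_def)
qed

end

section \<open>Mutation in categories with symmetric vanishing of extensions\<close>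

text \<open>Inclusion and projection of \<open>Y\<close> embed End(Y) into End(Z). The identity is
  missed, because everything in the image dies on the nonzero summand \<open>X\<close>. This drives
  the minimality and decomposition arguments.\<close>

lemma (in linear_category) len_End_less:
 assumes m: "X : Ob C" "Z : Ob C" "Y : Ob C" "j : mors C X Z" "p : mors C Z X" "k : mors C Y Z" "v : mors C Z Y"
  and e: "cmp C X Z X p j = idm C X" "cmp C Y Z Y v k = idm C Y" "cmp C X Z Y v j = zr (Mor C X Y)"
  and X: "~ zero_object C X" and fl: "fl K (Mor C Z Z)"
 shows "len K (Mor C Y Y) (mors C Y Y) < len K (Mor C Z Z) (mors C Z Z)"
proof (rule len_inj_less[OF mor_module[OF m(3,3)] mor_module[OF m(2,2)] _ fl])
 let ?ph = "%x. cmp C Z Y Z (cmp C Y Y Z k x) v"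
 show "lin_map K (Mor C Y Y) (Mor C Z Z) ?ph"
  using m by (auto simp: lin_map_def cmp_linear cmp_smult_left cmp_smult_right)
 have "cmp C Y Z Y v (cmp C Y Z Z (?ph x) k) = x" if "x : mors C Y Y" for x
  using that m e by (simp add: cmp_assoc cmp_cancel)
 then show "inj_on ?ph (mors C Y Y)"
  by (rule inj_on_inverseI[where g = "%y. cmp C Y Z Y v (cmp C Y Z Z y k)"])
 show "?ph ` mors C Y Y ~= mors C Z Z"
 proof
  assume eq: "?ph ` mors C Y Y = mors C Z Z"
  have "idm C Z : ?ph ` mors C Y Y" unfolding eq using m by simp
  then obtain x where x: "x : mors C Y Y" "?ph x = idm C Z" by auto
  have "idm C X = cmp C X Z X p (cmp C X Z Z (?ph x) j)" using x m e by simp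
  also have "... = zr (Mor C X X)" unfolding x(2)[symmetric] using x(1) m e by (simp add: cmp_assoc)
  finally show False using X m by (simp add: zero_object_def)
 qed
qed

lemma (in linear_category) in_add_mono: "[|in_add C S X; S <= S'|] ==> in_add C S' X"
 by (auto simp: in_add_def intro: thru_mono)

text \<open>Lifting through \<open>s\<close> is additive in the map to be lifted and stable under
  precomposition, so it passes from \<open>S\<close> to whatever is built from
  \<open>S\<close>.\<close>

lemma (in linear_category) in_add_surj:
 assumes S: "S <= Ob C" and X: "in_add C S X" and s: "s : mors C B N" and Ob: "B : Ob C" "N : Ob C"
  and surj: "!!W f. [|W : S; f : mors C W N|] ==> EX g:mors C W B. f = cmp C W B N s g"
  and f: "f : mors C X N"
 shows "EX g:mors C X B. f = cmp C X B N s g"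
proof -
 have Xo: "X : Ob C" using X by (simp add: in_add_def)
 have "f : thru C S X N" by (rule in_add_hom[OF S X f Ob(2)])
 then show ?thesis
 proof (induction rule: thru.induct)
  case thru_zero
  then show ?case using s Ob Xo by (intro bexI[of _ "zr (Mor C X B)"]) auto
 next
  case (thru_cmp W b a)
  then obtain g where "g : mors C W B" "a = cmp C W B N s g" using surj by blast
  then show ?case using thru_cmp s Ob Xo S
   by (intro bexI[of _ "cmp C X W B g b"]) (auto simp: cmp_assoc)
 next
  case (thru_add f f')
  then obtain g g' where "g : mors C X B" "f = cmp C X B N s g" "g' : mors C X B" "f' = cmp C X B N s g'" by blast
  then show ?case using s Ob Xo by (intro bexI[of _ "g +[Mor C X B] g'"]) (auto simp: cmp_add_right)
 qed
qed

lemma (in linear_category) in_add_inj: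
 assumes S: "S <= Ob C" and Y: "in_add C S Y" and u: "u : mors C M B" and Ob: "M : Ob C" "B : Ob C"
  and surj: "!!W f. [|W : S; f : mors C M W|] ==> EX g:mors C B W. f = cmp C M B W g u"
  and f: "f : mors C M Y"
 shows "EX g:mors C B Y. f = cmp C M B Y g u"
proof -
 have Yo: "Y : Ob C" using Y by (simp add: in_add_def)
 have "f : thru C S M Y" by (rule in_add_hom'[OF S Y f Ob(1)])
 then show ?thesis
 proof (induction rule: thru.induct)
  case thru_zero
  then show ?case using u Ob Yo by (intro bexI[of _ "zr (Mor C B Y)"]) auto
 next
  case (thru_cmp W b a)
  then obtain g where "g : mors C B W" "b = cmp C M B W g u" using surj by blast
  then show ?case using thru_cmp u Ob Yo S
   by (intro bexI[of _ "cmp C B W Y a g"]) (auto simp: cmp_assoc)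
 next
  case (thru_add f f')
  then obtain g g' where "g : mors C B Y" "f = cmp C M B Y g u" "g' : mors C B Y" "f' = cmp C M B Y g' u" by blast
  then show ?case using u Ob Yo by (intro bexI[of _ "g +[Mor C B Y] g'"]) (auto simp: cmp_add_left)
 qed
qed

lemma (in triangulated_category) sh_nat_pow:
 assumes X: "X : Ob C" and f: "f : mors C X X"
 shows "fmor \<Sigma> X X f ^[End C (fob \<Sigma> X)] (k::nat) = fmor \<Sigma> X X (f ^[End C X] k)"
proof (induction k)
 case (Suc k)
 interpret R: ring "End C X" by (rule End[OF X])
 have "f ^[End C X] k : mors C X X" using R.nat_pow_closed[of f k] f by simp
 then show ?case using Suc X f by (simp add: sh_cmp)
qed (use X in simp)

text \<open>What mutation requires of the cluster category. The set \<open>S\<close> in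
  \<open>local_decomposition\<close> may be infinite or contain isomorphic members, since
  \<open>in_add\<close> draws on finitely many of them.\<close>

locale ext_symmetric_category = triangulated_category K C \<Sigma> \<Delta>
 for K :: "'k ring" and C :: "('k, 'o, 'm) lincat" and \<Sigma> :: "('o, 'm, 'o, 'm) cfunctor"
  and \<Delta> :: "('o, 'm) tri set" +
 assumes hom_fl: "[|X : Ob C; Y : Ob C|] ==> fl K (Mor C X Y)"
  and local_if_indecomposable: "indecomposable C X ==> local_object C X"
  and local_decomposition: "X : Ob C ==>
   EX S<=Ob C. in_add C S X & (ALL Y:S. local_object C Y & retract C Y X)"
  and ext_sym: "[|X : Ob C; Y : Ob C; hom_zero C X (fob \<Sigma> Y)|] ==> hom_zero C Y (fob \<Sigma> X)"
begin

abbreviation ext :: "'o => 'o => bool" where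
 "ext X Y == hom_zero C X (sh Y)"

lemma ext_iff: "ext1_vanishes C \<Sigma> X Y \<longleftrightarrow> ext X Y"
 by (simp add: ext1_vanishes_def hom_zero_def)

lemma ext_retract:
 assumes "ext X Y" "retract C X' X" "retract C Y' Y" shows "ext X' Y'"
 using hom_zero_left[OF assms(1,2)] hom_zero_right[OF _ retract_sh[OF assms(3)]]
  retract_Ob[OF assms(2)] retract_Ob[OF assms(3)] by auto

lemma ext_in_add_left:
 "[|S <= Ob C; in_add C S X; !!W. W : S ==> ext W Y; Y : Ob C|] ==> ext X Y"
 by (rule in_add_hom_zero_left) auto

text \<open>Symmetry turns the second argument into the first and spares a second induction.\<close>

lemma ext_in_add_right:
 assumes "S <= Ob C" "in_add C S Y" "!!W. W : S ==> ext X W" "X : Ob C" shows "ext X Y"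
proof -
 have Y: "Y : Ob C" using assms by (simp add: in_add_def)
 have "ext Y X" by (rule ext_in_add_left[OF assms(1,2)]) (use assms ext_sym in auto)
 then show ?thesis using ext_sym Y assms(4) by blast
qed

lemma local_Ob: "local_object C X ==> X : Ob C"
 by (simp add: local_object_def)

text \<open>A map into the shift of \<open>R1\<close> comes from a map to \<open>N\<close>, because
  Ext into \<open>R0\<close> vanishes. From \<open>W\<close> that map lifts to \<open>R0\<close>,
  where the connecting map is zero. From \<open>R1\<close> it first extends over \<open>R0\<close>
  by rigidity of \<open>N\<close>, and then the approximation property applies to \<open>R0\<close>
  itself.\<close>

lemma approximation_kernel:
 assumes S: "S <= Ob C" "!!V W. [|V : S; W : S|] ==> ext V W" and N: "ext N N"
  and t: "(R1, R0, N, r, s, w) : \<Delta>" and R0: "in_add C S R0"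
  and surj: "!!W f. [|W : S; f : mors C W N|] ==> EX g:mors C W R0. f = cmp C W R0 N s g"
 shows "!!W. W : S ==> ext W R1" "!!W. W : S ==> ext R1 W" "ext R1 R1"
proof -
 note t' = triD[OF t]
 show 1: "ext W R1" if W: "W : S" for W
 proof (rule hom_zeroI)
  have Wo: "W : Ob C" using W S by auto
  fix g assume g: "g : mors C W (sh R1)"
  have "ext W R0" by (rule ext_in_add_right[OF S(1) R0]) (use W S Wo in auto)
  then have "cmp C W (sh R1) (sh R0) (shm R1 R0 r) g = zr (Mor C W (sh R0))"
   by (rule hom_zeroD) (use g Wo t' in auto)
  then obtain h where h: "h : mors C W N" "g = cmp C W N (sh R1) w h"
   using tri_lift_sh[OF t Wo g] by blast
  then obtain k where k: "k : mors C W R0" "h = cmp C W R0 N s k" using surj W by blast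
  then show "g = zr (Mor C W (sh R1))"
   using h t' Wo tri_wv[OF t] by (simp add: cmp_assoc[symmetric])
 qed (use t' W S in auto)
 show 2: "ext R1 W" if "W : S" for W using ext_sym[OF _ _ 1[OF that]] that S t' by auto
 show "ext R1 R1"
 proof (rule hom_zeroI)
  fix g assume g: "g : mors C R1 (sh R1)"
  have "ext R1 R0" by (rule ext_in_add_right[OF S(1) R0 2]) (use t' in auto)
  then have "cmp C R1 (sh R1) (sh R0) (shm R1 R0 r) g = zr (Mor C R1 (sh R0))"
   by (rule hom_zeroD) (use g t' in auto)
  then obtain h where h: "h : mors C R1 N" "g = cmp C R1 N (sh R1) w h"
   using tri_lift_sh[OF t t'(1) g] by blast
  have "cmp C N (sh R1) (sh N) (shm R1 N h) w = zr (Mor C N (sh N))"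
   by (rule hom_zeroD[OF N]) (use h t' in auto)
  then obtain k where k: "k : mors C R0 N" "h = cmp C R1 R0 N k r"
   using tri_extend_sh[OF t t'(3) h(1)] by blast
  obtain l where l: "l : mors C R0 R0" "k = cmp C R0 R0 N s l"
   using in_add_surj[OF S(1) R0 t'(5,2,3) surj k(1)] by blast
  have "g = cmp C R1 R0 (sh R1) (cmp C R0 N (sh R1) w s) (cmp C R1 R0 R0 l r)"
   using h k l t' by (simp add: cmp_assoc)
  then show "g = zr (Mor C R1 (sh R1))" using tri_wv[OF t] l t' by simp
 qed (use t' in auto)
qed

section \<open>Complements of an almost complete tilting object\<close>

context
 fixes T assumes T: "almost_complete_tilting C \<Sigma> T"
begin

lemma T_Ob: "T : Ob C" and ext_TT: "ext T T"
 using T by (auto simp: almost_complete_tilting_def exceptional_def ext_iff)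

lemma T_sub: "{T} <= Ob C" using T_Ob by simp

lemma T_decomposition:
 obtains S0 j p where "biproduct C T S0 (%X. X) j p" "nonisomorphic_indecomposables C S0" "S0 <= Ob C"
  "!!X. X : S0 ==> local_object C X" "!!X. X : S0 ==> retract C X T" "in_add C S0 T"
proof -
 obtain S0 j p where S0: "nonisomorphic_indecomposables C S0" "biproduct C T S0 (%X. X) j p"
  using T by (auto simp: almost_complete_tilting_def basic_def direct_sum_def)
 have "!!X. X : S0 ==> local_object C X"
  using S0 local_if_indecomposable by (auto simp: nonisomorphic_indecomposables_def)
 then show thesis
  using that[OF S0(2,1)] S0(2) biproduct_retraction[OF S0(2)] biproduct_in_add[OF S0(2)]
  by (auto simp: biproduct_def retract_def)
qed

lemma complementD:
 assumes N: "complement C \<Sigma> T N"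
 shows "local_object C N" "N : Ob C" "ext N N" "ext N T" "ext T N" "~ in_add C {T} N"
proof -
 obtain Z where Z: "indecomposable C N" "direct_sum2 C Z T N" "basic C Z" "exceptional C \<Sigma> Z"
  using N by (auto simp: complement_def tilting_def)
 show loc: "local_object C N" by (rule local_if_indecomposable[OF Z(1)])
 then show No: "N : Ob C" by (rule local_Ob)
 have ZZ: "ext Z Z" using Z by (simp add: exceptional_def ext_iff)
 note r = direct_sum2_retract[OF Z(2)]
 show "ext N N" "ext N T" "ext T N" using ext_retract[OF ZZ] r by auto
 show "~ in_add C {T} N"
 proof
  assume "in_add C {T} N"
  \<comment> \<open>\<open>N\<close> would be a summand of \<open>T\<close> and so occur twice in
    the basic object \<open>Z\<close>, once inside \<open>T\<close> and once as the
    complement.\<close>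
  then have "retract C N T" using local_in_add_retract[OF T_sub loc] by auto
  then obtain i q where iq: "retraction C N T i q" by (auto simp: retract_def)
  obtain j1 p1 j2 p2 where d: "Z : Ob C" "T : Ob C" "N : Ob C"
   "j1 : mors C T Z" "p1 : mors C Z T" "j2 : mors C N Z" "p2 : mors C Z N"
   "cmp C T Z T p1 j1 = idm C T" "cmp C N Z N p2 j2 = idm C N"
   "cmp C T Z N p2 j1 = zr (Mor C T N)" "cmp C N Z T p1 j2 = zr (Mor C N T)"
   using Z(2) by (rule direct_sum2E) blast
  have r1: "retraction C N Z (cmp C N T Z j1 i) (cmp C Z T N q p1)"
   by (rule retraction_cmp[OF iq]) (use d in \<open>auto simp: retraction_def\<close>)
  have r2: "retraction C N Z j2 p2" using d by (auto simp: retraction_def)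
  obtain S j p where S: "nonisomorphic_indecomposables C S" "biproduct C Z S (%X. X) j p"
   using Z(3) by (auto simp: basic_def direct_sum_def)
  show False
  proof (rule biproduct_multiplicity_free[OF S(2,1) _ loc r1 r2])
   show "local_object C Y" if "Y : S" for Y
    using S(1) that local_if_indecomposable by (auto simp: nonisomorphic_indecomposables_def)
   show "cmp C N Z N (cmp C Z T N q p1) j2 = zr (Mor C N N)"
    using d retractionD[OF iq] by (simp add: cmp_assoc)
  qed
 qed
qed

context
 fixes M assumes M: "complement C \<Sigma> T M"
begin

lemmas M_props = complementD[OF M]

lemma TM_sub: "{T, M} <= Ob C" using T_Ob M_props by simp

lemma ext_TM: "[|V : {T, M}; W : {T, M}|] ==> ext V W"
 using M_props ext_TT by auto

text \<open>If \<open>N\<close> were not already a summand of the tilting object \<open>Z\<close>,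
  it could be added to the summands of \<open>Z\<close>, against maximality.\<close>

lemma complement_maximal:
 assumes N: "local_object C N" "ext N N" "ext N T" "ext N M"
 shows "in_add C {T, M} N"
proof -
 have No: "N : Ob C" by (rule local_Ob[OF N(1)])
 obtain Z where Z: "direct_sum2 C Z T M" "tilting C \<Sigma> Z"
  using M by (auto simp: complement_def)
 then obtain S where S: "indecomposable_summands C Z S" "rigid_set C \<Sigma> S"
  "!!S'. rigid_set C \<Sigma> S' ==> S <= S' ==> S' = S" by (auto simp: tilting_def)
 have iZ: "in_add C {T, M} Z" by (rule direct_sum2_in_add[OF Z(1)])
 have NZ: "ext N Z" by (rule ext_in_add_right[OF TM_sub iZ]) (use N No in auto)
 have SZ: "retract C Y Z" if "Y : S" for Y
  using S(1) that summand_retract by (auto simp: indecomposable_summands_def)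
 have NY: "ext N Y" "ext Y N" if "Y : S" for Y
 proof -
  show "ext N Y" using ext_retract[OF NZ _ SZ[OF that]] isomorphic_retract[OF isomorphic_refl[OF No]] by blast
  then show "ext Y N" using ext_sym No retract_Ob(1)[OF SZ[OF that]] by blast
 qed
 have "EX Y:S. isomorphic C N Y"
 proof (rule ccontr)
  assume no: "~ ?thesis"
  then have no': "~ isomorphic C Y N" if "Y : S" for Y using that isomorphic_sym by blast
  have "rigid_set C \<Sigma> (insert N S)"
   using S(2) no no' NY N(2) local_indecomposable[OF N(1)]
   unfolding rigid_set_def nonisomorphic_indecomposables_def ext_iff by auto
  then have "N : S" using S(3) by blast
  then show False using no isomorphic_refl[OF No] by blast
 qed
 then obtain Y where Y: "Y : S" "isomorphic C N Y" by auto
 then have "retract C N Z" using isomorphic_retract SZ retract_trans by blast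
 then show ?thesis by (rule in_add_retract[OF TM_sub iZ])
qed

section \<open>Approximations by T and M, and the exchange step\<close>

lemma in_add_TM_cases:
 assumes "in_add C {T, M} N" "local_object C N" shows "in_add C {T} N \<or> isomorphic C N M"
proof -
 obtain W where "W = T \<or> W = M" "retract C N W"
  using local_in_add_retract[OF TM_sub assms(2,1)] by auto
 then show ?thesis
  using in_add_retract[OF T_sub in_add_self[OF T_sub]]
   retract_local_iso[OF _ M_props(1) local_not_zero[OF assms(2)]] by auto
qed

lemma in_add_T_if_no_M:
 assumes X: "in_add C {T, M} X" and no: "~ retract C M X" shows "in_add C {T} X"
proof -
 have Xo: "X : Ob C" using X by (simp add: in_add_def)
 obtain S where S: "S <= Ob C" "in_add C S X" "!!Y. Y : S ==> local_object C Y & retract C Y X"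
  using local_decomposition[OF Xo] by blast
 show ?thesis
 proof (rule in_add_trans[OF S(2) _ S(1) T_sub])
  fix Y assume Y: "Y : S"
  then have "in_add C {T, M} Y" using S in_add_retract[OF TM_sub X] by blast
  then have "in_add C {T} Y \<or> isomorphic C Y M" using in_add_TM_cases S Y by blast
  moreover have "~ isomorphic C Y M"
   using no S(3)[OF Y] isomorphic_sym isomorphic_retract retract_trans by blast
  ultimately show "in_add C {T} Y" by blast
 qed
qed

text \<open>Minimality is needed only in the form that no copy of \<open>M\<close> splits off inside
  the kernel of \<open>s\<close>. It is achieved by choosing an approximation with End(R0) of least
  length, since a copy of \<open>M\<close> killed by \<open>s\<close> can be removed.\<close>

lemma minimal_TM_approximation:
 assumes N: "N : Ob C"
 obtains R0 s where "in_add C {T, M} R0" "s : mors C R0 N"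
  "!!W f. [|W : {T, M}; f : mors C W N|] ==> EX g:mors C W R0. f = cmp C W R0 N s g"
  "!!i q. [|i : mors C M R0; q : mors C R0 M; cmp C M R0 N s i = zr (Mor C M N)|] ==>
    cmp C M R0 M q i ~: Units (End C M)"
proof -
 define app where "app R0 s \<longleftrightarrow> in_add C {T, M} R0 & s : mors C R0 N &
  (ALL W:{T, M}. ALL f:mors C W N. EX g:mors C W R0. f = cmp C W R0 N s g)" for R0 s
 obtain Z where Z: "direct_sum2 C Z T M" using M by (auto simp: complement_def)
 then have Zo: "Z : Ob C" and iZ: "in_add C {T, M} Z" using direct_sum2_in_add by (auto simp: in_add_def)
 obtain R s where R: "in_add C {Z} R" "s : mors C R N"
  "!!f. f : mors C Z N ==> EX g:mors C Z R. f = cmp C Z R N s g"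
  using approximation_exists[OF additive Zo N hom_fl[OF Zo N]] by blast
 have Ro: "R : Ob C" using R by (simp add: in_add_def)
 have "app R s"
  unfolding app_def
 proof (intro conjI ballI)
  show "in_add C {T, M} R" by (rule in_add_trans[OF R(1) _ _ TM_sub]) (use iZ Zo in auto)
  fix W f assume W: "W : {T, M}" and f: "f : mors C W N"
  have "retract C W Z" using W direct_sum2_retract[OF Z] by auto
  then obtain j p where "retraction C W Z j p" by (auto simp: retract_def)
  note r = retractionD[OF this]
  obtain g where g: "g : mors C Z R" "cmp C Z W N f p = cmp C Z R N s g"
   using R(3)[of "cmp C Z W N f p"] f r N by auto
  have "f = cmp C W Z N (cmp C Z W N f p) j" using r f N by (simp add: cmp_assoc)
  also have "... = cmp C W R N s (cmp C W Z R g j)" using g r N R Ro by (simp add: cmp_assoc)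
  finally show "EX g:mors C W R. f = cmp C W R N s g" using g r Ro by auto
 qed (rule R(2))
 then obtain R0 s where min: "app R0 s"
  "!!R s'. app R s' ==> len K (Mor C R0 R0) (mors C R0 R0) <= len K (Mor C R R) (mors C R R)"
  using ex_has_least_nat[of "%(R, s). app R s" "(R, s)" "%(R, s). len K (Mor C R R) (mors C R R)"]
  by auto
 show thesis
 proof (rule that[of R0 s])
  show app: "in_add C {T, M} R0" "s : mors C R0 N"
   "!!W f. [|W : {T, M}; f : mors C W N|] ==> EX g:mors C W R0. f = cmp C W R0 N s g"
   using min(1) unfolding app_def by auto
  have R0: "R0 : Ob C" and Mo: "M : Ob C" using app M_props by (auto simp: in_add_def)
  fix i q assume i: "i : mors C M R0" and q: "q : mors C R0 M" and 0: "cmp C M R0 N s i = zr (Mor C M N)"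
  show "cmp C M R0 M q i ~: Units (End C M)"
  proof
   assume "cmp C M R0 M q i : Units (End C M)"
   then obtain g where g: "g : mors C M M" "cmp C M M M g (cmp C M R0 M q i) = idm C M"
    by (auto simp: Units_def)
   define p where "p = cmp C R0 M M g q"
   have p: "p : mors C R0 M" "cmp C M R0 M p i = idm C M"
    using g q i R0 Mo by (auto simp: p_def cmp_assoc)
   have "retraction C M R0 i p" using p i R0 Mo by (simp add: retraction_def)
   then obtain Y k v where Y: "Y : Ob C" "k : mors C Y R0" "v : mors C R0 Y" "cmp C Y R0 Y v k = idm C Y"
    "cmp C M R0 Y v i = zr (Mor C M Y)"
    "cmp C R0 M R0 i p +[Mor C R0 R0] cmp C R0 Y R0 k v = idm C R0"
    by (rule retraction_complement) blast
   \<comment> \<open>The complement \<open>Y\<close> of the killed copy still approximates: the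
     component through \<open>M\<close> contributes only \<open>s i = 0\<close>.\<close>
   have "app Y (cmp C Y R0 N s k)"
    unfolding app_def
   proof (intro conjI ballI)
    show "in_add C {T, M} Y"
     by (rule in_add_retract[OF TM_sub app(1)]) (use Y R0 in \<open>auto simp: retract_def retraction_def\<close>)
    show "cmp C Y R0 N s k : mors C Y N" using Y app R0 N by simp
    fix W f assume W: "W : {T, M}" and f: "f : mors C W N"
    then obtain g where g: "g : mors C W R0" "f = cmp C W R0 N s g" using app by blast
    have Wo: "W : Ob C" using W TM_sub by auto
    have "f = cmp C W R0 N s (cmp C W R0 R0 (cmp C R0 M R0 i p +[Mor C R0 R0] cmp C R0 Y R0 k v) g)"
     using g Y Wo R0 by simp
    also have "... = cmp C W M N (cmp C M R0 N s i) (cmp C W R0 M p g)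
      +[Mor C W N] cmp C W Y N (cmp C Y R0 N s k) (cmp C W R0 Y v g)"
     using g(1) Y(1-3) Wo R0 app(2) N i p Mo by (simp add: cmp_linear cmp_assoc)
    also have "... = cmp C W Y N (cmp C Y R0 N s k) (cmp C W R0 Y v g)"
     using g(1) Y(1-3) Wo R0 app(2) N p Mo 0 by simp
    finally show "EX g:mors C W Y. f = cmp C W Y N (cmp C Y R0 N s k) g"
     using g(1) Y(1-3) Wo R0 by (intro bexI[of _ "cmp C W R0 Y v g"]) auto
   qed
   then have "len K (Mor C R0 R0) (mors C R0 R0) <= len K (Mor C Y Y) (mors C Y Y)" by (rule min(2))
   moreover have "len K (Mor C Y Y) (mors C Y Y) < len K (Mor C R0 R0) (mors C R0 R0)"
    by (rule len_End_less[of M R0 Y i p k v])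
     (use Y p i R0 Mo local_not_zero[OF M_props(1)] hom_fl in auto)
   ultimately show False by simp
  qed
 qed
qed

text \<open>
 If \<open>N\<close> is rigid, every map \<open>h\<close> from \<open>R1\<close> to \<open>R0\<close> has the form \<open>r x + y r\<close>: this is the vanishing of
 the composite \<open>N \<rightarrow> \<Sigma>R1 \<rightarrow> \<Sigma>R0 \<rightarrow> \<Sigma>N\<close>.
\<close>

lemma rigid_factorisation:
 assumes t: "(R1, R0, N, r, s, w) : \<Delta>" and N: "ext N N" and e: "ext R0 R1" and h: "h : mors C R1 R0"
 obtains x y where "x : mors C R1 R1" "y : mors C R0 R0"
  "h = cmp C R1 R1 R0 r x +[Mor C R1 R0] cmp C R1 R0 R0 y r"
proof -
 note t' = triD[OF t]
 let ?g = "cmp C N (sh R1) (sh R0) (shm R1 R0 h) w"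
 have "cmp C N (sh R0) (sh N) (shm R0 N s) ?g = zr (Mor C N (sh N))"
  by (rule hom_zeroD[OF N]) (use h t' in auto)
 then obtain x' where x': "x' : mors C N (sh R1)" "?g = cmp C N (sh R1) (sh R0) (shm R1 R0 r) x'"
  using tri_lift_shv[OF t t'(3), of ?g] h t' by auto
 have "cmp C R0 N (sh R1) x' s = zr (Mor C R0 (sh R1))"
  by (rule hom_zeroD[OF e]) (use x' t' in auto)
 then obtain k where k: "k : mors C (sh R1) (sh R1)" "x' = cmp C N (sh R1) (sh R1) k w"
  using tri_extend_w[OF t _ x'(1)] t' by auto
 obtain x where x: "x : mors C R1 R1" "k = shm R1 R1 x" using sh_full[OF t'(1,1) k(1)] .
 let ?d = "h -[Mor C R1 R0] cmp C R1 R1 R0 r x"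
 have \<Sigma>d: "shm R1 R0 ?d = shm R1 R0 h -[Mor C (sh R1) (sh R0)] cmp C (sh R1) (sh R1) (sh R0) (shm R1 R0 r) k"
  using h x t' linear_functor_neg[OF sh_functor is_linear_category is_linear_category]
  by (simp add: a_minus_def sh_add sh_cmp)
 have "cmp C N (sh R1) (sh R0) (shm R1 R0 ?d) w = zr (Mor C N (sh R0))"
  unfolding \<Sigma>d using x' k h t' by (simp add: cmp_linear cmp_assoc hom_diff_zero)
 then obtain y where y: "y : mors C R0 R0" "?d = cmp C R1 R0 R0 y r"
  using tri_extend_sh[OF t t'(2), of ?d] h x t' by auto
 have "h = cmp C R1 R1 R0 r x +[Mor C R1 R0] ?d"
  using h x t' by (simp add: hom_add_diff)
 then show thesis using that[OF x(1) y(1)] y(2) by simp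
qed

text \<open>If \<open>M\<close> occurred on both sides, the map \<open>R1 -> M -> R0\<close> would
  be \<open>r x + y r\<close>, which writes the identity of \<open>M\<close> as a sum of two
  endomorphisms passing through \<open>r\<close>. One of them is a unit, and \<open>s r = 0\<close>
  makes this a copy of \<open>M\<close> killed by \<open>s\<close>, against minimality.\<close>

lemma retract_one_side:
 assumes t: "(R1, R0, N, r, s, w) : \<Delta>" and N: "ext N N" and e: "ext R0 R1"
  and min: "!!i q. [|i : mors C M R0; q : mors C R0 M; cmp C M R0 N s i = zr (Mor C M N)|] ==>
    cmp C M R0 M q i ~: Units (End C M)"
  and r1: "retract C M R1" and r0: "retract C M R0"
 shows False
proof -
 note t' = triD[OF t]
 obtain i1 p1 i0 p0 where R: "retraction C M R1 i1 p1" "retraction C M R0 i0 p0"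
  using r1 r0 by (auto simp: retract_def)
 note R1 = retractionD[OF R(1)] and R0 = retractionD[OF R(2)]
 let ?h = "cmp C R1 M R0 i0 p1"
 obtain x y where xy: "x : mors C R1 R1" "y : mors C R0 R0"
  "?h = cmp C R1 R1 R0 r x +[Mor C R1 R0] cmp C R1 R0 R0 y r"
  using rigid_factorisation[OF t N e, of ?h] R1 R0 by auto
 interpret R: ring "End C M" by (rule End) (use R1 in auto)
 have loc: "unit_or_nilpotent (End C M)" using M_props by (simp add: local_object_def)
 let ?al = "cmp C M R0 M p0 (cmp C M R1 R0 r (cmp C M R1 R1 x i1))"
 let ?be = "cmp C M R0 M (cmp C R0 R0 M p0 y) (cmp C M R1 R0 r i1)"
 have "idm C M = cmp C M R0 M p0 (cmp C M R1 R0 ?h i1)"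
  using R1 R0 by (simp add: cmp_assoc)
 also have "... = ?al +[Mor C M M] ?be"
  unfolding xy(3) using xy(1,2) R1 R0 t' by (simp add: cmp_linear cmp_assoc)
 finally have "?al +[End C M] ?be : Units (End C M)" using R.Units_one_closed by simp
 then have "?al : Units (End C M) \<or> ?be : Units (End C M)"
  using R.Unit_sum[OF loc] xy R1 R0 t' by simp
 moreover have sr: "cmp C M R0 N s (cmp C M R1 R0 r z) = zr (Mor C M N)" if "z : mors C M R1" for z
  using that t' R1 tri_vu[OF t] by (simp add: cmp_assoc[symmetric])
 ultimately show False
  using min[of "cmp C M R1 R0 r (cmp C M R1 R1 x i1)" p0] min[of "cmp C M R1 R0 r i1" "cmp C R0 R0 M p0 y"]
   xy R1 R0 t' by simp
qed

text \<open>The identity of \<open>R1\<close> is a sum of maps through \<open>T\<close> and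
  \<open>M\<close>. Those through \<open>T\<close> extend over \<open>R0\<close> and are invisible
  after the connecting map; those through \<open>M\<close> induce maps between the triangles
  \<open>t\<close> and \<open>t2\<close>. Hence \<open>w = w n\<close> with \<open>n\<close> through
  \<open>M2\<close>. If \<open>n\<close> is a unit, \<open>N\<close> splits off from
  \<open>M2\<close>; if it is nilpotent, \<open>w = 0\<close> and \<open>N\<close> would lie in add
  T.\<close>

lemma retract_of_cone:
 assumes t: "(R1, R0, N, r, s, w) : \<Delta>" and R1: "in_add C {T, M} R1" and R0: "in_add C {T} R0"
  and N: "local_object C N" "ext N T" "~ in_add C {T} N"
  and t2: "(M, B', M2, u, c, d) : \<Delta>" and B': "in_add C {T} B'"
  and u: "!!f. f : mors C M T ==> EX g:mors C B' T. f = cmp C M B' T g u"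
 shows "retract C N M2"
proof -
 note t' = triD[OF t] and t2' = triD[OF t2]
 have left: "EX g:mors C R0 Y. f = cmp C R1 R0 Y g r" if Y: "in_add C {T} Y" and f: "f : mors C R1 Y" for Y f
 proof -
  have Yo: "Y : Ob C" using Y by (simp add: in_add_def)
  have "ext N Y" by (rule ext_in_add_right[OF T_sub Y]) (use N t' in auto)
  then have "cmp C N (sh R1) (sh Y) (shm R1 Y f) w = zr (Mor C N (sh Y))"
   by (rule hom_zeroD) (use f t' Yo in auto)
  then show ?thesis using tri_extend_sh[OF t Yo f] by metis
 qed
 have sr: "cmp C R1 R0 N s r = zr (Mor C R1 N)" by (rule tri_vu[OF t])
 have M2: "{M2} <= Ob C" using t2' by simp
 \<comment> \<open>Endomorphisms of \<open>R1\<close> whose effect on \<open>w\<close> can be moved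
   to the other side, as an endomorphism of \<open>N\<close> through \<open>M2\<close>; an additive
   condition, fit for induction over \<open>thru\<close>.\<close>
 define good where "good e \<longleftrightarrow> (EX n:thru C {M2} N N.
   cmp C N (sh R1) (sh R1) (shm R1 R1 e) w = cmp C N N (sh R1) w n)" for e
 have "good e" if "e : thru C {T, M} R1 R1" for e
  using that
 proof (induction rule: thru.induct)
  case thru_zero
  then show ?case unfolding good_def using t' by (intro bexI[of _ "zr (Mor C N N)"]) (auto intro: thru.thru_zero)
 next
  case (thru_add f g)
  then obtain m n where mn: "m : thru C {M2} N N" "n : thru C {M2} N N"
   "cmp C N (sh R1) (sh R1) (shm R1 R1 f) w = cmp C N N (sh R1) w m"
   "cmp C N (sh R1) (sh R1) (shm R1 R1 g) w = cmp C N N (sh R1) w n"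
   unfolding good_def by blast
  have "f : mors C R1 R1" "g : mors C R1 R1" "m : mors C N N" "n : mors C N N"
   using thru_closed[OF TM_sub] thru_closed[OF M2] thru_add mn t' by blast+
  then show ?case unfolding good_def using mn t'
   by (intro bexI[of _ "m +[Mor C N N] n"]) (auto simp: sh_add cmp_linear intro: thru.thru_add)
 next
  case (thru_cmp W b a)
  show ?case
  proof (cases "W = T")
   case True
   then obtain g where g: "g : mors C R0 T" "b = cmp C R1 R0 T g r"
    using left[OF in_add_self[OF T_sub]] thru_cmp by auto
   have a: "a : mors C T R1" using thru_cmp True by simp
   have "shm R1 R1 (cmp C R1 T R1 a b) =
    cmp C (sh R1) (sh R0) (sh R1) (shm R0 R1 (cmp C R0 T R1 a g)) (shm R1 R0 r)"
    using g a t' T_Ob by (simp add: sh_cmp[symmetric] cmp_assoc)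
   then have "cmp C N (sh R1) (sh R1) (shm R1 R1 (cmp C R1 T R1 a b)) w = zr (Mor C N (sh R1))"
    using g a t' T_Ob tri_uw[OF t] by (simp add: cmp_assoc)
   then show ?thesis unfolding good_def True using t'
    by (intro bexI[of _ "zr (Mor C N N)"]) (auto intro: thru.thru_zero)
  next
   case False
   then have W: "W = M" using thru_cmp by auto
   have ab: "a : mors C M R1" "b : mors C R1 M" using thru_cmp W by auto
   obtain be where be: "be : mors C R0 B'" "cmp C R1 M B' u b = cmp C R1 R0 B' be r"
    using left[OF B', of "cmp C R1 M B' u b"] ab t' t2' by auto
   obtain ga where ga: "ga : mors C B' R0" "cmp C M R1 R0 r a = cmp C M B' R0 ga u"
    using in_add_inj[OF T_sub R0 t2'(4,1,2), of "cmp C M R1 R0 r a"] u ab t' t2' by auto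
   obtain n1 where n1: "n1 : mors C N M2"
    "cmp C N (sh R1) (sh M) (shm R1 M b) w = cmp C N M2 (sh M) d n1"
    using TR3E[OF t t2 ab(2) be(1)] be(2) by metis
   obtain n2 where n2: "n2 : mors C M2 N"
    "cmp C M2 (sh M) (sh R1) (shm M R1 a) d = cmp C M2 N (sh R1) w n2"
    using TR3E[OF t2 t ab(1) ga(1)] ga(2) by metis
   have "cmp C N (sh R1) (sh R1) (shm R1 R1 (cmp C R1 M R1 a b)) w =
    cmp C N (sh M) (sh R1) (shm M R1 a) (cmp C N (sh R1) (sh M) (shm R1 M b) w)"
    using ab t' t2' by (simp add: sh_cmp cmp_assoc)
   also have "... = cmp C N M2 (sh R1) (cmp C M2 (sh M) (sh R1) (shm M R1 a) d) n1"
    using n1 ab t' t2' by (simp add: cmp_assoc)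
   also have "... = cmp C N N (sh R1) w (cmp C N M2 N n2 n1)"
    unfolding n2(2) using n1 n2(1) t' t2' by (simp add: cmp_assoc)
   finally show ?thesis unfolding good_def W using n1 n2 by (blast intro: thru.thru_cmp)
  qed
 qed
 then obtain n where n: "n : thru C {M2} N N" "cmp C N N (sh R1) w n = w"
  using R1 t' unfolding in_add_def good_def by fastforce
 have nm: "n : mors C N N" using thru_closed[OF M2 n(1)] t' by blast
 show ?thesis
 proof (cases "n : Units (End C N)")
  case True
  then show ?thesis using local_thru_retract[OF M2 N(1) n(1)] by auto
 next
  case False
  interpret R: ring "End C N" by (rule End) (use t' in auto)
  obtain k :: nat where k: "n ^[End C N] k = zr (End C N)"
   using False N(1) nm unfolding local_object_def unit_or_nilpotent_def by auto
  have pc: "n ^[End C N] i : mors C N N" for i :: nat using R.nat_pow_closed[of n i] nm by simp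
  have "cmp C N N (sh R1) w (n ^[End C N] i) = w" for i :: nat
  proof (induction i)
   case (Suc i)
   have "cmp C N N (sh R1) w (n ^[End C N] Suc i) = cmp C N N (sh R1) (cmp C N N (sh R1) w (n ^[End C N] i)) n"
    using pc nm t' by (simp add: cmp_assoc)
   then show ?case using Suc n by simp
  qed (use t' in simp)
  from this[of k] have "w = zr (Mor C N (sh R1))" using k t' by simp
  then have "retract C N R0" by (rule tri_w_zero_retract[OF t])
  then show ?thesis using N(3) in_add_retract[OF T_sub R0] by blast
 qed
qed

lemma exchange:
 assumes t2: "(M, B', M2, u, c, d) : \<Delta>" and B': "in_add C {T} B'"
  and u: "!!f. f : mors C M T ==> EX g:mors C B' T. f = cmp C M B' T g u"
  and N: "local_object C N" "ext N N" "ext N T" "~ in_add C {T} N"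
 shows "isomorphic C N M \<or> retract C N M2"
proof -
 have No: "N : Ob C" by (rule local_Ob[OF N(1)])
 obtain R0 s where R0: "in_add C {T, M} R0" "s : mors C R0 N"
  and surj: "!!W f. [|W : {T, M}; f : mors C W N|] ==> EX g:mors C W R0. f = cmp C W R0 N s g"
  and min: "!!i q. [|i : mors C M R0; q : mors C R0 M; cmp C M R0 N s i = zr (Mor C M N)|] ==>
    cmp C M R0 M q i ~: Units (End C M)"
  using minimal_TM_approximation[OF No] by blast
 have R0o: "R0 : Ob C" using R0 by (simp add: in_add_def)
 obtain R1 r w where t: "(R1, R0, N, r, s, w) : \<Delta>" using tri_complete_right[OF R0o No R0(2)] .
 note t' = triD[OF t]
 note ker = approximation_kernel[OF TM_sub ext_TM N(2) t R0(1) surj]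
 have R1: "in_add C {T, M} R1"
 proof -
  obtain S where S: "S <= Ob C" "in_add C S R1" "!!Y. Y : S ==> local_object C Y & retract C Y R1"
   using local_decomposition[OF t'(1)] by blast
  show ?thesis
  proof (rule in_add_trans[OF S(2) _ S(1) TM_sub])
   fix Y assume Y: "Y : S"
   have r: "retract C V V" if "V : {T, M}" for V
    using that TM_sub isomorphic_retract[OF isomorphic_refl] by blast
   show "in_add C {T, M} Y"
    using S(3)[OF Y] ext_retract[OF ker(3), of Y Y] ext_retract[OF ker(2)[of T] _ r[of T], of Y]
     ext_retract[OF ker(2)[of M] _ r[of M], of Y]
    by (intro complement_maximal) auto
  qed
 qed
 have e01: "ext R0 R1" by (rule ext_in_add_left[OF TM_sub R0(1) ker(1) t'(1)])
 have "~ retract C M R1 \<or> ~ retract C M R0"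
  using retract_one_side[OF t N(2) e01 min] by blast
 then show ?thesis
 proof
  assume "~ retract C M R1"
  then have "in_add C {T} R1" by (rule in_add_T_if_no_M[OF R1])
  then have "ext N R1" by (rule ext_in_add_right[OF T_sub]) (use N No in auto)
  then have "retract C N R0" using tri_w_zero_retract[OF t] hom_zeroD t'(6) by blast
  then have "in_add C {T, M} N" by (rule in_add_retract[OF TM_sub R0(1)])
  then show ?thesis using in_add_TM_cases N by blast
 next
  assume "~ retract C M R0"
  then have "in_add C {T} R0" by (rule in_add_T_if_no_M[OF R0(1)])
  then show ?thesis using retract_of_cone[OF t R1 _ N(1,3,4) t2 B' u] by blast
 qed
qed


section \<open>Indecomposability of the two mutations\<close>

lemma thru_T_not_Unit: assumes "x : thru C {T} M M" shows "x ~: Units (End C M)"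
 using local_thru_retract[OF T_sub M_props(1) assms] M_props(6)
  in_add_retract[OF T_sub in_add_self[OF T_sub]] by auto

text \<open>\<open>z (1 - z)\<close> factors through \<open>T\<close> and so is not a unit; hence
  one of its factors is not, and non-units are nilpotent.\<close>

lemma idempotent_mod_T:
 assumes z: "z : mors C M M" and "z -[Mor C M M] cmp C M M M z z : thru C {T} M M"
 shows "(EX k::nat. z ^[End C M] k = zr (End C M)) \<or>
  (EX k::nat. (idm C M -[Mor C M M] z) ^[End C M] k = zr (End C M))"
proof -
 interpret R: ring "End C M" by (rule End) (use M_props in auto)
 have loc: "unit_or_nilpotent (End C M)" using M_props by (simp add: local_object_def)
 have "cmp C M M M z (idm C M -[Mor C M M] z) = z -[Mor C M M] cmp C M M M z z"
  using z M_props by (simp add: cmp_linear)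
 then have "cmp C M M M z (idm C M -[Mor C M M] z) ~: Units (End C M)"
  using thru_T_not_Unit[OF assms(2)] by simp
 then have "z ~: Units (End C M) \<or> idm C M -[Mor C M M] z ~: Units (End C M)"
  using R.Units_m_closed[of z "idm C M -[Mor C M M] z"] by auto
 then show ?thesis using loc z M_props unfolding unit_or_nilpotent_def by auto
qed

text \<open>From \<open>d e = z d\<close> and \<open>e e = e\<close> follows
  \<open>d e = z^k (d e)\<close> for all \<open>k\<close>.\<close>

lemma intertwined_nilpotent:
 assumes Ob: "X : Ob C" "Y : Ob C" and m: "e : mors C X X" "z : mors C Y Y" "d : mors C X Y"
  and ee: "cmp C X X X e e = e" and de: "cmp C X X Y d e = cmp C X Y Y z d"
  and nil: "z ^[End C Y] (k::nat) = zr (End C Y)"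
 shows "cmp C X X Y d e = zr (Mor C X Y)"
proof -
 interpret R: ring "End C Y" by (rule End[OF Ob(2)])
 have pc: "z ^[End C Y] i : mors C Y Y" for i :: nat using R.nat_pow_closed[of z i] m by simp
 have "cmp C X Y Y (z ^[End C Y] i) (cmp C X X Y d e) = cmp C X X Y d e" for i :: nat
 proof (induction i)
  case (Suc i)
  have "cmp C X Y Y (z ^[End C Y] Suc i) (cmp C X X Y d e)
    = cmp C X Y Y (z ^[End C Y] i) (cmp C X X Y (cmp C X Y Y z d) e)"
   using pc[of i] m Ob by (simp add: cmp_assoc)
  also have "cmp C X X Y (cmp C X Y Y z d) e = cmp C X X Y d e"
   unfolding de[symmetric] using m Ob ee by (simp add: cmp_assoc)
  finally show ?case using Suc by simp
 qed (use m Ob in simp)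
 from this[of k] show ?thesis using nil m Ob by simp
qed

lemma intertwined_nilpotent':
 assumes Ob: "X : Ob C" "Y : Ob C" and m: "e : mors C X X" "z : mors C Y Y" "d : mors C Y X"
  and ee: "cmp C X X X e e = e" and de: "cmp C Y X X e d = cmp C Y Y X d z"
  and nil: "z ^[End C Y] (k::nat) = zr (End C Y)"
 shows "cmp C Y X X e d = zr (Mor C Y X)"
proof -
 interpret R: ring "End C Y" by (rule End[OF Ob(2)])
 have pc: "z ^[End C Y] i : mors C Y Y" for i :: nat using R.nat_pow_closed[of z i] m by simp
 have "cmp C Y Y X (cmp C Y X X e d) (z ^[End C Y] i) = cmp C Y X X e d" for i :: nat
 proof (induction i)
  case (Suc i)
  have "cmp C Y Y X (cmp C Y X X e d) (z ^[End C Y] Suc i)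
    = cmp C Y Y X (cmp C Y Y X (cmp C Y X X e d) (z ^[End C Y] i)) z"
   using pc[of i] m Ob by (simp add: cmp_assoc)
  also have "... = cmp C Y Y X (cmp C Y X X e d) z" using Suc by simp
  also have "... = cmp C Y X X e (cmp C Y Y X d z)" using m Ob by (simp add: cmp_assoc)
  also have "... = cmp C Y X X e (cmp C Y X X e d)" using de by simp
  also have "... = cmp C Y X X e d" using m Ob ee by (simp add: cmp_assoc[symmetric])
  finally show ?case .
 qed (use m Ob in simp)
 from this[of k] show ?thesis using nil m Ob by simp
qed

text \<open>Since Ext(U, M) = 0, the inclusion of \<open>U\<close> lifts to \<open>B'\<close>.
  Removing this copy of \<open>U\<close> from \<open>B'\<close> fixes \<open>u\<close>, so by
  minimality the removal is invertible, which leaves nothing to be removed.\<close>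

lemma right_mutation_no_T:
 assumes t: "(M, B', M2, u, c, d) : \<Delta>"
  and min: "!!g. [|g : mors C B' B'; cmp C M B' B' g u = u|] ==> is_iso C B' B' g"
  and U: "retract C U M2" "in_add C {T} U"
 shows "zero_object C U"
proof -
 note t' = triD[OF t]
 obtain i p where "retraction C U M2 i p" using U by (auto simp: retract_def)
 note r = retractionD[OF this]
 have "ext U M" by (rule ext_in_add_left[OF T_sub U(2)]) (use M_props in auto)
 then have "cmp C U M2 (sh M) d i = zr (Mor C U (sh M))" by (rule hom_zeroD) (use r t' in auto)
 then obtain y where y: "y : mors C U B'" "i = cmp C U B' M2 c y" using tri_lift_w[OF t r(1,3)] by blast
 let ?pc = "cmp C B' M2 U p c"
 let ?g = "idm C B' -[Mor C B' B'] cmp C B' U B' y ?pc"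
 have "cmp C M B' B' (cmp C B' U B' y ?pc) u = zr (Mor C M B')"
  using y t' r tri_vu[OF t] by (simp add: cmp_assoc)
 then have "cmp C M B' B' ?g u = u"
  using y t' r by (simp add: cmp_linear a_minus_def hom_minus_zero)
 then have "is_iso C B' B' ?g" using y t' r by (intro min) auto
 then obtain g' where g': "g' : mors C B' B'" "cmp C B' B' B' ?g g' = idm C B'"
  by (auto simp: is_iso_def is_inverse_def)
 have pcy: "cmp C U B' U ?pc y = idm C U" using r y t' by (simp add: cmp_assoc)
 have "cmp C B' B' U ?pc (cmp C B' U B' y ?pc) = ?pc"
  using pcy y r t' by (simp add: cmp_assoc[symmetric])
 then have "cmp C B' B' U ?pc ?g = zr (Mor C B' U)" using y r t' by (simp add: cmp_diff_right)
 then have "cmp C B' B' U (cmp C B' B' U ?pc ?g) g' = zr (Mor C B' U)" using g' r t' by simp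
 then have "?pc = zr (Mor C B' U)" using g' r t' y by (simp add: cmp_assoc)
 then have "idm C U = zr (Mor C U U)" using pcy y r t' by simp
 then show ?thesis using r by (simp add: zero_object_def)
qed

text \<open>The idempotent of a decomposition of \<open>M2\<close> is part of an endomorphism of the
  triangle, whose component \<open>z\<close> on \<open>M\<close> is idempotent up to maps through
  \<open>B'\<close>. So \<open>z\<close> or \<open>1 - z\<close> is nilpotent, and the connecting
  map kills one summand. That summand is then a retract of \<open>B'\<close> and vanishes by
  \<open>right_mutation_no_T\<close>.\<close>

lemma right_mutation_indecomposable:
 assumes t: "(M, B', M2, u, c, d) : \<Delta>" and B': "in_add C {T} B'"
  and min: "!!g. [|g : mors C B' B'; cmp C M B' B' g u = u|] ==> is_iso C B' B' g"
  and nz: "~ zero_object C M2"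
 shows "indecomposable C M2"
 unfolding indecomposable_def
proof (intro conjI allI impI)
 note t' = triD[OF t]
 show "M2 : Ob C" by (rule t'(3))
 show "~ zero_object C M2" by fact
 fix U V assume UV: "direct_sum2 C M2 U V"
 then obtain j1 p1 j2 p2 where D: "M2 : Ob C" "U : Ob C" "V : Ob C"
  "j1 : mors C U M2" "p1 : mors C M2 U" "j2 : mors C V M2" "p2 : mors C M2 V"
  "cmp C U M2 U p1 j1 = idm C U" "cmp C V M2 V p2 j2 = idm C V"
  "cmp C U M2 V p2 j1 = zr (Mor C U V)" "cmp C V M2 U p1 j2 = zr (Mor C V U)"
  "cmp C M2 U M2 j1 p1 +[Mor C M2 M2] cmp C M2 V M2 j2 p2 = idm C M2"
  by (rule direct_sum2E) blast
 have zero: "zero_object C W" if r: "retraction C W M2 j p"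
  and de: "cmp C M2 M2 (sh M) d (cmp C M2 W M2 j p) = zr (Mor C M2 (sh M))" for W j p
 proof -
  note r' = retractionD[OF r]
  obtain h where h: "h : mors C M2 B'" "cmp C M2 W M2 j p = cmp C M2 B' M2 c h"
   using tri_lift_w[OF t t'(3) _ de] r' by auto
  have "idm C W = cmp C W M2 W p (cmp C W M2 M2 (cmp C M2 W M2 j p) j)"
   using r' by (simp add: cmp_assoc)
  also have "... = cmp C W B' W (cmp C B' M2 W p c) (cmp C W M2 B' h j)"
   unfolding h(2) using h(1) r' t' by (simp add: cmp_assoc)
  finally have "retraction C W B' (cmp C W M2 B' h j) (cmp C B' M2 W p c)"
   using h(1) r' t' by (simp add: retraction_def)
  then have "in_add C {T} W" using in_add_retract[OF T_sub B'] by (auto simp: retract_def)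
  moreover have "retract C W M2" using r by (auto simp: retract_def)
  ultimately show ?thesis using right_mutation_no_T[OF t min] by blast
 qed
 let ?e = "cmp C M2 U M2 j1 p1" and ?e' = "cmp C M2 V M2 j2 p2"
 have em: "?e : mors C M2 M2" "?e' : mors C M2 M2" using D by auto
 have ee: "cmp C M2 M2 M2 ?e ?e = ?e" "cmp C M2 M2 M2 ?e' ?e' = ?e'" using D by (simp_all add: cmp_assoc cmp_cancel)
 have e': "?e' = idm C M2 -[Mor C M2 M2] ?e"
  unfolding D(12)[symmetric] using hom_comm[of M2 M2 ?e ?e'] em D(1)
  by (simp add: a_minus_def hom_assoc)
 \<comment> \<open>Vanishing of Ext(B', M) carries the idempotent over to \<open>B'\<close>; the
   resulting \<open>y\<close> need not be idempotent.\<close>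
 have "ext B' M" by (rule ext_in_add_left[OF T_sub B']) (use M_props in auto)
 then have "cmp C B' M2 (sh M) d (cmp C B' M2 M2 ?e c) = zr (Mor C B' (sh M))"
  by (rule hom_zeroD) (use em t' in auto)
 then obtain y where y: "y : mors C B' B'" "cmp C B' M2 M2 ?e c = cmp C B' B' M2 c y"
  using tri_lift_w[OF t t'(2), of "cmp C B' M2 M2 ?e c"] em t' by auto
 obtain z where z: "z : mors C M M" "cmp C M2 (sh M) (sh M) (shm M M z) d = cmp C M2 M2 (sh M) d ?e"
  using TR3_backE[OF t t y(1) em(1) y(2)] by metis
 let ?z' = "idm C M -[Mor C M M] z"
 have \<Sigma>m: "shm M M (x -[Mor C M M] x') = shm M M x -[Mor C (sh M) (sh M)] shm M M x'"
  if "x : mors C M M" "x' : mors C M M" for x x'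
  using that t' linear_functor_neg[OF sh_functor is_linear_category is_linear_category]
  by (simp add: a_minus_def sh_add)
 have "cmp C M2 (sh M) (sh M) (shm M M (cmp C M M M z z)) d =
   cmp C M2 (sh M) (sh M) (shm M M z) (cmp C M2 (sh M) (sh M) (shm M M z) d)"
  using z(1) t' by (simp add: sh_cmp cmp_assoc)
 also have "... = cmp C M2 (sh M) (sh M) (shm M M z) (cmp C M2 M2 (sh M) d ?e)" using z(2) by simp
 also have "... = cmp C M2 M2 (sh M) (cmp C M2 (sh M) (sh M) (shm M M z) d) ?e"
  using z(1) em t' by (intro cmp_assoc[symmetric]) auto
 also have "... = cmp C M2 M2 (sh M) (cmp C M2 M2 (sh M) d ?e) ?e" using z(2) by simp
 also have "... = cmp C M2 M2 (sh M) d ?e" using cmp_assoc[OF D(1,1,1), of "sh M" ?e ?e d] ee em t' by simp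
 finally have "cmp C M2 (sh M) (sh M) (shm M M (z -[Mor C M M] cmp C M M M z z)) d = zr (Mor C M2 (sh M))"
  using z em t' by (simp add: \<Sigma>m cmp_diff_left hom_diff_zero)
 then obtain h where h: "h : mors C B' M" "z -[Mor C M M] cmp C M M M z z = cmp C M B' M h u"
  using tri_extend_sh[OF t t'(1), of "z -[Mor C M M] cmp C M M M z z"] z t' by auto
 have "h : thru C {T} B' M" by (rule in_add_hom[OF T_sub B' h(1) t'(1)])
 then have "z -[Mor C M M] cmp C M M M z z : thru C {T} M M"
  unfolding h(2) using thru_cmp_right[OF T_sub _ t'(4)] t' by blast
 from idempotent_mod_T[OF z(1) this]
 show "zero_object C U \<or> zero_object C V"
 proof (elim disjE exE)
  fix k :: nat assume k: "z ^[End C M] k = zr (End C M)"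
  have "shm M M z ^[End C (sh M)] k = zr (End C (sh M))"
   using sh_nat_pow[OF t'(1) z(1), of k] k t' by simp
  then have "cmp C M2 M2 (sh M) d ?e = zr (Mor C M2 (sh M))"
   by (intro intertwined_nilpotent[OF _ _ em(1) _ _ ee(1)]) (use z t' in auto)
  then show ?thesis using zero[of U j1 p1] D by (simp add: retraction_def)
 next
  fix k :: nat assume k: "?z' ^[End C M] k = zr (End C M)"
  have z'm: "?z' : mors C M M" using z t' by simp
  have "shm M M ?z' ^[End C (sh M)] k = zr (End C (sh M))"
   using sh_nat_pow[OF t'(1) z'm, of k] k t' by simp
  moreover have "cmp C M2 M2 (sh M) d ?e' = cmp C M2 (sh M) (sh M) (shm M M ?z') d"
   unfolding e' using z em t' by (simp add: \<Sigma>m cmp_diff_left cmp_diff_right)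
  ultimately have "cmp C M2 M2 (sh M) d ?e' = zr (Mor C M2 (sh M))"
   by (intro intertwined_nilpotent[OF _ _ em(2) _ _ ee(2)]) (use z'm t' in auto)
  then show ?thesis using zero[of V j2 p2] D by (simp add: retraction_def)
 qed
qed

text \<open>Here Ext(M, U) = 0 extends the projection onto \<open>U\<close> over \<open>B\<close>,
  and the same removal argument applies on the other side.\<close>

lemma left_mutation_no_T:
 assumes t: "(M1, B, M, a, f, b) : \<Delta>"
  and min: "!!g. [|g : mors C B B; cmp C B B M f g = f|] ==> is_iso C B B g"
  and U: "retract C U M1" "in_add C {T} U"
 shows "zero_object C U"
proof -
 note t' = triD[OF t]
 obtain i p where "retraction C U M1 i p" using U by (auto simp: retract_def)
 note r = retractionD[OF this]
 have "ext M U" by (rule ext_in_add_right[OF T_sub U(2)]) (use M_props in auto)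
 then have "cmp C M (sh M1) (sh U) (shm M1 U p) b = zr (Mor C M (sh U))"
  by (rule hom_zeroD) (use r t' in auto)
 then obtain y where y: "y : mors C B U" "p = cmp C M1 B U y a" using tri_extend_sh[OF t r(1,4)] by blast
 let ?ai = "cmp C U M1 B a i"
 let ?g = "idm C B -[Mor C B B] cmp C B U B ?ai y"
 have yai: "cmp C U B U y ?ai = idm C U" using r y t' by (simp add: cmp_assoc[symmetric])
 have fa: "cmp C U B M f ?ai = zr (Mor C U M)"
  using r t' tri_vu[OF t] by (simp add: cmp_assoc[symmetric])
 then have "cmp C B B M f (cmp C B U B ?ai y) = zr (Mor C B M)"
  using y t' r by (simp add: cmp_assoc[symmetric, of B U B M])
 then have "cmp C B B M f ?g = f"
  using y t' r by (simp add: cmp_linear a_minus_def hom_minus_zero)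
 then have "is_iso C B B ?g" using y t' r by (intro min) auto
 then obtain g' where g': "g' : mors C B B" "cmp C B B B g' ?g = idm C B"
  by (auto simp: is_iso_def is_inverse_def)
 have aim: "?ai : mors C U B" "cmp C B U B ?ai y : mors C B B" using y t' r by auto
 have "cmp C U B B (cmp C B U B ?ai y) ?ai = ?ai"
  using cmp_assoc[OF r(1) t'(2) r(1) t'(2) aim(1) y(1) aim(1)] yai aim r t' by simp
 then have "cmp C U B B ?g ?ai = zr (Mor C U B)" using aim r t' by (simp add: cmp_diff_left)
 then have "cmp C U B B g' (cmp C U B B ?g ?ai) = zr (Mor C U B)" using g' r t' by simp
 then have "?ai = zr (Mor C U B)"
  using g' r t' y cmp_assoc[OF r(1) t'(2,2,2) aim(1) _ g'(1), of ?g] aim by simp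
 then have "idm C U = zr (Mor C U U)" using yai y r t' by simp
 then show ?thesis using r by (simp add: zero_object_def)
qed

text \<open>Dual to the right-hand case: Ext(M, B) = 0 extends the idempotent over \<open>B\<close>,
  and \<open>z\<close> now acts on the third object of the triangle.\<close>

lemma left_mutation_indecomposable:
 assumes t: "(M1, B, M, a, f, b) : \<Delta>" and B: "in_add C {T} B"
  and min: "!!g. [|g : mors C B B; cmp C B B M f g = f|] ==> is_iso C B B g"
  and nz: "~ zero_object C M1"
 shows "indecomposable C M1"
 unfolding indecomposable_def
proof (intro conjI allI impI)
 note t' = triD[OF t]
 show "M1 : Ob C" by (rule t'(1))
 show "~ zero_object C M1" by fact
 fix U V assume UV: "direct_sum2 C M1 U V"
 then obtain j1 p1 j2 p2 where D: "M1 : Ob C" "U : Ob C" "V : Ob C"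
  "j1 : mors C U M1" "p1 : mors C M1 U" "j2 : mors C V M1" "p2 : mors C M1 V"
  "cmp C U M1 U p1 j1 = idm C U" "cmp C V M1 V p2 j2 = idm C V"
  "cmp C U M1 V p2 j1 = zr (Mor C U V)" "cmp C V M1 U p1 j2 = zr (Mor C V U)"
  "cmp C M1 U M1 j1 p1 +[Mor C M1 M1] cmp C M1 V M1 j2 p2 = idm C M1"
  by (rule direct_sum2E) blast
 have zero: "zero_object C W" if r: "retraction C W M1 j p"
  and de: "cmp C M (sh M1) (sh M1) (shm M1 M1 (cmp C M1 W M1 j p)) b = zr (Mor C M (sh M1))" for W j p
 proof -
  note r' = retractionD[OF r]
  obtain h where h: "h : mors C B M1" "cmp C M1 W M1 j p = cmp C M1 B M1 h a"
   using tri_extend_sh[OF t t'(1) _ de] r' by auto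
  have "idm C W = cmp C W M1 W p (cmp C W M1 M1 (cmp C M1 W M1 j p) j)"
   using r' by (simp add: cmp_assoc)
  also have "... = cmp C W B W (cmp C B M1 W p h) (cmp C W M1 B a j)"
   unfolding h(2) using h(1) r' t' by (simp add: cmp_assoc)
  finally have "retraction C W B (cmp C W M1 B a j) (cmp C B M1 W p h)"
   using h(1) r' t' by (simp add: retraction_def)
  then have "in_add C {T} W" using in_add_retract[OF T_sub B] by (auto simp: retract_def)
  moreover have "retract C W M1" using r by (auto simp: retract_def)
  ultimately show ?thesis using left_mutation_no_T[OF t min] by blast
 qed
 let ?e = "cmp C M1 U M1 j1 p1" and ?e' = "cmp C M1 V M1 j2 p2"
 have em: "?e : mors C M1 M1" "?e' : mors C M1 M1" using D by auto
 have ee: "cmp C M1 M1 M1 ?e ?e = ?e" "cmp C M1 M1 M1 ?e' ?e' = ?e'" using D by (simp_all add: cmp_assoc cmp_cancel)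
 have \<Sigma>ee: "cmp C (sh M1) (sh M1) (sh M1) (shm M1 M1 x) (shm M1 M1 x) = shm M1 M1 x"
  if "x : mors C M1 M1" "cmp C M1 M1 M1 x x = x" for x
  using that sh_cmp[OF t'(1,1,1) that(1,1)] by simp
 have e': "?e' = idm C M1 -[Mor C M1 M1] ?e"
  unfolding D(12)[symmetric] using hom_comm[of M1 M1 ?e ?e'] em D(1)
  by (simp add: a_minus_def hom_assoc)
 have "ext M B" by (rule ext_in_add_right[OF T_sub B]) (use M_props in auto)
 then have "cmp C M (sh M1) (sh B) (shm M1 B (cmp C M1 M1 B a ?e)) b = zr (Mor C M (sh B))"
  by (rule hom_zeroD) (use em t' in auto)
 then obtain y where y: "y : mors C B B" "cmp C M1 M1 B a ?e = cmp C M1 B B y a"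
  using tri_extend_sh[OF t t'(2), of "cmp C M1 M1 B a ?e"] em t' by auto
 obtain z where z: "z : mors C M M" "cmp C M (sh M1) (sh M1) (shm M1 M1 ?e) b = cmp C M M (sh M1) b z"
  using TR3E[OF t t em(1) y(1)] y(2) by metis
 let ?z' = "idm C M -[Mor C M M] z"
 have \<Sigma>m: "shm M1 M1 (x -[Mor C M1 M1] x') = shm M1 M1 x -[Mor C (sh M1) (sh M1)] shm M1 M1 x'"
  if "x : mors C M1 M1" "x' : mors C M1 M1" for x x'
  using that t' linear_functor_neg[OF sh_functor is_linear_category is_linear_category]
  by (simp add: a_minus_def sh_add)
 have "cmp C M M (sh M1) b (cmp C M M M z z) = cmp C M M (sh M1) (cmp C M M (sh M1) b z) z"
  using z t' by (simp add: cmp_assoc)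
 also have "... = cmp C M M (sh M1) (cmp C M (sh M1) (sh M1) (shm M1 M1 ?e) b) z" using z(2) by simp
 also have "... = cmp C M (sh M1) (sh M1) (shm M1 M1 ?e) (cmp C M M (sh M1) b z)"
  using z(1) em t' by (intro cmp_assoc) auto
 also have "... = cmp C M (sh M1) (sh M1) (cmp C (sh M1) (sh M1) (sh M1) (shm M1 M1 ?e) (shm M1 M1 ?e)) b"
  unfolding z(2)[symmetric] using em t' by (simp add: cmp_assoc)
 also have "... = cmp C M M (sh M1) b z" using \<Sigma>ee[OF em(1) ee(1)] z by simp
 finally have "cmp C M M (sh M1) b (z -[Mor C M M] cmp C M M M z z) = zr (Mor C M (sh M1))"
  using z em t' by (simp add: cmp_diff_right hom_diff_zero)
 then obtain h where h: "h : mors C M B" "z -[Mor C M M] cmp C M M M z z = cmp C M B M f h"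
  using tri_lift_w[OF t t'(3), of "z -[Mor C M M] cmp C M M M z z"] z t' by auto
 have "h : thru C {T} M B" by (rule in_add_hom'[OF T_sub B h(1) t'(3)])
 then have "z -[Mor C M M] cmp C M M M z z : thru C {T} M M"
  unfolding h(2) using thru_cmp_left[OF T_sub _ t'(5)] t' by blast
 from idempotent_mod_T[OF z(1) this]
 show "zero_object C U \<or> zero_object C V"
 proof (elim disjE exE)
  fix k :: nat assume k: "z ^[End C M] k = zr (End C M)"
  have "cmp C M (sh M1) (sh M1) (shm M1 M1 ?e) b = zr (Mor C M (sh M1))"
   by (intro intertwined_nilpotent'[OF _ _ _ z(1) _ \<Sigma>ee[OF em(1) ee(1)] z(2) k]) (use em t' in auto)
  then show ?thesis using zero[of U j1 p1] D by (simp add: retraction_def)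
 next
  fix k :: nat assume k: "?z' ^[End C M] k = zr (End C M)"
  have "cmp C M (sh M1) (sh M1) (shm M1 M1 ?e') b = cmp C M M (sh M1) b ?z'"
   unfolding e' using z em t' by (simp add: \<Sigma>m cmp_diff_left cmp_diff_right)
  then have "cmp C M (sh M1) (sh M1) (shm M1 M1 ?e') b = zr (Mor C M (sh M1))"
   by (intro intertwined_nilpotent'[OF _ _ _ _ _ \<Sigma>ee[OF em(2) ee(2)] _ k]) (use em z t' in auto)
  then show ?thesis using zero[of V j2 p2] D by (simp add: retraction_def)
 qed
qed

end

end

section \<open>Both mutations give the same complement\<close>

lemma add_closure_in_add: assumes T: "T : Ob C" and "B : add_closure C T" shows "in_add C {T} B"
proof -
 obtain n :: nat and Z where Z: "direct_sum C Z {..<n} (%_. T)" "summand C B Z"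
  using assms(2) by (auto simp: add_closure_def)
 then obtain j p where "biproduct C Z {..<n} (%_. T) j p" by (auto simp: direct_sum_def)
 from biproduct_in_add[OF this] have "in_add C {T} Z" by (rule in_add_mono) auto
 then show ?thesis using in_add_retract[of "{T}"] summand_retract[OF Z(2)] T by auto
qed

lemma add_closure_self: assumes T: "T : Ob C" shows "T : add_closure C T"
proof -
 obtain Z j p where b: "biproduct C Z {..<1::nat} (%_. T) j p"
  using direct_sum_exists[OF additive, of "{..<1::nat}" "%_. T"] T by auto
 then have "summand C T Z" using biproduct_retraction[OF b, of 0] retract_summand by (auto simp: retract_def)
 then show ?thesis using b by (auto simp: add_closure_def direct_sum_def)
qed

theorem mutation:
 assumes T: "almost_complete_tilting C \<Sigma> T" and M: "complement C \<Sigma> T M"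
  and f: "minimal_right_approximation C (add_closure C T) B M f"
  and u: "minimal_left_approximation C (add_closure C T) M B' u"
  and t1: "(M1, B, M, a, f, b) : \<Delta>" and t2: "(M, B', M2, u, c, d) : \<Delta>"
 shows "isomorphic C M1 M2 & complement C \<Sigma> T M1 & ~ isomorphic C M1 M &
     (ALL N. complement C \<Sigma> T N & ~ isomorphic C N M --> isomorphic C N M1)"
proof -
 note t1' = triD[OF t1] and t2' = triD[OF t2]
 note To = T_Ob[OF T] and Mp = complementD[OF T M] and TT = ext_TT[OF T]
 have Ts: "{T} <= Ob C" using To by simp
 have B: "in_add C {T} B" "in_add C {T} B'"
  using f u add_closure_in_add[OF To]
  by (auto simp: minimal_right_approximation_def right_approximation_def
    minimal_left_approximation_def left_approximation_def)
 have fs: "EX g:mors C W B. h = cmp C W B M f g" if "W : {T}" "h : mors C W M" for W h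
  using f add_closure_self[OF To] that
  unfolding minimal_right_approximation_def right_approximation_def by blast
 have us: "EX g:mors C B' T. h = cmp C M B' T g u" if "h : mors C M T" for h
  using u add_closure_self[OF To] that
  unfolding minimal_left_approximation_def left_approximation_def by blast
 have fmin: "is_iso C B B g" if "g : mors C B B" "cmp C B B M f g = f" for g
  using f that by (auto simp: minimal_right_approximation_def)
 have umin: "is_iso C B' B' g" if "g : mors C B' B'" "cmp C M B' B' g u = u" for g
  using u that by (auto simp: minimal_left_approximation_def)
 note ker = approximation_kernel[OF Ts _ Mp(3) t1 B(1) fs, simplified]
 have M1T: "ext T M1" "ext M1 T" "ext M1 M1" using ker TT by auto
 \<comment> \<open>Were Ext(M, M1) zero, the approximation \<open>f\<close> would split and
   \<open>M\<close> would lie in add T. This one non-vanishing keeps \<open>M1\<close> out of add T,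
   separates it from \<open>M\<close>, and forbids both in one rigid set.\<close>
 have b0: "~ ext M M1"
 proof
  assume "ext M M1"
  then have "retract C M B" using tri_w_zero_retract[OF t1] hom_zeroD t1'(6) by blast
  then show False using Mp(6) in_add_retract[OF Ts B(1)] by blast
 qed
 have M1n: "~ in_add C {T} M1"
 proof
  assume "in_add C {T} M1"
  then have "ext M M1" by (rule ext_in_add_right[OF Ts]) (use Mp in auto)
  then show False using b0 by simp
 qed
 have M1z: "~ zero_object C M1"
 proof
  assume "zero_object C M1"
  then have "in_add C {T} M1" by (auto simp: in_add_def zero_object_def intro: thru_zero)
  then show False using M1n by simp
 qed
 have M1i: "indecomposable C M1" by (rule left_mutation_indecomposable[OF T M t1 B(1) fmin M1z])
 then have M1l: "local_object C M1" by (rule local_if_indecomposable)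
 have M1M: "~ isomorphic C M1 M"
 proof
  assume "isomorphic C M1 M"
  then have "ext M M1"
   using ext_retract[OF Mp(3)] isomorphic_retract isomorphic_refl[OF Mp(2)] by blast
  then show False using b0 by simp
 qed
 have ex: "isomorphic C N M \<or> retract C N M2"
  if "local_object C N" "ext N N" "ext N T" "~ in_add C {T} N" for N
  by (rule exchange[OF T M t2 B(2)]) (use us that in auto)
 have r12: "retract C M1 M2" using ex[OF M1l M1T(3,2) M1n] M1M by simp
 have "~ zero_object C M2" using retract_zero[OF r12] M1z by blast
 then have M2l: "local_object C M2"
  by (intro local_if_indecomposable right_mutation_indecomposable[OF T M t2 B(2) umin])
 have iso12: "isomorphic C M1 M2" by (rule retract_local_iso[OF r12 M2l M1z])
 have uniq: "isomorphic C N M1" if N: "local_object C N" "ext N N" "ext N T" "~ in_add C {T} N"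
  and NM: "~ isomorphic C N M" for N
 proof -
  have "retract C N M2" using ex[OF N] NM by simp
  then have "isomorphic C N M2" using retract_local_iso[OF _ M2l local_not_zero[OF N(1)]] by blast
  then show ?thesis using iso12 isomorphic_sym isomorphic_trans by blast
 qed
 have all: "isomorphic C N M1" if "complement C \<Sigma> T N" "~ isomorphic C N M" for N
  using complementD[OF T that(1)] that(2) by (intro uniq) auto
 have "complement C \<Sigma> T M1"
 proof -
  obtain S0 j p where S0: "biproduct C T S0 (%X. X) j p" "nonisomorphic_indecomposables C S0" "S0 <= Ob C"
   "!!X. X : S0 ==> local_object C X" "!!X. X : S0 ==> retract C X T" "in_add C S0 T"
   using T_decomposition[OF T] by blast
  obtain Z where Z: "direct_sum2 C Z T M1"
   using additive To t1'(1) by (auto simp: additive_category_def)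
  have Zo: "Z : Ob C" using Z by (rule direct_sum2E)
  note rZ = direct_sum2_retract[OF Z]
  let ?S = "insert M1 S0"
  have S0M1: "~ isomorphic C X M1" "~ isomorphic C M1 X" if "X : S0" for X
  proof -
   show "~ isomorphic C M1 X"
   proof
    assume "isomorphic C M1 X"
    then have "retract C M1 T" using isomorphic_retract S0(5)[OF that] retract_trans by blast
    then show False using M1n in_add_retract[OF Ts in_add_self[OF Ts]] by blast
   qed
   then show "~ isomorphic C X M1" using isomorphic_sym by blast
  qed
  then have M1S0: "M1 ~: S0" using isomorphic_refl[OF t1'(1)] by blast
  obtain j' p' where b: "biproduct C Z ?S (%X. X) j' p'"
   using biproduct_insert[OF S0(1) _ M1S0] Z by blast
  have nS: "nonisomorphic_indecomposables C ?S"
   using S0(2) S0M1 M1i unfolding nonisomorphic_indecomposables_def by auto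
  have TM1: "{T, M1} <= Ob C" using To t1' by simp
  have iZ: "in_add C {T, M1} Z" by (rule direct_sum2_in_add[OF Z])
  have ZW: "ext Z W" if "W : {T, M1}" for W
   by (rule ext_in_add_left[OF TM1 iZ]) (use that M1T TT To t1' in auto)
  have ZZ: "ext Z Z" by (rule ext_in_add_right[OF TM1 iZ ZW Zo])
  have SZ: "retract C X Z" if "X : ?S" for X
   using biproduct_retraction[OF b that] by (auto simp: retract_def)
  have "indecomposable_summands C Z ?S"
   unfolding indecomposable_summands_def
  proof (intro conjI ballI allI impI nS)
   fix X assume "X : ?S" then show "summand C X Z" using SZ retract_summand by blast
  next
   fix X assume X: "indecomposable C X & summand C X Z"
   have lX: "local_object C X" using X local_if_indecomposable by blast
   have So: "?S <= Ob C" using S0 t1' by auto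
   have "in_add C ?S Z" using biproduct_in_add[OF b] by simp
   then have "in_add C ?S X" using in_add_retract[OF So] X summand_retract by blast
   then obtain Y where Y: "Y : ?S" "retract C X Y" using local_in_add_retract[OF So lX] by auto
   have "local_object C Y" using Y(1) S0(4) M1l by auto
   then show "EX Y:?S. isomorphic C X Y" using retract_local_iso[OF Y(2) _ local_not_zero[OF lX]] Y(1) by blast
  qed
  moreover have "rigid_set C \<Sigma> ?S"
   unfolding rigid_set_def ext_iff using nS ext_retract[OF ZZ SZ SZ] by blast
  \<comment> \<open>A further compatible \<open>N\<close> lies outside add T, so it is
    \<open>M\<close> or \<open>M1\<close> by \<open>uniq\<close>. It is not \<open>M1\<close>, and
    \<open>M\<close> is excluded because Ext(M, M1) is nonzero.\<close>
  moreover have "S' = ?S" if S': "rigid_set C \<Sigma> S'" "?S <= S'" for S'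
  proof (rule ccontr)
   assume "S' ~= ?S"
   then obtain N where N: "N : S'" "N ~: ?S" using S'(2) by blast
   have Ni: "local_object C N" using S'(1) N local_if_indecomposable
    by (auto simp: rigid_set_def nonisomorphic_indecomposables_def)
   have No: "N : Ob C" by (rule local_Ob[OF Ni])
   have eN: "ext N N" "!!Y. Y : ?S ==> ext N Y"
    using S' N by (auto simp: rigid_set_def ext_iff)
   have nN: "~ isomorphic C N Y" if "Y : ?S" for Y
    using S' N that unfolding rigid_set_def nonisomorphic_indecomposables_def by blast
   have NT: "ext N T" by (rule ext_in_add_right[OF S0(3,6)]) (use eN No in auto)
   have "~ in_add C {T} N"
   proof
    assume "in_add C {T} N"
    then have "in_add C S0 N" by (rule in_add_trans[OF _ _ Ts S0(3)]) (use S0 in auto)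
    then obtain Y where Y: "Y : S0" "retract C N Y" using local_in_add_retract[OF S0(3) Ni] by auto
    then have "isomorphic C N Y" using retract_local_iso[OF _ S0(4) local_not_zero[OF Ni]] by blast
    then show False using nN Y by blast
   qed
   then have "isomorphic C N M" using uniq[OF Ni eN(1) NT] nN[of M1] by blast
   then have "retract C M N" using isomorphic_sym isomorphic_retract by blast
   then have "ext M M1"
    using ext_retract[OF eN(2)[of M1]] isomorphic_retract[OF isomorphic_refl[OF t1'(1)]] by blast
   then show False using b0 by simp
  qed
  moreover have "exceptional C \<Sigma> Z" using Zo ZZ by (simp add: exceptional_def ext_iff)
  ultimately have "tilting C \<Sigma> Z" unfolding tilting_def by blast
  moreover have "basic C Z" using nS b by (auto simp: basic_def direct_sum_def)
  ultimately show ?thesis using M1i Z by (auto simp: complement_def)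
 qed
 then show ?thesis using iso12 M1M all by blast
qed

end

section \<open>Modules and complexes\<close>

lemma lin_space_simps [simp]:
 "carrier (lin_space A z p s) = A" "zr (lin_space A z p s) = z"
 "x +[lin_space A z p s] y = p x y" "c *[lin_space A z p s] x = s c x"
 by (simp_all add: lin_space_def)

lemma fgmod_simps [simp]:
 "M : Ob (fgmod H) \<longleftrightarrow> left_module H M & fin_generated H M"
 "mors (fgmod H) M N = module_maps H M N"
 "zr (Mor (fgmod H) M N) = (\<lambda>x\<in>carrier M. zr N)"
 "f +[Mor (fgmod H) M N] g = (\<lambda>x\<in>carrier M. f x +[N] g x)"
 "c *[Mor (fgmod H) M N] f = (\<lambda>x\<in>carrier M. scal H c *[N] f x)"
 "idm (fgmod H) M = (\<lambda>x\<in>carrier M. x)"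
 "cmp (fgmod H) L M N g f = (\<lambda>x\<in>carrier L. g (f x))"
 by (simp_all add: fgmod_def)

lemma left_module_group: "left_module H M ==> abelian_group M"
 by (simp add: left_module_def)

lemma left_module_zero:
 assumes "left_module H M" "a : carrier H" shows "a *[M] zr M = zr M"
proof -
 interpret left_module H M by fact
 have "a *[M] zr M +[M] a *[M] zr M = a *[M] zr M"
  using act_r_distr[OF assms(2) M.zero_closed M.zero_closed] by simp
 then show ?thesis using act_closed[OF assms(2) M.zero_closed] M.add.l_cancel_one' by metis
qed

lemma mapsD:
 assumes "f : module_maps H M N"
 shows "x : carrier M ==> f x : carrier N"
  "[|x : carrier M; y : carrier M|] ==> f (x +[M] y) = f x +[N] f y"
  "[|a : carrier H; x : carrier M|] ==> f (a *[M] x) = a *[N] f x"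
  "x ~: carrier M ==> f x = undefined"
 using assms by (auto simp: module_maps_def PiE_def extensional_def)

lemma maps_zero:
 assumes "f : module_maps H M N" "left_module H M" "left_module H N" shows "f (zr M) = zr N"
proof -
 interpret M: abelian_group M using assms left_module_group by blast
 interpret N: abelian_group N using assms left_module_group by blast
 have "f (zr M) +[N] f (zr M) = f (zr M)"
  using mapsD(2)[OF assms(1), of "zr M" "zr M"] by simp
 then show ?thesis using mapsD(1)[OF assms(1)] N.add.l_cancel_one' by (metis M.zero_closed)
qed

lemma module_maps_minus:
 assumes "f : module_maps H M N" "left_module H M" "left_module H N" "x : carrier M"
 shows "f (-[M] x) = -[N] f x"
proof -
 interpret M: abelian_group M using assms left_module_group by blast
 interpret N: abelian_group N using assms left_module_group by blast
 have "f (-[M] x) +[N] f x = zr N"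
  using mapsD(2)[OF assms(1), of "-[M] x" x] assms maps_zero[OF assms(1-3)]
  by (simp add: M.l_neg)
 then show ?thesis using mapsD(1)[OF assms(1)] assms(4) by (simp add: N.minus_equality)
qed

section \<open>Scalars of K acting on H-modules\<close>

lemma scalar:
 assumes H: "fd_algebra K H" and c: "c : carrier K"
 shows scalar_closed: "c *[H] un H : carrier H"
  and scalar_central: "a : carrier H ==> a **[H] scal H c = scal H c **[H] a"
  and scalar_mult: "c' : carrier K ==> (c **[K] c') *[H] un H = scal H c **[H] (c' *[H] un H)"
  and scalar_add: "c' : carrier K ==> (c +[K] c') *[H] un H = scal H c +[H] (c' *[H] un H)"
  and scalar_one: "un K *[H] un H = un H"
proof -
 interpret R: ring H using H by (simp add: fd_algebra_def)
 interpret V: module K H using H by (simp add: fd_algebra_def)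
 have bil: "!!a x y. [|a : carrier K; x : carrier H; y : carrier H|] ==> (a *[H] x) **[H] y = a *[H] (x **[H] y)"
  "!!a x y. [|a : carrier K; x : carrier H; y : carrier H|] ==> x **[H] (a *[H] y) = a *[H] (x **[H] y)"
  using H by (auto simp: fd_algebra_def)
 show "c *[H] un H : carrier H" using c by simp
 show "a **[H] scal H c = scal H c **[H] a" if "a : carrier H"
  using bil c that by simp
 show "(c **[K] c') *[H] un H = scal H c **[H] (c' *[H] un H)" if "c' : carrier K"
  using bil(1)[of c "un H" "c' *[H] un H"] c that by (simp add: V.smult_assoc1)
 show "(c +[K] c') *[H] un H = scal H c +[H] (c' *[H] un H)" if "c' : carrier K"
  using c that by (simp add: V.smult_l_distr)
 show "un K *[H] un H = un H" by simp
qed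

definition scalars :: "('k, 'h) module => ('h, 'v) module => ('k, 'v) module" where
 "scalars H M = lin_space (carrier M) (zr M) (add M) (%c x. scal H c *[M] x)"

lemma scalars_simps [simp]:
 "carrier (scalars H M) = carrier M" "zr (scalars H M) = zr M"
 "x +[scalars H M] y = x +[M] y" "c *[scalars H M] x = scal H c *[M] x"
 by (simp_all add: scalars_def)

lemma scalars_module:
 assumes H: "fd_algebra K H" and M: "left_module H M" shows "module K (scalars H M)"
proof -
 interpret M: left_module H M by fact
 have K: "cring K" using H by (simp add: fd_algebra_def field_def domain_def)
 show ?thesis
 proof (rule moduleI[OF K])
  show "abelian_group (scalars H M)"
   by (rule abelian_groupI) (auto simp: M.M.a_ac intro!: bexI[of _ "-[M] x" for x] M.M.l_neg)
 qed (simp_all add: M.act_closed M.act_l_distr M.act_r_distr M.act_assoc M.act_one scalar_closed[OF H]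
   scalar_mult[OF H] scalar_add[OF H] scalar_one[OF H cring.cring_simprules(6)[OF K]])
qed

text \<open>Products of generators of \<open>H\<close> over \<open>K\<close> with generators of the
  module span the module over \<open>K\<close>.\<close>

lemma scalars_fl:
 assumes H: "fd_algebra K H" and M: "left_module H M" and fg: "fin_generated H M"
 shows "fl K (scalars H M)"
proof -
 interpret M: left_module H M by fact
 have K: "field K" and HK: "module K H" and fgH: "fin_generated K H"
  and bil: "!!a x y. [|a : carrier K; x : carrier H; y : carrier H|] ==> (a *[H] x) **[H] y = a *[H] (x **[H] y)"
  using H by (auto simp: fd_algebra_def)
 obtain A where A: "finite A" "A <= carrier M" "!!N. submodule N H M ==> A <= N ==> N = carrier M"
  using fg by (auto simp: fin_generated_def)
 obtain B where B: "finite B" "B <= carrier H" "!!N. submodule N K H ==> B <= N ==> N = carrier H"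
  using fgH by (auto simp: fin_generated_def)
 note V = scalars_module[OF H M]
 have "fin_generated K (scalars H M)"
  unfolding fin_generated_def
 proof (intro exI conjI allI impI)
  let ?S = "(%(b, a). b *[M] a) ` (B \<times> A)"
  show "finite ?S" using A B by auto
  show "?S <= carrier (scalars H M)" using A(2) B(2) M.act_closed by (auto simp: subset_iff)
  fix N assume N: "submodule N K (scalars H M) & ?S <= N"
  have Ns: "N <= carrier M" "zr M : N" "!!x y. x : N ==> y : N ==> x +[M] y : N"
   "!!c x. c : carrier K ==> x : N ==> scal H c *[M] x : N"
   using N submodule_iff[OF V, of N] by auto
  have Nm: "-[M] x : N" if "x : N" for x
  proof -
   have "-[scalars H M] x : N" using module.submoduleE(3)[OF V] N that by blast
   moreover have "-[scalars H M] x = -[M] x"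
    using abelian_group.minus_equality[OF module.axioms(2)[OF V], of "-[M] x" x] that Ns(1)
    by (auto simp: M.M.l_neg)
   ultimately show ?thesis by simp
  qed
  have ha: "h *[M] a : N" if a: "a : A" and h: "h : carrier H" for h a
  proof -
   have ac: "a : carrier M" using a A by auto
   \<comment> \<open>Generation is used twice. For a generator \<open>a\<close>, the
     \<open>h\<close> with \<open>h a\<close> in \<open>N\<close> form a \<open>K\<close>-subspace
     containing \<open>B\<close>; afterwards the \<open>x\<close> with \<open>H x\<close> inside
     \<open>N\<close> form an \<open>H\<close>-submodule containing \<open>A\<close>.\<close>
   have "{h : carrier H. h *[M] a : N} = carrier H"
   proof (rule B(3))
    show "B <= {h : carrier H. h *[M] a : N}" using N a B by auto
    have z: "zr H *[M] a = zr M"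
     using M.act_l_distr[OF M.H.zero_closed M.H.zero_closed ac] M.act_closed[OF M.H.zero_closed ac]
     by (metis M.H.l_zero M.H.zero_closed M.M.add.l_cancel_one')
    have s: "(c *[H] h) *[M] a = scal H c *[M] (h *[M] a)"
     if "c : carrier K" "h : carrier H" for c h
     using that M.act_assoc[OF scalar_closed[OF H that(1)] that(2) ac] bil[of c "un H" h] by simp
    show "submodule {h : carrier H. h *[M] a : N} K H"
     unfolding submodule_iff[OF HK] using z Ns ac M.act_l_distr s module.smult_closed[OF HK] by auto
   qed
   then show ?thesis using h by auto
  qed
  have "{x : carrier M. ALL h:carrier H. h *[M] x : N} = carrier M"
  proof (rule A(3))
   show "A <= {x : carrier M. ALL h:carrier H. h *[M] x : N}" using ha A by auto
   show "submodule {x : carrier M. ALL h:carrier H. h *[M] x : N} H M"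
   proof (intro submodule.intro subgroup.intro submodule_axioms.intro)
    fix x assume x: "x : {x : carrier M. ALL h:carrier H. h *[M] x : N}"
    then have xc: "x : carrier M" by simp
    have "h *[M] (-[M] x) = -[M] (h *[M] x)" if "h : carrier H" for h
     using M.act_r_distr[OF that, of "-[M] x" x] xc left_module_zero[OF M that] M.act_closed[OF that]
     by (simp add: M.M.l_neg M.M.minus_equality)
    then show "inv\<^bsub>add_monoid M\<^esub> x : {x : carrier M. ALL h:carrier H. h *[M] x : N}"
     using x Nm by (simp add: a_inv_def[symmetric])
   qed (use M.act_closed M.act_r_distr M.act_assoc Ns left_module_zero[OF M] in
     \<open>auto simp: M.act_assoc[symmetric]\<close>)
  qed
  then have "x : N" if "x : carrier M" for x using that M.act_one[of x] M.H.one_closed by force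
  then show "N = carrier (scalars H M)" using Ns by auto
 qed
 then show ?thesis by (rule fin_generated_imp_fl[OF K V])
qed

lemma fgmod_linear_category:
 assumes H: "fd_algebra K H" shows "linear_category K (fgmod H)"
proof (rule linear_category.intro)
 show K: "field K" using H by (simp add: fd_algebra_def)
 fix M N assume "M : Ob (fgmod H)" "N : Ob (fgmod H)"
 then have M: "left_module H M" and N: "left_module H N" by auto
 interpret M: left_module H M by fact
 interpret N: left_module H N by fact
 have Kc: "cring K" using K by (simp add: field_def domain_def)
 note s = scalar_closed[OF H]
 show "module K (Mor (fgmod H) M N)"
 proof (rule moduleI[OF Kc])
  show "abelian_group (Mor (fgmod H) M N)"
  proof (rule abelian_groupI)
   fix f g h assume "f : mors (fgmod H) M N" "g : mors (fgmod H) M N" "h : mors (fgmod H) M N"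
   then have fg: "f : module_maps H M N" "g : module_maps H M N" "h : module_maps H M N" by auto
   note d = mapsD[OF fg(1)] mapsD[OF fg(2)] mapsD[OF fg(3)]
   show "f +[Mor (fgmod H) M N] g : mors (fgmod H) M N"
    using d M.act_closed N.act_r_distr by (auto simp: module_maps_def N.M.a_ac)
   show "f +[Mor (fgmod H) M N] g +[Mor (fgmod H) M N] h = f +[Mor (fgmod H) M N] (g +[Mor (fgmod H) M N] h)"
    using d by (auto simp: N.M.a_ac restrict_def fun_eq_iff)
   show "f +[Mor (fgmod H) M N] g = g +[Mor (fgmod H) M N] f"
    using d by (auto simp: N.M.a_ac restrict_def fun_eq_iff)
   show "zr (Mor (fgmod H) M N) +[Mor (fgmod H) M N] f = f" using d by (auto simp: fun_eq_iff restrict_def)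
   show "EX y:mors (fgmod H) M N. y +[Mor (fgmod H) M N] f = zr (Mor (fgmod H) M N)"
   proof (rule bexI[of _ "\<lambda>x\<in>carrier M. -[N] f x"])
    have "-[N] (a *[N] y) = a *[N] (-[N] y)" if "a : carrier H" "y : carrier N" for a y
     using N.act_r_distr[OF that(1), of "-[N] y" y] that left_module_zero[OF N that(1)] N.act_closed[OF that(1)]
     by (simp add: N.M.l_neg N.M.minus_equality)
    then show "(\<lambda>x\<in>carrier M. -[N] f x) : mors (fgmod H) M N"
     using d M.act_closed by (auto simp: module_maps_def N.M.minus_add)
   qed (use d in \<open>auto simp: N.M.l_neg restrict_def fun_eq_iff\<close>)
  qed (use M.act_closed left_module_zero[OF N] in \<open>auto simp: module_maps_def\<close>)
 next
  fix c f assume c: "c : carrier K" and "f : mors (fgmod H) M N"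
  then have f: "f : module_maps H M N" by simp
  note d = mapsD[OF f]
  have "scal H c *[N] (a *[N] y) = a *[N] (scal H c *[N] y)"
   if "a : carrier H" "y : carrier N" for a y
   using N.act_assoc s[OF c] that scalar_central[OF H c that(1)] by metis
  then show "c *[Mor (fgmod H) M N] f : mors (fgmod H) M N"
   using d s[OF c] M.act_closed N.act_closed N.act_r_distr by (auto simp: module_maps_def)
  fix g c' assume "g : mors (fgmod H) M N" and c': "c' : carrier K"
  then have g: "g : module_maps H M N" by simp
  note d = d mapsD[OF g]
  show "(c +[K] c') *[Mor (fgmod H) M N] f = c *[Mor (fgmod H) M N] f +[Mor (fgmod H) M N] c' *[Mor (fgmod H) M N] f"
   using d s c c' N.act_l_distr scalar_add[OF H] by (auto simp: restrict_def fun_eq_iff)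
  show "c *[Mor (fgmod H) M N] (f +[Mor (fgmod H) M N] g) = c *[Mor (fgmod H) M N] f +[Mor (fgmod H) M N] c *[Mor (fgmod H) M N] g"
   using d s c N.act_r_distr by (auto simp: restrict_def fun_eq_iff)
  show "(c **[K] c') *[Mor (fgmod H) M N] f = c *[Mor (fgmod H) M N] (c' *[Mor (fgmod H) M N] f)"
   using d s c c' N.act_assoc scalar_mult[OF H] by (auto simp: restrict_def fun_eq_iff)
 next
  fix f assume "f : mors (fgmod H) M N"
  then have f: "f : module_maps H M N" by simp
  interpret K: field K by fact
  show "un K *[Mor (fgmod H) M N] f = f"
   using mapsD[OF f] N.act_one scalar_one[OF H K.one_closed] by (auto simp: restrict_def fun_eq_iff)
 qed
next
 fix M assume "M : Ob (fgmod H)"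
 then interpret M: left_module H M by simp
 show "idm (fgmod H) M : mors (fgmod H) M M" using M.act_closed by (auto simp: module_maps_def)
next
 fix L M N f g assume "L : Ob (fgmod H)" "M : Ob (fgmod H)" "N : Ob (fgmod H)" "f : mors (fgmod H) L M" "g : mors (fgmod H) M N"
 then interpret L: left_module H L + f: left_module H M by auto
 have fg: "f : module_maps H L M" "g : module_maps H M N"
  using \<open>f : mors (fgmod H) L M\<close> \<open>g : mors (fgmod H) M N\<close> by auto
 show "cmp (fgmod H) L M N g f : mors (fgmod H) L N"
  using L.act_closed mapsD[OF fg(1)] mapsD[OF fg(2)]
  by (auto simp: module_maps_def[of H L N])
next
 fix W X Y Z f g h assume "W : Ob (fgmod H)" "f : mors (fgmod H) W X" "g : mors (fgmod H) X Y"
 then show "cmp (fgmod H) W X Z (cmp (fgmod H) X Y Z h g) f = cmp (fgmod H) W Y Z h (cmp (fgmod H) W X Y g f)"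
  using mapsD(1) by (fastforce simp: restrict_def fun_eq_iff)
next
 fix X Y f assume "f : mors (fgmod H) X Y"
 then have f: "f : module_maps H X Y" by simp
 show "cmp (fgmod H) X Y Y (idm (fgmod H) Y) f = f" "cmp (fgmod H) X X Y f (idm (fgmod H) X) = f"
  using mapsD[OF f] by (auto simp: restrict_def fun_eq_iff)
next
 fix X Y Z f g h
 assume Ob: "X : Ob (fgmod H)" "Y : Ob (fgmod H)" "Z : Ob (fgmod H)"
  and m: "f : mors (fgmod H) X Y" "g : mors (fgmod H) Y Z" "h : mors (fgmod H) Y Z"
 show "cmp (fgmod H) X Y Z (g +[Mor (fgmod H) Y Z] h) f =
   cmp (fgmod H) X Y Z g f +[Mor (fgmod H) X Z] cmp (fgmod H) X Y Z h f"
  using m mapsD(1)[of f H X Y] by (auto simp: restrict_def fun_eq_iff)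
next
 fix X Y Z f g h
 assume Ob: "X : Ob (fgmod H)" "Y : Ob (fgmod H)" "Z : Ob (fgmod H)"
  and m: "f : mors (fgmod H) X Y" "g : mors (fgmod H) X Y" "h : mors (fgmod H) Y Z"
 show "cmp (fgmod H) X Y Z h (f +[Mor (fgmod H) X Y] g) =
   cmp (fgmod H) X Y Z h f +[Mor (fgmod H) X Z] cmp (fgmod H) X Y Z h g"
  using m mapsD(1)[of f H X Y] mapsD(1)[of g H X Y] mapsD(2)[of h H Y Z]
  by (auto simp: restrict_def fun_eq_iff)
next
 fix X Y Z a f g
 assume Ob: "X : Ob (fgmod H)" "Y : Ob (fgmod H)" "Z : Ob (fgmod H)" and a: "a : carrier K"
  and m: "f : mors (fgmod H) X Y" "g : mors (fgmod H) Y Z"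
 show "cmp (fgmod H) X Y Z (a *[Mor (fgmod H) Y Z] g) f = a *[Mor (fgmod H) X Z] cmp (fgmod H) X Y Z g f"
  using m mapsD(1)[of f H X Y] by (auto simp: restrict_def fun_eq_iff)
 show "cmp (fgmod H) X Y Z g (a *[Mor (fgmod H) X Y] f) = a *[Mor (fgmod H) X Z] cmp (fgmod H) X Y Z g f"
  using m mapsD(1)[of f H X Y] mapsD(3)[of g H Y Z] scalar_closed[OF H a]
  by (auto simp: restrict_def fun_eq_iff)
qed

section \<open>The homotopy category\<close>

context linear_category
begin

lemma complexD:
 assumes "X : bounded_complexes C"
 shows "cob X i : Ob C" "dif X i : mors C (cob X i) (cob X (i + 1))"
  "cmp C (cob X i) (cob X (i + 1)) (cob X (i + 2)) (dif X (i + 1)) (dif X i) = zr (Mor C (cob X i) (cob X (i + 2)))"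
 using assms by (auto simp: bounded_complexes_def)

lemma dif_prev: "X : bounded_complexes C ==> dif X (i - 1) : mors C (cob X (i - 1)) (cob X i)"
 using complexD(2)[of X "i - 1"] by simp

lemma chain_mapsD:
 assumes "f : chain_maps C X Y"
 shows "f i : mors C (cob X i) (cob Y i)"
  "cmp C (cob X i) (cob X (i + 1)) (cob Y (i + 1)) (f (i + 1)) (dif X i) =
   cmp C (cob X i) (cob Y i) (cob Y (i + 1)) (dif Y i) (f i)"
 using assms by (auto simp: chain_maps_def)

lemma chain_maps_prev:
 assumes "f : chain_maps C X Y"
 shows "cmp C (cob X (i - 1)) (cob X i) (cob Y i) (f i) (dif X (i - 1)) =
   cmp C (cob X (i - 1)) (cob Y (i - 1)) (cob Y i) (dif Y (i - 1)) (f (i - 1))"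
 using chain_mapsD(2)[OF assms, of "i - 1"] by simp

lemma complex_simps [simp]:
 "mors (complex_category C) X Y = chain_maps C X Y"
 "zr (Mor (complex_category C) X Y) = (%i. zr (Mor C (cob X i) (cob Y i)))"
 "f +[Mor (complex_category C) X Y] g = (%i. f i +[Mor C (cob X i) (cob Y i)] g i)"
 "c *[Mor (complex_category C) X Y] f = (%i. c *[Mor C (cob X i) (cob Y i)] f i)"
 "cmp (complex_category C) X Y Z g f = (%i. cmp C (cob X i) (cob Y i) (cob Z i) (g i) (f i))"
 "Ob (complex_category C) = bounded_complexes C"
 "idm (complex_category C) X = (%i. idm C (cob X i))"
 by (simp_all add: complex_category_def)

lemma chain_maps_cmp:
 assumes Ob: "X : bounded_complexes C" "Y : bounded_complexes C" "Z : bounded_complexes C"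
  and f: "f : chain_maps C X Y" and g: "g : chain_maps C Y Z"
 shows "(%i. cmp C (cob X i) (cob Y i) (cob Z i) (g i) (f i)) : chain_maps C X Z"
proof -
 note o = complexD[OF Ob(1)] complexD[OF Ob(2)] complexD[OF Ob(3)]
 note f' = chain_mapsD[OF f] and g' = chain_mapsD[OF g]
 have "cmp C (cob X i) (cob X (i + 1)) (cob Z (i + 1))
   (cmp C (cob X (i + 1)) (cob Y (i + 1)) (cob Z (i + 1)) (g (i + 1)) (f (i + 1))) (dif X i) =
  cmp C (cob X i) (cob Z i) (cob Z (i + 1)) (dif Z i) (cmp C (cob X i) (cob Y i) (cob Z i) (g i) (f i))" for i
 proof -
  have "cmp C (cob X i) (cob X (i + 1)) (cob Z (i + 1))
   (cmp C (cob X (i + 1)) (cob Y (i + 1)) (cob Z (i + 1)) (g (i + 1)) (f (i + 1))) (dif X i) =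
   cmp C (cob X i) (cob Y (i + 1)) (cob Z (i + 1)) (g (i + 1)) (cmp C (cob X i) (cob Y i) (cob Y (i + 1)) (dif Y i) (f i))"
   using o f' g' by (simp add: cmp_assoc)
  also have "... = cmp C (cob X i) (cob Y i) (cob Z (i + 1)) (cmp C (cob Y i) (cob Y (i + 1)) (cob Z (i + 1)) (g (i + 1)) (dif Y i)) (f i)"
   using o f' g' by (intro cmp_assoc[symmetric]) auto
  also have "... = cmp C (cob X i) (cob Y i) (cob Z (i + 1)) (cmp C (cob Y i) (cob Z i) (cob Z (i + 1)) (dif Z i) (g i)) (f i)"
   by (simp only: g'(2))
  finally show ?thesis using o f' g' by (simp add: cmp_assoc)
 qed
 then show ?thesis using o f' g' by (simp add: chain_maps_def)
qed

lemma chain_maps_id: "X : bounded_complexes C ==> (%i. idm C (cob X i)) : chain_maps C X X"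
 using complexD[of X] by (simp add: chain_maps_def)

context
 fixes X Y assumes X: "X : bounded_complexes C" and Y: "Y : bounded_complexes C"
begin

lemmas obs = complexD[OF X] complexD[OF Y] dif_prev[OF X] dif_prev[OF Y]

lemma chain_maps_add:
 "[|f : chain_maps C X Y; g : chain_maps C X Y|] ==> (%i. f i +[Mor C (cob X i) (cob Y i)] g i) : chain_maps C X Y"
 using obs by (auto simp: chain_maps_def cmp_linear)

lemma chain_maps_smult:
 assumes "c : carrier K" "f : chain_maps C X Y"
 shows "(%i. c *[Mor C (cob X i) (cob Y i)] f i) : chain_maps C X Y"
proof -
 have "!!i. c *[Mor C (cob X i) (cob Y i)] f i : mors C (cob X i) (cob Y i)"
  using assms obs chain_mapsD module.smult_closed[OF mor_module] by metis
 then show ?thesis using assms obs by (auto simp: chain_maps_def cmp_smult_left cmp_smult_right)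
qed

lemma complex_hom_group: "abelian_group (Mor (complex_category C) X Y)"
proof (rule abelian_groupI)
 fix f g h assume "f : mors (complex_category C) X Y" "g : mors (complex_category C) X Y" "h : mors (complex_category C) X Y"
 then have m: "f : chain_maps C X Y" "g : chain_maps C X Y" "h : chain_maps C X Y" by auto
 note d = chain_mapsD(1)[OF m(1)] chain_mapsD(1)[OF m(2)] chain_mapsD(1)[OF m(3)]
 show "f +[Mor (complex_category C) X Y] g : mors (complex_category C) X Y" using chain_maps_add m by simp
 show "f +[Mor (complex_category C) X Y] g +[Mor (complex_category C) X Y] h
   = f +[Mor (complex_category C) X Y] (g +[Mor (complex_category C) X Y] h)"
  using d obs by (simp add: hom_assoc)
 show "f +[Mor (complex_category C) X Y] g = g +[Mor (complex_category C) X Y] f"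
  using d obs by (simp add: hom_comm)
 show "zr (Mor (complex_category C) X Y) +[Mor (complex_category C) X Y] f = f" using d obs by simp
 show "EX g:mors (complex_category C) X Y. g +[Mor (complex_category C) X Y] f = zr (Mor (complex_category C) X Y)"
  by (rule bexI[of _ "%i. -[Mor C (cob X i) (cob Y i)] f i"])
   (use d obs m in \<open>auto simp: chain_maps_def cmp_linear\<close>)
qed (use obs in \<open>auto simp: chain_maps_def\<close>)

lemma null_homotopicI:
 assumes f: "f : chain_maps C X Y" and h: "!!i. h i : mors C (cob X i) (cob Y (i - 1))"
  and e: "!!i. f i = cmp C (cob X i) (cob Y (i - 1)) (cob Y i) (dif Y (i - 1)) (h i)
   +[Mor C (cob X i) (cob Y i)] cmp C (cob X i) (cob X (i + 1)) (cob Y i) (h (i + 1)) (dif X i)"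
 shows "f : null_homotopic C X Y"
 unfolding null_homotopic_def using f h e by (intro CollectI conjI exI[of _ h]) auto

text \<open>The third conclusion is the second at \<open>i + 1\<close>, stated separately because
  the target would otherwise appear at index \<open>i + 1 - 1\<close>.\<close>

lemma null_homotopicE:
 assumes "f : null_homotopic C X Y"
 obtains h where "f : chain_maps C X Y" "!!i. h i : mors C (cob X i) (cob Y (i - 1))"
  "!!i. h (i + 1) : mors C (cob X (i + 1)) (cob Y i)"
  "!!i. f i = cmp C (cob X i) (cob Y (i - 1)) (cob Y i) (dif Y (i - 1)) (h i)
   +[Mor C (cob X i) (cob Y i)] cmp C (cob X i) (cob X (i + 1)) (cob Y i) (h (i + 1)) (dif X i)"
proof -
 obtain h where h: "f : chain_maps C X Y" "!!i. h i : mors C (cob X i) (cob Y (i - 1))"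
  "!!i. f i = cmp C (cob X i) (cob Y (i - 1)) (cob Y i) (dif Y (i - 1)) (h i)
   +[Mor C (cob X i) (cob Y i)] cmp C (cob X i) (cob X (i + 1)) (cob Y i) (h (i + 1)) (dif X i)"
  using assms unfolding null_homotopic_def by auto
 have "h (i + 1) : mors C (cob X (i + 1)) (cob Y i)" for i using h(2)[of "i + 1"] by simp
 then show thesis using that h by blast
qed

lemma null_subgroup: "abelian_subgroup (null_homotopic C X Y) (Mor (complex_category C) X Y)"
proof (rule abelian_subgroupI3)
 interpret G: abelian_group "Mor (complex_category C) X Y" by (rule complex_hom_group)
 show "abelian_group (Mor (complex_category C) X Y)" by (rule complex_hom_group)
 have sub: "null_homotopic C X Y <= mors (complex_category C) X Y" by (auto simp: null_homotopic_def)
 have zero: "(%i. zr (Mor C (cob X i) (cob Y i))) : null_homotopic C X Y"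
  by (rule null_homotopicI[of _ "%i. zr (Mor C (cob X i) (cob Y (i - 1)))"])
   (use G.zero_closed obs hom_zero_closed[of "cob X i" "cob Y (i - 1)" for i]
     hom_zero_closed[of "cob X (i + 1)" "cob Y i" for i] in simp_all)
 have add: "(%i. f i +[Mor C (cob X i) (cob Y i)] g i) : null_homotopic C X Y"
  if "f : null_homotopic C X Y" "g : null_homotopic C X Y" for f g
 proof -
  obtain h where h: "f : chain_maps C X Y" "!!i. h i : mors C (cob X i) (cob Y (i - 1))"
  "!!i. h (i + 1) : mors C (cob X (i + 1)) (cob Y i)"
  "!!i. f i = cmp C (cob X i) (cob Y (i - 1)) (cob Y i) (dif Y (i - 1)) (h i)
   +[Mor C (cob X i) (cob Y i)] cmp C (cob X i) (cob X (i + 1)) (cob Y i) (h (i + 1)) (dif X i)"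
   using \<open>f : _\<close> by (rule null_homotopicE) blast
  obtain k where k: "g : chain_maps C X Y" "!!i. k i : mors C (cob X i) (cob Y (i - 1))"
  "!!i. k (i + 1) : mors C (cob X (i + 1)) (cob Y i)"
  "!!i. g i = cmp C (cob X i) (cob Y (i - 1)) (cob Y i) (dif Y (i - 1)) (k i)
   +[Mor C (cob X i) (cob Y i)] cmp C (cob X i) (cob X (i + 1)) (cob Y i) (k (i + 1)) (dif X i)"
   using \<open>g : _\<close> by (rule null_homotopicE) blast
  show ?thesis
  proof (rule null_homotopicI[of _ "%i. h i +[Mor C (cob X i) (cob Y (i - 1))] k i"])
   fix i
   interpret A: abelian_group "Mor C (cob X i) (cob Y i)" by (rule hom_group) (use obs in auto)
   show "f i +[Mor C (cob X i) (cob Y i)] g i =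
     cmp C (cob X i) (cob Y (i - 1)) (cob Y i) (dif Y (i - 1)) (h i +[Mor C (cob X i) (cob Y (i - 1))] k i)
     +[Mor C (cob X i) (cob Y i)] cmp C (cob X i) (cob X (i + 1)) (cob Y i)
      (h (i + 1) +[Mor C (cob X (i + 1)) (cob Y (i + 1 - 1))] k (i + 1)) (dif X i)"
    unfolding h(4)[of i] k(4)[of i] using h(2,3)[of i] k(2,3)[of i] obs
    by (simp add: cmp_add_left cmp_add_right A.a_ac)
  qed (use h(1,2) k(1,2) obs chain_maps_add in auto)
 qed
 have neg: "-[Mor (complex_category C) X Y] f : null_homotopic C X Y" if "f : null_homotopic C X Y" for f
 proof -
  obtain h where h: "f : chain_maps C X Y" "!!i. h i : mors C (cob X i) (cob Y (i - 1))"
  "!!i. h (i + 1) : mors C (cob X (i + 1)) (cob Y i)"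
  "!!i. f i = cmp C (cob X i) (cob Y (i - 1)) (cob Y i) (dif Y (i - 1)) (h i)
   +[Mor C (cob X i) (cob Y i)] cmp C (cob X i) (cob X (i + 1)) (cob Y i) (h (i + 1)) (dif X i)"
   using \<open>f : _\<close> by (rule null_homotopicE) blast
  have n: "(%i. -[Mor C (cob X i) (cob Y i)] f i) : chain_maps C X Y"
   using h(1) obs by (auto simp: chain_maps_def cmp_linear)
  then have "-[Mor (complex_category C) X Y] f = (%i. -[Mor C (cob X i) (cob Y i)] f i)"
   by (intro G.minus_equality) (use h(1) obs chain_mapsD(1)[OF h(1)] in auto)
  moreover have "(%i. -[Mor C (cob X i) (cob Y i)] f i) : null_homotopic C X Y"
  proof (rule null_homotopicI[OF n, of "%i. -[Mor C (cob X i) (cob Y (i - 1))] h i"])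
   fix i
   interpret A: abelian_group "Mor C (cob X i) (cob Y i)" by (rule hom_group) (use obs in auto)
   show "-[Mor C (cob X i) (cob Y i)] f i =
     cmp C (cob X i) (cob Y (i - 1)) (cob Y i) (dif Y (i - 1)) (-[Mor C (cob X i) (cob Y (i - 1))] h i)
     +[Mor C (cob X i) (cob Y i)] cmp C (cob X i) (cob X (i + 1)) (cob Y i)
      (-[Mor C (cob X (i + 1)) (cob Y (i + 1 - 1))] h (i + 1)) (dif X i)"
    unfolding h(4)[of i] using h(2,3)[of i] obs
    by (simp add: cmp_neg_left cmp_neg_right A.minus_add)
  qed (use h obs in auto)
  ultimately show ?thesis by simp
 qed
 show "additive_subgroup (null_homotopic C X Y) (Mor (complex_category C) X Y)"
  by (intro additive_subgroup.intro subgroup.intro)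
   (use sub zero add neg in \<open>auto simp: a_inv_def\<close>)
qed

lemma homotopy_class_iff:
 assumes "f : chain_maps C X Y"
 shows "g : homotopy_class C X Y f \<longleftrightarrow> (EX n:null_homotopic C X Y. g = (%i. n i +[Mor C (cob X i) (cob Y i)] f i))"
 by (auto simp: homotopy_class_def a_r_coset_def')

lemma class_self: assumes "f : chain_maps C X Y" shows "f : homotopy_class C X Y f"
proof -
 interpret abelian_subgroup "null_homotopic C X Y" "Mor (complex_category C) X Y" by (rule null_subgroup)
 show ?thesis unfolding homotopy_class_def using a_rcos_self assms by simp
qed

lemma homotopy_class_eq:
 assumes "f : chain_maps C X Y" "g : homotopy_class C X Y f"
 shows "homotopy_class C X Y g = homotopy_class C X Y f"
proof -
 interpret abelian_subgroup "null_homotopic C X Y" "Mor (complex_category C) X Y" by (rule null_subgroup)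
 show ?thesis unfolding homotopy_class_def
  by (rule a_repr_independence[OF _ _ a_subgroup, symmetric]) (use assms in \<open>auto simp: homotopy_class_def\<close>)
qed

lemma homotopy_class_chain_map:
 assumes "f : chain_maps C X Y" "g : homotopy_class C X Y f" shows "g : chain_maps C X Y"
 using assms chain_maps_add by (auto simp: homotopy_class_iff null_homotopic_def)

lemma homotopy_mors:
 "al : mors (homotopy_category C) X Y \<longleftrightarrow> (EX f:chain_maps C X Y. al = homotopy_class C X Y f)"
 by (auto simp: homotopy_category_def quotient_category_def A_RCOSETS_def' homotopy_class_def)

lemma homotopy_mors_class:
 assumes "al : mors (homotopy_category C) X Y" "f : al"
 shows "f : chain_maps C X Y" "al = homotopy_class C X Y f"
proof -
 obtain g where g: "g : chain_maps C X Y" "al = homotopy_class C X Y g" using assms homotopy_mors by auto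
 show "f : chain_maps C X Y" using homotopy_class_chain_map[OF g(1)] assms(2) g(2) by simp
 show "al = homotopy_class C X Y f" using homotopy_class_eq[OF g(1)] assms(2) g(2) by simp
qed

end

lemma null_cmp_right:
 assumes Ob: "X : bounded_complexes C" "Y : bounded_complexes C" "Z : bounded_complexes C"
  and n: "n : null_homotopic C Y Z" and f: "f : chain_maps C X Y"
 shows "(%i. cmp C (cob X i) (cob Y i) (cob Z i) (n i) (f i)) : null_homotopic C X Z"
proof -
 note o = obs[OF Ob(1,2)] obs[OF Ob(2,3)] and f' = chain_mapsD[OF f]
 obtain h where h: "n : chain_maps C Y Z" "!!i. h i : mors C (cob Y i) (cob Z (i - 1))"
  "!!i. h (i + 1) : mors C (cob Y (i + 1)) (cob Z i)"
  "!!i. n i = cmp C (cob Y i) (cob Z (i - 1)) (cob Z i) (dif Z (i - 1)) (h i)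
   +[Mor C (cob Y i) (cob Z i)] cmp C (cob Y i) (cob Y (i + 1)) (cob Z i) (h (i + 1)) (dif Y i)"
  using null_homotopicE[OF Ob(2,3) n] by blast
 show ?thesis
 proof (rule null_homotopicI[OF Ob(1,3), of _ "%i. cmp C (cob X i) (cob Y i) (cob Z (i - 1)) (h i) (f i)"])
  fix i
  show "cmp C (cob X i) (cob Y i) (cob Z i) (n i) (f i) =
   cmp C (cob X i) (cob Z (i - 1)) (cob Z i) (dif Z (i - 1)) (cmp C (cob X i) (cob Y i) (cob Z (i - 1)) (h i) (f i))
   +[Mor C (cob X i) (cob Z i)]
   cmp C (cob X i) (cob X (i + 1)) (cob Z i) (cmp C (cob X (i + 1)) (cob Y (i + 1)) (cob Z (i + 1 - 1)) (h (i + 1)) (f (i + 1))) (dif X i)"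
   unfolding h(4)[of i] using h(2,3)[of i] o f' by (simp add: cmp_add_left cmp_assoc)
 qed (use o f' h chain_maps_cmp[OF Ob f h(1)] in auto)
qed

lemma null_cmp_left:
 assumes Ob: "X : bounded_complexes C" "Y : bounded_complexes C" "Z : bounded_complexes C"
  and n: "n : null_homotopic C X Y" and g: "g : chain_maps C Y Z"
 shows "(%i. cmp C (cob X i) (cob Y i) (cob Z i) (g i) (n i)) : null_homotopic C X Z"
proof -
 note o = obs[OF Ob(1,2)] obs[OF Ob(2,3)] and g' = chain_mapsD[OF g]
 obtain h where h: "n : chain_maps C X Y" "!!i. h i : mors C (cob X i) (cob Y (i - 1))"
  "!!i. h (i + 1) : mors C (cob X (i + 1)) (cob Y i)"
  "!!i. n i = cmp C (cob X i) (cob Y (i - 1)) (cob Y i) (dif Y (i - 1)) (h i)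
   +[Mor C (cob X i) (cob Y i)] cmp C (cob X i) (cob X (i + 1)) (cob Y i) (h (i + 1)) (dif X i)"
  using null_homotopicE[OF Ob(1,2) n] by blast
 show ?thesis
 proof (rule null_homotopicI[OF Ob(1,3), of _ "%i. cmp C (cob X i) (cob Y (i - 1)) (cob Z (i - 1)) (g (i - 1)) (h i)"])
  fix i
  have "cmp C (cob X i) (cob Y i) (cob Z i) (g i) (cmp C (cob X i) (cob Y (i - 1)) (cob Y i) (dif Y (i - 1)) (h i)) =
    cmp C (cob X i) (cob Y (i - 1)) (cob Z i) (cmp C (cob Y (i - 1)) (cob Z (i - 1)) (cob Z i) (dif Z (i - 1)) (g (i - 1))) (h i)"
   unfolding chain_maps_prev[OF g, symmetric] using h(2)[of i] o g' by (simp add: cmp_assoc)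
  then show "cmp C (cob X i) (cob Y i) (cob Z i) (g i) (n i) =
   cmp C (cob X i) (cob Z (i - 1)) (cob Z i) (dif Z (i - 1)) (cmp C (cob X i) (cob Y (i - 1)) (cob Z (i - 1)) (g (i - 1)) (h i))
   +[Mor C (cob X i) (cob Z i)]
   cmp C (cob X i) (cob X (i + 1)) (cob Z i) (cmp C (cob X (i + 1)) (cob Y (i + 1 - 1)) (cob Z (i + 1 - 1)) (g (i + 1 - 1)) (h (i + 1))) (dif X i)"
   unfolding h(4)[of i] using h(2,3)[of i] o g' by (simp add: cmp_add_right cmp_assoc)
 qed (use o g' h chain_maps_cmp[OF Ob h(1) g] in auto)
qed

text \<open>Composition of cosets is a union over representatives. It is a single coset because two
  composites differ by null-homotopic maps, by \<open>null_cmp_right\<close> and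
  \<open>null_cmp_left\<close>.\<close>

lemma homotopy_cmp:
 assumes Ob: "X : bounded_complexes C" "Y : bounded_complexes C" "Z : bounded_complexes C"
  and f: "f : chain_maps C X Y" and g: "g : chain_maps C Y Z"
 shows "cmp (homotopy_category C) X Y Z (homotopy_class C Y Z g) (homotopy_class C X Y f) =
  homotopy_class C X Z (%i. cmp C (cob X i) (cob Y i) (cob Z i) (g i) (f i))"
proof -
 let ?gf = "%g f i. cmp C (cob X i) (cob Y i) (cob Z i) (g i) (f i)"
 note o = obs[OF Ob(1,2)] obs[OF Ob(2,3)] and f' = chain_mapsD[OF f] and g' = chain_mapsD[OF g]
 have "homotopy_class C X Z (?gf g1 f1) = homotopy_class C X Z (?gf g f)"
  if g1: "g1 : homotopy_class C Y Z g" and f1: "f1 : homotopy_class C X Y f" for g1 f1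
 proof (rule homotopy_class_eq[OF Ob(1,3) chain_maps_cmp[OF Ob f g]])
  obtain n where n: "n : null_homotopic C Y Z" "g1 = (%i. n i +[Mor C (cob Y i) (cob Z i)] g i)"
   using g1 homotopy_class_iff[OF Ob(2,3) g] by auto
  obtain m where m: "m : null_homotopic C X Y" "f1 = (%i. m i +[Mor C (cob X i) (cob Y i)] f i)"
   using f1 homotopy_class_iff[OF Ob(1,2) f] by auto
  have f1c: "f1 : chain_maps C X Y" by (rule homotopy_class_chain_map[OF Ob(1,2) f f1])
  have nm: "n i : mors C (cob Y i) (cob Z i)" "m i : mors C (cob X i) (cob Y i)" "f1 i : mors C (cob X i) (cob Y i)" for i
   using n m f1c by (auto simp: null_homotopic_def chain_maps_def)
  interpret S: abelian_subgroup "null_homotopic C X Z" "Mor (complex_category C) X Z" by (rule null_subgroup[OF Ob(1,3)])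
  have "(%i. ?gf n f1 i +[Mor C (cob X i) (cob Z i)] ?gf g m i) : null_homotopic C X Z"
   using additive_subgroup.a_closed[OF S.additive_subgroup_axioms null_cmp_right[OF Ob n(1) f1c] null_cmp_left[OF Ob m(1) g]] by simp
  moreover have "?gf g1 f1 = (%i. (?gf n f1 i +[Mor C (cob X i) (cob Z i)] ?gf g m i) +[Mor C (cob X i) (cob Z i)] ?gf g f i)"
  proof
   fix i
   have "?gf g1 f1 i = ?gf n f1 i +[Mor C (cob X i) (cob Z i)] ?gf g f1 i"
    using nm o g' n(2) by (simp add: cmp_add_left)
   also have "?gf g f1 i = ?gf g m i +[Mor C (cob X i) (cob Z i)] ?gf g f i"
    using nm o g' f' m(2) by (simp add: cmp_add_right)
   finally show "?gf g1 f1 i = (?gf n f1 i +[Mor C (cob X i) (cob Z i)] ?gf g m i) +[Mor C (cob X i) (cob Z i)] ?gf g f i"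
    using nm o g' f' by (simp add: hom_assoc)
  qed
  ultimately show "?gf g1 f1 : homotopy_class C X Z (?gf g f)"
   using homotopy_class_iff[OF Ob(1,3) chain_maps_cmp[OF Ob f g]] by auto
 qed
 then have "(\<Union>g1\<in>homotopy_class C Y Z g. \<Union>f1\<in>homotopy_class C X Y f. homotopy_class C X Z (?gf g1 f1)) =
   homotopy_class C X Z (?gf g f)"
  using class_self[OF Ob(1,2) f] class_self[OF Ob(2,3) g] by blast
 then show ?thesis
  by (simp add: homotopy_category_def quotient_category_def homotopy_class_def)
qed

lemma homotopy_idm: "idm (homotopy_category C) X = homotopy_class C X X (%i. idm C (cob X i))"
 by (simp add: homotopy_category_def quotient_category_def homotopy_class_def)

lemma homotopy_Ob [simp]: "Ob (homotopy_category C) = bounded_complexes C"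
 by (simp add: homotopy_category_def quotient_category_def)

end

section \<open>Cohomology\<close>

text \<open>Equality of cohomology classes, kept on the level of cocycles so that no quotient
  modules are formed.\<close>

definition hcong :: "('h hmodule, 'h hmap) cpx => int => 'h elt => 'h elt => bool" where
 "hcong X i x y \<longleftrightarrow> x : cocycles X i & y : cocycles X i & x -[cob X i] y : coboundaries X i"

locale fd_algebra_over =
 fixes K :: "'k ring" and H :: "('k, 'h) module"
 assumes fd: "fd_algebra K H"
begin

sublocale A: linear_category K "fgmod H"
 by (rule fgmod_linear_category[OF fd])

abbreviation complexes :: "('h hmodule, 'h hmap) cpx set" where
 "complexes == bounded_complexes (fgmod H)"

abbreviation kb where "kb == homotopy_category (fgmod H)"

context
 fixes X and i :: int assumes X: "X : complexes"
begin

lemma cob_module: "left_module H (cob X i)" and cob_fg: "fin_generated H (cob X i)"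
 using A.complexD(1)[OF X, of i] by auto

lemma cob_group: "abelian_group (cob X i)"
 using cob_module by (rule left_module_group)

interpretation G: abelian_group "cob X i" by (rule cob_group)

lemma dif_map: "dif X i : module_maps H (cob X i) (cob X (i + 1))"
 and dif_map': "dif X (i - 1) : module_maps H (cob X (i - 1)) (cob X i)"
 using A.complexD(2)[OF X, of i] A.dif_prev[OF X, of i] by auto

lemma coc_carrier: "x : cocycles X i ==> x : carrier (cob X i)"
 by (simp add: cocycles_def)

end

lemma coboundary_cocycle:
 assumes X: "X : complexes" and x: "x : coboundaries X i" shows "x : cocycles X i"
proof -
 obtain y where y: "y : carrier (cob X (i - 1))" "x = dif X (i - 1) y" using x by (auto simp: coboundaries_def)
 have "cmp (fgmod H) (cob X (i - 1)) (cob X i) (cob X (i + 1)) (dif X i) (dif X (i - 1)) y = zr (cob X (i + 1))"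
  using A.complexD(3)[OF X, of "i - 1"] y by (simp add: add.commute)
 then have "dif X i x = zr (cob X (i + 1))" using y by simp
 then show ?thesis using y mapsD(1)[OF dif_map'[OF X]] by (simp add: cocycles_def)
qed

lemma cocycles_closed:
 assumes X: "X : complexes"
 shows "zr (cob X i) : cocycles X i"
  "[|x : cocycles X i; y : cocycles X i|] ==> x +[cob X i] y : cocycles X i"
  "[|a : carrier H; x : cocycles X i|] ==> a *[cob X i] x : cocycles X i"
  "x : cocycles X i ==> -[cob X i] x : cocycles X i"
proof -
 interpret M: left_module H "cob X i" by (rule cob_module[OF X])
 interpret N: left_module H "cob X (i + 1)" by (rule cob_module[OF X])
 note d = mapsD[OF dif_map[OF X, of i]]
 show "zr (cob X i) : cocycles X i"
  using maps_zero[OF dif_map[OF X] cob_module[OF X] cob_module[OF X]] by (simp add: cocycles_def)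
 show "x +[cob X i] y : cocycles X i" if "x : cocycles X i" "y : cocycles X i"
  using that d by (simp add: cocycles_def)
 show "a *[cob X i] x : cocycles X i" if "a : carrier H" "x : cocycles X i"
  using that d M.act_closed left_module_zero[OF cob_module[OF X]] by (simp add: cocycles_def)
 show "-[cob X i] x : cocycles X i" if "x : cocycles X i"
  using that module_maps_minus[OF dif_map[OF X] cob_module[OF X] cob_module[OF X]]
  by (simp add: cocycles_def)
qed

lemma coboundaries_closed:
 assumes X: "X : complexes"
 shows "zr (cob X i) : coboundaries X i"
  "[|x : coboundaries X i; y : coboundaries X i|] ==> x +[cob X i] y : coboundaries X i"
  "[|a : carrier H; x : coboundaries X i|] ==> a *[cob X i] x : coboundaries X i"
  "x : coboundaries X i ==> -[cob X i] x : coboundaries X i"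
proof -
 interpret M: left_module H "cob X (i - 1)" by (rule cob_module[OF X])
 note d = mapsD[OF dif_map'[OF X, of i]]
 show "zr (cob X i) : coboundaries X i"
  using maps_zero[OF dif_map'[OF X] cob_module[OF X] cob_module[OF X]]
  by (metis M.M.zero_closed coboundaries_def imageI)
 show "x +[cob X i] y : coboundaries X i" if xy: "x : coboundaries X i" "y : coboundaries X i"
 proof -
  obtain u v where "u : carrier (cob X (i - 1))" "v : carrier (cob X (i - 1))" "x = dif X (i - 1) u" "y = dif X (i - 1) v"
   using xy by (auto simp: coboundaries_def)
  then show ?thesis using d(2)[of u v] unfolding coboundaries_def by (metis M.M.a_closed imageI)
 qed
 show "a *[cob X i] x : coboundaries X i" if a: "a : carrier H" and x: "x : coboundaries X i"
 proof -
  obtain u where "u : carrier (cob X (i - 1))" "x = dif X (i - 1) u" using x by (auto simp: coboundaries_def)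
  then show ?thesis using d(3)[of a u] a unfolding coboundaries_def by (metis M.act_closed imageI)
 qed
 show "-[cob X i] x : coboundaries X i" if x: "x : coboundaries X i"
 proof -
  obtain u where "u : carrier (cob X (i - 1))" "x = dif X (i - 1) u" using x by (auto simp: coboundaries_def)
  then show ?thesis using module_maps_minus[OF dif_map'[OF X] cob_module[OF X] cob_module[OF X], of u]
   unfolding coboundaries_def by (metis M.M.a_inv_closed imageI)
 qed
qed

lemma hcong_iff:
 assumes X: "X : complexes"
 shows "hcong X i x y \<longleftrightarrow> x : cocycles X i & y : cocycles X i & (EX b:coboundaries X i. x = b +[cob X i] y)"
proof -
 interpret G: abelian_group "cob X i" by (rule cob_group[OF X])
 show ?thesis
 proof
  assume h: "hcong X i x y"
  then have c: "x : carrier (cob X i)" "y : carrier (cob X i)" by (auto simp: hcong_def cocycles_def)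
  then have "x = (x -[cob X i] y) +[cob X i] y" by (simp add: G.minus_eq G.a_assoc G.l_neg)
  then show "x : cocycles X i & y : cocycles X i & (EX b:coboundaries X i. x = b +[cob X i] y)"
   using h unfolding hcong_def by blast
 next
  assume "x : cocycles X i & y : cocycles X i & (EX b:coboundaries X i. x = b +[cob X i] y)"
  then obtain b where b: "x : cocycles X i" "y : cocycles X i" "b : coboundaries X i" "x = b +[cob X i] y" by auto
  then have "x -[cob X i] y = b" using coc_carrier[OF X] coboundary_cocycle[OF X b(3)]
   by (simp add: G.minus_eq G.a_assoc G.r_neg)
  then show "hcong X i x y" using b by (simp add: hcong_def)
 qed
qed

context
 fixes X and i :: int assumes X: "X : complexes"
begin

interpretation G: abelian_group "cob X i" by (rule cob_group[OF X])

lemma hcongD: "hcong X i x y ==> x : cocycles X i" "hcong X i x y ==> y : cocycles X i"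
 by (auto simp: hcong_def)

lemma hcong_refl: "x : cocycles X i ==> hcong X i x x"
 using coboundaries_closed(1)[OF X] coc_carrier[OF X] by (simp add: hcong_def G.minus_eq G.r_neg)

lemma hcong_sym: assumes "hcong X i x y" shows "hcong X i y x"
proof -
 have c: "x : carrier (cob X i)" "y : carrier (cob X i)" using assms by (auto simp: hcong_def cocycles_def)
 have "y -[cob X i] x = -[cob X i] (x -[cob X i] y)" using c by (simp add: G.minus_eq G.minus_add G.a_comm)
 then show ?thesis using assms coboundaries_closed(4)[OF X] by (simp add: hcong_def)
qed

lemma hcong_trans: assumes "hcong X i x y" "hcong X i y z" shows "hcong X i x z"
proof -
 have c: "x : carrier (cob X i)" "y : carrier (cob X i)" "z : carrier (cob X i)"
  using assms by (auto simp: hcong_def cocycles_def)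
 have "x -[cob X i] z = (x -[cob X i] y) +[cob X i] (y -[cob X i] z)"
  using c by (simp add: G.minus_eq G.a_assoc G.r_neg1)
 then show ?thesis using assms coboundaries_closed(2)[OF X] by (simp add: hcong_def)
qed

lemma hcong_add: assumes "hcong X i x y" "hcong X i x' y'"
 shows "hcong X i (x +[cob X i] x') (y +[cob X i] y')"
proof -
 have c: "x : carrier (cob X i)" "y : carrier (cob X i)" "x' : carrier (cob X i)" "y' : carrier (cob X i)"
  using assms by (auto simp: hcong_def cocycles_def)
 have "(x +[cob X i] x') -[cob X i] (y +[cob X i] y') = (x -[cob X i] y) +[cob X i] (x' -[cob X i] y')"
  using c by (simp add: G.minus_eq G.minus_add G.a_ac)
 then show ?thesis using assms coboundaries_closed(2)[OF X] cocycles_closed(2)[OF X] by (simp add: hcong_def)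
qed

lemma hcong_smult: assumes "a : carrier H" "hcong X i x y" shows "hcong X i (a *[cob X i] x) (a *[cob X i] y)"
proof -
 interpret M: left_module H "cob X i" by (rule cob_module[OF X])
 have c: "x : carrier (cob X i)" "y : carrier (cob X i)" using assms by (auto simp: hcong_def cocycles_def)
 obtain b where b: "b : coboundaries X i" "x = b +[cob X i] y" using assms(2) hcong_iff[OF X] by auto
 have "a *[cob X i] x = a *[cob X i] b +[cob X i] a *[cob X i] y"
  using b c assms(1) coboundary_cocycle[OF X b(1)] by (simp add: M.act_r_distr cocycles_def)
 then show ?thesis unfolding hcong_iff[OF X]
  using assms coboundaries_closed(3)[OF X assms(1) b(1)] cocycles_closed(3)[OF X assms(1)] hcongD[OF assms(2)] by blast
qed

lemma hcong_zero_iff: "hcong X i x (zr (cob X i)) \<longleftrightarrow> x : coboundaries X i"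
proof -
 have "-[cob X i] zr (cob X i) = zr (cob X i)" by (rule G.minus_equality) simp_all
 then have "x -[cob X i] zr (cob X i) = x" if "x : cocycles X i"
  using coc_carrier[OF X that] by (simp add: G.minus_eq)
 then show ?thesis using cocycles_closed(1)[OF X] coboundary_cocycle[OF X] by (auto simp: hcong_def)
qed

lemma hcong_diff: assumes "x : cocycles X i" "y : cocycles X i"
 shows "hcong X i (x -[cob X i] y) (zr (cob X i)) \<longleftrightarrow> hcong X i x y"
 using assms unfolding hcong_zero_iff by (simp add: hcong_def)

end

context
 fixes X Y assumes X: "X : complexes" and Y: "Y : complexes"
begin

lemma chain_map_maps: "f : chain_maps (fgmod H) X Y ==> f i : module_maps H (cob X i) (cob Y i)"
 using A.chain_mapsD(1)[of f X Y i] by simp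

lemma chain_map_dif:
 assumes f: "f : chain_maps (fgmod H) X Y" and x: "x : carrier (cob X i)"
 shows "f (i + 1) (dif X i x) = dif Y i (f i x)"
 using fun_cong[OF A.chain_mapsD(2)[OF f, of i], of x] x by simp

lemma chain_map_cocycle:
 assumes f: "f : chain_maps (fgmod H) X Y" and x: "x : cocycles X i" shows "f i x : cocycles Y i"
 using chain_map_dif[OF f, of x i] x mapsD(1)[OF chain_map_maps[OF f]]
  maps_zero[OF chain_map_maps[OF f] cob_module[OF X] cob_module[OF Y], of "i + 1"]
 by (simp add: cocycles_def)

lemma chain_map_coboundary:
 assumes f: "f : chain_maps (fgmod H) X Y" and x: "x : coboundaries X i" shows "f i x : coboundaries Y i"
proof -
 obtain u where u: "u : carrier (cob X (i - 1))" "x = dif X (i - 1) u" using x by (auto simp: coboundaries_def)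
 then have "f i x = dif Y (i - 1) (f (i - 1) u)" using chain_map_dif[OF f u(1)] by simp
 then show ?thesis using mapsD(1)[OF chain_map_maps[OF f] u(1)] by (auto simp: coboundaries_def)
qed

lemma chain_map_hcong:
 assumes f: "f : chain_maps (fgmod H) X Y" and h: "hcong X i x y" shows "hcong Y i (f i x) (f i y)"
proof -
 obtain b where b: "b : coboundaries X i" "x = b +[cob X i] y" using h hcong_iff[OF X] by auto
 have "f i x = f i b +[cob Y i] f i y"
  using b h coboundary_cocycle[OF X b(1)] mapsD(2)[OF chain_map_maps[OF f]] by (simp add: hcong_def cocycles_def)
 then show ?thesis unfolding hcong_iff[OF Y]
  using chain_map_cocycle[OF f] chain_map_coboundary[OF f b(1)] hcongD[OF X h] by blast
qed

lemma homotopic_hcong: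
 assumes al: "al : mors kb X Y" and f: "f : al" "g : al" and x: "x : cocycles X i"
 shows "hcong Y i (f i x) (g i x)"
proof -
 note g = A.homotopy_mors_class[OF X Y al f(2)] and fc = A.homotopy_mors_class(1)[OF X Y al f(1)]
 obtain n where n: "n : null_homotopic (fgmod H) X Y" "f = (%i. n i +[Mor (fgmod H) (cob X i) (cob Y i)] g i)"
  using f(1) g A.homotopy_class_iff[OF X Y g(1)] by auto
 obtain h where h0: "n : chain_maps (fgmod H) X Y" and h: "!!i. h i : mors (fgmod H) (cob X i) (cob Y (i - 1))"
  "!!i. h (i + 1) : mors (fgmod H) (cob X (i + 1)) (cob Y i)"
  "!!i. n i = cmp (fgmod H) (cob X i) (cob Y (i - 1)) (cob Y i) (dif Y (i - 1)) (h i)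
   +[Mor (fgmod H) (cob X i) (cob Y i)] cmp (fgmod H) (cob X i) (cob X (i + 1)) (cob Y i) (h (i + 1)) (dif X i)"
  by (rule A.null_homotopicE[OF X Y n(1)]) blast
 interpret G: abelian_group "cob Y i" by (rule cob_group[OF Y])
 have xc: "x : carrier (cob X i)" and dx: "dif X i x = zr (cob X (i + 1))" using x by (auto simp: cocycles_def)
 have hz: "h (i + 1) (zr (cob X (i + 1))) = zr (cob Y i)"
  by (rule maps_zero[of _ H]) (use h(2)[of i] cob_module X Y in auto)
 have hx: "h i x : carrier (cob Y (i - 1))" using h(1)[of i] xc mapsD(1) by auto
 have c: "dif Y (i - 1) (h i x) : carrier (cob Y i)" using mapsD(1)[OF dif_map'[OF Y] hx] .
 have "n i x = dif Y (i - 1) (h i x)" unfolding h(3)[of i] using xc dx hz c by simp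
 then have "f i x = dif Y (i - 1) (h i x) +[cob Y i] g i x" unfolding n(2) using xc by simp
 then show ?thesis unfolding hcong_iff[OF Y]
  using chain_map_cocycle[OF fc x] chain_map_cocycle[OF g(1) x] hx by (auto simp: coboundaries_def)
qed

lemma coset_eq_iff:
 assumes "x : cocycles X i" "y : cocycles X i"
 shows "coboundaries X i +>\<^bsub>cob X i\<^esub> x = coboundaries X i +>\<^bsub>cob X i\<^esub> y \<longleftrightarrow> hcong X i x y"
proof
 interpret G: abelian_group "cob X i" by (rule cob_group[OF X])
 have m: "z : coboundaries X i +>\<^bsub>cob X i\<^esub> x \<longleftrightarrow> hcong X i z x" if "x : cocycles X i" for x z
  using that coboundary_cocycle[OF X] cocycles_closed(2)[OF X] unfolding hcong_iff[OF X] a_r_coset_def' by blast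
 {
  assume "coboundaries X i +>\<^bsub>cob X i\<^esub> x = coboundaries X i +>\<^bsub>cob X i\<^esub> y"
  moreover have "x : coboundaries X i +>\<^bsub>cob X i\<^esub> x" using m[OF assms(1)] hcong_refl[OF X assms(1)] by simp
  ultimately show "hcong X i x y" using m[OF assms(2)] by simp
 next
  assume h: "hcong X i x y"
  then show "coboundaries X i +>\<^bsub>cob X i\<^esub> x = coboundaries X i +>\<^bsub>cob X i\<^esub> y"
   using m[OF assms(1)] m[OF assms(2)] hcong_trans[OF X] hcong_sym[OF X h] by blast
 }
qed

end

lemma quasi_isomorphism_iff:
 assumes X: "X : complexes" and Y: "Y : complexes" and f: "f : chain_maps (fgmod H) X Y"
 shows "quasi_isomorphism X Y f \<longleftrightarrow>
  (ALL i. (ALL x:cocycles X i. ALL x':cocycles X i. hcong Y i (f i x) (f i x') --> hcong X i x x') &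
     (ALL y:cocycles Y i. EX x:cocycles X i. hcong Y i (f i x) y))" (is "_ \<longleftrightarrow> (ALL i. ?P i)")
proof -
 have "bij_betw (%\<xi>. \<Union>x\<in>\<xi>. coboundaries Y i +>\<^bsub>cob Y i\<^esub> f i x) (cohomology X i) (cohomology Y i) \<longleftrightarrow> ?P i" for i
 proof -
  let ?F = "%\<xi>. \<Union>x\<in>\<xi>. coboundaries Y i +>\<^bsub>cob Y i\<^esub> f i x"
  let ?c = "%x. coboundaries X i +>\<^bsub>cob X i\<^esub> x" and ?d = "%y. coboundaries Y i +>\<^bsub>cob Y i\<^esub> y"
  have m: "z : ?c x \<longleftrightarrow> hcong X i z x" if "x : cocycles X i" for x z
   using that coboundary_cocycle[OF X] cocycles_closed(2)[OF X] unfolding hcong_iff[OF X] a_r_coset_def' by blast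
  have F: "?F (?c x) = ?d (f i x)" if x: "x : cocycles X i" for x
  proof -
   have "?d (f i z) = ?d (f i x)" if "z : ?c x" for z
    using that m[OF x] coset_eq_iff[OF Y X] chain_map_hcong[OF X Y f] chain_map_cocycle[OF X Y f] x hcongD[OF X]
    by (metis hcong_def)
   moreover have "x : ?c x" using m[OF x] hcong_refl[OF X x] by simp
   ultimately show ?thesis by blast
  qed
  note fc = chain_map_cocycle[OF X Y f]
  have "inj_on ?F (cohomology X i) \<longleftrightarrow>
   (ALL x:cocycles X i. ALL x':cocycles X i. hcong Y i (f i x) (f i x') --> hcong X i x x')"
   unfolding cohomology_def inj_on_def ball_simps
   by (simp add: F coset_eq_iff[OF X Y] coset_eq_iff[OF Y X] fc cong: ball_cong)
  moreover have "?F ` cohomology X i = cohomology Y i \<longleftrightarrow> (ALL y:cocycles Y i. EX x:cocycles X i. hcong Y i (f i x) y)"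
  proof -
   have "?F ` cohomology X i = (%x. ?d (f i x)) ` cocycles X i"
    unfolding cohomology_def image_image using F by (intro image_cong) auto
   moreover have "(%x. ?d (f i x)) ` cocycles X i <= cohomology Y i" unfolding cohomology_def using fc by auto
   moreover have "cohomology Y i <= (%x. ?d (f i x)) ` cocycles X i \<longleftrightarrow> (ALL y:cocycles Y i. EX x:cocycles X i. hcong Y i (f i x) y)"
    unfolding cohomology_def image_subset_iff image_iff
    by (simp add: coset_eq_iff[OF Y X] fc cong: ball_cong bex_cong) (metis hcong_sym[OF Y])
   ultimately show ?thesis by (metis subset_antisym order_refl)
  qed
  ultimately show ?thesis unfolding bij_betw_def by simp
 qed
 then show ?thesis unfolding quasi_isomorphism_def by simp
qed

end

section \<open>Cohomology as a functor on the derived category\<close>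

lemma (in linear_category) null_smult:
 assumes X: "X : bounded_complexes C" and Y: "Y : bounded_complexes C"
  and n: "n : null_homotopic C X Y" and c: "c : carrier K"
 shows "(%i. c *[Mor C (cob X i) (cob Y i)] n i) : null_homotopic C X Y"
proof -
 note o = obs[OF X Y]
 obtain h where h: "n : chain_maps C X Y" "!!i. h i : mors C (cob X i) (cob Y (i - 1))"
  "!!i. h (i + 1) : mors C (cob X (i + 1)) (cob Y i)"
  "!!i. n i = cmp C (cob X i) (cob Y (i - 1)) (cob Y i) (dif Y (i - 1)) (h i)
   +[Mor C (cob X i) (cob Y i)] cmp C (cob X i) (cob X (i + 1)) (cob Y i) (h (i + 1)) (dif X i)"
  by (rule null_homotopicE[OF X Y n]) blast
 have m: "c *[Mor C A B] f : mors C A B" if "A : Ob C" "B : Ob C" "f : mors C A B" for A B f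
  using module.smult_closed[OF mor_module[OF that(1,2)] c that(3)] .
 show ?thesis
 proof (rule null_homotopicI[OF X Y chain_maps_smult[OF X Y c h(1)], of "%i. c *[Mor C (cob X i) (cob Y (i - 1))] h i"])
  fix i
  show "c *[Mor C (cob X i) (cob Y i)] n i =
   cmp C (cob X i) (cob Y (i - 1)) (cob Y i) (dif Y (i - 1)) (c *[Mor C (cob X i) (cob Y (i - 1))] h i)
   +[Mor C (cob X i) (cob Y i)]
   cmp C (cob X i) (cob X (i + 1)) (cob Y i) (c *[Mor C (cob X (i + 1)) (cob Y (i + 1 - 1))] h (i + 1)) (dif X i)"
   unfolding h(4)[of i] using h(2,3)[of i] o c
   by (simp add: cmp_smult_left cmp_smult_right module.smult_r_distr[OF mor_module])
 qed (use o h m in auto)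
qed

lemma (in linear_category) homotopy_add:
 assumes X: "X : bounded_complexes C" and Y: "Y : bounded_complexes C"
  and f: "f : chain_maps C X Y" and g: "g : chain_maps C X Y"
 shows "homotopy_class C X Y f +[Mor (homotopy_category C) X Y] homotopy_class C X Y g =
  homotopy_class C X Y (%i. f i +[Mor C (cob X i) (cob Y i)] g i)"
proof -
 interpret S: abelian_subgroup "null_homotopic C X Y" "Mor (complex_category C) X Y" by (rule null_subgroup[OF X Y])
 show ?thesis using S.a_rcos_sum[of f g] f g
  by (simp add: homotopy_category_def quotient_category_def homotopy_class_def)
qed

lemma (in linear_category) homotopy_smult:
 assumes X: "X : bounded_complexes C" and Y: "Y : bounded_complexes C"
  and f: "f : chain_maps C X Y" and c: "c : carrier K"
 shows "c *[Mor (homotopy_category C) X Y] homotopy_class C X Y f =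
  homotopy_class C X Y (%i. c *[Mor C (cob X i) (cob Y i)] f i)"
proof -
 let ?s = "%f i. c *[Mor C (cob X i) (cob Y i)] f i"
 have "homotopy_class C X Y (?s g) = homotopy_class C X Y (?s f)" if "g : homotopy_class C X Y f" for g
 proof (rule homotopy_class_eq[OF X Y chain_maps_smult[OF X Y c f]])
  have "g : homotopy_class C X Y f" by (rule that)
  then obtain n where n: "n : null_homotopic C X Y" "g = (%i. n i +[Mor C (cob X i) (cob Y i)] f i)"
   unfolding homotopy_class_iff[OF X Y f] by blast
  have m: "n i : mors C (cob X i) (cob Y i)" "f i : mors C (cob X i) (cob Y i)" for i
   using n f by (auto simp: null_homotopic_def chain_maps_def)
  have "?s g = (%i. ?s n i +[Mor C (cob X i) (cob Y i)] ?s f i)"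
   unfolding n(2) using m c obs[OF X Y] by (simp add: module.smult_r_distr[OF mor_module])
  then show "?s g : homotopy_class C X Y (?s f)"
   using homotopy_class_iff[OF X Y chain_maps_smult[OF X Y c f]] null_smult[OF X Y n(1) c] by auto
 qed
 then have "(\<Union>g\<in>homotopy_class C X Y f. homotopy_class C X Y (?s g)) = homotopy_class C X Y (?s f)"
  using class_self[OF X Y f] by blast
 then show ?thesis by (simp add: homotopy_category_def quotient_category_def homotopy_class_def)
qed

definition hrel :: "int => ('h hmodule, 'h hmap) cpx => ('h hmodule, 'h hmap) cpx =>
  ('h hmodule, 'h hmap) cpx \<times> (int => 'h hmap) set \<times> (int => 'h hmap) set => 'h elt => 'h elt => bool" where
 "hrel n X Y = (%(U, s, f) x y. EX u:cocycles U n. EX s':s. EX f':f. hcong X n (s' n u) x & hcong Y n (f' n u) y)"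

text \<open>The graph, modulo coboundaries, of the map induced on cohomology by a morphism of the derived category.\<close>

definition hmap_rel :: "int => 'h cplx => 'h cplx => 'h dmor => 'h elt => 'h elt => bool" where
 "hmap_rel n X Y al x y \<longleftrightarrow> (EX r:al. hrel n X Y r x y)"

context fd_algebra_over
begin

abbreviation "qis == quasi_isos H"

abbreviation "cls == homotopy_class (fgmod H)"

abbreviation chain where "chain == chain_maps (fgmod H)"

lemma class_ex:
 assumes "X : complexes" "Y : complexes" "al : mors kb X Y"
 obtains f where "f : chain X Y" "al = cls X Y f" "f : al"
 using assms A.homotopy_mors[OF assms(1,2)] A.class_self[OF assms(1,2)] by auto

lemma class_mors: "[|X : complexes; Y : complexes; f : chain X Y|] ==> cls X Y f : mors kb X Y"
 using A.homotopy_mors by auto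

definition compose :: "(int => 'h hmap) => 'h cplx => (int => 'h hmap) => int => 'h hmap" where
 "compose g X f = (%i. \<lambda>x\<in>carrier (cob X i). g i (f i x))"

lemma compose_chain:
 assumes "X : complexes" "Y : complexes" "Z : complexes" "f : chain X Y" "g : chain Y Z"
 shows "compose g X f : chain X Z" "cmp kb X Y Z (cls Y Z g) (cls X Y f) = cls X Z (compose g X f)"
 using A.chain_maps_cmp[OF assms] A.homotopy_cmp[OF assms] by (simp_all add: compose_def)

lemma compose_apply: "[|X : complexes; x : cocycles X i|] ==> compose g X f i x = g i (f i x)"
 using coc_carrier by (simp add: compose_def)

lemma kb_cmp_mors:
 assumes "X : complexes" "Y : complexes" "Z : complexes" "al : mors kb X Y" "be : mors kb Y Z"
  "f : al" "g : be"
 shows "cmp kb X Y Z be al : mors kb X Z" "compose g X f : cmp kb X Y Z be al"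
proof -
 note f = A.homotopy_mors_class[OF assms(1,2,4,6)] and g = A.homotopy_mors_class[OF assms(2,3,5,7)]
 note c = compose_chain[OF assms(1-3) f(1) g(1)]
 show "cmp kb X Y Z be al : mors kb X Z" "compose g X f : cmp kb X Y Z be al"
  using c class_mors[OF assms(1,3) c(1)] A.class_self[OF assms(1,3) c(1)] f(2) g(2) by auto
qed

definition qprop :: "'h cplx => 'h cplx => (int => 'h hmap) => bool" where
 "qprop X Y f \<longleftrightarrow> (ALL i. (ALL x:cocycles X i. ALL x':cocycles X i. hcong Y i (f i x) (f i x') --> hcong X i x x') &
     (ALL y:cocycles Y i. EX x:cocycles X i. hcong Y i (f i x) y))"

lemma qprop_inj: "[|qprop X Y f; x : cocycles X i; x' : cocycles X i; hcong Y i (f i x) (f i x')|] ==> hcong X i x x'"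
 and qprop_surj: "[|qprop X Y f; y : cocycles Y i|] ==> EX x:cocycles X i. hcong Y i (f i x) y"
 by (auto simp: qprop_def)

lemma qprop_class:
 assumes X: "X : complexes" and Y: "Y : complexes" and al: "al : mors kb X Y" and fg: "f : al" "g : al"
  and q: "qprop X Y f"
 shows "qprop X Y g"
proof -
 note h = homotopic_hcong[OF X Y al fg] and t = hcong_trans[OF Y] and s = hcong_sym[OF Y]
 show ?thesis unfolding qprop_def
 proof (intro allI conjI ballI impI)
  fix i x x' assume x: "x : cocycles X i" "x' : cocycles X i" "hcong Y i (g i x) (g i x')"
  show "hcong X i x x'" by (rule qprop_inj[OF q x(1,2) t[OF h[OF x(1)] t[OF x(3) s[OF h[OF x(2)]]]]])
 next
  fix i y assume "y : cocycles Y i"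
  then obtain x where "x : cocycles X i" "hcong Y i (f i x) y" using qprop_surj[OF q] by blast
  then show "EX x:cocycles X i. hcong Y i (g i x) y" using h t s by blast
 qed
qed

lemma qis_iff:
 assumes X: "X : complexes" and Y: "Y : complexes" and al: "al : mors kb X Y" and f: "f : al"
 shows "al : qis X Y \<longleftrightarrow> qprop X Y f"
proof
 note f' = A.homotopy_mors_class[OF X Y al f]
 show "qprop X Y f ==> al : qis X Y"
  using f' quasi_isomorphism_iff[OF X Y f'(1)] by (auto simp: quasi_isos_def qprop_def)
 assume "al : qis X Y"
 then obtain g where g: "g : chain X Y" "quasi_isomorphism X Y g" "al = cls X Y g"
  by (auto simp: quasi_isos_def)
 have "qprop X Y g" using g quasi_isomorphism_iff[OF X Y g(1)] by (simp add: qprop_def)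
 then show "qprop X Y f"
  using qprop_class[OF X Y al _ f] A.class_self[OF X Y g(1)] g(3) by blast
qed

lemma qprop_compose:
 assumes Ob: "X : complexes" "Y : complexes" "Z : complexes" and f: "f : chain X Y" and g: "g : chain Y Z"
  and q: "qprop X Y f" "qprop Y Z g"
 shows "qprop X Z (compose g X f)"
 unfolding qprop_def
proof (intro allI conjI ballI impI)
 fix i x x' assume "x : cocycles X i" "x' : cocycles X i" "hcong Z i (compose g X f i x) (compose g X f i x')"
 then show "hcong X i x x'"
  using qprop_inj[OF q(1)] qprop_inj[OF q(2)] chain_map_cocycle[OF Ob(1,2) f] by (simp add: compose_apply[OF Ob(1)])
next
 fix i z assume "z : cocycles Z i"
 then obtain y where y: "y : cocycles Y i" "hcong Z i (g i y) z" using qprop_surj[OF q(2)] by blast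
 obtain x where x: "x : cocycles X i" "hcong Y i (f i x) y" using qprop_surj[OF q(1) y(1)] by blast
 then have "hcong Z i (g i (f i x)) z"
  using chain_map_hcong[OF Ob(2,3) g x(2)] hcong_trans[OF Ob(3)] y(2) by blast
 then show "EX x:cocycles X i. hcong Z i (compose g X f i x) z" using x(1) compose_apply[OF Ob(1)] by auto
qed

lemma id_chain: "Z : complexes ==> (%i. \<lambda>x\<in>carrier (cob Z i). x) : chain Z Z"
 using A.chain_maps_id[of Z] by simp

lemma idm_kb: "Z : complexes ==> idm kb Z : mors kb Z Z & (%i. \<lambda>x\<in>carrier (cob Z i). x) : idm kb Z"
 using class_mors[OF _ _ id_chain, of Z] A.class_self[OF _ _ id_chain, of Z] A.homotopy_idm[of Z] by simp

section \<open>Roofs and the relation they induce\<close>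

context
 fixes X Y assumes X: "X : complexes" and Y: "Y : complexes"
begin

lemma roofE:
 assumes "r : roofs kb qis X Y"
 obtains U s f s0 f0 where "r = (U, s, f)" "U : complexes" "s : mors kb U X" "f : mors kb U Y"
  "s0 : s" "f0 : f" "s0 : chain U X" "f0 : chain U Y" "qprop U X s0"
proof -
 obtain U s f where r: "r = (U, s, f)" "U : complexes" "s : mors kb U X" "f : mors kb U Y" "s : qis U X"
  using assms by (auto simp: roofs_def)
 obtain s0 where s0: "s0 : chain U X" "s0 : s" using class_ex[OF r(2) X r(3)] by blast
 obtain f0 where f0: "f0 : chain U Y" "f0 : f" using class_ex[OF r(2) Y r(4)] by blast
 show thesis using that[OF r(1-4) s0(2) f0(2) s0(1) f0(1)] qis_iff[OF r(2) X r(3) s0(2)] r(5) by blast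
qed

lemma roof_tripleE:
 assumes "(U, s, f) : roofs kb qis X Y"
 obtains s0 f0 where "U : complexes" "s : mors kb U X" "f : mors kb U Y"
  "s0 : s" "f0 : f" "s0 : chain U X" "f0 : chain U Y" "qprop U X s0"
 using roofE[OF assms] by (metis prod.inject)

lemma hrel_iff:
 assumes U: "U : complexes" and s: "s : mors kb U X" "s0 : s" and f: "f : mors kb U Y" "f0 : f"
 shows "hrel n X Y (U, s, f) x y \<longleftrightarrow> (EX u:cocycles U n. hcong X n (s0 n u) x & hcong Y n (f0 n u) y)"
proof
 assume "hrel n X Y (U, s, f) x y"
 then obtain u s' f' where u: "u : cocycles U n" "s' : s" "f' : f" "hcong X n (s' n u) x" "hcong Y n (f' n u) y"
  unfolding hrel_def prod.case by blast
 then show "EX u:cocycles U n. hcong X n (s0 n u) x & hcong Y n (f0 n u) y"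
  using hcong_trans[OF X homotopic_hcong[OF U X s u(2,1)] u(4)] hcong_trans[OF Y homotopic_hcong[OF U Y f u(3,1)] u(5)]
  by blast
next
 assume "EX u:cocycles U n. hcong X n (s0 n u) x & hcong Y n (f0 n u) y"
 then show "hrel n X Y (U, s, f) x y" using s(2) f(2) unfolding hrel_def prod.case by blast
qed

lemma hrel_mem: "hrel n X Y r x y ==> x : cocycles X n & y : cocycles Y n"
 by (auto simp: hrel_def hcong_def split: prod.splits)

lemma hrel_cong: "[|hrel n X Y r x y; hcong X n x x'; hcong Y n y y'|] ==> hrel n X Y r x' y'"
 using hcong_trans[OF X] hcong_trans[OF Y] unfolding hrel_def by (simp split: prod.splits) meson

lemma hrel_total: assumes r: "r : roofs kb qis X Y" and x: "x : cocycles X n" shows "EX y. hrel n X Y r x y"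
proof -
 obtain U s f s0 f0 where R: "r = (U, s, f)" "U : complexes" "s : mors kb U X" "f : mors kb U Y"
  "s0 : s" "f0 : f" "s0 : chain U X" "f0 : chain U Y" "qprop U X s0" using roofE[OF r] .
 obtain u where u: "u : cocycles U n" "hcong X n (s0 n u) x" using qprop_surj[OF R(9) x] by blast
 have "hcong Y n (f0 n u) (f0 n u)" using hcong_refl[OF Y chain_map_cocycle[OF R(2) Y R(8) u(1)]] .
 then show ?thesis using u hrel_iff[OF R(2,3,5,4,6)] R(1) by blast
qed

lemma hrel_fun: assumes r: "r : roofs kb qis X Y" and h: "hrel n X Y r x y" "hrel n X Y r x y'" shows "hcong Y n y y'"
proof -
 obtain U s f s0 f0 where R: "r = (U, s, f)" "U : complexes" "s : mors kb U X" "f : mors kb U Y"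
  "s0 : s" "f0 : f" "s0 : chain U X" "f0 : chain U Y" "qprop U X s0" using roofE[OF r] .
 obtain u u' where u: "u : cocycles U n" "hcong X n (s0 n u) x" "hcong Y n (f0 n u) y"
  "u' : cocycles U n" "hcong X n (s0 n u') x" "hcong Y n (f0 n u') y'"
  using h hrel_iff[OF R(2,3,5,4,6)] R(1) by blast
 have "hcong U n u u'"
  using qprop_inj[OF R(9) u(1,4)] hcong_trans[OF X u(2) hcong_sym[OF X u(5)]] by blast
 then have "hcong Y n (f0 n u) (f0 n u')" by (rule chain_map_hcong[OF R(2) Y R(8)])
 then show ?thesis using u hcong_trans[OF Y] hcong_sym[OF Y] by blast
qed

lemma hrel_add:
 assumes r: "r : roofs kb qis X Y" and h: "hrel n X Y r x y" "hrel n X Y r x' y'"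
 shows "hrel n X Y r (x +[cob X n] x') (y +[cob Y n] y')"
proof -
 obtain U s f s0 f0 where R: "r = (U, s, f)" "U : complexes" "s : mors kb U X" "f : mors kb U Y"
  "s0 : s" "f0 : f" "s0 : chain U X" "f0 : chain U Y" "qprop U X s0" using roofE[OF r] .
 obtain u u' where u: "u : cocycles U n" "hcong X n (s0 n u) x" "hcong Y n (f0 n u) y"
  "u' : cocycles U n" "hcong X n (s0 n u') x'" "hcong Y n (f0 n u') y'"
  using h hrel_iff[OF R(2,3,5,4,6)] R(1) by blast
 have c: "u : carrier (cob U n)" "u' : carrier (cob U n)" using u coc_carrier[OF R(2)] by auto
 have "hcong X n (s0 n (u +[cob U n] u')) (x +[cob X n] x')"
  using hcong_add[OF X u(2,5)] mapsD(2)[OF chain_map_maps[OF R(2) X R(7)] c] by simp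
 moreover have "hcong Y n (f0 n (u +[cob U n] u')) (y +[cob Y n] y')"
  using hcong_add[OF Y u(3,6)] mapsD(2)[OF chain_map_maps[OF R(2) Y R(8)] c] by simp
 ultimately show ?thesis unfolding R(1) hrel_iff[OF R(2,3,5,4,6)]
  using cocycles_closed(2)[OF R(2) u(1,4)] by blast
qed

lemma hrel_smult:
 assumes r: "r : roofs kb qis X Y" and h: "hrel n X Y r x y" and a: "a : carrier H"
 shows "hrel n X Y r (a *[cob X n] x) (a *[cob Y n] y)"
proof -
 obtain U s f s0 f0 where R: "r = (U, s, f)" "U : complexes" "s : mors kb U X" "f : mors kb U Y"
  "s0 : s" "f0 : f" "s0 : chain U X" "f0 : chain U Y" "qprop U X s0" using roofE[OF r] .
 obtain u where u: "u : cocycles U n" "hcong X n (s0 n u) x" "hcong Y n (f0 n u) y"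
  using h hrel_iff[OF R(2,3,5,4,6)] R(1) by blast
 have c: "u : carrier (cob U n)" using u coc_carrier[OF R(2)] by auto
 have "hcong X n (s0 n (a *[cob U n] u)) (a *[cob X n] x)"
  using hcong_smult[OF X a u(2)] mapsD(3)[OF chain_map_maps[OF R(2) X R(7)] a c] by simp
 moreover have "hcong Y n (f0 n (a *[cob U n] u)) (a *[cob Y n] y)"
  using hcong_smult[OF Y a u(3)] mapsD(3)[OF chain_map_maps[OF R(2) Y R(8)] a c] by simp
 ultimately show ?thesis unfolding R(1) hrel_iff[OF R(2,3,5,4,6)]
  using cocycles_closed(3)[OF R(2) a u(1)] by blast
qed

lemma roof_equiv_sym: "roof_equiv kb qis X Y r r' ==> roof_equiv kb qis X Y r' r"
 unfolding roof_equiv_def by (simp split: prod.splits) metis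

text \<open>The common refinement \<open>W\<close> of two equivalent roofs is again quasi-isomorphic
  to \<open>X\<close>, so a cocycle realising \<open>x\<close> can be chosen on \<open>W\<close> and
  pushed to either roof.\<close>

lemma hrel_equiv:
 assumes r: "r : roofs kb qis X Y" "r' : roofs kb qis X Y" and e: "roof_equiv kb qis X Y r r'"
  and h: "hrel n X Y r x y"
 shows "hrel n X Y r' x y"
proof -
 obtain U s f s0 f0 where R: "r = (U, s, f)" "U : complexes" "s : mors kb U X" "f : mors kb U Y"
  "s0 : s" "f0 : f" "s0 : chain U X" "f0 : chain U Y" "qprop U X s0" using roofE[OF r(1)] .
 obtain V t g t0 g0 where R': "r' = (V, t, g)" "V : complexes" "t : mors kb V X" "g : mors kb V Y"
  "t0 : t" "g0 : g" "t0 : chain V X" "g0 : chain V Y" "qprop V X t0" using roofE[OF r(2)] .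
 obtain W a b where W: "W : complexes" "a : mors kb W U" "b : mors kb W V" "cmp kb W U X s a = cmp kb W V X t b"
  "cmp kb W U X s a : qis W X" "cmp kb W U Y f a = cmp kb W V Y g b"
  using e unfolding roof_equiv_def R R' by auto
 obtain a0 where a0: "a0 : chain W U" "a0 : a" using class_ex[OF W(1) R(2) W(2)] by blast
 obtain b0 where b0: "b0 : chain W V" "b0 : b" using class_ex[OF W(1) R'(2) W(3)] by blast
 note sa = kb_cmp_mors[OF W(1) R(2) X W(2) R(3) a0(2) R(5)]
 note tb = kb_cmp_mors[OF W(1) R'(2) X W(3) R'(3) b0(2) R'(5)]
 note fa = kb_cmp_mors[OF W(1) R(2) Y W(2) R(4) a0(2) R(6)]
 note gb = kb_cmp_mors[OF W(1) R'(2) Y W(3) R'(4) b0(2) R'(6)]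
 have q: "qprop W X (compose s0 W a0)" using W(5) qis_iff[OF W(1) X sa] by simp
 obtain u where u: "u : cocycles U n" "hcong X n (s0 n u) x" "hcong Y n (f0 n u) y"
  using h hrel_iff[OF R(2,3,5,4,6)] R(1) by blast
 obtain w where w: "w : cocycles W n" "hcong X n (s0 n (a0 n w)) x"
  using qprop_surj[OF q, of x n] hcongD(2)[OF X u(2)] compose_apply[OF W(1)] by auto
 have aw: "a0 n w : cocycles U n" by (rule chain_map_cocycle[OF W(1) R(2) a0(1) w(1)])
 have "hcong U n (a0 n w) u"
  using qprop_inj[OF R(9) aw u(1)] hcong_trans[OF X w(2) hcong_sym[OF X u(2)]] by blast
 then have fy: "hcong Y n (f0 n (a0 n w)) y"
  using chain_map_hcong[OF R(2) Y R(8)] hcong_trans[OF Y _ u(3)] by blast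
 have "hcong X n (t0 n (b0 n w)) (s0 n (a0 n w))"
  using homotopic_hcong[OF W(1) X sa(1) _ sa(2) w(1)] tb(2) W(4) compose_apply[OF W(1) w(1)] by metis
 then have 1: "hcong X n (t0 n (b0 n w)) x" using hcong_trans[OF X] w(2) by blast
 have "hcong Y n (g0 n (b0 n w)) (f0 n (a0 n w))"
  using homotopic_hcong[OF W(1) Y fa(1) _ fa(2) w(1)] gb(2) W(6) compose_apply[OF W(1) w(1)] by metis
 then have 2: "hcong Y n (g0 n (b0 n w)) y" using hcong_trans[OF Y] fy by blast
 show ?thesis unfolding R'(1) hrel_iff[OF R'(2,3,5,4,6)]
  using 1 2 chain_map_cocycle[OF W(1) R'(2) b0(1) w(1)] by blast
qed

lemma roof_equiv_refl: assumes r: "r : roofs kb qis X Y" shows "roof_equiv kb qis X Y r r"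
proof -
 obtain U s f s0 f0 where R: "r = (U, s, f)" "U : complexes" "s : mors kb U X" "f : mors kb U Y"
  "s0 : s" "f0 : f" "s0 : chain U X" "f0 : chain U Y" "qprop U X s0" using roofE[OF r] .
 let ?i = "%i. \<lambda>x\<in>carrier (cob U i). x"
 note i = idm_kb[OF R(2)] and sa = kb_cmp_mors[OF R(2,2) X _ R(3) _ R(5), of "idm kb U" ?i]
 have "qprop U X (compose s0 U ?i)"
  using R(9) compose_apply[OF R(2)] coc_carrier[OF R(2)] unfolding qprop_def by simp
 then have "cmp kb U U X s (idm kb U) : qis U X" using qis_iff[OF R(2) X sa] i by blast
 then show ?thesis unfolding roof_equiv_def R using i R by auto
qed

lemma derived_mors: "al : mors (Der H) X Y \<longleftrightarrow> (EX r:roofs kb qis X Y. al = roof_class kb qis X Y r)"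
 by (auto simp: derived_category_def localisation_def)

lemma derived_morsD:
 assumes al: "al : mors (Der H) X Y"
 shows "al ~= {}" "r : al ==> r : roofs kb qis X Y" "r : al ==> hmap_rel n X Y al x y \<longleftrightarrow> hrel n X Y r x y"
proof -
 obtain q where q: "q : roofs kb qis X Y" "al = roof_class kb qis X Y q" using al derived_mors by auto
 have "q : al" using q(1) roof_equiv_refl[OF q(1)] unfolding q(2) roof_class_def by blast
 then show "al ~= {}" by blast
 show r: "r : roofs kb qis X Y" if "r : al" for r using that q by (simp add: roof_class_def)
 have eq: "hrel n X Y r x y \<longleftrightarrow> hrel n X Y q x y" if "r : al" for r n x y
 proof -
  have e: "roof_equiv kb qis X Y q r" using that unfolding q(2) roof_class_def by blast
  show ?thesis using hrel_equiv[OF q(1) r[OF that] e] hrel_equiv[OF r[OF that] q(1) roof_equiv_sym[OF e]] by blast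
 qed
 show "hmap_rel n X Y al x y \<longleftrightarrow> hrel n X Y r x y" if "r : al"
  unfolding hmap_rel_def using that eq by blast
qed

lemma hmap_rel_props:
 assumes al: "al : mors (Der H) X Y"
 shows "hmap_rel n X Y al x y ==> x : cocycles X n & y : cocycles Y n"
  "[|hmap_rel n X Y al x y; hcong X n x x'; hcong Y n y y'|] ==> hmap_rel n X Y al x' y'"
  "x : cocycles X n ==> EX y. hmap_rel n X Y al x y"
  "[|hmap_rel n X Y al x y; hmap_rel n X Y al x y'|] ==> hcong Y n y y'"
  "[|hmap_rel n X Y al x y; hmap_rel n X Y al x' y'|] ==>
    hmap_rel n X Y al (x +[cob X n] x') (y +[cob Y n] y')"
  "[|hmap_rel n X Y al x y; a : carrier H|] ==> hmap_rel n X Y al (a *[cob X n] x) (a *[cob Y n] y)"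
proof -
 obtain r where r: "r : al" using derived_morsD(1)[OF al] by blast
 note R = derived_morsD(2)[OF al r] and eq = derived_morsD(3)[OF al r]
 show "hmap_rel n X Y al x y ==> x : cocycles X n & y : cocycles Y n"
  "[|hmap_rel n X Y al x y; hcong X n x x'; hcong Y n y y'|] ==> hmap_rel n X Y al x' y'"
  "x : cocycles X n ==> EX y. hmap_rel n X Y al x y"
  "[|hmap_rel n X Y al x y; hmap_rel n X Y al x y'|] ==> hcong Y n y y'"
  "[|hmap_rel n X Y al x y; hmap_rel n X Y al x' y'|] ==>
    hmap_rel n X Y al (x +[cob X n] x') (y +[cob Y n] y')"
  "[|hmap_rel n X Y al x y; a : carrier H|] ==> hmap_rel n X Y al (a *[cob X n] x) (a *[cob Y n] y)"
  unfolding eq by (blast intro: hrel_cong hrel_total[OF R] hrel_fun[OF R] hrel_add[OF R] hrel_smult[OF R] dest: hrel_mem)+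
qed

end

lemma hmap_rel_id:
 assumes X: "X : complexes"
 shows "idm (Der H) X : mors (Der H) X X"
  "hmap_rel n X X (idm (Der H) X) x y \<longleftrightarrow> hcong X n x y"
proof -
 let ?i = "%i. \<lambda>x\<in>carrier (cob X i). x"
 note i = idm_kb[OF X]
 have "qprop X X ?i"
  using hcong_refl[OF X] coc_carrier[OF X] unfolding qprop_def by fastforce
 then have "idm kb X : qis X X" using qis_iff[OF X X] i by blast
 then have r: "(X, idm kb X, idm kb X) : roofs kb qis X X" using i X by (simp add: roofs_def)
 have e: "idm (Der H) X = roof_class kb qis X X (X, idm kb X, idm kb X)"
  by (simp add: derived_category_def localisation_def)
 show m: "idm (Der H) X : mors (Der H) X X" unfolding derived_mors[OF X X] e using r by blast
 have "(X, idm kb X, idm kb X) : idm (Der H) X"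
  unfolding e using r roof_equiv_refl[OF X X r] by (simp add: roof_class_def)
 from derived_morsD(3)[OF X X m this] have "hmap_rel n X X (idm (Der H) X) x y \<longleftrightarrow>
   (EX u:cocycles X n. hcong X n (?i n u) x & hcong X n (?i n u) y)"
  using hrel_iff[OF X X X] i by blast
 also have "... \<longleftrightarrow> (EX u:cocycles X n. hcong X n u x & hcong X n u y)"
  using coc_carrier[OF X] by (intro bex_cong) auto
 also have "... \<longleftrightarrow> hcong X n x y"
  using hcong_refl[OF X] hcong_sym[OF X] hcong_trans[OF X] hcongD[OF X] by blast
 finally show "hmap_rel n X X (idm (Der H) X) x y \<longleftrightarrow> hcong X n x y" .
qed

text \<open>The hypothesis that the composite is a morphism makes it inhabited, and then one roof in
  it, formed over some \<open>W\<close>, decides the relation. The hypothesis is met through the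
  functor \<open>E\<close>, in place of a calculus of fractions.\<close>

lemma hmap_rel_cmp:
 assumes X: "X : complexes" and Y: "Y : complexes" and Z: "Z : complexes"
  and al: "al : mors (Der H) X Y" and be: "be : mors (Der H) Y Z"
  and ga: "cmp (Der H) X Y Z be al : mors (Der H) X Z"
 shows "hmap_rel n X Z (cmp (Der H) X Y Z be al) x z \<longleftrightarrow> (EX y. hmap_rel n X Y al x y & hmap_rel n Y Z be y z)"
proof -
 let ?ga = "cmp (Der H) X Y Z be al"
 obtain r where r: "r : ?ga" using derived_morsD(1)[OF X Z ga] by blast
 then obtain U s f V t g W a b where D: "r : roof_class kb qis X Z (W, cmp kb W U X s a, cmp kb W V Z g b)"
  "(U, s, f) : al" "(V, t, g) : be" "W : complexes" "a : mors kb W U" "a : qis W U" "b : mors kb W V"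
  "cmp kb W U Y f a = cmp kb W V Y t b"
  unfolding derived_category_def localisation_def by auto
 have R1: "(U, s, f) : roofs kb qis X Y" by (rule derived_morsD(2)[OF X Y al D(2)])
 have R2: "(V, t, g) : roofs kb qis Y Z" by (rule derived_morsD(2)[OF Y Z be D(3)])
 obtain s0 f0 where R: "U : complexes" "s : mors kb U X" "f : mors kb U Y"
  "s0 : s" "f0 : f" "s0 : chain U X" "f0 : chain U Y" "qprop U X s0" by (rule roof_tripleE[OF X Y R1])
 obtain t0 g0 where R': "V : complexes" "t : mors kb V Y" "g : mors kb V Z"
  "t0 : t" "g0 : g" "t0 : chain V Y" "g0 : chain V Z" "qprop V Y t0" by (rule roof_tripleE[OF Y Z R2])
 obtain a0 where a0: "a0 : chain W U" "a0 : a" using class_ex[OF D(4) R(1) D(5)] by blast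
 obtain b0 where b0: "b0 : chain W V" "b0 : b" using class_ex[OF D(4) R'(1) D(7)] by blast
 note sa = kb_cmp_mors[OF D(4) R(1) X D(5) R(2) a0(2) R(4)]
 note gb = kb_cmp_mors[OF D(4) R'(1) Z D(7) R'(3) b0(2) R'(5)]
 note fa = kb_cmp_mors[OF D(4) R(1) Y D(5) R(3) a0(2) R(5)]
 note tb = kb_cmp_mors[OF D(4) R'(1) Y D(7) R'(2) b0(2) R'(4)]
 have qa: "qprop W U a0" using qis_iff[OF D(4) R(1) D(5) a0(2)] D(6) by simp
 have "cmp kb W U X s a : qis W X"
  unfolding qis_iff[OF D(4) X sa] by (rule qprop_compose[OF D(4) R(1) X a0(1) R(6) qa R(8)])
 then have R3: "(W, cmp kb W U X s a, cmp kb W V Z g b) : roofs kb qis X Z"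
  using D(4) sa gb by (simp add: roofs_def)
 have "r : roofs kb qis X Z" and e: "roof_equiv kb qis X Z (W, cmp kb W U X s a, cmp kb W V Z g b) r"
  using D(1) by (auto simp: roof_class_def)
 then have "hmap_rel n X Z ?ga x z \<longleftrightarrow> hrel n X Z (W, cmp kb W U X s a, cmp kb W V Z g b) x z"
  using derived_morsD(3)[OF X Z ga r] hrel_equiv[OF X Z R3 _ e] hrel_equiv[OF X Z _ R3 roof_equiv_sym[OF X Z e]] by blast
 also have "... \<longleftrightarrow> (EX w:cocycles W n. hcong X n (compose s0 W a0 n w) x & hcong Z n (compose g0 W b0 n w) z)"
  by (rule hrel_iff[OF X Z D(4) sa gb])
 also have "... \<longleftrightarrow> (EX w:cocycles W n. hcong X n (s0 n (a0 n w)) x & hcong Z n (g0 n (b0 n w)) z)"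
  using compose_apply[OF D(4)] by (intro bex_cong) auto
 also have "... \<longleftrightarrow> (EX y. hrel n X Y (U, s, f) x y & hrel n Y Z (V, t, g) y z)"
 proof
  have m: "hcong Y n (f0 n (a0 n w)) (t0 n (b0 n w))" if "w : cocycles W n" for w
   using homotopic_hcong[OF D(4) Y fa(1) fa(2) _ that] tb(2) D(8) compose_apply[OF D(4) that] by metis
  {
   assume "EX w:cocycles W n. hcong X n (s0 n (a0 n w)) x & hcong Z n (g0 n (b0 n w)) z"
   then obtain w where w: "w : cocycles W n" "hcong X n (s0 n (a0 n w)) x" "hcong Z n (g0 n (b0 n w)) z" by blast
   have aw: "a0 n w : cocycles U n" "b0 n w : cocycles V n"
    using chain_map_cocycle[OF D(4) R(1) a0(1) w(1)] chain_map_cocycle[OF D(4) R'(1) b0(1) w(1)] by auto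
   have "hrel n X Y (U, s, f) x (t0 n (b0 n w))"
    unfolding hrel_iff[OF X Y R(1,2,4,3,5)] using aw w m[OF w(1)] by blast
   moreover have "hrel n Y Z (V, t, g) (t0 n (b0 n w)) z"
    unfolding hrel_iff[OF Y Z R'(1,2,4,3,5)]
    using aw w hcong_refl[OF Y chain_map_cocycle[OF R'(1) Y R'(6) aw(2)]] by blast
   ultimately show "EX y. hrel n X Y (U, s, f) x y & hrel n Y Z (V, t, g) y z" by blast
  next
   assume "EX y. hrel n X Y (U, s, f) x y & hrel n Y Z (V, t, g) y z"
   then obtain y u v where y: "u : cocycles U n" "hcong X n (s0 n u) x" "hcong Y n (f0 n u) y"
    "v : cocycles V n" "hcong Y n (t0 n v) y" "hcong Z n (g0 n v) z"
    unfolding hrel_iff[OF X Y R(1,2,4,3,5)] hrel_iff[OF Y Z R'(1,2,4,3,5)] by blast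
   \<comment> \<open>Only \<open>a\<close> is known to be a quasi-isomorphism. That \<open>b\<close>
     nevertheless hits the class of \<open>v\<close> follows by cancelling the quasi-isomorphism
     \<open>t\<close>.\<close>
   obtain w where w: "w : cocycles W n" "hcong U n (a0 n w) u" using qprop_surj[OF qa y(1)] by blast
   have bw: "b0 n w : cocycles V n" by (rule chain_map_cocycle[OF D(4) R'(1) b0(1) w(1)])
   have "hcong Y n (t0 n (b0 n w)) (t0 n v)"
    by (rule hcong_trans[OF Y hcong_sym[OF Y m[OF w(1)]]
      hcong_trans[OF Y chain_map_hcong[OF R(1) Y R(7) w(2)] hcong_trans[OF Y y(3) hcong_sym[OF Y y(5)]]]])
   then have "hcong V n (b0 n w) v" using qprop_inj[OF R'(8) bw y(4)] by blast
   then have "hcong Z n (g0 n (b0 n w)) z" using chain_map_hcong[OF R'(1) Z R'(7)] hcong_trans[OF Z _ y(6)] by blast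
   moreover have "hcong X n (s0 n (a0 n w)) x"
    using chain_map_hcong[OF R(1) X R(6) w(2)] hcong_trans[OF X _ y(2)] by blast
   ultimately show "EX w:cocycles W n. hcong X n (s0 n (a0 n w)) x & hcong Z n (g0 n (b0 n w)) z" using w(1) by blast
  }
 qed
 also have "... \<longleftrightarrow> (EX y. hmap_rel n X Y al x y & hmap_rel n Y Z be y z)"
  using derived_morsD(3)[OF X Y al D(2)] derived_morsD(3)[OF Y Z be D(3)] by simp
 finally show ?thesis .
qed

lemma hmap_rel_plus:
 assumes X: "X : complexes" and Y: "Y : complexes"
  and al: "al : mors (Der H) X Y" and be: "be : mors (Der H) X Y"
  and ga: "al +[Mor (Der H) X Y] be : mors (Der H) X Y"
  and h: "hmap_rel n X Y al x y" "hmap_rel n X Y be x y'"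
 shows "hmap_rel n X Y (al +[Mor (Der H) X Y] be) x (y +[cob Y n] y')"
proof -
 obtain r where r: "r : al +[Mor (Der H) X Y] be" using derived_morsD(1)[OF X Y ga] by blast
 then obtain U s f g where D: "r : roof_class kb qis X Y (U, s, f +[Mor kb U Y] g)" "(U, s, f) : al" "(U, s, g) : be"
  unfolding derived_category_def localisation_def by auto
 obtain s0 f0 where R: "U : complexes" "s : mors kb U X" "f : mors kb U Y"
  "s0 : s" "f0 : f" "s0 : chain U X" "f0 : chain U Y" "qprop U X s0"
  by (rule roof_tripleE[OF X Y derived_morsD(2)[OF X Y al D(2)]])
 have g: "g : mors kb U Y" using derived_morsD(2)[OF X Y be D(3)] by (simp add: roofs_def)
 obtain g0 where g0: "g0 : chain U Y" "g0 : g" using class_ex[OF R(1) Y g] by blast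
 let ?h = "%i. \<lambda>x\<in>carrier (cob U i). f0 i x +[cob Y i] g0 i x"
 have hc: "?h : chain U Y" using A.chain_maps_add[OF R(1) Y R(7) g0(1)] by simp
 have "f +[Mor kb U Y] g = cls U Y ?h"
  using A.homotopy_add[OF R(1) Y R(7) g0(1)] A.homotopy_mors_class(2)[OF R(1) Y R(3,5)]
   A.homotopy_mors_class(2)[OF R(1) Y g g0(2)] by simp
 then have fg: "f +[Mor kb U Y] g : mors kb U Y" "?h : f +[Mor kb U Y] g"
  using class_mors[OF R(1) Y hc] A.class_self[OF R(1) Y hc] by auto
 have R3: "(U, s, f +[Mor kb U Y] g) : roofs kb qis X Y"
  using derived_morsD(2)[OF X Y al D(2)] fg by (simp add: roofs_def)
 have rr: "r : roofs kb qis X Y" and e: "roof_equiv kb qis X Y (U, s, f +[Mor kb U Y] g) r"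
  using D(1) by (auto simp: roof_class_def)
 obtain u where u: "u : cocycles U n" "hcong X n (s0 n u) x" "hcong Y n (f0 n u) y"
  using h(1) derived_morsD(3)[OF X Y al D(2)] hrel_iff[OF X Y R(1,2,4,3,5)] by auto
 obtain u' where u': "u' : cocycles U n" "hcong X n (s0 n u') x" "hcong Y n (g0 n u') y'"
  using h(2) derived_morsD(3)[OF X Y be D(3)] hrel_iff[OF X Y R(1,2,4) g g0(2)] by auto
 have "hcong U n u u'" using qprop_inj[OF R(8) u(1) u'(1)] hcong_trans[OF X u(2) hcong_sym[OF X u'(2)]] by blast
 then have "hcong Y n (g0 n u) y'" using chain_map_hcong[OF R(1) Y g0(1)] hcong_trans[OF Y _ u'(3)] by blast
 then have "hcong Y n (?h n u) (y +[cob Y n] y')"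
  using hcong_add[OF Y u(3)] coc_carrier[OF R(1) u(1)] by simp
 then have "hrel n X Y (U, s, f +[Mor kb U Y] g) x (y +[cob Y n] y')"
  unfolding hrel_iff[OF X Y R(1,2,4) fg] using u by blast
 then show ?thesis using hrel_equiv[OF X Y R3 rr e] derived_morsD(3)[OF X Y ga r] by blast
qed

lemma hmap_rel_scalar:
 assumes X: "X : complexes" and Y: "Y : complexes" and c: "c : carrier K"
  and al: "al : mors (Der H) X Y"
  and ga: "c *[Mor (Der H) X Y] al : mors (Der H) X Y"
  and h: "hmap_rel n X Y al x y"
 shows "hmap_rel n X Y (c *[Mor (Der H) X Y] al) x (scal H c *[cob Y n] y)"
proof -
 obtain r where r: "r : c *[Mor (Der H) X Y] al" using derived_morsD(1)[OF X Y ga] by blast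
 then obtain U s f where D: "r : roof_class kb qis X Y (U, s, c *[Mor kb U Y] f)" "(U, s, f) : al"
  unfolding derived_category_def localisation_def by auto
 obtain s0 f0 where R: "U : complexes" "s : mors kb U X" "f : mors kb U Y"
  "s0 : s" "f0 : f" "s0 : chain U X" "f0 : chain U Y" "qprop U X s0"
  by (rule roof_tripleE[OF X Y derived_morsD(2)[OF X Y al D(2)]])
 let ?h = "%i. \<lambda>x\<in>carrier (cob U i). scal H c *[cob Y i] f0 i x"
 have hc: "?h : chain U Y" using A.chain_maps_smult[OF R(1) Y c R(7)] by simp
 have "c *[Mor kb U Y] f = cls U Y ?h"
  using A.homotopy_smult[OF R(1) Y R(7) c] A.homotopy_mors_class(2)[OF R(1) Y R(3,5)] by simp
 then have fg: "c *[Mor kb U Y] f : mors kb U Y" "?h : c *[Mor kb U Y] f"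
  using class_mors[OF R(1) Y hc] A.class_self[OF R(1) Y hc] by auto
 have R3: "(U, s, c *[Mor kb U Y] f) : roofs kb qis X Y"
  using derived_morsD(2)[OF X Y al D(2)] fg by (simp add: roofs_def)
 have rr: "r : roofs kb qis X Y" and e: "roof_equiv kb qis X Y (U, s, c *[Mor kb U Y] f) r"
  using D(1) by (auto simp: roof_class_def)
 obtain u where u: "u : cocycles U n" "hcong X n (s0 n u) x" "hcong Y n (f0 n u) y"
  using h derived_morsD(3)[OF X Y al D(2)] hrel_iff[OF X Y R(1,2,4,3,5)] by auto
 have "hcong Y n (?h n u) (scal H c *[cob Y n] y)"
  using hcong_smult[OF Y scalar_closed[OF fd c] u(3)] coc_carrier[OF R(1) u(1)] by simp
 then have "hrel n X Y (U, s, c *[Mor kb U Y] f) x (scal H c *[cob Y n] y)"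
  unfolding hrel_iff[OF X Y R(1,2,4) fg] using u by blast
 then show ?thesis using hrel_equiv[OF X Y R3 rr e] derived_morsD(3)[OF X Y ga r] by blast
qed

end

section \<open>Free modules and lifting\<close>

text \<open>Vectors are functions vanishing from \<open>l\<close> on, wrapped as singletons because
  the elements of modules here are sets of functions; \<open>the_elem\<close> unwraps them.\<close>

definition free :: "('k, 'h) module => nat => 'h hmodule" where
 "free H l = lin_space {{v} |v. (ALL i. v i : carrier H) & (ALL i>=l. v i = zr H)} {%i. zr H}
   (%x y. {%i. the_elem x i +[H] the_elem y i}) (%a x. {%i. a **[H] the_elem x i})"

definition uvec :: "('k, 'h) module => nat => 'h elt" where
 "uvec H i = {%j. if j = i then un H else zr H}"

primrec combination :: "('h, 'a) module => (nat => 'a) => (nat => 'h) => nat => 'a" where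
 "combination M x v 0 = zr M"
| "combination M x v (Suc k) = combination M x v k +[M] v k *[M] x k"

lemma free_simps [simp]:
 "zr (free H l) = {%i. zr H}"
 "{v} +[free H l] {w} = {%i. v i +[H] w i}"
 "a *[free H l] {v} = {%i. a **[H] v i}"
 by (simp_all add: free_def)

lemma free_carrier: "x : carrier (free H l) \<longleftrightarrow> (EX v. x = {v} & (ALL i. v i : carrier H) & (ALL i>=l. v i = zr H))"
 by (auto simp: free_def)

lemma submodule_left_module:
 assumes M: "left_module H M" and N: "submodule N H M" shows "left_module H (M(|carrier := N|))"
proof -
 interpret M: left_module H M by fact
 interpret N: submodule N H M by fact
 have inv: "-[M] x : N" if "x : N" for x using N.m_inv_closed[OF that] by (simp add: a_inv_def)
 have c: "x : N ==> x : carrier M" for x using N.subset by auto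
 have "abelian_group (M(|carrier := N|))"
 proof (rule abelian_groupI)
  fix x assume x: "x : carrier (M(|carrier := N|))"
  then have "-[M] x +[M] x = zr M" using c M.M.l_neg by simp
  then show "EX y:carrier (M(|carrier := N|)). y +[M(|carrier := N|)] x = zr (M(|carrier := N|))"
   using inv x by (intro bexI[of _ "-[M] x"]) auto
 qed (use c N.m_closed N.one_closed in \<open>auto simp: M.M.a_ac\<close>)
 then show ?thesis
  unfolding left_module_def left_module_axioms_def
  using M.H.ring_axioms c N.smult_closed by (auto simp: M.act_l_distr M.act_r_distr M.act_assoc M.act_one)
qed

lemma left_module_null:
 assumes M: "left_module H M" and x: "x : carrier M" shows "zr H *[M] x = zr M"
proof -
 interpret M: left_module H M by fact
 show ?thesis using M.act_l_distr[of "zr H" "zr H" x] x M.act_closed[of "zr H" x]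
  by (metis M.H.l_zero M.H.zero_closed M.M.add.l_cancel_one')
qed

lemma module_maps_comp:
 assumes "left_module H L" "f : module_maps H L M" "g : module_maps H M N"
 shows "(\<lambda>x\<in>carrier L. g (f x)) : module_maps H L N"
proof -
 interpret L: left_module H L by fact
 show ?thesis unfolding module_maps_def
  using mapsD[OF assms(2)] mapsD[OF assms(3)] by (simp add: L.act_closed)
qed

lemma submoduleI:
 assumes M: "left_module H M" and "N <= carrier M" "zr M : N"
  and "!!x y. [|x : N; y : N|] ==> x +[M] y : N"
  and sm: "!!a x. [|a : carrier H; x : N|] ==> a *[M] x : N"
 shows "submodule N H M"
proof -
 interpret M: left_module H M by fact
 have neg: "(-[H] un H) *[M] x = -[M] x" if x: "x : carrier M" for x
 proof -
  note z = left_module_null[OF M x]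
  have "(-[H] un H) *[M] x +[M] un H *[M] x = zr H *[M] x"
   using M.act_l_distr[of "-[H] un H" "un H" x] x by (simp add: M.H.l_neg)
  then have "(-[H] un H) *[M] x +[M] x = zr M" using x z M.act_one by simp
  then show ?thesis using x M.act_closed by (simp add: M.M.minus_equality)
 qed
 have "-[M] x : N" if "x : N" for x using neg[of x] sm[of "-[H] un H" x] that assms(2) by auto
 then show ?thesis
  by (intro submodule.intro subgroup.intro) (use assms in \<open>auto simp: submodule_axioms_def a_inv_def[symmetric]\<close>)
qed

context fd_algebra_over
begin

interpretation H: ring H using fd by (simp add: fd_algebra_def)

lemma free_left_module: "left_module H (free H l)"
proof -
 let ?F = "free H l"
 have "abelian_group ?F"
 proof (rule abelian_groupI)
  fix x assume "x : carrier ?F"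
  then obtain v where v: "x = {v}" "!!i. v i : carrier H" "!!i. i >= l ==> v i = zr H" by (auto simp: free_carrier)
  show "EX y:carrier ?F. y +[?F] x = zr (?F)"
   by (rule bexI[of _ "{%i. -[H] v i}"]) (use v in \<open>auto simp: free_carrier H.l_neg\<close>)
 qed (auto simp: free_carrier H.a_ac)
 then show ?thesis unfolding left_module_def left_module_axioms_def
  using H.ring_axioms by (auto simp: free_carrier H.l_distr H.r_distr H.m_assoc)
qed

lemma uvec_closed: "i < l ==> uvec H i : carrier (free H l)"
 by (auto simp: free_carrier uvec_def)

text \<open>Vectors are built up coordinate by coordinate, with \<open>k\<close> bounding the
  support.\<close>

lemma free_induct:
 assumes x: "x : carrier (free H l)"
  and zero: "P (zr (free H l))"
  and step: "!!x a i. [|x : carrier (free H l); P x; a : carrier H; i < l|]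
   ==> P (x +[free H l] a *[free H l] uvec H i)"
 shows "P x"
proof -
 have "P {v}" if "k <= l" "!!i. v i : carrier H" "!!i. i >= k ==> v i = zr H" for k v
  using that
 proof (induction k arbitrary: v)
  case 0
  then have "v = (%i. zr H)" by auto
  then show ?case using zero by simp
 next
  case (Suc k)
  let ?w = "v(k := zr H)"
  have "P {?w}"
  proof (rule Suc.IH)
   fix i assume "k <= i"
   then show "?w i = zr H" using Suc.prems(3)[of i] by (cases "i = k") auto
  qed (use Suc.prems in auto)
  moreover have "?w i = zr H" if "i >= l" for i using that Suc.prems(1,3) by auto
  then have "{?w} : carrier (free H l)" unfolding free_carrier using Suc.prems(2) by auto
  ultimately have "P ({?w} +[free H l] v k *[free H l] uvec H k)"
   using step[of "{?w}" "v k" k] Suc.prems by auto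
  moreover have "(%i. ?w i +[H] v k **[H] (if i = k then un H else zr H)) = v"
   using Suc.prems by (auto simp: fun_eq_iff)
  ultimately show ?case by (simp add: uvec_def)
 qed
 then show ?thesis using x by (auto simp: free_carrier)
qed

lemma free_ob: "free H l : Ob (fgmod H)"
proof -
 have "N = carrier (free H l)"
  if N: "submodule N H (free H l)" and e: "uvec H ` {..<l} <= N" for N
 proof -
  interpret N: submodule N H "free H l" by fact
  have "x : N" if "x : carrier (free H l)" for x
   using that
  proof (rule free_induct)
   show "zr (free H l) : N" using N.one_closed by simp
   fix x a i assume "x : N" "a : carrier H" "i < l"
   then show "x +[free H l] a *[free H l] uvec H i : N"
    using N.m_closed[of x] N.smult_closed[of a] e by auto
  qed
  then show ?thesis using N.subset by auto
 qed
 then have "fin_generated H (free H l)" unfolding fin_generated_def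
  using uvec_closed by (intro exI[of _ "uvec H ` {..<l}"]) auto
 then show ?thesis using free_left_module by simp
qed

lemma free_hom_ex:
 assumes M: "left_module H M" and x: "!!i. i < l ==> x i : carrier M"
 shows "EX ph:module_maps H (free H l) M. ALL i<l. ph (uvec H i) = x i"
proof -
 interpret M: left_module H M by fact
 note z = left_module_null[OF M]
 have cl: "combination M x v k : carrier M" if "k <= l" "!!i. v i : carrier H" for k v
  using that by (induction k) (auto simp: x M.act_closed)
 have add: "combination M x (%i. v i +[H] w i) k = combination M x v k +[M] combination M x w k"
  if "k <= l" "!!i. v i : carrier H" "!!i. w i : carrier H" for k v w
  using that by (induction k) (auto simp: x M.act_closed M.act_l_distr cl M.M.a_ac)
 have smult: "combination M x (%i. a **[H] v i) k = a *[M] combination M x v k"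
  if "k <= l" "a : carrier H" "!!i. v i : carrier H" for k v a
  using that by (induction k) (auto simp: x M.act_closed M.act_r_distr M.act_assoc cl left_module_zero[OF M])
 have unit: "combination M x (%j. if j = i then un H else zr H) k = (if i < k then x i else zr M)" if "k <= l" for i k
  using that
 proof (induction k)
  case (Suc k)
  then show ?case using x[of k] x[of i] z[of "x k"] M.act_one[of "x k"] by (auto simp: less_Suc_eq)
 qed simp
 let ?ph = "\<lambda>y\<in>carrier (free H l). combination M x (the_elem y) l"
 interpret F: left_module H "free H l" by (rule free_left_module)
 have "?ph : module_maps H (free H l) M"
  unfolding module_maps_def
 proof (intro CollectI conjI ballI PiE_I)
  fix y w assume "y : carrier (free H l)" "w : carrier (free H l)"
  moreover from this obtain v v' where "y = {v}" "w = {v'}" "!!i. v i : carrier H" "!!i. v' i : carrier H"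
   by (auto simp: free_carrier)
  ultimately show "?ph (y +[free H l] w) = ?ph y +[M] ?ph w"
   using F.M.a_closed[of y w] add by simp
 next
  fix a y assume "a : carrier H" "y : carrier (free H l)"
  moreover from this obtain v where "y = {v}" "!!i. v i : carrier H" by (auto simp: free_carrier)
  ultimately show "?ph (a *[free H l] y) = a *[M] ?ph y"
   using F.act_closed[of a y] smult by simp
 qed (auto simp: free_carrier intro: cl)
 moreover have "?ph (uvec H i) = x i" if "i < l" for i
  using that uvec_closed[OF that] unit[of l i] by (simp add: uvec_def)
 ultimately show ?thesis by blast
qed

text \<open>Lifting along an additive and \<open>H\<close>-homogeneous relation instead of a
  surjective map. One statement thus serves surjections of modules, choices of cocycles up to
  coboundaries, and the relations induced by derived morphisms.\<close>

lemma free_lift: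
 assumes M: "left_module H M" and L: "left_module H L" and ph: "ph : module_maps H (free H l) L"
  and dom: "!!a y. R a y ==> a : carrier M" and zero: "R (zr M) (zr L)"
  and add: "!!a b y z. [|R a y; R b z|] ==> R (a +[M] b) (y +[L] z)"
  and smult: "!!c a y. [|c : carrier H; R a y|] ==> R (c *[M] a) (c *[L] y)"
  and ex: "!!x. x : carrier (free H l) ==> EX a. R a (ph x)"
 shows "EX ps:module_maps H (free H l) M. ALL x:carrier (free H l). R (ps x) (ph x)"
proof -
 have "ALL i. EX a. i < l --> R a (ph (uvec H i))" using ex uvec_closed by blast
 then obtain x where x: "!!i. i < l ==> R (x i) (ph (uvec H i))" by metis
 obtain ps where ps: "ps : module_maps H (free H l) M" "!!i. i < l ==> ps (uvec H i) = x i"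
  using free_hom_ex[OF M, of l x] x dom by blast
 interpret F: left_module H "free H l" by (rule free_left_module)
 have "R (ps y) (ph y)" if "y : carrier (free H l)" for y
  using that
 proof (rule free_induct)
  show "R (ps (zr (free H l))) (ph (zr (free H l)))"
   using zero maps_zero[OF ps(1) free_left_module M] maps_zero[OF ph free_left_module L] by simp
  fix y a i assume y: "y : carrier (free H l)" "R (ps y) (ph y)" "a : carrier H" "i < l"
  note e = uvec_closed[OF y(4)]
  note ae = F.act_closed[OF y(3) e]
  show "R (ps (y +[free H l] a *[free H l] uvec H i))
    (ph (y +[free H l] a *[free H l] uvec H i))"
   unfolding mapsD(2)[OF ps(1) y(1) ae] mapsD(2)[OF ph y(1) ae]
    mapsD(3)[OF ps(1) y(3) e] mapsD(3)[OF ph y(3) e] ps(2)[OF y(4)]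
   by (rule add[OF y(2) smult[OF y(3) x[OF y(4)]]])
 qed
 then show ?thesis using ps(1) by blast
qed

lemma free_projective: "projective_module H (free H l)"
 unfolding projective_module_def
proof (intro conjI ballI impI)
 fix M N g f assume M: "M : Ob (fgmod H)" "N : Ob (fgmod H)" and g: "g : module_maps H M N"
  and f: "f : module_maps H (free H l) N" and s: "g ` carrier M = carrier N"
 interpret M: left_module H M using M by simp
 let ?R = "%a y. a : carrier M & y = g a"
 have "EX ps:module_maps H (free H l) M. ALL x:carrier (free H l). ?R (ps x) (f x)"
 proof (rule free_lift[where L = N])
  show "EX a. ?R a (f x)" if "x : carrier (free H l)" for x
   using mapsD(1)[OF f that] s by (metis image_iff)
 qed (use M f mapsD[OF g] maps_zero[OF g] M.act_closed in auto)
 then obtain ps where ps: "ps : module_maps H (free H l) M" "!!x. x : carrier (free H l) ==> f x = g (ps x)" by blast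
 have "cmp (fgmod H) (free H l) M N g ps = f"
  using ps(2) mapsD(4)[OF f] by (auto simp: fun_eq_iff)
 then show "EX h:module_maps H (free H l) M. cmp (fgmod H) (free H l) M N g h = f" using ps(1) by blast
qed (rule free_ob)

lemma map_range_submodule:
 assumes g: "g : module_maps H M N" and M: "left_module H M" and N: "left_module H N"
 shows "submodule (g ` carrier M) H N"
proof (rule submoduleI[OF N])
 interpret M: left_module H M by fact
 note g' = mapsD[OF g]
 show "g ` carrier M <= carrier N" using g' by auto
 show "zr N : g ` carrier M" using maps_zero[OF g M N] M.M.zero_closed by (metis imageI)
 show "x +[N] y : g ` carrier M" if "x : g ` carrier M" "y : g ` carrier M" for x y
  using that g'(2) M.M.a_closed by (metis (no_types, lifting) image_iff)
 show "a *[N] x : g ` carrier M" if "a : carrier H" "x : g ` carrier M" for a x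
  using that g'(3) M.act_closed by (metis (no_types, lifting) image_iff)
qed

lemma free_cover:
 assumes N: "N : Ob (fgmod H)"
 obtains l \<pi> where "\<pi> : module_maps H (free H l) N" "\<pi> ` carrier (free H l) = carrier N"
proof -
 have M: "left_module H N" using N by simp
 obtain A where A: "finite A" "A <= carrier N" "!!W. [|submodule W H N; A <= W|] ==> W = carrier N"
  using N by (auto simp: fin_generated_def)
 obtain l and x :: "nat => _" where x: "A = x ` {..<l}"
  using A(1) finite_imp_nat_seg_image_inj_on[of A] by (metis lessThan_def)
 obtain \<pi> where \<pi>: "\<pi> : module_maps H (free H l) N" "!!i. i < l ==> \<pi> (uvec H i) = x i"
  using free_hom_ex[OF M, of l x] A(2) unfolding x by blast
 have "x i : \<pi> ` carrier (free H l)" if "i < l" for i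
  using \<pi>(2)[OF that] uvec_closed[OF that] by (metis imageI)
 then have "\<pi> ` carrier (free H l) = carrier N"
  using A(3)[OF map_range_submodule[OF \<pi>(1) free_left_module M]] x by auto
 then show thesis using that \<pi>(1) by blast
qed

text \<open>A projective module is a retract of a free one: the lift is made on the free cover and
  pulled back along the section \<open>\<sigma>\<close>.\<close>

lemma projective_lift:
 assumes N: "projective_module H N" and M: "left_module H M" and L: "left_module H L" and ph: "ph : module_maps H N L"
  and dom: "!!a y. R a y ==> a : carrier M" and zero: "R (zr M) (zr L)"
  and add: "!!a b y z. [|R a y; R b z|] ==> R (a +[M] b) (y +[L] z)"
  and smult: "!!c a y. [|c : carrier H; R a y|] ==> R (c *[M] a) (c *[L] y)"
  and ex: "!!x. x : carrier N ==> EX a. R a (ph x)"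
 obtains ps where "ps : module_maps H N M" "!!x. x : carrier N ==> R (ps x) (ph x)"
proof -
 have Nm: "N : Ob (fgmod H)" using N by (simp add: projective_module_def)
 obtain l \<pi> where \<pi>: "\<pi> : module_maps H (free H l) N" "\<pi> ` carrier (free H l) = carrier N"
  by (rule free_cover[OF Nm])
 have "(\<lambda>x\<in>carrier N. x) : module_maps H N N" using A.idm_closed[OF Nm] by simp
 then obtain \<sigma> where \<sigma>: "\<sigma> : module_maps H N (free H l)"
  "cmp (fgmod H) N (free H l) N \<pi> \<sigma> = (\<lambda>x\<in>carrier N. x)"
  using N Nm free_ob[of l] \<pi> unfolding projective_module_def by blast
 have \<sigma>': "\<pi> (\<sigma> x) = x" if "x : carrier N" for x using fun_cong[OF \<sigma>(2), of x] that by simp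
 have c: "(\<lambda>x\<in>carrier (free H l). ph (\<pi> x)) : module_maps H (free H l) L"
  by (rule module_maps_comp[OF free_left_module \<pi>(1) ph])
 have "EX ps:module_maps H (free H l) M. ALL x:carrier (free H l). R (ps x) ((\<lambda>x\<in>carrier (free H l). ph (\<pi> x)) x)"
  by (rule free_lift[OF M L c dom zero add smult]) (use ex mapsD(1)[OF \<pi>(1)] in auto)
 then obtain ps where ps: "ps : module_maps H (free H l) M" "!!x. x : carrier (free H l) ==> R (ps x) (ph (\<pi> x))" by auto
 have "(\<lambda>x\<in>carrier N. ps (\<sigma> x)) : module_maps H N M"
  using module_maps_comp[OF _ \<sigma>(1) ps(1)] Nm by simp
 moreover have "R ((\<lambda>x\<in>carrier N. ps (\<sigma> x)) x) (ph x)" if "x : carrier N" for x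
  using ps(2)[of "\<sigma> x"] \<sigma>'[OF that] mapsD(1)[OF \<sigma>(1) that] that by simp
 ultimately show thesis by (rule that)
qed

end

section \<open>Complexes with projective cohomology in one degree\<close>

text \<open>The zero modules off degree \<open>n\<close> are \<open>N\<close> with its carrier cut
  down to \<open>{zr N}\<close>, so that zero and the operations are those of \<open>N\<close> in
  every degree.\<close>

definition stalk :: "int => 'h hmodule => 'h cplx" where
 "stalk n N = (|cob = (%i. if i = n then N else N(|carrier := {zr N}|)),
   dif = (%i. \<lambda>x\<in>(if i = n then carrier N else {zr N}). zr N)|)"

definition stalk_map :: "int => 'h hmodule => 'h cplx => 'h hmap => int => 'h hmap" where
 "stalk_map n N X mu = (%i. if i = n then mu else (\<lambda>x\<in>{zr N}. zr (cob X i)))"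

lemma stalk_simps [simp]:
 "carrier (cob (stalk n N) i) = (if i = n then carrier N else {zr N})"
 "zr (cob (stalk n N) i) = zr N" "cob (stalk n N) n = N"
 "dif (stalk n N) i = (\<lambda>x\<in>(if i = n then carrier N else {zr N}). zr N)"
 by (auto simp: stalk_def)

context fd_algebra_over
begin

interpretation H: ring H using fd by (simp add: fd_algebra_def)

lemma zero_map:
 assumes "left_module H M" "left_module H L" shows "(\<lambda>x\<in>carrier M. zr L) : module_maps H M L"
proof -
 interpret M: left_module H M by fact
 interpret L: left_module H L by fact
 show ?thesis unfolding module_maps_def using left_module_zero[OF assms(2)] by (auto simp: M.act_closed)
qed

lemma zero_module:
 assumes N: "N : Ob (fgmod H)"
 shows "N(|carrier := {zr N}|) : Ob (fgmod H)" "zero_object (fgmod H) (N(|carrier := {zr N}|))"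
proof -
 have M: "left_module H N" using N by simp
 interpret N: left_module H N by (rule M)
 have "submodule {zr N} H N" by (rule submoduleI[OF M]) (auto simp: left_module_zero[OF M])
 note m = submodule_left_module[OF M this]
 have "W = {zr N}" if "submodule W H (N(|carrier := {zr N}|))" for W
 proof -
  interpret W: submodule W H "N(|carrier := {zr N}|)" by (rule that)
  show ?thesis using W.subset W.one_closed by auto
 qed
 then show o: "N(|carrier := {zr N}|) : Ob (fgmod H)"
  using m by (auto simp: fin_generated_def intro!: exI[of _ "{}"])
 show "zero_object (fgmod H) (N(|carrier := {zr N}|))"
  unfolding zero_object_def using o by (auto simp: fun_eq_iff)
qed

lemma stalk_ob: "N : Ob (fgmod H) ==> cob (stalk n N) i : Ob (fgmod H)"
 using zero_module(1)[of N] by (auto simp: stalk_def)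

lemma stalk_complex: assumes N: "N : Ob (fgmod H)" shows "stalk n N : complexes"
 unfolding bounded_complexes_def
proof (intro CollectI conjI allI)
 note o = stalk_ob[OF N, of n]
 fix i
 show "cob (stalk n N) i : Ob (fgmod H)" by (rule o)
 have "(\<lambda>x\<in>carrier (cob (stalk n N) i). zr (cob (stalk n N) (i + 1))) : module_maps H (cob (stalk n N) i) (cob (stalk n N) (i + 1))"
  using o[of i] o[of "i + 1"] by (intro zero_map) auto
 then show "dif (stalk n N) i : mors (fgmod H) (cob (stalk n N) i) (cob (stalk n N) (i + 1))"
  by (auto simp: fun_eq_iff restrict_def)
 have "zr N : carrier N" using N left_module_group abelian_group.axioms(1) abelian_monoid.zero_closed by auto
 then show "cmp (fgmod H) (cob (stalk n N) i) (cob (stalk n N) (i + 1)) (cob (stalk n N) (i + 2)) (dif (stalk n N) (i + 1)) (dif (stalk n N) i) =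
   zr (Mor (fgmod H) (cob (stalk n N) i) (cob (stalk n N) (i + 2)))"
  by (auto simp: fun_eq_iff)
 have "{i. ~ zero_object (fgmod H) (cob (stalk n N) i)} <= {n}" using zero_module(2)[OF N] by (auto simp: stalk_def)
 then show "finite {i. ~ zero_object (fgmod H) (cob (stalk n N) i)}" by (rule finite_subset) simp
qed

lemma stalk_cocycles:
 assumes N: "N : Ob (fgmod H)"
 shows "cocycles (stalk n N) i = (if i = n then carrier N else {zr N})" "coboundaries (stalk n N) i = {zr N}"
proof -
 have "zr N : carrier N" using N left_module_group abelian_group.axioms(1) abelian_monoid.zero_closed by auto
 then show "cocycles (stalk n N) i = (if i = n then carrier N else {zr N})" "coboundaries (stalk n N) i = {zr N}"
  by (auto simp: cocycles_def coboundaries_def)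
qed

lemma stalk_map_chain:
 assumes N: "N : Ob (fgmod H)" and X: "X : complexes"
  and mu: "mu : module_maps H N (cob X n)" "!!x. x : carrier N ==> mu x : cocycles X n"
 shows "stalk_map n N X mu : chain (stalk n N) X"
 unfolding chain_maps_def
proof (intro CollectI conjI allI)
 fix i
 have Z: "left_module H (N(|carrier := {zr N}|))" and M: "left_module H N" using N zero_module(1)[OF N] by auto
 have "(\<lambda>x\<in>{zr N}. zr (cob X i)) : module_maps H (N(|carrier := {zr N}|)) (cob X i)"
  using zero_map[OF Z cob_module[OF X, of i]] by simp
 then show "stalk_map n N X mu i : mors (fgmod H) (cob (stalk n N) i) (cob X i)"
  using mu(1) by (auto simp: stalk_map_def stalk_def)
 have z: "mu (zr N) = zr (cob X n)" by (rule maps_zero[OF mu(1) M cob_module[OF X]])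
 have d: "dif X i (zr (cob X i)) = zr (cob X (i + 1))" by (rule maps_zero[OF dif_map[OF X] cob_module[OF X] cob_module[OF X]])
 have e: "dif X n (mu x) = zr (cob X (n + 1))" if "x : carrier N" for x using mu(2)[OF that] by (simp add: cocycles_def)
 show "cmp (fgmod H) (cob (stalk n N) i) (cob (stalk n N) (i + 1)) (cob X (i + 1)) (stalk_map n N X mu (i + 1)) (dif (stalk n N) i) =
   cmp (fgmod H) (cob (stalk n N) i) (cob X i) (cob X (i + 1)) (dif X i) (stalk_map n N X mu i)"
  using z d e by (auto simp: fun_eq_iff stalk_map_def)
qed

text \<open>Projectivity lifts the coboundary-valued map through the differential, and the lift is
  the homotopy; the source lives in one degree, so no further condition arises.\<close>

lemma stalk_null:
 assumes N: "projective_module H N" and X: "X : complexes" and f: "f : chain (stalk n N) X"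
  and b: "!!x. x : carrier N ==> f n x : coboundaries X n"
 shows "f : null_homotopic (fgmod H) (stalk n N) X"
proof -
 have No: "N : Ob (fgmod H)" using N by (simp add: projective_module_def)
 note S = stalk_complex[OF No, of n]
 have fn: "f n : module_maps H N (cob X n)" using chain_map_maps[OF S X f, of n] by simp
 let ?R = "%a y. a : carrier (cob X (n - 1)) & y = dif X (n - 1) a"
 note d = mapsD[OF dif_map'[OF X, of n]] maps_zero[OF dif_map'[OF X] cob_module[OF X] cob_module[OF X], of n]
 interpret P: left_module H "cob X (n - 1)" by (rule cob_module[OF X])
 obtain h where h: "h : module_maps H N (cob X (n - 1))" "!!x. x : carrier N ==> ?R (h x) (f n x)"
 proof (rule projective_lift[OF N cob_module[OF X, of "n - 1"] cob_module[OF X] fn, of ?R])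
  show "EX a. ?R a (f n x)" if "x : carrier N" for x using b[OF that] by (auto simp: coboundaries_def)
 qed (use d P.act_closed in auto)
 let ?h = "%i. if i = n then h else (\<lambda>x\<in>{zr N}. zr (cob X (i - 1)))"
 have M: "left_module H N" and Z: "left_module H (N(|carrier := {zr N}|))" using No zero_module(1)[OF No] by auto
 have hz: "h (zr N) = zr (cob X (n - 1))" by (rule maps_zero[OF h(1) M cob_module[OF X]])
 have fz: "f i (zr N) = zr (cob X i)" for i
  using maps_zero[OF chain_map_maps[OF S X f, of i] cob_module[OF S] cob_module[OF X]] by simp
 show ?thesis
 proof (rule A.null_homotopicI[OF S X f, of ?h])
  fix i
  have "(\<lambda>x\<in>{zr N}. zr (cob X (i - 1))) : module_maps H (N(|carrier := {zr N}|)) (cob X (i - 1))"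
   using zero_map[OF Z cob_module[OF X, of "i - 1"]] by simp
  then show "?h i : mors (fgmod H) (cob (stalk n N) i) (cob X (i - 1))" using h(1) by (auto simp: stalk_def)
  interpret G: abelian_group "cob X i" by (rule cob_group[OF X])
  have dz: "dif X (i - 1) (zr (cob X (i - 1))) = zr (cob X i)"
   by (rule maps_zero[OF dif_map'[OF X] cob_module[OF X] cob_module[OF X]])
  have ext: "f i x = undefined" if "x ~: carrier (cob (stalk n N) i)" for x
   using mapsD(4)[OF chain_map_maps[OF S X f] that] .
  have fc: "dif X (n - 1) (h x) +[cob X n] zr (cob X n) = dif X (n - 1) (h x)" if "x : carrier N" for x
   using mapsD(1)[OF fn that] h(2)[OF that] abelian_monoid.r_zero[of "cob X n"] cob_group[OF X, of n]
   by (simp add: abelian_group_def)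
  show "f i = cmp (fgmod H) (cob (stalk n N) i) (cob X (i - 1)) (cob X i) (dif X (i - 1)) (?h i)
   +[Mor (fgmod H) (cob (stalk n N) i) (cob X i)]
   cmp (fgmod H) (cob (stalk n N) i) (cob (stalk n N) (i + 1)) (cob X i) (?h (i + 1)) (dif (stalk n N) i)"
  proof
   fix x
   show "f i x = (cmp (fgmod H) (cob (stalk n N) i) (cob X (i - 1)) (cob X i) (dif X (i - 1)) (?h i)
    +[Mor (fgmod H) (cob (stalk n N) i) (cob X i)]
    cmp (fgmod H) (cob (stalk n N) i) (cob (stalk n N) (i + 1)) (cob X i) (?h (i + 1)) (dif (stalk n N) i)) x"
    using ext[of x] fz[of i] hz dz h(2)[of x] fc[of x] by (cases "i = n"; cases "i + 1 = n") auto
  qed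
 qed
qed

lemma stalk_class:
 assumes N: "projective_module H N" and X: "X : complexes" and f: "f : chain (stalk n N) X" "g : chain (stalk n N) X"
  and e: "!!x. x : carrier N ==> hcong X n (f n x) (g n x)"
 shows "cls (stalk n N) X f = cls (stalk n N) X g"
proof -
 have No: "N : Ob (fgmod H)" using N by (simp add: projective_module_def)
 note S = stalk_complex[OF No, of n]
 interpret G: abelian_group "Mor (complex_category (fgmod H)) (stalk n N) X" by (rule A.complex_hom_group[OF S X])
 interpret V: abelian_group "cob X n" by (rule cob_group[OF X])
 let ?n = "f -[Mor (complex_category (fgmod H)) (stalk n N) X] g"
 have nc: "?n : chain (stalk n N) X" using G.minus_closed[of f g] f by simp
 have s: "?n +[Mor (complex_category (fgmod H)) (stalk n N) X] g = f"
 proof -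
  have "f : mors (complex_category (fgmod H)) (stalk n N) X" "g : mors (complex_category (fgmod H)) (stalk n N) X" using f by auto
  then show ?thesis by (simp add: G.minus_eq G.a_assoc G.l_neg del: A.complex_simps)
 qed
 have "?n n x : coboundaries X n" if x: "x : carrier N" for x
 proof -
  have c: "?n n x : carrier (cob X n)" "g n x : carrier (cob X n)"
   using mapsD(1)[OF chain_map_maps[OF S X nc, of n], of x] mapsD(1)[OF chain_map_maps[OF S X f(2), of n], of x] x by auto
  have "?n n x +[cob X n] g n x = f n x" using fun_cong[OF fun_cong[OF s, of n], of x] x by simp
  then have "?n n x = f n x -[cob X n] g n x" using c V.minus_eq V.a_assoc V.r_neg by (metis V.a_inv_closed V.r_zero)
  then show ?thesis using e[OF x] by (simp add: hcong_def)
 qed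
 then have "?n : null_homotopic (fgmod H) (stalk n N) X" by (rule stalk_null[OF N X nc])
 then have "f : cls (stalk n N) X g"
  unfolding A.homotopy_class_iff[OF S X f(2)] using s by (intro bexI[of _ ?n]) auto
 then show ?thesis by (rule A.homotopy_class_eq[OF S X f(2)])
qed

text \<open>The cohomology of \<open>X\<close> is a projective module \<open>N\<close>, in degree
  \<open>n\<close> only. The map \<open>nu\<close> chooses cocycle representatives linearly, and
  through it the stalk complex of \<open>N\<close> is quasi-isomorphic to \<open>X\<close>.\<close>

definition rep :: "int => 'h hmodule => 'h cplx => 'h hmap => bool" where
 "rep n N X nu \<longleftrightarrow> projective_module H N & nu : module_maps H N (cob X n) & (ALL x:carrier N. nu x : cocycles X n) &
   (ALL x:carrier N. nu x : coboundaries X n --> x = zr N) &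
   (ALL y:cocycles X n. EX x:carrier N. hcong X n (nu x) y) & (ALL i. i ~= n --> cocycles X i <= coboundaries X i)"

lemma repD:
 assumes "rep n N X nu"
 shows "projective_module H N" "nu : module_maps H N (cob X n)" "!!x. x : carrier N ==> nu x : cocycles X n"
  "!!x. [|x : carrier N; nu x : coboundaries X n|] ==> x = zr N"
  "!!y. y : cocycles X n ==> EX x:carrier N. hcong X n (nu x) y"
  "!!i x. [|i ~= n; x : cocycles X i|] ==> x : coboundaries X i" "N : Ob (fgmod H)"
 using assms by (auto simp: rep_def projective_module_def)

lemma rep_stalk: assumes "projective_module H N" shows "rep n N (stalk n N) (\<lambda>x\<in>carrier N. x)"
proof -
 have No: "N : Ob (fgmod H)" using assms by (simp add: projective_module_def)
 have "EX x:carrier N. hcong (stalk n N) n ((\<lambda>x\<in>carrier N. x) x) y" if "y : carrier N" for y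
  by (rule bexI[OF _ that]) (use that hcong_refl[OF stalk_complex[OF No], of y n n] in \<open>simp add: stalk_cocycles[OF No]\<close>)
 then show ?thesis unfolding rep_def
  using assms A.idm_closed[OF No] hcong_refl[OF stalk_complex[OF No]] by (auto simp: stalk_cocycles[OF No])
qed

context
 fixes n N Q nu X assumes Q: "Q : complexes" and r: "rep n N Q nu" and X: "X : complexes"
begin

lemma rep_inj:
 assumes c: "x : carrier N" "x' : carrier N" and h: "hcong Q n (nu x) (nu x')" shows "x = x'"
proof -
 note R = repD[OF r]
 interpret V: abelian_group "cob Q n" by (rule cob_group[OF Q])
 interpret W: left_module H N using R(7) by simp
 have "nu (x -[N] x') = nu x -[cob Q n] nu x'"
  using c mapsD(2)[OF R(2)] module_maps_minus[OF R(2) W.left_module_axioms cob_module[OF Q]]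
  by (simp add: W.M.minus_eq V.minus_eq)
 then have "nu (x -[N] x') : coboundaries Q n" using h by (simp add: hcong_def)
 then have "x -[N] x' = zr N" using R(4) c by blast
 then show ?thesis using c W.M.minus_eq W.M.minus_equality W.M.minus_minus by (metis W.M.a_inv_closed)
qed

lemma rep_class:
 assumes f: "f : chain (stalk n N) Q" and e: "!!x. x : carrier N ==> hcong Q n (f n x) (nu x)"
 shows "cls (stalk n N) Q f = cls (stalk n N) Q (stalk_map n N Q nu)" "qprop (stalk n N) Q f"
proof -
 note R = repD[OF r]
 note S = stalk_complex[OF R(7), of n] and m = stalk_map_chain[OF R(7) Q R(2,3)]
 show c: "cls (stalk n N) Q f = cls (stalk n N) Q (stalk_map n N Q nu)"
  by (rule stalk_class[OF R(1) Q f m]) (use e in \<open>auto simp: stalk_map_def\<close>)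
 have "qprop (stalk n N) Q (stalk_map n N Q nu)"
  unfolding qprop_def
 proof (intro allI conjI ballI impI)
  fix i x x' assume x: "x : cocycles (stalk n N) i" "x' : cocycles (stalk n N) i"
   "hcong Q i (stalk_map n N Q nu i x) (stalk_map n N Q nu i x')"
  have "x = x'"
  proof (cases "i = n")
   case True
   then have c: "x : carrier N" "x' : carrier N" and h: "hcong Q n (nu x) (nu x')"
    using x by (auto simp: stalk_cocycles[OF R(7)] stalk_map_def)
   show ?thesis by (rule rep_inj[OF c h])
  qed (use x in \<open>auto simp: stalk_cocycles[OF R(7)]\<close>)
  then show "hcong (stalk n N) i x x'" using hcong_refl[OF S x(1)] by simp
 next
  fix i y assume y: "y : cocycles Q i"
  show "EX x:cocycles (stalk n N) i. hcong Q i (stalk_map n N Q nu i x) y"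
  proof (cases "i = n")
   case True
   then show ?thesis using y R(5) by (auto simp: stalk_cocycles[OF R(7)] stalk_map_def)
  next
   case False
   then have "hcong Q i y (zr (cob Q i))" using hcong_zero_iff[OF Q] R(6) y by blast
   then show ?thesis using False hcong_sym[OF Q] by (auto simp: stalk_cocycles[OF R(7)] stalk_map_def)
  qed
 qed
 then show "qprop (stalk n N) Q f"
  using qprop_class[OF S Q class_mors[OF S Q m], of "stalk_map n N Q nu" f] A.class_self[OF S Q m]
   A.class_self[OF S Q f] c by simp
qed

text \<open>By projectivity \<open>nu\<close> lifts through the quasi-isomorphism of any roof, so
  the stalk complex of \<open>N\<close> refines both roofs. Over the stalk, chain maps that agree on
  cohomology are homotopic.\<close>

lemma rep_hom_unique:
 assumes al: "al : mors (Der H) Q X" and be: "be : mors (Der H) Q X"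
  and e: "!!x. x : carrier N ==> EX y. hmap_rel n Q X al (nu x) y & hmap_rel n Q X be (nu x) y"
 shows "al = be"
proof -
 note R = repD[OF r]
 note S = stalk_complex[OF R(7), of n]
 have lift: "EX a0 a. a0 : chain (stalk n N) U & a = cls (stalk n N) U a0 & (ALL x:carrier N. a0 n x : cocycles U n & hcong Q n (s0 n (a0 n x)) (nu x))"
  if U: "U : complexes" and s0: "s0 : chain U Q" "qprop U Q s0" for U s0
 proof -
  let ?R = "%a y. a : cocycles U n & hcong Q n (s0 n a) y"
  note m = mapsD[OF chain_map_maps[OF U Q s0(1), of n]] maps_zero[OF chain_map_maps[OF U Q s0(1), of n] cob_module[OF U] cob_module[OF Q]]
  obtain u where u: "u : module_maps H N (cob U n)" "!!x. x : carrier N ==> ?R (u x) (nu x)"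
  proof (rule projective_lift[OF R(1) cob_module[OF U, of n] cob_module[OF Q, of n] R(2), of ?R])
   show "EX a. ?R a (nu x)" if "x : carrier N" for x using qprop_surj[OF s0(2) R(3)[OF that]] by blast
   show "?R (zr (cob U n)) (zr (cob Q n))" using cocycles_closed(1)[OF U] m(5) hcong_refl[OF Q cocycles_closed(1)[OF Q]] by simp
   show "?R (a +[cob U n] b) (y +[cob Q n] z)" if "?R a y" "?R b z" for a b y z
    using that cocycles_closed(2)[OF U] m(2) coc_carrier[OF U] hcong_add[OF Q] by simp
   show "?R (c *[cob U n] a) (c *[cob Q n] y)" if "c : carrier H" "?R a y" for c a y
    using that cocycles_closed(3)[OF U] m(3) coc_carrier[OF U] hcong_smult[OF Q] by simp
  qed (use coc_carrier[OF U] in auto)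
  have "stalk_map n N U u : chain (stalk n N) U" using stalk_map_chain[OF R(7) U u(1)] u(2) by blast
  then show ?thesis using u(2) by (intro exI[of _ "stalk_map n N U u"]) (auto simp: stalk_map_def)
 qed
 have eq: "roof_equiv kb qis Q X p q"
  if p: "p : roofs kb qis Q X" and q: "q : roofs kb qis Q X"
   and e: "!!x. x : carrier N ==> EX y. hrel n Q X p (nu x) y & hrel n Q X q (nu x) y" for p q
 proof -
  obtain U s f s0 f0 where P: "p = (U, s, f)" "U : complexes" "s : mors kb U Q" "f : mors kb U X"
   "s0 : s" "f0 : f" "s0 : chain U Q" "f0 : chain U X" "qprop U Q s0" using roofE[OF Q X p] .
  obtain V t g t0 g0 where P': "q = (V, t, g)" "V : complexes" "t : mors kb V Q" "g : mors kb V X"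
   "t0 : t" "g0 : g" "t0 : chain V Q" "g0 : chain V X" "qprop V Q t0" using roofE[OF Q X q] .
  obtain a0 a where a: "a0 : chain (stalk n N) U" "a = cls (stalk n N) U a0"
   "!!x. x : carrier N ==> a0 n x : cocycles U n & hcong Q n (s0 n (a0 n x)) (nu x)" using lift[OF P(2,7,9)] by blast
  obtain b0 b where b: "b0 : chain (stalk n N) V" "b = cls (stalk n N) V b0"
   "!!x. x : carrier N ==> b0 n x : cocycles V n & hcong Q n (t0 n (b0 n x)) (nu x)" using lift[OF P'(2,7,9)] by blast
  have sc: "s = cls U Q s0" "f = cls U X f0" "t = cls V Q t0" "g = cls V X g0"
   using A.homotopy_mors_class(2)[OF P(2) Q P(3,5)] A.homotopy_mors_class(2)[OF P(2) X P(4,6)]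
    A.homotopy_mors_class(2)[OF P'(2) Q P'(3,5)] A.homotopy_mors_class(2)[OF P'(2) X P'(4,6)] by auto
  note c1 = compose_chain[OF S P(2) Q a(1) P(7)] and c2 = compose_chain[OF S P'(2) Q b(1) P'(7)]
   and c3 = compose_chain[OF S P(2) X a(1) P(8)] and c4 = compose_chain[OF S P'(2) X b(1) P'(8)]
  have ap: "compose h (stalk n N) k n x = h n (k n x)" if "x : carrier N" for h k x
   using that by (simp add: compose_def)
  note k1 = rep_class[OF c1(1)] and k2 = rep_class[OF c2(1)]
  have "cls (stalk n N) X (compose f0 (stalk n N) a0) = cls (stalk n N) X (compose g0 (stalk n N) b0)"
  proof (rule stalk_class[OF R(1) X c3(1) c4(1)])
   fix x assume x: "x : carrier N"
   obtain y where y: "hrel n Q X p (nu x) y" "hrel n Q X q (nu x) y" using e[OF x] by blast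
   obtain w where w: "w : cocycles U n" "hcong Q n (s0 n w) (nu x)" "hcong X n (f0 n w) y"
    using y(1) unfolding P(1) hrel_iff[OF Q X P(2,3,5,4,6)] by blast
   obtain v where v: "v : cocycles V n" "hcong Q n (t0 n v) (nu x)" "hcong X n (g0 n v) y"
    using y(2) unfolding P'(1) hrel_iff[OF Q X P'(2,3,5,4,6)] by blast
   have "hcong U n (a0 n x) w"
    using qprop_inj[OF P(9) _ w(1)] a(3)[OF x] hcong_trans[OF Q _ hcong_sym[OF Q w(2)]] by blast
   moreover have "hcong V n (b0 n x) v"
    using qprop_inj[OF P'(9) _ v(1)] b(3)[OF x] hcong_trans[OF Q _ hcong_sym[OF Q v(2)]] by blast
   ultimately have "hcong X n (f0 n (a0 n x)) y" "hcong X n (g0 n (b0 n x)) y"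
    using hcong_trans[OF X chain_map_hcong[OF P(2) X P(8)] w(3)] hcong_trans[OF X chain_map_hcong[OF P'(2) X P'(8)] v(3)] by auto
   then show "hcong X n (compose f0 (stalk n N) a0 n x) (compose g0 (stalk n N) b0 n x)"
    unfolding ap[OF x] using hcong_trans[OF X _ hcong_sym[OF X]] by blast
  qed
  then have 1: "cmp kb (stalk n N) U X f a = cmp kb (stalk n N) V X g b" using c3(2) c4(2) sc a(2) b(2) by simp
  have "cls (stalk n N) Q (compose s0 (stalk n N) a0) = cls (stalk n N) Q (compose t0 (stalk n N) b0)"
   using k1(1) k2(1) ap a(3) b(3) by simp
  then have 2: "cmp kb (stalk n N) U Q s a = cmp kb (stalk n N) V Q t b" using c1(2) c2(2) sc a(2) b(2) by simp
  have am: "a : mors kb (stalk n N) U" "b : mors kb (stalk n N) V"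
   using class_mors[OF S P(2) a(1)] class_mors[OF S P'(2) b(1)] a(2) b(2) by auto
  have "cmp kb (stalk n N) U Q s a : qis (stalk n N) Q"
   using qis_iff[OF S Q class_mors[OF S Q c1(1)] A.class_self[OF S Q c1(1)]] k1(2) ap a(3) c1(2) sc a(2) by simp
  then show ?thesis unfolding roof_equiv_def P(1) P'(1) prod.case A.homotopy_Ob using 1 2 am S by blast
 qed
 obtain p where p: "p : roofs kb qis Q X" "al = roof_class kb qis Q X p" using al derived_mors[OF Q X] by blast
 obtain q where q: "q : roofs kb qis Q X" "be = roof_class kb qis Q X q" using be derived_mors[OF Q X] by blast
 have pa: "p : al" "q : be" using p q roof_equiv_refl[OF Q X] by (auto simp: roof_class_def)
 have iff: "hmap_rel n Q X al x y \<longleftrightarrow> hrel n Q X p x y" "hmap_rel n Q X be x y \<longleftrightarrow> hrel n Q X q x y" for x y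
  using derived_morsD(3)[OF Q X al pa(1)] derived_morsD(3)[OF Q X be pa(2)] by auto
 \<comment> \<open>Equality of the classes asks for more than equivalence of \<open>p\<close> and
   \<open>q\<close>. Transitivity is replaced by applying \<open>eq\<close> directly to the other
   roof and \<open>t\<close>, whose actions agree.\<close>
 have "roof_equiv kb qis Q X p t \<longleftrightarrow> roof_equiv kb qis Q X q t" if t: "t : roofs kb qis Q X" for t
 proof -
  have *: "roof_equiv kb qis Q X q' t"
   if "p' : roofs kb qis Q X" "q' : roofs kb qis Q X" "roof_equiv kb qis Q X p' t"
    and e': "!!x. x : carrier N ==> EX y. hrel n Q X p' (nu x) y & hrel n Q X q' (nu x) y" for p' q'
   by (rule eq[OF that(2) t]) (use e' hrel_equiv[OF Q X that(1) t that(3)] in blast)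
  show ?thesis using *[OF p(1) q(1)] *[OF q(1) p(1)] e iff by blast
 qed
 then show ?thesis unfolding p(2) q(2) roof_class_def by blast
qed

text \<open>The roof has the stalk complex as its apex, with \<open>nu\<close> as quasi-isomorphism
  and \<open>mu\<close> as numerator.\<close>

lemma rep_hom_exists:
 assumes mu: "mu : module_maps H N (cob X n)" "!!x. x : carrier N ==> mu x : cocycles X n"
 obtains al where "al : mors (Der H) Q X" "!!x. x : carrier N ==> hmap_rel n Q X al (nu x) (mu x)"
proof -
 note R = repD[OF r]
 note S = stalk_complex[OF R(7), of n]
 note m = stalk_map_chain[OF R(7) Q R(2,3)] and m' = stalk_map_chain[OF R(7) X mu]
 let ?s = "cls (stalk n N) Q (stalk_map n N Q nu)" and ?f = "cls (stalk n N) X (stalk_map n N X mu)"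
 have q: "qprop (stalk n N) Q (stalk_map n N Q nu)"
  by (rule rep_class(2)[OF m]) (use R(3) hcong_refl[OF Q] in \<open>auto simp: stalk_map_def\<close>)
 note sm = class_mors[OF S Q m] A.class_self[OF S Q m] and fm = class_mors[OF S X m'] A.class_self[OF S X m']
 have rf: "(stalk n N, ?s, ?f) : roofs kb qis Q X"
  using q qis_iff[OF S Q sm] sm fm S by (simp add: roofs_def)
 let ?al = "roof_class kb qis Q X (stalk n N, ?s, ?f)"
 have al: "?al : mors (Der H) Q X" using rf derived_mors[OF Q X] by blast
 have "(stalk n N, ?s, ?f) : ?al" using rf roof_equiv_refl[OF Q X rf] by (simp add: roof_class_def)
 then have "hmap_rel n Q X ?al (nu x) (mu x)" if x: "x : carrier N" for x
  using derived_morsD(3)[OF Q X al] hrel_iff[OF Q X S sm fm] x hcong_refl[OF Q R(3)[OF x]] hcong_refl[OF X mu(2)[OF x]]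
  by (auto simp: stalk_cocycles[OF R(7)] stalk_map_def intro!: bexI[of _ x])
 then show thesis using that al by blast
qed

end

lemma hmap_rel_zero:
 assumes X: "X : complexes" and Y: "Y : complexes" and al: "al : mors (Der H) X Y"
 shows "hmap_rel n X Y al (zr (cob X n)) (zr (cob Y n))"
proof -
 obtain y where y: "hmap_rel n X Y al (zr (cob X n)) y"
  using hmap_rel_props(3)[OF X Y al cocycles_closed(1)[OF X]] by blast
 have "hmap_rel n X Y al (zr H *[cob X n] zr (cob X n)) (zr H *[cob Y n] y)"
  by (rule hmap_rel_props(6)[OF X Y al y]) simp
 moreover have "zr (cob X n) : carrier (cob X n)" "y : carrier (cob Y n)"
  using hmap_rel_props(1)[OF X Y al y] coc_carrier[OF X] coc_carrier[OF Y] by auto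
 ultimately show ?thesis using left_module_null[OF cob_module[OF X]] left_module_null[OF cob_module[OF Y]] by simp
qed

context
 fixes X Y al be assumes X: "X : complexes" and Y: "Y : complexes"
  and iso: "is_inverse (Der H) X Y al be"
begin

lemma derived_inverse_mors: "al : mors (Der H) X Y" "be : mors (Der H) Y X"
 using iso by (auto simp: is_inverse_def)

lemma derived_inverse_rel: "hmap_rel n X Y al x y \<longleftrightarrow> hmap_rel n Y X be y x"
proof -
 have *: "hmap_rel n Y X be y x"
  if X: "X : complexes" and Y: "Y : complexes" and i: "is_inverse (Der H) X Y al be" and h: "hmap_rel n X Y al x y"
  for X Y al be x y
 proof -
  have m: "al : mors (Der H) X Y" "be : mors (Der H) Y X"
   and e: "cmp (Der H) X Y X be al = idm (Der H) X"
   using i by (auto simp: is_inverse_def)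
  obtain z where z: "hmap_rel n Y X be y z"
   using hmap_rel_props(3)[OF Y X m(2)] hmap_rel_props(1)[OF X Y m(1) h] by blast
  then have "hmap_rel n X X (cmp (Der H) X Y X be al) x z"
   using hmap_rel_cmp[OF X Y X m] h e hmap_rel_id(1)[OF X] by auto
  then have "hcong X n x z" using e hmap_rel_id(2)[OF X] by simp
  moreover have "hcong Y n y y" using hcong_refl[OF Y] hmap_rel_props(1)[OF X Y m(1) h] by blast
  ultimately show ?thesis using hmap_rel_props(2)[OF Y X m(2) z] hcong_sym[OF X] by blast
 qed
 have "is_inverse (Der H) Y X be al" using iso by (auto simp: is_inverse_def)
 then show ?thesis using *[OF X Y iso] *[OF Y X] by blast
qed

lemma derived_inverse_hcong:
 assumes h: "hmap_rel n X Y al x y" "hmap_rel n X Y al x' y'" shows "hcong X n x x' \<longleftrightarrow> hcong Y n y y'"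
proof
 note m = derived_inverse_mors
 assume "hcong X n x x'"
 then have "hmap_rel n X Y al x' y"
  using hmap_rel_props(2)[OF X Y m(1) h(1)] hcong_refl[OF Y] hmap_rel_props(1)[OF X Y m(1) h(1)] by blast
 then show "hcong Y n y y'" using hmap_rel_props(4)[OF X Y m(1)] h(2) by blast
next
 note m = derived_inverse_mors
 assume c: "hcong Y n y y'"
 note h' = h[unfolded derived_inverse_rel]
 have "hmap_rel n Y X be y' x"
  using hmap_rel_props(2)[OF Y X m(2) h'(1) c] hcong_refl[OF X] hmap_rel_props(1)[OF X Y m(1) h(1)] by blast
 then show "hcong X n x x'" using hmap_rel_props(4)[OF Y X m(2)] h'(2) by blast
qed

text \<open>An isomorphism matches cocycles modulo coboundaries; projectivity of \<open>N\<close>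
  selects a module map inside this relation.\<close>

lemma rep_iso:
 assumes r: "rep n N X nu" shows "EX nu'. rep n N Y nu'"
proof -
 note R = repD[OF r] and m = derived_inverse_mors
 note p = hmap_rel_props[OF X Y m(1)]
 obtain nu' where v: "nu' : module_maps H N (cob Y n)" "!!x. x : carrier N ==> hmap_rel n X Y al (nu x) (nu' x)"
 proof (rule projective_lift[OF R(1) cob_module[OF Y, of n] cob_module[OF X, of n] R(2), of "%a y. hmap_rel n X Y al y a"])
  show "EX a. hmap_rel n X Y al (nu x) a" if "x : carrier N" for x using p(3)[OF R(3)[OF that]] .
  show "hmap_rel n X Y al (zr (cob X n)) (zr (cob Y n))" by (rule hmap_rel_zero[OF X Y m(1)])
  show "a : carrier (cob Y n)" if "hmap_rel n X Y al y a" for a y using p(1)[OF that] coc_carrier[OF Y] by blast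
 qed (use p(5,6) in auto)
 have "rep n N Y nu'" unfolding rep_def
 proof (intro conjI ballI impI allI subsetI R(1) v(1))
  fix x assume x: "x : carrier N"
  show "nu' x : cocycles Y n" using p(1) v(2)[OF x] by blast
  assume "nu' x : coboundaries Y n"
  then have "hcong X n (nu x) (zr (cob X n))"
   using derived_inverse_hcong[OF v(2)[OF x] hmap_rel_zero[OF X Y m(1)]] hcong_zero_iff[OF Y] by blast
  then show "x = zr N" using R(4)[OF x] hcong_zero_iff[OF X] by blast
 next
  fix y assume "y : cocycles Y n"
  then obtain z where z: "hmap_rel n X Y al z y" using hmap_rel_props(3)[OF Y X m(2)] derived_inverse_rel by blast
  obtain x where x: "x : carrier N" "hcong X n (nu x) z" using R(5) p(1)[OF z] by blast
  then show "EX x:carrier N. hcong Y n (nu' x) y" using derived_inverse_hcong[OF v(2)[OF x(1)] z] by blast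
 next
  fix i y assume i: "i ~= n" and "y : cocycles Y i"
  then obtain z where z: "hmap_rel i X Y al z y" using hmap_rel_props(3)[OF Y X m(2)] derived_inverse_rel by blast
  have "hcong X i z (zr (cob X i))" using hcong_zero_iff[OF X] R(6)[OF i] hmap_rel_props(1)[OF X Y m(1) z] by blast
  then have "hcong Y i y (zr (cob Y i))" using derived_inverse_hcong[OF z hmap_rel_zero[OF X Y m(1)]] by blast
  then show "y : coboundaries Y i" using hcong_zero_iff[OF Y] by blast
 qed
 then show ?thesis by blast
qed

end

lemma neg_zero: assumes "abelian_group G" shows "-[G] zr G = zr G"
proof -
 interpret abelian_group G by fact
 show ?thesis by (rule minus_equality) simp_all
qed

lemma fgmod_minus:
 assumes M: "M : Ob (fgmod H)" "N : Ob (fgmod H)" and f: "f : module_maps H M N"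
 shows "x : carrier M ==> (-[Mor (fgmod H) M N] f) x = -[N] f x" "-[Mor (fgmod H) M N] f : module_maps H M N"
proof -
 interpret V: module K "Mor (fgmod H) M N" by (rule A.mor_module[OF M])
 interpret N: left_module H N using M by simp
 have f': "f : mors (fgmod H) M N" using f by simp
 have c: "-[Mor (fgmod H) M N] f : mors (fgmod H) M N" by (rule V.a_inv_closed[OF f'])
 then show m: "-[Mor (fgmod H) M N] f : module_maps H M N" by simp
 have "-[Mor (fgmod H) M N] f +[Mor (fgmod H) M N] f = zr (Mor (fgmod H) M N)" by (rule V.l_neg[OF f'])
 assume x: "x : carrier M"
 from fun_cong[OF \<open>_ +[Mor (fgmod H) M N] f = _\<close>, of x] have "(-[Mor (fgmod H) M N] f) x +[N] f x = zr N" using x by simp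
 then show "(-[Mor (fgmod H) M N] f) x = -[N] f x"
  using mapsD(1)[OF m x] mapsD(1)[OF f x] by (metis N.M.minus_equality)
qed

section \<open>The shift of complexes\<close>

context
 fixes X assumes X: "X : complexes"
begin

lemma shift_dif:
 "dif (shift_complex (fgmod H) X) i : module_maps H (cob X (i + 1)) (cob X (i + 2))"
 "x : carrier (cob X (i + 1)) ==> dif (shift_complex (fgmod H) X) i x = -[cob X (i + 2)] dif X (i + 1) x"
proof -
 have "dif X (i + 1) : module_maps H (cob X (i + 1)) (cob X (i + 2))"
  using dif_map[OF X, of "i + 1"] by (simp add: add.assoc)
 note m = fgmod_minus[OF A.complexD(1)[OF X] A.complexD(1)[OF X] this]
 show "dif (shift_complex (fgmod H) X) i : module_maps H (cob X (i + 1)) (cob X (i + 2))"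
  using m(2) by (simp add: shift_complex_def)
 show "x : carrier (cob X (i + 1)) ==> dif (shift_complex (fgmod H) X) i x = -[cob X (i + 2)] dif X (i + 1) x"
  using m(1) by (simp add: shift_complex_def)
qed

lemma shift_cob: "cob (shift_complex (fgmod H) X) i = cob X (i + 1)"
 by (simp add: shift_complex_def)

lemma shift_closed: "shift_complex (fgmod H) X : complexes"
 unfolding bounded_complexes_def
proof (intro CollectI conjI allI)
 let ?S = "shift_complex (fgmod H) X"
 fix i
 show "cob ?S i : Ob (fgmod H)" unfolding shift_cob by (rule A.complexD(1)[OF X])
 show "dif ?S i : mors (fgmod H) (cob ?S i) (cob ?S (i + 1))"
  using shift_dif(1)[of i] unfolding shift_cob by (simp add: add.assoc)
 interpret M: left_module H "cob X (i + 1 + 1)" by (rule cob_module[OF X])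
 have "dif ?S (i + 1) (dif ?S i x) = zr (cob X (i + 2 + 1))" if x: "x : carrier (cob X (i + 1))" for x
 proof -
  note d = mapsD(1)[OF dif_map[OF X, of "i + 1"] x]
  have e: "dif X (i + 1 + 1) (dif X (i + 1) x) = zr (cob X (i + 1 + 2))"
   using fun_cong[OF A.complexD(3)[OF X, of "i + 1"], of x] x by simp
  note z = neg_zero[OF cob_group[OF X, of "i + 1 + 2"]]
  have "dif X (i + 1 + 1) (-[cob X (i + 1 + 1)] dif X (i + 1) x) = -[cob X (i + 1 + 2)] zr (cob X (i + 1 + 2))"
   using module_maps_minus[OF dif_map[OF X, of "i + 1 + 1"] cob_module[OF X] cob_module[OF X] d] e by (simp add: add.assoc)
  then have dz: "dif X (i + 1 + 1) (-[cob X (i + 1 + 1)] dif X (i + 1) x) = zr (cob X (i + 1 + 2))" using z by simp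
  have c: "-[cob X (i + 1 + 1)] dif X (i + 1) x : carrier (cob X (i + 1 + 1))" by (rule M.M.a_inv_closed[OF d])
  show ?thesis
   using shift_dif(2)[OF x] shift_dif(2)[OF c] dz z by (simp add: add.assoc)
 qed
 then show "cmp (fgmod H) (cob ?S i) (cob ?S (i + 1)) (cob ?S (i + 2)) (dif ?S (i + 1)) (dif ?S i) =
   zr (Mor (fgmod H) (cob ?S i) (cob ?S (i + 2)))"
  unfolding shift_cob by (auto simp: fun_eq_iff)
next
 have "{i. ~ zero_object (fgmod H) (cob (shift_complex (fgmod H) X) i)} = (%i. i - 1) ` {i. ~ zero_object (fgmod H) (cob X i)}"
  unfolding shift_cob by (auto simp: image_iff) (metis add_diff_cancel)
 then show "finite {i. ~ zero_object (fgmod H) (cob (shift_complex (fgmod H) X) i)}"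
  using X by (simp add: bounded_complexes_def)
qed

text \<open>The sign in the shifted differential changes neither kernels nor images.\<close>

lemma shift_cocycles:
 "cocycles (shift_complex (fgmod H) X) i = cocycles X (i + 1)"
 "coboundaries (shift_complex (fgmod H) X) i = coboundaries X (i + 1)"
proof -
 interpret M: left_module H "cob X (i + 2)" by (rule cob_module[OF X])
 have d: "dif X (i + 1) x : carrier (cob X (i + 2))" if "x : carrier (cob X (i + 1))" for x
  using mapsD(1)[OF dif_map[OF X, of "i + 1"] that] by (simp add: add.assoc)
 have "-[cob X (i + 2)] y = zr (cob X (i + 2)) \<longleftrightarrow> y = zr (cob X (i + 2))" if "y : carrier (cob X (i + 2))" for y
  using that M.M.minus_minus neg_zero[OF M.M.abelian_group_axioms] by metis
 then show "cocycles (shift_complex (fgmod H) X) i = cocycles X (i + 1)"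
  unfolding cocycles_def shift_cob using shift_dif(2)[of _ i] d by (intro Collect_cong) (simp add: add.assoc cong: conj_cong)
 have e: "dif (shift_complex (fgmod H) X) (i - 1) x = dif X i (-[cob X i] x)" if "x : carrier (cob X i)" for x
 proof -
  have j: "i - 1 + 2 = i + 1" by simp
  show ?thesis
   using shift_dif(2)[of x "i - 1"] module_maps_minus[OF dif_map[OF X, of i] cob_module[OF X] cob_module[OF X] that] that
   unfolding j by simp
 qed
 interpret L: left_module H "cob X i" by (rule cob_module[OF X])
 have "(%x. -[cob X i] x) ` carrier (cob X i) = carrier (cob X i)"
  using L.M.minus_minus L.M.a_inv_closed by (metis (no_types, lifting) image_eqI image_subsetI subsetI subset_antisym)
 then have "dif X i ` carrier (cob X i) = (%x. dif X i (-[cob X i] x)) ` carrier (cob X i)" by (metis image_image)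
 then show "coboundaries (shift_complex (fgmod H) X) i = coboundaries X (i + 1)"
  unfolding coboundaries_def shift_cob using e by (simp add: image_def)
qed

lemma rep_shift: "rep n N (shift_complex (fgmod H) X) nu \<longleftrightarrow> rep (n + 1) N X nu"
proof -
 have h: "hcong (shift_complex (fgmod H) X) i x y \<longleftrightarrow> hcong X (i + 1) x y" for i x y
  by (simp add: hcong_def shift_cocycles shift_cob)
 have "(ALL i. i ~= n --> cocycles X (i + 1) <= coboundaries X (i + 1)) \<longleftrightarrow> (ALL i. i ~= n + 1 --> cocycles X i <= coboundaries X i)"
  by (metis add_right_cancel diff_add_cancel)
 then show ?thesis unfolding rep_def h shift_cocycles shift_cob by simp
qed

end

end

section \<open>Powers of an automorphism\<close>

text \<open>Functors are total functions, arbitrary off the category, so laws such as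
  \<open>F (G X) = X\<close> hold on its objects and morphisms only and cannot be equations between
  records.\<close>

definition feq :: "('k, 'o, 'm) lincat => ('o, 'm, 'p, 'n) cfunctor => ('o, 'm, 'p, 'n) cfunctor => bool" where
 "feq C F F' \<longleftrightarrow> (ALL X:Ob C. fob F X = fob F' X) & (ALL X:Ob C. ALL Y:Ob C. ALL f:mors C X Y. fmor F X Y f = fmor F' X Y f)"

lemma feqD:
 assumes "feq C F F'" shows "X : Ob C ==> fob F X = fob F' X"
  "[|X : Ob C; Y : Ob C; f : mors C X Y|] ==> fmor F X Y f = fmor F' X Y f"
 using assms by (auto simp: feq_def)

lemma fcomp_simps [simp]:
 "fob (fcomp G F) X = fob G (fob F X)" "fmor (fcomp G F) X Y f = fmor G (fob F X) (fob F Y) (fmor F X Y f)"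
 by (simp_all add: fcomp_def)

lemma fid_simps [simp]: "fob fid X = X" "fmor fid X Y f = f"
 by (simp_all add: fid_def)

lemma linear_functor_comp:
 assumes "linear_functor K C C' F" "linear_functor K C' C'' G" shows "linear_functor K C C'' (fcomp G F)"
proof -
 interpret F: linear_functor K C C' F by fact
 interpret G: linear_functor K C' C'' G by fact
 show ?thesis
  by unfold_locales (simp_all add: F.fob_closed F.fmor_closed F.fmor_id F.fmor_cmp F.fmor_add F.fmor_smult
   G.fob_closed G.fmor_closed G.fmor_id G.fmor_cmp G.fmor_add G.fmor_smult)
qed

lemma automorphismD:
 assumes "automorphism K C F"
 shows "linear_functor K C C F" "X : Ob C ==> fob F X : Ob C" "bij_betw (fob F) (Ob C) (Ob C)"
  "[|X : Ob C; Y : Ob C|] ==> bij_betw (fmor F X Y) (mors C X Y) (mors C (fob F X) (fob F Y))"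
  "[|X : Ob C; Y : Ob C; f : mors C X Y|] ==> fmor F X Y f : mors C (fob F X) (fob F Y)"
 using assms linear_functor.fob_closed[of K C C F] linear_functor.fmor_closed[of K C C F]
 by (auto simp: automorphism_def fully_faithful_def)

lemma automorphism_comp:
 assumes F: "automorphism K C F" and G: "automorphism K C G" shows "automorphism K C (fcomp G F)"
 unfolding automorphism_def fully_faithful_def
proof (intro conjI ballI)
 note f = automorphismD[OF F] and g = automorphismD[OF G]
 show "linear_functor K C C (fcomp G F)" by (rule linear_functor_comp[OF f(1) g(1)])
 show "bij_betw (fob (fcomp G F)) (Ob C) (Ob C)"
  using bij_betw_trans[OF f(3) g(3)] by (simp add: comp_def fcomp_def)
 fix X Y assume X: "X : Ob C" "Y : Ob C"
 show "bij_betw (fmor (fcomp G F) X Y) (mors C X Y) (mors C (fob (fcomp G F) X) (fob (fcomp G F) Y))"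
  using bij_betw_trans[OF f(4)[OF X] g(4)[OF f(2)[OF X(1)] f(2)[OF X(2)]]] by (simp add: comp_def fcomp_def)
qed

lemma automorphism_id: "automorphism K C fid"
 unfolding automorphism_def fully_faithful_def
 by (intro conjI ballI) (auto simp: fid_def bij_betw_def inj_on_def intro!: linear_functor.intro)

lemma automorphism_fiter: "automorphism K C F ==> automorphism K C (fiter F n)"
 by (induction n) (auto intro: automorphism_id automorphism_comp)

locale category_automorphism = linear_category K C
 for K :: "'k ring" and C :: "('k, 'o, 'm) lincat" and F :: "('o, 'm, 'o, 'm) cfunctor" +
 assumes aut: "automorphism K C F"
begin

lemmas F = automorphismD[OF aut]

abbreviation G where "G == finv C F"

lemma finv_ob: "X : Ob C ==> fob G X : Ob C" "X : Ob C ==> fob F (fob G X) = X" "X : Ob C ==> fob G (fob F X) = X"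
 using F(3) by (auto simp: finv_def Let_def bij_betw_def inv_into_into f_inv_into_f inv_into_f_f)

lemma finv_mor:
 assumes X: "X : Ob C" "Y : Ob C"
 shows "f : mors C X Y ==> fmor G X Y f : mors C (fob G X) (fob G Y)"
  "f : mors C X Y ==> fmor F (fob G X) (fob G Y) (fmor G X Y f) = f"
  "h : mors C (fob G X) (fob G Y) ==> fmor G X Y (fmor F (fob G X) (fob G Y) h) = h"
proof -
 have b: "bij_betw (fmor F (fob G X) (fob G Y)) (mors C (fob G X) (fob G Y)) (mors C X Y)"
  using F(4)[of "fob G X" "fob G Y"] finv_ob X by simp
 have e: "fmor G X Y = inv_into (mors C (fob G X) (fob G Y)) (fmor F (fob G X) (fob G Y))"
  by (simp add: finv_def Let_def)
 show "f : mors C X Y ==> fmor G X Y f : mors C (fob G X) (fob G Y)"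
  "f : mors C X Y ==> fmor F (fob G X) (fob G Y) (fmor G X Y f) = f"
  "h : mors C (fob G X) (fob G Y) ==> fmor G X Y (fmor F (fob G X) (fob G Y) h) = h"
  unfolding e using b by (auto simp: bij_betw_def inv_into_into f_inv_into_f inv_into_f_f)
qed

lemma finv_eqI:
 "[|X : Ob C; Y : Ob C; h : mors C (fob G X) (fob G Y); fmor F (fob G X) (fob G Y) h = f|] ==> fmor G X Y f = h"
 using finv_mor(3) by metis

lemma finv_automorphism: "automorphism K C G"
 unfolding automorphism_def fully_faithful_def
proof (intro conjI ballI)
 note l = F(1)
 show "linear_functor K C C G"
 proof
  fix X Y f g assume X: "X : Ob C" "Y : Ob C" and f: "f : mors C X Y" "g : mors C X Y"
  show "fmor G X Y (f +[Mor C X Y] g) = fmor G X Y f +[Mor C (fob G X) (fob G Y)] fmor G X Y g"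
   using X f finv_mor[OF X] finv_ob by (intro finv_eqI) (auto simp: linear_functor.fmor_add[OF l])
 next
  fix X Y a f assume X: "X : Ob C" "Y : Ob C" and f: "a : carrier K" "f : mors C X Y"
  show "fmor G X Y (a *[Mor C X Y] f) = a *[Mor C (fob G X) (fob G Y)] fmor G X Y f"
   using X f finv_mor[OF X] finv_ob
   by (intro finv_eqI) (auto simp: linear_functor.fmor_smult[OF l] module.smult_closed[OF mor_module])
 next
  fix X Y Z f g assume X: "X : Ob C" "Y : Ob C" "Z : Ob C" and f: "f : mors C X Y" "g : mors C Y Z"
  show "fmor G X Z (cmp C X Y Z g f) = cmp C (fob G X) (fob G Y) (fob G Z) (fmor G Y Z g) (fmor G X Y f)"
   using X f finv_mor[OF X(1,2)] finv_mor[OF X(2,3)] finv_ob by (intro finv_eqI) (auto simp: linear_functor.fmor_cmp[OF l] cmp_closed)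
 next
  fix X assume X: "X : Ob C"
  show "fmor G X X (idm C X) = idm C (fob G X)"
   using X finv_ob by (intro finv_eqI) (auto simp: linear_functor.fmor_id[OF l] idm_closed)
 qed (auto simp: finv_ob finv_mor)
 show "bij_betw (fob G) (Ob C) (Ob C)"
  by (rule bij_betw_byWitness[where f' = "fob F"]) (auto simp: finv_ob F(2))
 fix X Y assume X: "X : Ob C" "Y : Ob C"
 show "bij_betw (fmor G X Y) (mors C X Y) (mors C (fob G X) (fob G Y))"
  by (rule bij_betw_byWitness[where f' = "fmor F (fob G X) (fob G Y)"])
   (use finv_mor[OF X] F(5)[of "fob G X" "fob G Y"] finv_ob X in auto)
qed

lemma fpow_automorphism: "automorphism K C (fpow C F i)"
 by (simp add: fpow_def automorphism_fiter aut finv_automorphism)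

lemmas P = automorphismD[OF fpow_automorphism]

lemma FG: "feq C (fcomp F G) fid" and GF: "feq C (fcomp G F) fid"
proof -
 show "feq C (fcomp F G) fid" by (simp add: feq_def finv_ob finv_mor)
 have "fmor G (fob F X) (fob F Y) (fmor F X Y f) = f" if X: "X : Ob C" "Y : Ob C" and f: "f : mors C X Y" for X Y f
  using finv_mor(3)[of "fob F X" "fob F Y" f] X f F(2) by (simp add: finv_ob)
 then show "feq C (fcomp G F) fid" by (simp add: feq_def finv_ob)
qed

lemma feq_left:
 assumes "feq C A B" "automorphism K C D" shows "feq C (fcomp A D) (fcomp B D)"
 using assms(1) automorphismD[OF assms(2)] by (simp add: feq_def)

lemma feq_right:
 assumes "feq C A B" shows "feq C (fcomp D A) (fcomp D B)"
 using assms by (simp add: feq_def)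

lemma feq_trans: "[|feq C A B; feq C B D|] ==> feq C A D" and feq_sym: "feq C A B ==> feq C B A"
 by (simp_all add: feq_def)

lemma fcomp_assoc: "fcomp (fcomp A B) D = fcomp A (fcomp B D)"
 by (simp add: fcomp_def)

lemma fcomp_id [simp]: "fcomp fid A = A" "fcomp A fid = A"
 by (simp_all add: fcomp_def fid_def)

lemma fpow_Suc: "feq C (fpow C F (i + 1)) (fcomp F (fpow C F i))"
proof (cases "i >= 0")
 case True
 then have "nat (i + 1) = Suc (nat i)" by simp
 then show ?thesis using True by (simp add: fpow_def feq_def del: nat_0_le)
next
 case False
 then have "nat (- i) = Suc (nat (- (i + 1)))" by simp
 then have "fpow C F i = fcomp G (fiter G (nat (- (i + 1))))" using False by (simp add: fpow_def)
 moreover have "fpow C F (i + 1) = fiter G (nat (- (i + 1)))"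
  using False by (cases "i + 1 = 0") (auto simp: fpow_def)
 ultimately show ?thesis
  using feq_sym[OF feq_left[OF FG automorphism_fiter[OF finv_automorphism]]] by (simp add: fcomp_assoc)
qed

lemma fpow_pred: "feq C (fpow C F (i - 1)) (fcomp G (fpow C F i))"
proof -
 have "feq C (fcomp G (fpow C F i)) (fcomp G (fcomp F (fpow C F (i - 1))))"
  using feq_right[OF fpow_Suc[of "i - 1"]] by simp
 moreover have "feq C (fcomp G (fcomp F (fpow C F (i - 1)))) (fpow C F (i - 1))"
  using feq_left[OF GF fpow_automorphism[of "i - 1"]] by (simp add: fcomp_assoc)
 ultimately show ?thesis using feq_trans feq_sym by metis
qed

lemma fpow_0 [simp]: "fpow C F 0 = fid"
 by (simp add: fpow_def)

lemma fpow_add: "feq C (fpow C F (i + j)) (fcomp (fpow C F i) (fpow C F j))"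
proof (induction i rule: int_induct[where k = 0])
 case base
 show ?case by (simp add: feq_def)
next
 case (step1 i)
 have "feq C (fpow C F (i + 1 + j)) (fcomp F (fpow C F (i + j)))" using fpow_Suc[of "i + j"] by (simp add: algebra_simps)
 moreover have "feq C (fcomp F (fpow C F (i + j))) (fcomp (fcomp F (fpow C F i)) (fpow C F j))"
  using feq_right[OF step1(2)] by (simp add: fcomp_assoc)
 ultimately show ?case using feq_trans feq_sym feq_left[OF fpow_Suc fpow_automorphism] by metis
next
 case (step2 i)
 have "feq C (fpow C F (i - 1 + j)) (fcomp G (fpow C F (i + j)))" using fpow_pred[of "i + j"] by (simp add: algebra_simps)
 moreover have "feq C (fcomp G (fpow C F (i + j))) (fcomp (fcomp G (fpow C F i)) (fpow C F j))"
  using feq_right[OF step2(2)] by (simp add: fcomp_assoc)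
 ultimately show ?case using feq_trans feq_sym feq_left[OF fpow_pred fpow_automorphism] by metis
qed

lemmas fpow_add_ob = feqD(1)[OF fpow_add, unfolded fcomp_simps]
 and fpow_add_mor = feqD(2)[OF fpow_add, unfolded fcomp_simps]

lemmas fpow_Suc_ob = feqD(1)[OF fpow_Suc, unfolded fcomp_simps]

lemma fpow_inverse:
 "X : Ob C ==> fob (fpow C F i) (fob (fpow C F (- i)) X) = X"
 "X : Ob C ==> fob (fpow C F (- i)) (fob (fpow C F i) X) = X"
 using fpow_add_ob[of X i "- i"] fpow_add_ob[of X "- i" i] by auto

end

section \<open>Objects of the derived category with projective cohomology\<close>

text \<open>Exactness comes from the triangles of \<open>D\<close>, cohomology from the derived
  category; \<open>E\<close> carries the latter back to \<open>D\<close>, and \<open>\<eta>\<close>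
  relates the two shifts.\<close>

locale derived_model = fd_algebra_over K H + triangulated_category K D \<Sigma> \<Delta>
 for K :: "'k ring" and H :: "('k, 'h) module" and D :: "('k, 'o, 'm) lincat"
  and \<Sigma> :: "('o, 'm, 'o, 'm) cfunctor" and \<Delta> :: "('o, 'm) tri set" +
 fixes E :: "('o, 'm, 'h cplx, 'h dmor) cfunctor" and \<eta> :: "'o => 'h dmor"
 assumes hered: "hereditary H"
  and equiv: "equivalence K D (Der H) E"
  and shift: "natural_iso D (Der H) (fcomp E \<Sigma>) (fcomp (derived_shift H) E) \<eta>"
begin

interpretation H: ring H using fd by (simp add: fd_algebra_def)

lemma E_functor: "linear_functor K D (Der H) E"
 using equiv by (simp add: equivalence_def)

interpretation E: linear_functor K D "Der H" E by (rule E_functor)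

lemma derived_Ob: "Ob (Der H) = complexes"
 by (simp add: derived_category_def localisation_def)

lemma E_ob [simp]: "X : Ob D ==> fob E X : complexes"
 using E.fob_closed derived_Ob by auto

definition rel :: "int => 'o => 'o => 'm => 'h elt => 'h elt => bool" where
 "rel n X Y ph = hmap_rel n (fob E X) (fob E Y) (fmor E X Y ph)"

abbreviation coc where "coc n X == cocycles (fob E X) n"

abbreviation deg where "deg n X == cob (fob E X) n"

context
 fixes X Y ph assumes X: "X : Ob D" and Y: "Y : Ob D" and ph: "ph : mors D X Y"
begin

lemma rel_props:
 "rel n X Y ph x y ==> x : coc n X & y : coc n Y"
 "[|rel n X Y ph x y; hcong (fob E X) n x x'; hcong (fob E Y) n y y'|] ==> rel n X Y ph x' y'"
 "x : coc n X ==> EX y. rel n X Y ph x y"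
 "[|rel n X Y ph x y; rel n X Y ph x y'|] ==> hcong (fob E Y) n y y'"
 "[|rel n X Y ph x y; rel n X Y ph x' y'|] ==> rel n X Y ph (x +[deg n X] x') (y +[deg n Y] y')"
 "[|rel n X Y ph x y; a : carrier H|] ==> rel n X Y ph (a *[deg n X] x) (a *[deg n Y] y)"
 "rel n X Y ph (zr (deg n X)) (zr (deg n Y))"
 unfolding rel_def
 by (fact hmap_rel_props[OF E_ob[OF X] E_ob[OF Y] E.fmor_closed[OF X Y ph]] hmap_rel_zero[OF E_ob[OF X] E_ob[OF Y] E.fmor_closed[OF X Y ph]])+

lemma rel_smult:
 assumes "c : carrier K" "rel n X Y ph x y"
 shows "rel n X Y (c *[Mor D X Y] ph) x (scal H c *[deg n Y] y)"
proof -
 have e: "fmor E X Y (c *[Mor D X Y] ph) = c *[Mor (Der H) (fob E X) (fob E Y)] fmor E X Y ph"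
  by (rule E.fmor_smult[OF X Y assms(1) ph])
 have "fmor E X Y (c *[Mor D X Y] ph) : mors (Der H) (fob E X) (fob E Y)"
  by (rule E.fmor_closed[OF X Y]) (use assms X Y ph module.smult_closed[OF mor_module] in blast)
 then show ?thesis unfolding rel_def e
  using hmap_rel_scalar[OF E_ob[OF X] E_ob[OF Y] assms(1) E.fmor_closed[OF X Y ph]] assms(2) by (simp add: rel_def)
qed

lemma rel_plus:
 assumes ps: "ps : mors D X Y" and "rel n X Y ph x y" "rel n X Y ps x y'"
 shows "rel n X Y (ph +[Mor D X Y] ps) x (y +[deg n Y] y')"
proof -
 have e: "fmor E X Y (ph +[Mor D X Y] ps) = fmor E X Y ph +[Mor (Der H) (fob E X) (fob E Y)] fmor E X Y ps"
  by (rule E.fmor_add[OF X Y ph ps])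
 have "fmor E X Y (ph +[Mor D X Y] ps) : mors (Der H) (fob E X) (fob E Y)"
  by (rule E.fmor_closed[OF X Y]) (use X Y ph ps in simp)
 then show ?thesis unfolding rel_def e
  using hmap_rel_plus[OF E_ob[OF X] E_ob[OF Y] E.fmor_closed[OF X Y ph] E.fmor_closed[OF X Y ps]] assms by (simp add: rel_def)
qed

end

lemma rel_id: "X : Ob D ==> rel n X X (idm D X) x y \<longleftrightarrow> hcong (fob E X) n x y"
 unfolding rel_def E.fmor_id by (rule hmap_rel_id(2)) simp

lemma rel_cmp:
 assumes "X : Ob D" "Y : Ob D" "Z : Ob D" "f : mors D X Y" "g : mors D Y Z"
 shows "rel n X Z (cmp D X Y Z g f) x z \<longleftrightarrow> (EX y. rel n X Y f x y & rel n Y Z g y z)"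
proof -
 have "cmp (Der H) (fob E X) (fob E Y) (fob E Z) (fmor E Y Z g) (fmor E X Y f) : mors (Der H) (fob E X) (fob E Z)"
  unfolding E.fmor_cmp[OF assms, symmetric] by (rule E.fmor_closed) (use assms in simp_all)
 from hmap_rel_cmp[OF E_ob[OF assms(1)] E_ob[OF assms(2)] E_ob[OF assms(3)] E.fmor_closed[OF assms(1,2,4)] E.fmor_closed[OF assms(2,3,5)] this]
 show ?thesis unfolding rel_def E.fmor_cmp[OF assms] .
qed

lemma rel_zero:
 assumes X: "X : Ob D" and Y: "Y : Ob D" and x: "x : coc n X" shows "rel n X Y (zr (Mor D X Y)) x (zr (deg n Y))"
proof -
 interpret V: module K "Mor D X Y" by (rule mor_module[OF X Y])
 have z: "zr (Mor D X Y) : mors D X Y" by simp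
 obtain y where y: "rel n X Y (zr (Mor D X Y)) x y" using rel_props(3)[OF X Y z x] by blast
 have "rel n X Y (zr K *[Mor D X Y] zr (Mor D X Y)) x ((zr K *[H] un H) *[deg n Y] y)"
  by (rule rel_smult[OF X Y z _ y]) simp
 moreover have "zr K *[H] un H = zr H"
  using fd module.smult_l_null[of K H "un H"] by (simp add: fd_algebra_def)
 moreover have "y : carrier (deg n Y)" using rel_props(1)[OF X Y z y] coc_carrier[OF E_ob[OF Y]] by blast
 ultimately show ?thesis using left_module_null[OF cob_module[OF E_ob[OF Y]]] by simp
qed

lemma rel_unique:
 assumes "rep n N (fob E Q) nu" "Q : Ob D" "X : Ob D" "ph : mors D Q X" "ps : mors D Q X"
  "!!x. x : carrier N ==> EX y. rel n Q X ph (nu x) y & rel n Q X ps (nu x) y"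
 shows "ph = ps"
proof -
 have "fmor E Q X ph = fmor E Q X ps"
  by (rule rep_hom_unique[OF _ assms(1)]) (use assms E.fmor_closed in \<open>auto simp: rel_def\<close>)
 then show ?thesis using equiv assms(2-5) by (auto simp: equivalence_def fully_faithful_def bij_betw_def inj_on_def)
qed

lemma rel_exists:
 assumes "rep n N (fob E Q) nu" "Q : Ob D" "X : Ob D" "mu : module_maps H N (deg n X)"
  "!!x. x : carrier N ==> mu x : coc n X"
 obtains ph where "ph : mors D Q X" "!!x. x : carrier N ==> rel n Q X ph (nu x) (mu x)"
proof -
 obtain al where al: "al : mors (Der H) (fob E Q) (fob E X)" "!!x. x : carrier N ==> hmap_rel n (fob E Q) (fob E X) al (nu x) (mu x)"
  using rep_hom_exists[OF E_ob[OF assms(2)] assms(1) E_ob[OF assms(3)] assms(4,5)] by blast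
 moreover have "fmor E Q X ` mors D Q X = mors (Der H) (fob E Q) (fob E X)"
  using equiv assms(2,3) by (simp add: equivalence_def fully_faithful_def bij_betw_def)
 then have "al : fmor E Q X ` mors D Q X" using al(1) by simp
 then obtain ph where "ph : mors D Q X" "fmor E Q X ph = al" by blast
 ultimately show thesis using that by (auto simp: rel_def)
qed

definition proj :: "int => 'o => bool" where
 "proj n Q \<longleftrightarrow> Q : Ob D & (EX N nu. rep n N (fob E Q) nu)"

lemma proj_of_module:
 assumes "projective_module H N" obtains Q nu where "Q : Ob D" "rep n N (fob E Q) nu"
proof -
 note r = rep_stalk[OF assms, of n]
 have S: "stalk n N : complexes" by (rule stalk_complex[OF repD(7)[OF r]])
 then obtain Q where Q: "Q : Ob D" "isomorphic (Der H) (fob E Q) (stalk n N)"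
  using equiv derived_Ob by (auto simp: equivalence_def)
 then obtain f g where "is_inverse (Der H) (fob E Q) (stalk n N) f g" by (auto simp: isomorphic_def is_iso_def)
 then have "is_inverse (Der H) (stalk n N) (fob E Q) g f" by (auto simp: is_inverse_def)
 from rep_iso[OF S E_ob[OF Q(1)] this r] show thesis using that Q(1) by blast
qed

lemma rep_suspension:
 assumes X: "X : Ob D" shows "(EX nu. rep n N (fob E (sh X)) nu) \<longleftrightarrow> (EX nu. rep (n + 1) N (fob E X) nu)"
proof -
 have e: "fob (derived_shift H) (fob E X) = shift_complex (fgmod H) (fob E X)"
  by (simp add: derived_shift_def localised_functor_def homotopy_shift_def)
 obtain g where g: "is_inverse (Der H) (fob E (sh X)) (shift_complex (fgmod H) (fob E X)) (\<eta> X) g"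
  using shift X e by (auto simp: natural_iso_def is_iso_def)
 then have g': "is_inverse (Der H) (shift_complex (fgmod H) (fob E X)) (fob E (sh X)) g (\<eta> X)"
  by (auto simp: is_inverse_def)
 note S = shift_closed[OF E_ob[OF X]] and T = E_ob[OF sh_ob[OF X]]
 have "(EX nu. rep n N (fob E (sh X)) nu) \<longleftrightarrow> (EX nu. rep n N (shift_complex (fgmod H) (fob E X)) nu)"
  using rep_iso[OF T S g] rep_iso[OF S T g'] by blast
 then show ?thesis unfolding rep_shift[OF E_ob[OF X]] .
qed

lemma proj_suspension: "X : Ob D ==> proj n (sh X) \<longleftrightarrow> proj (n + 1) X"
 unfolding proj_def using rep_suspension by auto

interpretation Sig: category_automorphism K D \<Sigma>
 by unfold_locales (rule shift_automorphism)

text \<open>The module \<open>H\<close> placed in degree \<open>n\<close>. All these objects are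
  shifts of one chosen object, so that \<open>sh (P (n + 1)) = P n\<close> is an equation and not
  merely an isomorphism.\<close>

definition P :: "int => 'o" where
 "P n = fob (fpow D \<Sigma> (- n)) (SOME Q. Q : Ob D & (EX nu. rep 0 (free H 1) (fob E Q) nu))"

lemma P_ob [simp]: "P n : Ob D" and P_rep: "EX nu. rep n (free H 1) (fob E (P n)) nu"
 and P_suspension: "sh (P (n + 1)) = P n"
proof -
 let ?Q = "SOME Q. Q : Ob D & (EX nu. rep 0 (free H 1) (fob E Q) nu)"
 have Q: "?Q : Ob D & (EX nu. rep 0 (free H 1) (fob E ?Q) nu)"
  by (rule someI_ex) (metis proj_of_module[OF free_projective])
 then show ob: "P n : Ob D" for n unfolding P_def using Sig.P(2) by simp
 show S: "sh (P (n + 1)) = P n" for n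
  unfolding P_def using Sig.fpow_Suc_ob[of ?Q "- n - 1"] Q by simp
 show "EX nu. rep n (free H 1) (fob E (P n)) nu"
 proof (induction n rule: int_induct[where k = 0])
  case base then show ?case using Q by (simp add: P_def)
 next
  case (step1 i) then show ?case using rep_suspension[OF ob[of "i + 1"], of i] S[of i] by simp
 next
  case (step2 i) then show ?case using rep_suspension[OF ob[of i], of "i - 1"] S[of "i - 1"] by simp
 qed
qed

lemma P_proj: "proj n (P n)"
 unfolding proj_def using P_rep P_ob by blast

lemma proj_ob: "proj n Q ==> Q : Ob D"
 by (simp add: proj_def)

section \<open>Cohomology as maps from the objects P n\<close>

definition P_gen :: "int => 'h hmap" where
 "P_gen n = (SOME nu. rep n (free H 1) (fob E (P n)) nu)"

lemma P_gen: "rep n (free H 1) (fob E (P n)) (P_gen n)"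
 unfolding P_gen_def by (rule someI_ex[OF P_rep])

text \<open>A cocycle is the image of the generator of a free module of rank one. The last
  conclusion says that all other values are multiples of \<open>x\<close>; it allows composites to
  be tested for vanishing on the whole module.\<close>

lemma P_hom:
 assumes X: "X : Ob D" and x: "x : coc n X"
 obtains ph where "ph : mors D (P n) X" "rel n (P n) X ph (P_gen n (uvec H 0)) x"
  "!!v. v : carrier (free H 1) ==> EX b:carrier H. rel n (P n) X ph (P_gen n v) (b *[deg n X] x)"
proof -
 have xc: "x : carrier (deg n X)" by (rule coc_carrier[OF E_ob[OF X] x])
 note M = cob_module[OF E_ob[OF X], of n]
 interpret M: left_module H "deg n X" by (rule M)
 obtain mu where mu: "mu : module_maps H (free H 1) (deg n X)" "mu (uvec H 0) = x"
  using free_hom_ex[OF M, of 1 "%_. x"] xc by auto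
 have m: "EX b:carrier H. mu v = b *[deg n X] x" if "v : carrier (free H 1)" for v
  using that
 proof (rule free_induct)
  show "EX b:carrier H. mu (zr (free H 1)) = b *[deg n X] x"
   using maps_zero[OF mu(1) free_left_module M] left_module_null[OF M xc] by (intro bexI[of _ "zr H"]) auto
  fix y a i assume y: "y : carrier (free H 1)" "EX b:carrier H. mu y = b *[deg n X] x" "a : carrier H" "i < (1::nat)"
  then obtain b where b: "b : carrier H" "mu y = b *[deg n X] x" by blast
  have u: "uvec H i : carrier (free H 1)" "i = 0" using uvec_closed[OF y(4)] y(4) by auto
  have a: "a *[free H 1] uvec H i : carrier (free H 1)"
   using left_module.act_closed[OF free_left_module y(3) u(1)] .
  have "mu (y +[free H 1] a *[free H 1] uvec H i) = (b +[H] a) *[deg n X] x"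
   unfolding mapsD(2)[OF mu(1) y(1) a] mapsD(3)[OF mu(1) y(3) u(1)]
   unfolding u(2) mu(2) b(2) by (rule M.act_l_distr[OF b(1) y(3) xc, symmetric])
  then show "EX b:carrier H. mu (y +[free H 1] a *[free H 1] uvec H i) = b *[deg n X] x"
   using b(1) y(3) by blast
 qed
 then have z: "mu v : coc n X" if "v : carrier (free H 1)" for v
  using that cocycles_closed(3)[OF E_ob[OF X] _ x] by fastforce
 obtain ph where "ph : mors D (P n) X" "!!v. v : carrier (free H 1) ==> rel n (P n) X ph (P_gen n v) (mu v)"
  using rel_exists[OF P_gen P_ob X mu(1) z] by blast
 then show thesis using that[of ph] mu(2) m uvec_closed[of 0 1] by fastforce
qed

lemma proj_hom_zero:
 assumes Q: "proj n Q" and X: "X : Ob D" and z: "coc n X <= coboundaries (fob E X) n" shows "hom_zero D Q X"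
proof (rule hom_zeroI)
 obtain N nu where r: "rep n N (fob E Q) nu" and Qo: "Q : Ob D" using Q by (auto simp: proj_def)
 show "Q : Ob D" "X : Ob D" by fact+
 fix f assume f: "f : mors D Q X"
 show "f = zr (Mor D Q X)"
 proof (rule rel_unique[OF r Qo X f])
  fix x assume "x : carrier N"
  then have c: "nu x : coc n Q" using repD(3)[OF r] by blast
  obtain y where y: "rel n Q X f (nu x) y" using rel_props(3)[OF Qo X f c] by blast
  have "hcong (fob E X) n (zr (deg n X)) y"
   using rel_props(1)[OF Qo X f y] z hcong_zero_iff[OF E_ob[OF X]] hcong_sym[OF E_ob[OF X]] by blast
  then have "rel n Q X (zr (Mor D Q X)) (nu x) y"
   using rel_props(2)[OF Qo X _ rel_zero[OF Qo X c]] hcong_refl[OF E_ob[OF Qo] c] Qo X by simp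
  then show "EX y. rel n Q X f (nu x) y & rel n Q X (zr (Mor D Q X)) (nu x) y" using y by blast
 qed (use Qo X in simp)
qed

text \<open>This turns vanishing of cohomology into vanishing of maps inside \<open>D\<close>, the
  form in which later sections see it.\<close>

lemma P_hom_zero:
 assumes X: "X : Ob D" shows "hom_zero D (P n) X \<longleftrightarrow> coc n X <= coboundaries (fob E X) n"
proof
 assume h: "hom_zero D (P n) X"
 show "coc n X <= coboundaries (fob E X) n"
 proof
  fix x assume x: "x : coc n X"
  obtain ph e where ph: "ph : mors D (P n) X" "rel n (P n) X ph e x" using P_hom[OF X x] by blast
  have e: "e : coc n (P n)" using rel_props(1)[OF P_ob X ph] by blast
  have z: "zr (Mor D (P n) X) : mors D (P n) X" using X by simp
  have "ph = zr (Mor D (P n) X)" by (rule hom_zeroD[OF h ph(1)])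
  then have "hcong (fob E X) n x (zr (deg n X))" using rel_props(4)[OF P_ob X z] ph(2) rel_zero[OF P_ob X e] by blast
  then show "x : coboundaries (fob E X) n" using hcong_zero_iff[OF E_ob[OF X]] by blast
 qed
qed (rule proj_hom_zero[OF P_proj X])

lemma proj_concentrated: "[|proj n Q; m ~= n|] ==> hom_zero D (P m) Q"
 unfolding P_hom_zero[OF proj_ob] using repD(6) by (auto simp: proj_def)

lemma proj_vanish: "[|proj n Q; X : Ob D; hom_zero D (P n) X|] ==> hom_zero D Q X"
 by (rule proj_hom_zero) (auto simp: P_hom_zero)

lemma bounded:
 assumes X: "X : Ob D" shows "finite {n. ~ hom_zero D (P n) X}"
proof (rule finite_subset)
 show "finite {n. ~ zero_object (fgmod H) (deg n X)}" using E_ob[OF X] by (simp add: bounded_complexes_def)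
 show "{n. ~ hom_zero D (P n) X} <= {n. ~ zero_object (fgmod H) (deg n X)}"
 proof clarify
  fix n assume n: "zero_object (fgmod H) (deg n X)" "~ hom_zero D (P n) X"
  have "x = zr (deg n X)" if "x : carrier (deg n X)" for x
  proof -
   have "(\<lambda>x\<in>carrier (deg n X). x) = (\<lambda>x\<in>carrier (deg n X). zr (deg n X))" using n(1) by (simp add: zero_object_def)
   from fun_cong[OF this, of x] show ?thesis using that by simp
  qed
  then have "coc n X <= {zr (deg n X)}" using coc_carrier[OF E_ob[OF X]] by blast
  then have "coc n X <= coboundaries (fob E X) n" using coboundaries_closed(1)[OF E_ob[OF X], of n] by blast
  then show False using n(2) P_hom_zero[OF X] by blast
 qed
qed

definition hom_surj :: "'o => 'o => 'o => 'm => bool" where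
 "hom_surj Q X Y al \<longleftrightarrow> (ALL f:mors D Q Y. EX g:mors D Q X. f = cmp D Q X Y al g)"

definition hom_inj :: "'o => 'o => 'o => 'm => bool" where
 "hom_inj Q X Y al \<longleftrightarrow> (ALL f:mors D Q X. cmp D Q X Y al f = zr (Mor D Q Y) --> f = zr (Mor D Q X))"

text \<open>Composing \<open>f\<close> with the converse of the relation of \<open>al\<close> gives
  an additive relation, and \<open>projective_lift\<close> finds a module map inside it.\<close>

lemma proj_surj_rel:
 assumes Q: "proj n Q" and X: "X : Ob D" and Y: "Y : Ob D" and al: "al : mors D X Y"
  and s: "!!y. y : coc n Y ==> EX x. rel n X Y al x y"
 shows "hom_surj Q X Y al"
 unfolding hom_surj_def
proof
 obtain N nu where r: "rep n N (fob E Q) nu" and Qo: "Q : Ob D" using Q by (auto simp: proj_def)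
 note R = repD[OF r]
 fix f assume f: "f : mors D Q Y"
 note a = rel_props[OF X Y al, where n = n] and b = rel_props[OF Qo Y f, where n = n]
 let ?R = "%a b. EX y. rel n X Y al a y & rel n Q Y f b y"
 obtain mu where mu: "mu : module_maps H N (deg n X)" "!!x. x : carrier N ==> ?R (mu x) (nu x)"
 proof (rule projective_lift[OF R(1) cob_module[OF E_ob[OF X], of n] cob_module[OF E_ob[OF Qo], of n] R(2), of ?R])
  show "EX a. ?R a (nu x)" if "x : carrier N" for x
   using b(3)[OF R(3)[OF that]] b(1) s by blast
  show "?R (zr (deg n X)) (zr (deg n Q))" using a(7) b(7) by blast
  show "a : carrier (deg n X)" if "?R a y" for a y using that a(1) coc_carrier[OF E_ob[OF X]] by blast
  show "?R (a +[deg n X] b) (y +[deg n Q] z)" if "?R a y" "?R b z" for a b y z using that a(5) b(5) by blast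
  show "?R (c *[deg n X] a) (c *[deg n Q] y)" if "c : carrier H" "?R a y" for c a y using that a(6) b(6) by blast
 qed (rule that)
 have "mu x : coc n X" if "x : carrier N" for x using mu(2)[OF that] a(1) by blast
 then obtain g where g: "g : mors D Q X" "!!x. x : carrier N ==> rel n Q X g (nu x) (mu x)"
  using rel_exists[OF r Qo X mu(1)] by blast
 have "f = cmp D Q X Y al g"
 proof (rule rel_unique[OF r Qo Y f])
  show "cmp D Q X Y al g : mors D Q Y" using Qo X Y g al by simp
  fix x assume x: "x : carrier N"
  show "EX y. rel n Q Y f (nu x) y & rel n Q Y (cmp D Q X Y al g) (nu x) y"
   using mu(2)[OF x] g(2)[OF x] rel_cmp[OF Qo X Y g(1) al] by blast
 qed
 then show "EX g:mors D Q X. f = cmp D Q X Y al g" using g by blast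
qed

lemma proj_surj:
 assumes Q: "proj n Q" and X: "X : Ob D" and Y: "Y : Ob D" and al: "al : mors D X Y"
  and s: "hom_surj (P n) X Y al"
 shows "hom_surj Q X Y al"
proof (rule proj_surj_rel[OF Q X Y al])
 fix y assume y: "y : coc n Y"
 obtain ph e where ph: "ph : mors D (P n) Y" "rel n (P n) Y ph e y" using P_hom[OF Y y] by blast
 obtain g where g: "g : mors D (P n) X" "ph = cmp D (P n) X Y al g" using s ph(1) by (auto simp: hom_surj_def)
 show "EX x. rel n X Y al x y" using ph(2) unfolding g(2) rel_cmp[OF P_ob X Y g(1) al] by blast
qed

text \<open>Cocycles form a submodule of a module of finite length over \<open>K\<close>, so they
  are finitely generated, and the free module on the generators covers the cohomology in degree
  \<open>n\<close>.\<close>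

lemma proj_cover:
 assumes X: "X : Ob D"
 obtains Q al where "proj n Q" "al : mors D Q X" "hom_surj (P n) Q X al"
proof -
 note M = cob_module[OF E_ob[OF X], of n] and fg = cob_fg[OF E_ob[OF X], of n]
 interpret M: left_module H "deg n X" by (rule M)
 note SM = scalars_module[OF fd M]
 have sub: "submodule W K (scalars H (deg n X))" if "submodule W H (deg n X)" for W
 proof -
  interpret W: submodule W H "deg n X" by (rule that)
  show ?thesis unfolding submodule_iff[OF SM]
   using W.subset W.one_closed W.m_closed W.smult_closed scalar_closed[OF fd] by auto
 qed
 have Z: "submodule (coc n X) H (deg n X)"
  by (rule submoduleI[OF M]) (use cocycles_closed[OF E_ob[OF X]] coc_carrier[OF E_ob[OF X]] in auto)
 have fl: "finlen K (scalars H (deg n X)) (coc n X)"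
  by (rule finlen_mono[OF scalars_fl[OF fd M fg]]) (use coc_carrier[OF E_ob[OF X]] in auto)
 obtain A where A: "finite A" "A <= coc n X" "ALL W. submodule W K (scalars H (deg n X)) & A <= W --> coc n X <= W"
  using finlen_finite_span[OF A.K_field SM sub[OF Z] fl] by blast
 obtain l and x :: "nat => _" where x: "A = x ` {..<l}"
  using A(1) finite_imp_nat_seg_image_inj_on[of A] by (metis lessThan_def)
 have xc: "x i : coc n X" if "i < l" for i using that A(2) x by auto
 obtain mu where mu: "mu : module_maps H (free H l) (deg n X)" "!!i. i < l ==> mu (uvec H i) = x i"
  using free_hom_ex[OF M, of l x] xc coc_carrier[OF E_ob[OF X]] by blast
 have s: "coc n X <= mu ` carrier (free H l)"
 proof (rule A(3)[rule_format, OF conjI, OF sub[OF map_range_submodule[OF mu(1) free_left_module M]]])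
  have "x i : mu ` carrier (free H l)" if "i < l" for i
   using mu(2)[OF that] uvec_closed[OF that] by (metis imageI)
  then show "A <= mu ` carrier (free H l)" unfolding x by auto
 qed
 have z: "mu v : coc n X" if "v : carrier (free H l)" for v
  using that
 proof (rule free_induct)
  show "mu (zr (free H l)) : coc n X"
   using maps_zero[OF mu(1) free_left_module M] cocycles_closed(1)[OF E_ob[OF X], of n] by simp
  fix y a i assume y: "y : carrier (free H l)" "mu y : coc n X" "a : carrier H" "i < l"
  note u = uvec_closed[OF y(4)]
  have a: "a *[free H l] uvec H i : carrier (free H l)"
   using left_module.act_closed[OF free_left_module y(3) u] .
  show "mu (y +[free H l] a *[free H l] uvec H i) : coc n X"
   unfolding mapsD(2)[OF mu(1) y(1) a] mapsD(3)[OF mu(1) y(3) u] mu(2)[OF y(4)]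
   by (rule cocycles_closed(2)[OF E_ob[OF X] y(2) cocycles_closed(3)[OF E_ob[OF X] y(3) xc[OF y(4)]]])
 qed
 obtain Q nu where Q: "Q : Ob D" "rep n (free H l) (fob E Q) nu" by (rule proj_of_module[OF free_projective])
 obtain al where al: "al : mors D Q X" "!!v. v : carrier (free H l) ==> rel n Q X al (nu v) (mu v)"
  using rel_exists[OF Q(2,1) X mu(1) z] by blast
 have "hom_surj (P n) Q X al"
  by (rule proj_surj_rel[OF P_proj Q(1) X al(1)]) (use s al(2) in blast)
 then show thesis using that Q al(1) by (auto simp: proj_def)
qed

text \<open>This is where heredity enters: a submodule of the projective module \<open>H\<^sup>n(Q)\<close> is projective.\<close>

lemma proj_subobject:
 assumes Q: "proj n Q" and X: "X : Ob D" and al: "al : mors D X Q" and i: "hom_inj (P n) X Q al"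
  and c: "!!m. m ~= n ==> hom_zero D (P m) X"
 shows "proj n X"
proof -
 obtain N nu where r: "rep n N (fob E Q) nu" and Qo: "Q : Ob D" using Q by (auto simp: proj_def)
 note R = repD[OF r] and a = rel_props[OF X Qo al, where n = n]
 have M: "left_module H N" using R(7) by simp
 interpret N: left_module H N by (rule M)
 note CX = E_ob[OF X] and CQ = E_ob[OF Qo]
 interpret DQ: left_module H "deg n Q" by (rule cob_module[OF CQ])
 \<comment> \<open>Injectivity is given for maps from \<open>P n\<close> only. A class killed by
   \<open>al\<close> defines such a map, whose composite with \<open>al\<close> is zero on every
   multiple of the generator.\<close>
 have inj: "hcong (fob E X) n x (zr (deg n X))" if x: "rel n X Q al x y" "hcong (fob E Q) n y (zr (deg n Q))" for x y
 proof -
  have xc: "x : coc n X" using a(1) x by blast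
  obtain ph where ph: "ph : mors D (P n) X" "rel n (P n) X ph (P_gen n (uvec H 0)) x"
   "!!v. v : carrier (free H 1) ==> EX b:carrier H. rel n (P n) X ph (P_gen n v) (b *[deg n X] x)"
   using P_hom[OF X xc] by blast
  have "cmp D (P n) X Q al ph = zr (Mor D (P n) Q)"
  proof (rule rel_unique[OF P_gen P_ob Qo])
   fix v assume v: "v : carrier (free H 1)"
   obtain b where b: "b : carrier H" "rel n (P n) X ph (P_gen n v) (b *[deg n X] x)" using ph(3)[OF v] by blast
   have "hcong (fob E Q) n (b *[deg n Q] y) (zr (deg n Q))"
    using hcong_smult[OF CQ b(1) x(2)] left_module_zero[OF cob_module[OF CQ] b(1)] by simp
   moreover have "hcong (fob E X) n (b *[deg n X] x) (b *[deg n X] x)"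
    by (rule hcong_refl[OF CX cocycles_closed(3)[OF CX b(1) xc]])
   ultimately have "rel n X Q al (b *[deg n X] x) (zr (deg n Q))" using a(2)[OF a(6)[OF x(1) b(1)]] by blast
   moreover have "rel n (P n) Q (zr (Mor D (P n) Q)) (P_gen n v) (zr (deg n Q))"
    by (rule rel_zero[OF P_ob Qo repD(3)[OF P_gen v]])
   ultimately show "EX y. rel n (P n) Q (cmp D (P n) X Q al ph) (P_gen n v) y & rel n (P n) Q (zr (Mor D (P n) Q)) (P_gen n v) y"
    using b(2) rel_cmp[OF P_ob X Qo ph(1) al] by blast
  qed (use X Qo ph(1) al in auto)
  then have "ph = zr (Mor D (P n) X)" using i ph(1) by (simp add: hom_inj_def)
  moreover have "P_gen n (uvec H 0) : coc n (P n)" using rel_props(1)[OF P_ob X ph(1,2)] by blast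
  moreover have "zr (Mor D (P n) X) : mors D (P n) X" using X by simp
  ultimately show ?thesis using ph(2) rel_props(4)[OF P_ob X] rel_zero[OF P_ob X] by blast
 qed
 \<comment> \<open>The image of the degree \<open>n\<close> cohomology of \<open>X\<close> in that
   of \<open>Q\<close>, as a submodule of \<open>N\<close>.\<close>
 define N1 where "N1 = {x : carrier N. EX y. rel n X Q al y (nu x)}"
 have sub: "submodule N1 H N"
 proof (rule submoduleI[OF M])
  show "zr N : N1" unfolding N1_def using a(7) maps_zero[OF R(2) M cob_module[OF CQ]] by auto
  show "x +[N] y : N1" if "x : N1" "y : N1" for x y
   using that a(5) mapsD(2)[OF R(2)] unfolding N1_def by fastforce
  show "b *[N] x : N1" if "b : carrier H" "x : N1" for b x
   using that a(6) mapsD(3)[OF R(2)] N.act_closed unfolding N1_def by fastforce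
 qed (auto simp: N1_def)
 have p1: "projective_module H (N(|carrier := N1|))" using hered R(1) sub by (simp add: hereditary_def)
 have N1: "x : carrier N" "EX y. rel n X Q al y (nu x)" if "x : N1" for x using that by (auto simp: N1_def)
 interpret N1: submodule N1 H N by (rule sub)
 have nu1: "(\<lambda>x\<in>N1. nu x) : module_maps H (N(|carrier := N1|)) (deg n Q)"
  unfolding module_maps_def using mapsD[OF R(2)] N1.m_closed N1.smult_closed N1(1) by auto
 obtain mu where mu: "mu : module_maps H (N(|carrier := N1|)) (deg n X)" "!!x. x : N1 ==> rel n X Q al (mu x) (nu x)"
 proof (rule projective_lift[OF p1 cob_module[OF CX, of n] cob_module[OF CQ, of n] nu1, of "rel n X Q al"])
  show "EX y. rel n X Q al y ((\<lambda>x\<in>N1. nu x) x)" if "x : carrier (N(|carrier := N1|))" for x using that N1(2) by simp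
  show "y : carrier (deg n X)" if "rel n X Q al y z" for y z using that a(1) coc_carrier[OF CX] by blast
 qed (use a(5-7) in auto)
 have "rep n (N(|carrier := N1|)) (fob E X) mu" unfolding rep_def
 proof (intro conjI ballI impI allI p1 mu(1))
  fix x assume "x : carrier (N(|carrier := N1|))"
  then have x: "x : N1" by simp
  show "mu x : coc n X" using a(1) mu(2)[OF x] by blast
  assume b: "mu x : coboundaries (fob E X) n"
  have "hcong (fob E X) n (mu x) (zr (deg n X))" using b hcong_zero_iff[OF CX] by blast
  then have "rel n X Q al (zr (deg n X)) (nu x)"
   using a(2)[OF mu(2)[OF x]] hcong_refl[OF CQ R(3)[OF N1(1)[OF x]]] by blast
  then have "hcong (fob E Q) n (nu x) (zr (deg n Q))" using a(4,7) by blast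
  then show "x = zr (N(|carrier := N1|))" using R(4)[OF N1(1)[OF x]] hcong_zero_iff[OF CQ] by simp
 next
  fix y assume y: "y : coc n X"
  then obtain z where z: "rel n X Q al y z" using a(3) by blast
  obtain x where x: "x : carrier N" "hcong (fob E Q) n (nu x) z" using R(5) a(1)[OF z] by blast
  have yx: "rel n X Q al y (nu x)" using a(2)[OF z hcong_refl[OF CX y] hcong_sym[OF CQ x(2)]] .
  then have x1: "x : N1" using x(1) by (auto simp: N1_def)
  have yc: "y : carrier (deg n X)" "mu x : coc n X" "mu x : carrier (deg n X)"
   using coc_carrier[OF CX] y a(1)[OF mu(2)[OF x1]] by auto
  interpret DX: left_module H "deg n X" by (rule cob_module[OF CX])
  have neg: "rel n X Q al (-[deg n X] y) w ==> hcong (fob E Q) n (nu x +[deg n Q] w) (zr (deg n Q))" for w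
   using a(5)[OF yx, of "-[deg n X] y" w] yc(1) a(4)[OF _ a(7)] by (simp add: DX.M.r_neg)
  obtain w where w: "rel n X Q al (-[deg n X] y) w" using a(3) cocycles_closed(4)[OF CX y] by blast
  have "rel n X Q al (mu x -[deg n X] y) (nu x +[deg n Q] w)"
   using a(5)[OF mu(2)[OF x1] w] by (simp add: DX.M.minus_eq)
  then have "hcong (fob E X) n (mu x -[deg n X] y) (zr (deg n X))" using inj neg[OF w] by blast
  then have "hcong (fob E X) n (mu x) y" using hcong_diff[OF CX yc(2) y] by blast
  then show "EX x:carrier (N(|carrier := N1|)). hcong (fob E X) n (mu x) y" using x1 by auto
 next
  fix i assume "i ~= n"
  then show "coc i X <= coboundaries (fob E X) i" using c P_hom_zero[OF X] by blast
 qed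
 then show ?thesis using X by (auto simp: proj_def)
qed

text \<open>The idempotent acts on \<open>N\<close>, strictly and not only up to coboundaries by
  \<open>rep_inj\<close>. Its image is a projective module, and the object \<open>Q1\<close>
  realising it splits \<open>e\<close>.\<close>

lemma proj_idempotent:
 assumes Q: "proj n Q" and e: "e : mors D Q Q" "cmp D Q Q Q e e = e"
 obtains Q1 j q where "Q1 : Ob D" "j : mors D Q1 Q" "q : mors D Q Q1" "cmp D Q1 Q Q1 q j = idm D Q1" "cmp D Q Q1 Q j q = e"
proof -
 obtain N nu where r: "rep n N (fob E Q) nu" and Qo: "Q : Ob D" using Q by (auto simp: proj_def)
 note R = repD[OF r] and a = rel_props[OF Qo Qo e(1), where n = n]
 have M: "left_module H N" using R(7) by simp
 interpret N: left_module H N by (rule M)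
 note CQ = E_ob[OF Qo] and nu = mapsD[OF R(2)]
 obtain ep where ep: "ep : module_maps H N N" "!!x. x : carrier N ==> rel n Q Q e (nu x) (nu (ep x))"
 proof -
  let ?R = "%x b. x : carrier N & rel n Q Q e b (nu x)"
  obtain ep where "ep : module_maps H N N" "!!x. x : carrier N ==> ?R (ep x) (nu x)"
  proof (rule projective_lift[OF R(1) M cob_module[OF CQ, of n] R(2), of ?R])
   fix x assume x: "x : carrier N"
   obtain y where y: "rel n Q Q e (nu x) y" using a(3)[OF R(3)[OF x]] by blast
   obtain z where z: "z : carrier N" "hcong (fob E Q) n (nu z) y" using R(5) a(1)[OF y] by blast
   then show "EX z. ?R z (nu x)" using a(2)[OF y hcong_refl[OF CQ R(3)[OF x]] hcong_sym[OF CQ]] by blast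
  qed (use a(5-7) nu N.act_closed maps_zero[OF R(2) M cob_module[OF CQ]] in auto)
  then show thesis using that by blast
 qed
 note ep' = mapsD[OF ep(1)]
 have fn: "nu x : coc n Q" "hcong (fob E Q) n (nu x) (nu x)" if "x : carrier N" for x using R(3) that hcong_refl[OF CQ] by auto
 have idem: "ep (ep x) = ep x" if x: "x : carrier N" for x
 proof (rule rep_inj[OF CQ r CQ])
  have "rel n Q Q (cmp D Q Q Q e e) (nu x) (nu (ep (ep x)))"
   unfolding rel_cmp[OF Qo Qo Qo e(1) e(1)] using ep(2)[OF x] ep(2)[OF ep'(1)[OF x]] by blast
  then show "hcong (fob E Q) n (nu (ep (ep x))) (nu (ep x))" unfolding e(2) using a(4) ep(2)[OF x] by blast
 qed (use ep'(1) x in auto)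
 define N1 where "N1 = ep ` carrier N"
 have sub: "submodule N1 H N" unfolding N1_def by (rule map_range_submodule[OF ep(1) M M])
 interpret N1: submodule N1 H N by (rule sub)
 have N1: "x : carrier N" "ep x = x" if "x : N1" for x using that idem ep'(1) by (auto simp: N1_def)
 have p1: "projective_module H (N(|carrier := N1|))" using hered R(1) sub by (simp add: hereditary_def)
 obtain Q1 nu1 where Q1: "Q1 : Ob D" "rep n (N(|carrier := N1|)) (fob E Q1) nu1" by (rule proj_of_module[OF p1])
 note R1 = repD[OF Q1(2)] and nu1 = mapsD[OF repD(2)[OF Q1(2)]]
 have "(\<lambda>x\<in>N1. nu x) : module_maps H (N(|carrier := N1|)) (deg n Q)"
  unfolding module_maps_def using nu N1.m_closed N1.smult_closed N1(1) by auto
 from rel_exists[OF Q1(2,1) Qo this] fn(1) N1(1)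
 obtain j where j: "j : mors D Q1 Q" "!!x. x : N1 ==> rel n Q1 Q j (nu1 x) (nu x)" by auto
 have ep1: "ep x : N1" if "x : carrier N" for x using that by (auto simp: N1_def)
 have "(\<lambda>x\<in>carrier N. nu1 (ep x)) : module_maps H N (deg n Q1)"
  unfolding module_maps_def using nu1 ep' ep1 N.act_closed by auto
 from rel_exists[OF r Qo Q1(1) this] R1(3) ep1
 obtain q where q: "q : mors D Q Q1" "!!x. x : carrier N ==> rel n Q Q1 q (nu x) (nu1 (ep x))" by auto
 have "cmp D Q1 Q Q1 q j = idm D Q1"
 proof (rule rel_unique[OF Q1(2,1,1)])
  fix x assume "x : carrier (N(|carrier := N1|))"
  then have x: "x : N1" "x : carrier N" "ep x = x" "nu1 x : coc n Q1" using N1 R1(3) by auto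
  have "rel n Q1 Q1 (cmp D Q1 Q Q1 q j) (nu1 x) (nu1 x)"
   unfolding rel_cmp[OF Q1(1) Qo Q1(1) j(1) q(1)] using j(2)[OF x(1)] q(2)[OF x(2)] x(3) by auto
  moreover have "rel n Q1 Q1 (idm D Q1) (nu1 x) (nu1 x)" unfolding rel_id[OF Q1(1)] by (rule hcong_refl[OF E_ob[OF Q1(1)] x(4)])
  ultimately show "EX y. rel n Q1 Q1 (cmp D Q1 Q Q1 q j) (nu1 x) y & rel n Q1 Q1 (idm D Q1) (nu1 x) y" by blast
 qed (use Q1(1) Qo j(1) q(1) in auto)
 moreover have "cmp D Q Q1 Q j q = e"
 proof (rule rel_unique[OF r Qo Qo])
  fix x assume x: "x : carrier N"
  have "rel n Q Q (cmp D Q Q1 Q j q) (nu x) (nu (ep x))"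
   unfolding rel_cmp[OF Qo Q1(1) Qo q(1) j(1)] using q(2)[OF x] j(2)[OF ep1[OF x]] by blast
  then show "EX y. rel n Q Q (cmp D Q Q1 Q j q) (nu x) y & rel n Q Q e (nu x) y" using ep(2)[OF x] by blast
 qed (use Q1(1) Qo j(1) q(1) e(1) in auto)
 ultimately show thesis using that Q1(1) j(1) q(1) by blast
qed

section \<open>Finite length of maps out of projective objects\<close>

abbreviation P_elt :: "int => 'h elt" where "P_elt n == P_gen n (uvec H 0)"

lemma P_hom_unique:
 assumes X: "X : Ob D" and f: "f : mors D (P n) X" "g : mors D (P n) X"
  and e: "rel n (P n) X f (P_elt n) x" "rel n (P n) X g (P_elt n) x"
 shows "f = g"
proof (rule rel_unique[OF P_gen P_ob X f])
 note a = rel_props[OF P_ob X f(1), where n = n] and b = rel_props[OF P_ob X f(2), where n = n]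
 note G = repD(2)[OF P_gen[of n]]
 fix v assume "v : carrier (free H 1)"
 then show "EX y. rel n (P n) X f (P_gen n v) y & rel n (P n) X g (P_gen n v) y"
 proof (rule free_induct)
  show "EX y. rel n (P n) X f (P_gen n (zr (free H 1))) y & rel n (P n) X g (P_gen n (zr (free H 1))) y"
   unfolding maps_zero[OF G free_left_module cob_module[OF E_ob[OF P_ob]]] using a(7) b(7) by blast
  fix y c i assume y: "y : carrier (free H 1)" "EX z. rel n (P n) X f (P_gen n y) z & rel n (P n) X g (P_gen n y) z"
   "c : carrier H" "i < (1::nat)"
  have u: "uvec H i : carrier (free H 1)" "i = 0" using uvec_closed[OF y(4)] y(4) by auto
  have c: "c *[free H 1] uvec H i : carrier (free H 1)"
   using left_module.act_closed[OF free_left_module y(3) u(1)] .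
  have "P_gen n (y +[free H 1] c *[free H 1] uvec H i) = P_gen n y +[deg n (P n)] c *[deg n (P n)] P_elt n"
   unfolding mapsD(2)[OF G y(1) c] mapsD(3)[OF G y(3) u(1)]
   unfolding u(2) ..
  then show "EX z. rel n (P n) X f (P_gen n (y +[free H 1] c *[free H 1] uvec H i)) z &
    rel n (P n) X g (P_gen n (y +[free H 1] c *[free H 1] uvec H i)) z"
   using y(2) a(5)[OF _ a(6)[OF e(1) y(3)]] b(5)[OF _ b(6)[OF e(2) y(3)]] by metis
 qed
qed

text \<open>Cocycles parametrise the maps from \<open>P n\<close>: each cocycle \<open>x\<close>
  yields \<open>ps x\<close>, linear in \<open>x\<close> because such a map is determined by its
  value at the generator.\<close>

lemma P_hom_fl: assumes X: "X : Ob D" shows "fl K (Mor D (P n) X)"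
proof -
 note CX = E_ob[OF X] and M = cob_module[OF E_ob[OF X], of n]
 have Z: "submodule (coc n X) H (deg n X)"
  by (rule submoduleI[OF M]) (use cocycles_closed[OF CX] coc_carrier[OF CX] in auto)
 let ?V = "scalars H (deg n X(|carrier := coc n X|))"
 have V: "module K ?V" by (rule scalars_module[OF fd submodule_left_module[OF M Z]])
 have fl: "fl K ?V"
  by (rule fl_inj[OF V scalars_module[OF fd M] _ scalars_fl[OF fd M cob_fg[OF CX]], of "%x. x"])
   (auto simp: lin_map_def coc_carrier[OF CX])
 define ps where "ps x = (SOME f. f : mors D (P n) X & rel n (P n) X f (P_elt n) x)" for x
 have ps: "ps x : mors D (P n) X" "rel n (P n) X (ps x) (P_elt n) x" if "x : coc n X" for x
  using someI_ex[of "%f. f : mors D (P n) X & rel n (P n) X f (P_elt n) x"] P_hom[OF X that] unfolding ps_def by blast+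
 have l: "lin_map K ?V (Mor D (P n) X) ps"
  unfolding lin_map_def
 proof (intro conjI ballI funcsetI)
  fix x y assume x: "x : carrier ?V" and y: "y : carrier ?V"
  have c: "x +[deg n X] y : coc n X" using x y cocycles_closed(2)[OF CX] by simp
  have "ps (x +[deg n X] y) = ps x +[Mor D (P n) X] ps y"
   by (rule P_hom_unique[OF X ps(1)[OF c] _ ps(2)[OF c] rel_plus[OF P_ob X]]) (use x y ps X in auto)
  then show "ps (x +[?V] y) = ps x +[Mor D (P n) X] ps y" by simp
 next
  fix a x assume a: "a : carrier K" and x: "x : carrier ?V"
  have c: "scal H a *[deg n X] x : coc n X" using x cocycles_closed(3)[OF CX scalar_closed[OF fd a]] by simp
  have "ps (scal H a *[deg n X] x) = a *[Mor D (P n) X] ps x"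
   by (rule P_hom_unique[OF X ps(1)[OF c] _ ps(2)[OF c] rel_smult[OF P_ob X]])
    (use a x ps X module.smult_closed[OF mor_module] in auto)
  then show "ps (a *[?V] x) = a *[Mor D (P n) X] ps x" by simp
 qed (use ps(1) in auto)
 have s: "mors D (P n) X <= ps ` carrier ?V"
 proof
  fix f assume f: "f : mors D (P n) X"
  have u: "P_elt n : coc n (P n)" using repD(3)[OF P_gen] uvec_closed[of 0 1] by auto
  obtain y where y: "rel n (P n) X f (P_elt n) y" using rel_props(3)[OF P_ob X f u] by blast
  then have yc: "y : coc n X" using rel_props(1)[OF P_ob X f] by blast
  have "f = ps y" by (rule P_hom_unique[OF X f ps(1)[OF yc] y ps(2)[OF yc]])
  then show "f : ps ` carrier ?V" using yc by simp
 qed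
 show ?thesis by (rule finlen_surj[OF V mor_module[OF P_ob X] l fl s submodule_carrier[OF V]])
qed

text \<open>Each generator of \<open>N\<close> is hit by a map from \<open>P n\<close>. A morphism
  out of \<open>Q\<close> that kills all of these acts as zero on cohomology and therefore is
  zero.\<close>

lemma proj_hom_fl: assumes Q: "proj n Q" and X: "X : Ob D" shows "fl K (Mor D Q X)"
proof -
 obtain N nu where r: "rep n N (fob E Q) nu" and Qo: "Q : Ob D" using Q by (auto simp: proj_def)
 note R = repD[OF r] and CX = E_ob[OF X] and CQ = E_ob[OF Qo]
 have M: "left_module H N" using R(7) by simp
 interpret N: left_module H N by (rule M)
 obtain A where A: "finite A" "A <= carrier N" "!!W. [|submodule W H N; A <= W|] ==> W = carrier N"
  using R(7) by (auto simp: fin_generated_def)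
 have "EX g. g : mors D (P n) Q & rel n (P n) Q g (P_elt n) (nu x)" if "x : A" for x
 proof -
  have "x : carrier N" using that A(2) by auto
  from P_hom[OF Qo R(3)[OF this]] show ?thesis by blast
 qed
 then obtain g where g: "!!x. x : A ==> g x : mors D (P n) Q & rel n (P n) Q (g x) (P_elt n) (nu x)" by metis
 show ?thesis
 proof (rule finlen_separated[OF mor_module[OF Qo X] A(1), of "%_. Mor D (P n) X" "%x f. cmp D (P n) Q X f (g x)"])
  show "lin_map K (Mor D Q X) (Mor D (P n) X) (%f. cmp D (P n) Q X f (g x))" if "x : A" for x
   by (rule lin_map_cmp_right) (use g[OF that] Qo X in auto)
  fix f assume f: "f : mors D Q X" and z: "!!x. x : A ==> cmp D (P n) Q X f (g x) = zr (Mor D (P n) X)"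
  note a = rel_props[OF Qo X f, where n = n]
  let ?W = "{x : carrier N. rel n Q X f (nu x) (zr (deg n X))}"
  interpret DX: left_module H "deg n X" by (rule cob_module[OF CX])
  have "?W = carrier N"
  proof (rule A(3)[OF submoduleI[OF M]])
   show "zr N : ?W" using a(7) maps_zero[OF R(2) M cob_module[OF CQ]] by simp
   show "x +[N] y : ?W" if "x : ?W" "y : ?W" for x y
    using that a(5)[of "nu x" "zr (deg n X)" "nu y" "zr (deg n X)"] mapsD(2)[OF R(2)] by simp
   show "b *[N] x : ?W" if "b : carrier H" "x : ?W" for b x
    using that a(6)[of "nu x" "zr (deg n X)" b] mapsD(3)[OF R(2)] left_module_zero[OF cob_module[OF CX]] N.act_closed by simp
   show "A <= ?W"
   proof
    fix x assume x: "x : A"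
    then have xN: "x : carrier N" using A(2) by auto
    note gx = g[OF x]
    obtain y where y: "rel n Q X f (nu x) y" using a(3)[OF R(3)[OF xN]] by blast
    have "rel n (P n) X (cmp D (P n) Q X f (g x)) (P_elt n) y"
     unfolding rel_cmp[OF P_ob Qo X conjunct1[OF gx] f] using gx y by blast
    then have "rel n (P n) X (zr (Mor D (P n) X)) (P_elt n) y" unfolding z[OF x] .
    moreover have "P_elt n : coc n (P n)" using repD(3)[OF P_gen] uvec_closed[of 0 1] by auto
    moreover have "zr (Mor D (P n) X) : mors D (P n) X" using X by simp
    ultimately have "hcong (fob E X) n y (zr (deg n X))" using rel_props(4)[OF P_ob X] rel_zero[OF P_ob X] by blast
    then show "x : ?W" using a(2)[OF y hcong_refl[OF CQ R(3)[OF xN]]] xN by blast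
   qed
  qed auto
  then have "rel n Q X f (nu x) (zr (deg n X))" if "x : carrier N" for x using that by blast
  then show "f = zr (Mor D Q X)"
   using rel_unique[OF r Qo X f] rel_zero[OF Qo X R(3)] Qo X by (metis hom_zero_closed)
 qed (use P_hom_fl[OF X] mor_module[OF P_ob X] in auto)
qed

text \<open>The zero map to \<open>P n\<close> is vacuously injective on maps from
  \<open>P n\<close>, so an object without cohomology counts as projective in every degree.\<close>

lemma acyclic:
 assumes X: "X : Ob D" and z: "!!m. hom_zero D (P m) X" shows "proj n X"
 by (rule proj_subobject[OF P_proj X, of "zr (Mor D X (P n))"]) (use X z hom_zeroD[OF z] in \<open>auto simp: hom_inj_def\<close>)

end

section \<open>Splitting idempotents along triangles\<close>

definition splits :: "('k, 'o, 'm) lincat => 'o => 'm => bool" where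
 "splits C X e \<longleftrightarrow> (EX V j q. retraction C V X j q & cmp C X V X j q = e)"

context linear_category
begin

lemma cmp_rule:
 "[|cmp C X Y Z g f = k; W : Ob C; X : Ob C; Y : Ob C; Z : Ob C; h : mors C W X; f : mors C X Y; g : mors C Y Z|]
  ==> cmp C W Y Z g (cmp C W X Y f h) = cmp C W X Z k h"
 by (simp add: cmp_assoc[symmetric])

text \<open>Fitting's argument is run inside the commutant of \<open>r\<close>, so that the
  quasi-inverse \<open>v\<close> commutes with \<open>r^k\<close>.\<close>

lemma End_fitting:
 assumes X: "X : Ob C" and fl: "fl K (Mor C X X)" and r: "r : mors C X X"
 obtains k v where "k >= (1::nat)" "v : mors C X X"
  "cmp C X X X v (r ^[End C X] k) = cmp C X X X (r ^[End C X] k) v"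
  "cmp C X X X (r ^[End C X] k) (cmp C X X X (r ^[End C X] k) v) = r ^[End C X] k"
proof -
 interpret R: ring "End C X" by (rule End[OF X])
 interpret V: module K "Mor C X X" by (rule mor_module[OF X X])
 let ?A = "{s : mors C X X. cmp C X X X r s = cmp C X X X s r}"
 have A: "submodule ?A K (Mor C X X)"
  unfolding submodule_iff[OF V.module_axioms] using X r by (auto simp: cmp_linear cmp_smult_left cmp_smult_right)
 have "EX k>=1::nat. EX s:?A. r ^[End C X] k =
   r ^[End C X] k **[End C X] r ^[End C X] k **[End C X] s ^[End C X] k"
 proof (rule R.fitting[OF V.module_axioms _ _ _ fl A, of r])
  show "s **[End C X] t : ?A" if "s : ?A" "t : ?A" for s t
   using that X r by simp (metis cmp_assoc)
 qed ((use X r in \<open>simp_all add: cmp_smult_right\<close>)[6], blast)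
 then obtain k s where k: "k >= (1::nat)" "s : ?A" "r ^[End C X] k =
   r ^[End C X] k **[End C X] r ^[End C X] k **[End C X] s ^[End C X] k" by blast
 note s = k(2)[simplified]
 let ?v = "s ^[End C X] k" and ?u = "r ^[End C X] k"
 have c: "?u : mors C X X" "?v : mors C X X" using R.nat_pow_closed[of r k] R.nat_pow_closed[of s k] r s by auto
 have "r **[End C X] s = s **[End C X] r" using s by simp
 then have "?v **[End C X] ?u = ?u **[End C X] ?v"
  using R.pow_mult_distrib[of r s k] R.pow_mult_distrib[of s r k] r s by simp
 then show thesis using that[OF k(1) c(2)] k(3) c X by (simp add: cmp_assoc)
qed

lemma End_pow_right:
 assumes X: "X : Ob C" "W : Ob C" and m: "r : mors C X X" "e : mors C W W" "g : mors C W X"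
  and e: "cmp C W W W e e = e" "cmp C W X X r g = cmp C W W X g e" and k: "k >= (1::nat)"
 shows "cmp C W X X (r ^[End C X] k) g = cmp C W W X g e"
 using k
proof (induction k rule: dec_induct)
 interpret R: ring "End C X" by (rule End[OF X(1)])
 case base then show ?case using m e X by simp
next
 interpret R: ring "End C X" by (rule End[OF X(1)])
 case (step n)
 have "r ^[End C X] n : mors C X X" using R.nat_pow_closed[of r n] m by simp
 then show ?case using step m e X by (simp add: cmp_assoc cmp_rule[OF step.IH])
qed

lemma End_pow_left:
 assumes X: "X : Ob C" "W : Ob C" and m: "r : mors C X X" "e : mors C W W" "g : mors C X W"
  and e: "cmp C W W W e e = e" "cmp C X X W g r = cmp C X W W e g" and k: "k >= (1::nat)"
 shows "cmp C X X W g (r ^[End C X] k) = cmp C X W W e g"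
 using k
proof (induction k rule: dec_induct)
 interpret R: ring "End C X" by (rule End[OF X(1)])
 case base then show ?case using m e X by simp
next
 interpret R: ring "End C X" by (rule End[OF X(1)])
 case (step n)
 have "r ^[End C X] n : mors C X X" using R.nat_pow_closed[of r n] m by simp
 then show ?case using step m e X by (simp add: cmp_rule[OF step.IH] cmp_assoc cmp_rule[OF e(1)])
qed

text \<open>Lifting an idempotent along a map yields some \<open>r\<close> that need not be
  idempotent. The Fitting idempotent \<open>p\<close> may replace it: whatever \<open>r\<close>
  intertwines with an idempotent \<open>e\<close>, so does \<open>p\<close>, because
  \<open>r^k\<close> acts there just as \<open>e\<close> does.\<close>

lemma intertwined_idempotent:
 assumes X: "X : Ob C" and fl: "fl K (Mor C X X)" and r: "r : mors C X X"
 obtains p where "p : mors C X X" "cmp C X X X p p = p"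
  "!!W e g. [|W : Ob C; e : mors C W W; g : mors C W X; cmp C W W W e e = e; cmp C W X X r g = cmp C W W X g e|]
   ==> cmp C W X X p g = cmp C W W X g e"
  "!!W e g. [|W : Ob C; e : mors C W W; g : mors C X W; cmp C W W W e e = e; cmp C X X W g r = cmp C X W W e g|]
   ==> cmp C X X W g p = cmp C X W W e g"
proof -
 interpret R: ring "End C X" by (rule End[OF X])
 obtain k v where k: "k >= (1::nat)" "v : mors C X X"
  "cmp C X X X v (r ^[End C X] k) = cmp C X X X (r ^[End C X] k) v"
  "cmp C X X X (r ^[End C X] k) (cmp C X X X (r ^[End C X] k) v) = r ^[End C X] k"
  by (rule End_fitting[OF X fl r])
 define u where "u = r ^[End C X] k"
 have u: "u : mors C X X" using R.nat_pow_closed[of r k] r by (simp add: u_def)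
 note k' = k(3,4)[folded u_def]
 have uv: "cmp C X X X v (cmp C X X X u u) = u" using k' k(2) u X by (metis cmp_assoc)
 show thesis
 proof (rule that[of "cmp C X X X u v"])
  show "cmp C X X X u v : mors C X X" using u k(2) X by simp
  show "cmp C X X X (cmp C X X X u v) (cmp C X X X u v) = cmp C X X X u v"
   using u k(2) k' X by (metis cmp_assoc cmp_closed)
 next
  fix W e g assume W: "W : Ob C" "e : mors C W W" "g : mors C W X" "cmp C W W W e e = e" "cmp C W X X r g = cmp C W W X g e"
  have ug: "cmp C W X X u g = cmp C W W X g e" unfolding u_def by (rule End_pow_right[OF X W(1) r W(2-5) k(1)])
  have "cmp C W X X (cmp C X X X u v) g = cmp C W X X v (cmp C W X X u g)"
   using W u k(2) k'(1) X by (simp add: cmp_assoc[symmetric])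
  also have "... = cmp C W X X v (cmp C W X X u (cmp C W X X u g))"
   using W u k(2) X ug cmp_rule[OF ug, of W e] by (simp add: cmp_assoc)
  also have "... = cmp C W X X u g" using W u k(2) X by (simp add: cmp_assoc[symmetric]) (simp add: cmp_assoc uv)
  finally show "cmp C W X X (cmp C X X X u v) g = cmp C W W X g e" using ug by simp
 next
  fix W e g assume W: "W : Ob C" "e : mors C W W" "g : mors C X W" "cmp C W W W e e = e" "cmp C X X W g r = cmp C X W W e g"
  have gu: "cmp C X X W g u = cmp C X W W e g" unfolding u_def by (rule End_pow_left[OF X W(1) r W(2-5) k(1)])
  have "cmp C X X W (cmp C X X W g u) (cmp C X X X u v) = cmp C X W W e (cmp C X X W g (cmp C X X X u v))"
   using W u k(2) X by (simp add: gu cmp_assoc)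
  moreover have "cmp C X X W (cmp C X X W g u) (cmp C X X X u v) = cmp C X X W g u" using W u k k' X by (simp add: cmp_assoc)
  moreover have "cmp C X X W g (cmp C X X X u v) = cmp C X W W e (cmp C X X W g v)"
   using W u k(2) X gu by (simp add: cmp_assoc[symmetric])
  moreover have "cmp C X W W e (cmp C X W W e (cmp C X X W g v)) = cmp C X W W e (cmp C X X W g v)"
   using W u k(2) X by (simp add: cmp_rule[OF W(4)])
  ultimately show "cmp C X X W g (cmp C X X X u v) = cmp C X W W e g" using gu by simp
 qed
qed

end

context triangulated_category
begin

lemma tri_complete_w:
 assumes "X : Ob C" "Z : Ob C" "w : mors C Z (sh X)"
 obtains Y u v where "(X, Y, Z, u, v, w) : \<Delta>"
proof -
 obtain Y v m where t: "(Y, Z, sh X, v, w, m) : \<Delta>" using tri_complete_right[of Z "sh X" w] assms by auto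
 note t' = triD[OF t]
 obtain n where n: "n : mors C X Y" "m = shm X Y n" using sh_full[OF assms(1) t'(1,6)] .
 have "-[Mor C (sh X) (sh Y)] shm X Y (-[Mor C X Y] n) = m"
  using linear_functor_neg[OF sh_functor is_linear_category is_linear_category] n assms t' by simp
 then have "(X, Y, Z, -[Mor C X Y] n, v, w) : \<Delta>" using TR2[of X Y Z "-[Mor C X Y] n" v w] t t' assms n by (simp add: candidate_triangle_def)
 then show thesis by (rule that)
qed

lemma tri_middleE:
 assumes t: "(X, Y, Z, u, v, w) : \<Delta>" and s: "(X', Y', Z', u', v', w') : \<Delta>"
  and a: "a : mors C X X'" and c: "c : mors C Z Z'"
  and e: "cmp C Z (sh X) (sh X') (shm X X' a) w = cmp C Z Z' (sh X') w' c"
 obtains b where "b : mors C Y Y'" "cmp C X Y Y' b u = cmp C X X' Y' u' a" "cmp C Y Y' Z' v' b = cmp C Y Z Z' c v"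
proof -
 note t' = triD[OF t] and s' = triD[OF s]
 obtain b where b: "b : mors C Y Y'" "cmp C Y Z Z' c v = cmp C Y Y' Z' v' b"
  "cmp C (sh X) (sh Y) (sh Y') (shm Y Y' b) (-[Mor C (sh X) (sh Y)] shm X Y u) =
   cmp C (sh X) (sh X') (sh Y') (-[Mor C (sh X') (sh Y')] shm X' Y' u') (shm X X' a)"
  using TR3_backE[OF tri_rotate[OF t] tri_rotate[OF s] c _ e] t' s' a by auto
 have "shm X Y' (cmp C X Y Y' b u) = shm X Y' (cmp C X X' Y' u' a)"
  using b(1,3) t' s' a by (simp add: sh_cmp cmp_neg_left cmp_neg_right hom_neg_inject)
 then have "cmp C X Y Y' b u = cmp C X X' Y' u' a" 
  using sh_faithful[OF t'(1) s'(2) cmp_closed[OF t'(1,2) s'(2) t'(4) b(1)] cmp_closed[OF t'(1) s'(1,2) a s'(4)]] by blast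
 then show thesis using that b by simp
qed

text \<open>The split images \<open>V\<close> and \<open>W\<close> of the outer idempotents are
  joined by a triangle with middle object \<open>U\<close>, compared with the given one by
  \<open>al\<close> and \<open>be\<close>. The composite \<open>be e al\<close> is unipotent, hence
  invertible, and its inverse corrects the comparison maps to a splitting of
  \<open>e\<close>.\<close>

lemma splits_middle:
 assumes t: "(Q, Y, Z, a, b, c) : \<Delta>" and e: "e : mors C Y Y" "cmp C Y Y Y e e = e"
  and p: "p : mors C Q Q" "cmp C Q Q Y a p = cmp C Q Y Y e a" "splits C Q p"
  and z: "z : mors C Z Z" "cmp C Y Z Z z b = cmp C Y Y Z b e" "splits C Z z"
   "cmp C Z Z (sh Q) c z = cmp C Z (sh Q) (sh Q) (shm Q Q p) c"
 shows "splits C Y e"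
proof -
 obtain V j q where "retraction C V Q j q" and jq: "cmp C Q V Q j q = p" using p(3) by (auto simp: splits_def)
 note V = retractionD[OF this(1)]
 obtain W k l where "retraction C W Z k l" and kl: "cmp C Z W Z k l = z" using z(3) by (auto simp: splits_def)
 note W = retractionD[OF this(1)]
 note t' = triD[OF t]
 define w where "w = cmp C W (sh Q) (sh V) (shm Q V q) (cmp C W Z (sh Q) c k)"
 have wm: "w : mors C W (sh V)" using V W t' by (simp add: w_def)
 obtain U g h where s: "(V, U, W, g, h, w) : \<Delta>" by (rule tri_complete_w[OF V(1) W(1) wm])
 note s' = triD[OF s]
 have zk: "cmp C W Z Z z k = k" and lz: "cmp C Z Z W l z = l" and pj: "cmp C V Q Q p j = j" and qp: "cmp C Q Q V q p = q"
  unfolding kl[symmetric] jq[symmetric] using V W by (simp_all add: cmp_assoc cmp_cancel[OF _ W(1,2)] cmp_cancel[OF _ V(1,2)] cmp_rule[OF W(5)] cmp_rule[OF V(5)] )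
 have pp: "cmp C Q Q Q p p = p" and zz: "cmp C Z Z Z z z = z"
  unfolding kl[symmetric] jq[symmetric] using V W by (simp_all add: cmp_assoc cmp_rule[OF W(5)] cmp_rule[OF V(5)])
 have 1: "cmp C W (sh V) (sh Q) (shm V Q j) w = cmp C W Z (sh Q) c k"
 proof -
  have "cmp C W (sh V) (sh Q) (shm V Q j) w = cmp C W (sh Q) (sh Q) (shm Q Q p) (cmp C W Z (sh Q) c k)"
   unfolding w_def jq[symmetric] using V W t' by (simp add: sh_cmp cmp_assoc)
  also have "... = cmp C W Z (sh Q) c (cmp C W Z Z z k)" using W t' p z by (simp add: cmp_assoc[symmetric])
  finally show ?thesis by (simp add: zk)
 qed
 have 2: "cmp C Z (sh Q) (sh V) (shm Q V q) c = cmp C Z W (sh V) w l"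
 proof -
  have "cmp C Z W (sh V) w l = cmp C Z (sh Q) (sh V) (shm Q V q) (cmp C Z Z (sh Q) c z)"
   unfolding w_def kl[symmetric] using V W t' by (simp add: cmp_assoc)
  also have "... = cmp C Z (sh Q) (sh V) (shm Q V (cmp C Q Q V q p)) c"
   using V t' p z by (simp add: sh_cmp cmp_assoc)
  finally show ?thesis by (simp add: qp)
 qed
 obtain al where al: "al : mors C U Y" "cmp C V U Y al g = cmp C V Q Y a j" "cmp C U Y Z b al = cmp C U W Z k h"
  by (rule tri_middleE[OF s t V(3) W(3) 1])
 obtain be where be: "be : mors C Y U" "cmp C Q Y U be a = cmp C Q V U g q" "cmp C Y U W h be = cmp C Y Z W l b"
  by (rule tri_middleE[OF t s V(4) W(4) 2])
 note m = V(1-4) W(1-4) t' s' al(1) be(1) e(1) p(1) z(1)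
 define f where "f = cmp C U Y U be (cmp C U Y Y e al)"
 have fm: "f : mors C U U" using m by (simp add: f_def)
 have fg: "cmp C V U U f g = g"
  unfolding f_def using m by (simp add: cmp_assoc al(2) cmp_rule[OF p(2)[symmetric]] pj cmp_rule[OF be(2)] V(5))
 have hf: "cmp C U U W h f = h"
  unfolding f_def using m by (simp add: cmp_rule[OF be(3)] cmp_assoc cmp_rule[OF z(2)[symmetric]] al(3) cmp_rule[OF lz] cmp_rule[OF W(5)])
 obtain f' where f': "f' : mors C U U" "cmp C U U U f' f = idm C U" "cmp C U U U f f' = idm C U"
  using tri_unipotent_iso[OF s fm fg hf] by (auto simp: is_iso_def is_inverse_def)
 have f'g: "cmp C V U U f' g = g" using fg f' m fm by (metis cmp_assoc cmp_id_left)
 have hf': "cmp C U U W h f' = h" using hf f' m fm by (metis cmp_assoc cmp_id_right)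
 let ?J = "cmp C U Y Y e al" and ?P = "cmp C Y U U f' (cmp C Y Y U be e)"
 have PJ: "cmp C U Y U ?P ?J = idm C U"
  using f' m by (simp add: cmp_assoc cmp_rule[OF e(2)] f_def)
 \<comment> \<open>The error of the splitting. It kills \<open>a\<close> and is killed by
   \<open>b\<close>, so its square is zero; as a difference of nested idempotents it also equals its
   square.\<close>
 define x where "x = e -[Mor C Y Y] cmp C Y U Y ?J ?P"
 have xm: "x : mors C Y Y" using m f' by (simp add: x_def)
 have "cmp C Q Y Y (cmp C Y U Y ?J ?P) a = cmp C Q Y Y e a"
  using m f' by (simp add: cmp_assoc p(2)[symmetric] cmp_rule[OF be(2)] qp cmp_rule[OF f'g] cmp_rule[OF al(2)] jq cmp_rule[OF p(2)[symmetric]] pp)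
 then have xa: "cmp C Q Y Y x a = zr (Mor C Q Y)" unfolding x_def using m f' by (simp add: cmp_linear hom_diff_zero)
 have "cmp C Y Y Z b (cmp C Y U Y ?J ?P) = cmp C Y Y Z b e"
  using m f' by (simp add: cmp_assoc cmp_rule[OF z(2)[symmetric]] cmp_rule[OF al(3)] cmp_rule[OF hf'] cmp_rule[OF be(3)] cmp_rule[OF zk] cmp_rule[OF kl] cmp_rule[OF zz] z(2)[symmetric])
 then have bx: "cmp C Y Y Z b x = zr (Mor C Y Z)" unfolding x_def using m f' by (simp add: cmp_linear hom_diff_zero)
 obtain n where n: "n : mors C Z Y" "x = cmp C Y Z Y n b" by (rule tri_extend[OF t t'(2) xm xa])
 have "cmp C Y Y Y x x = cmp C Y Z Y n (cmp C Y Y Z b x)" using n m xm cmp_assoc[of Y Y Z Y x b n] by simp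
 then have xx: "cmp C Y Y Y x x = zr (Mor C Y Y)" using bx n m by simp
 define y where "y = cmp C Y U Y ?J ?P"
 have y: "y : mors C Y Y" "cmp C Y Y Y e y = y" "cmp C Y Y Y y e = y" "cmp C Y Y Y y y = y"
  unfolding y_def using m f' PJ cmp_rule[OF PJ, of Y ?P] by (simp_all add: cmp_assoc cmp_rule[OF e(2)] e(2))
 have xy: "x = e -[Mor C Y Y] y" by (simp add: x_def y_def)
 have "cmp C Y Y Y x x = (e -[Mor C Y Y] y) -[Mor C Y Y] (y -[Mor C Y Y] y)"
  unfolding xy using t'(2) e y by (simp add: cmp_diff_left cmp_diff_right)
 then have "e -[Mor C Y Y] y = zr (Mor C Y Y)"
  using xx t'(2) y(1) e(1) hom_diff_zero[of Y Y y y] by (simp add: a_minus_def hom_minus_zero)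
 then have "cmp C Y U Y ?J ?P = e" using t'(2) y(1) e(1) hom_diff_zero[of Y Y e y] by (simp add: y_def)
 moreover have "retraction C U Y ?J ?P" using m f' PJ by (simp add: retraction_def)
 ultimately show ?thesis by (auto simp: splits_def)
qed

end

section \<open>Devissage\<close>

context derived_model
begin

text \<open>The third object of a projective cover in degree \<open>n\<close> has no cohomology
  there and can gain some only in degree \<open>n - 1\<close>. If \<open>X\<close> lives in degree
  \<open>n\<close> alone, the gain is the kernel of the cover, projective by heredity: resolutions
  have length one.\<close>

lemma P_cover:
 assumes X: "X : Ob D"
 obtains Q Y a b c where "proj n Q" "(Q, X, Y, a, b, c) : \<Delta>" "hom_surj (P n) Q X a" "hom_zero D (P n) Y"
  "!!m. [|m ~= n - 1; hom_zero D (P m) X|] ==> hom_zero D (P m) Y"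
  "(!!m. m ~= n ==> hom_zero D (P m) X) ==> proj (n - 1) Y"
proof -
 obtain Q a where Q: "proj n Q" "a : mors D Q X" "hom_surj (P n) Q X a" by (rule proj_cover[OF X])
 note Qo = proj_ob[OF Q(1)]
 obtain Y b c where t: "(Q, X, Y, a, b, c) : \<Delta>" using TR1_complete[OF Qo X Q(2)] by blast
 note t' = triD[OF t]
 have S: "proj (n - 1) (sh Q)" using proj_suspension[OF Qo, of "n - 1"] Q(1) by simp
 have lift: "EX g:mors D (P m) X. f = cmp D (P m) X Y b g"
  if "m ~= n - 1" "f : mors D (P m) Y" for m f
  using tri_lift_w[OF t P_ob that(2)] hom_zeroD[OF proj_concentrated[OF S that(1)], of "cmp D (P m) Y (sh Q) c f"] t' that(2)
  by (metis P_ob sh_ob cmp_closed)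
 have 1: "hom_zero D (P n) Y"
 proof (rule hom_zeroI[OF P_ob t'(3)])
  fix f assume "f : mors D (P n) Y"
  then obtain g where g: "g : mors D (P n) X" "f = cmp D (P n) X Y b g" using lift[of n f] by auto
  obtain h where h: "h : mors D (P n) Q" "g = cmp D (P n) Q X a h" using Q(3) g(1) by (auto simp: hom_surj_def)
  show "f = zr (Mor D (P n) Y)" using g h t' tri_vu[OF t] by (simp add: cmp_assoc[symmetric])
 qed
 have 2: "hom_zero D (P m) Y" if "m ~= n - 1" "hom_zero D (P m) X" for m
  using lift[OF that(1)] hom_zeroD[OF that(2)] t' by (intro hom_zeroI[OF P_ob t'(3)]) (metis P_ob cmp_zero_right)
 have "proj (n - 1) Y" if "!!m. m ~= n ==> hom_zero D (P m) X"
 proof (rule proj_subobject[OF S t'(3,6)])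
  have "f = zr (Mor D (P (n - 1)) Y)"
   if f: "f : mors D (P (n - 1)) Y" "cmp D (P (n - 1)) Y (sh Q) c f = zr (Mor D (P (n - 1)) (sh Q))" for f
  proof -
   obtain g where "g : mors D (P (n - 1)) X" "f = cmp D (P (n - 1)) X Y b g" by (rule tri_lift_w[OF t P_ob f])
   then show ?thesis using hom_zeroD[OF \<open>!!m. m ~= n ==> hom_zero D (P m) X\<close>, of "n - 1" g] t' by simp
  qed
  then show "hom_inj (P (n - 1)) Y (sh Q) c" by (simp add: hom_inj_def)
  show "hom_zero D (P m) Y" if "m ~= n - 1" for m using 1 2[OF that] that \<open>!!m. m ~= n ==> hom_zero D (P m) X\<close> by (cases "m = n") auto
 qed
 then show thesis using that[OF Q(1) t Q(3) 1] 2 by blast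
qed

lemma bounded_below: assumes "X : Ob D" shows "EX n. ALL m<n. hom_zero D (P m) X"
proof -
 obtain n where "!!m. m : {m. ~ hom_zero D (P m) X} ==> n <= m"
  using bounded[OF assms] bdd_below_finite[of "{m. ~ hom_zero D (P m) X}"] by (auto simp: bdd_below_def)
 then show ?thesis by (intro exI[of _ n]) (metis mem_Collect_eq not_less)
qed

text \<open>Induction on the width of the range of degrees. At width one heredity makes the next
  object projective, in degree \<open>k - 1\<close>, so the recursion ends there instead of
  descending forever.\<close>

lemma devissage:
 assumes X: "X : Ob D" and n: "ALL m>n. hom_zero D (P m) X"
  and base: "!!k Q. [|k <= n; proj k Q|] ==> R Q"
  and step: "!!k Q X Y a b c. [|k <= n; proj k Q; (Q, X, Y, a, b, c) : \<Delta>; hom_surj (P k) Q X a; R Y|] ==> R X"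
 shows "R X"
proof -
 have "R X" if "X : Ob D" "!!m. m > k ==> hom_zero D (P m) X" "!!m. m < l ==> hom_zero D (P m) X" "k <= n" for k l X
  using that
 proof (induction "nat (k + 1 - l)" arbitrary: k X rule: less_induct)
  case less
  obtain Q Y a b c where c: "proj k Q" "(Q, X, Y, a, b, c) : \<Delta>" "hom_surj (P k) Q X a" "hom_zero D (P k) Y"
   "!!m. [|m ~= k - 1; hom_zero D (P m) X|] ==> hom_zero D (P m) Y"
   "(!!m. m ~= k ==> hom_zero D (P m) X) ==> proj (k - 1) Y" by (rule P_cover[OF less.prems(1), of k]) blast
  consider "k < l" | "k = l" | "l < k" by linarith
  then show ?case
  proof cases
   case 1
   have "proj k X" by (rule acyclic[OF less.prems(1)]) (meson 1 less.prems(2,3) not_less less_le_trans)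
   then show ?thesis using base less.prems(4) by blast
  next
   case 2
   have "proj (k - 1) Y" by (rule c(6)) (use 2 less.prems(2,3) in \<open>metis linorder_neqE\<close>)
   then show ?thesis using step[OF less.prems(4) c(1-3)] base[of "k - 1" Y] less.prems(4) by simp
  next
   case 3
   have "R Y"
   proof (rule less.hyps[of "k - 1"])
    show "hom_zero D (P m) Y" if "k - 1 < m" for m using c(4) c(5)[of m] less.prems(2)[of m] that by (cases "m = k") auto
    show "hom_zero D (P m) Y" if "m < l" for m using c(5)[of m] less.prems(3)[of m] that 3 by simp
   qed (use 3 less.prems triD[OF c(2)] in auto)
   then show ?thesis using step[OF less.prems(4) c(1-3)] by blast
  qed
 qed
 moreover obtain l where "!!m. m < l ==> hom_zero D (P m) X" using bounded_below[OF X] by blast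
 ultimately show ?thesis using X n by blast
qed

lemma bounded_above: assumes "X : Ob D" shows "EX n. ALL m>n. hom_zero D (P m) X"
proof -
 obtain n where "!!m. m : {m. ~ hom_zero D (P m) X} ==> m <= n"
  using bounded[OF assms] bdd_above_finite[of "{m. ~ hom_zero D (P m) X}"] by (auto simp: bdd_above_def)
 then show ?thesis by (intro exI[of _ n]) (metis mem_Collect_eq not_less)
qed

lemma D_hom_fl: assumes X: "X : Ob D" and Z: "Z : Ob D" shows "fl K (Mor D X Z)"
proof -
 obtain n where n: "ALL m>n. hom_zero D (P m) X" using bounded_above[OF X] by blast
 show ?thesis
 proof (rule devissage[OF X n, where R = "%X. fl K (Mor D X Z)"])
  fix k Q X Y a b c
  assume step: "k <= n" "proj k Q" "(Q, X, Y, a, b, c) : \<Delta>" "hom_surj (P k) Q X a" "fl K (Mor D Y Z)"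
  note t' = triD[OF step(3)]
  show "fl K (Mor D X Z)"
  proof (rule finlen_exact[OF mor_module[OF t'(3) Z] mor_module[OF t'(2) Z] mor_module[OF t'(1) Z]
     lin_map_cmp_right[OF t'(2,3) Z t'(5)] lin_map_cmp_right[OF t'(1,2) Z t'(4)] step(5) proj_hom_fl[OF step(2) Z]])
   fix f assume "f : mors D X Z" "cmp D Q X Z f a = zr (Mor D Q Z)"
   then obtain h where "h : mors D Y Z" "f = cmp D X Y Z h b" by (rule tri_extend[OF step(3) Z])
   then show "f : (%g. cmp D X Y Z g b) ` mors D Y Z" by blast
  qed
 qed (rule proj_hom_fl[OF _ Z])
qed

lemma D_splits:
 assumes X: "X : Ob D" and e: "e : mors D X X" "cmp D X X X e e = e" shows "splits D X e"
proof -
 obtain n where n: "ALL m>n. hom_zero D (P m) X" using bounded_above[OF X] by blast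
 have base: "splits D Q e" if Q: "proj k Q" "e : mors D Q Q" "cmp D Q Q Q e e = e" for k Q e
 proof -
  obtain Q1 j q where "Q1 : Ob D" "j : mors D Q1 Q" "q : mors D Q Q1" "cmp D Q1 Q Q1 q j = idm D Q1" "cmp D Q Q1 Q j q = e"
   by (rule proj_idempotent[OF Q])
  then show ?thesis using proj_ob[OF Q(1)] unfolding splits_def retraction_def by blast
 qed
 let ?R = "%X. ALL e. e : mors D X X & cmp D X X X e e = e --> splits D X e"
 have "?R X"
 proof (rule devissage[OF X n, where R = ?R])
  fix k Q X Y a b c
  assume step: "k <= n" "proj k Q" "(Q, X, Y, a, b, c) : \<Delta>" "hom_surj (P k) Q X a" "?R Y"
  note t' = triD[OF step(3)]
  show "?R X"
  proof (intro allI impI)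
   fix e assume "e : mors D X X & cmp D X X X e e = e"
   then have e: "e : mors D X X" "cmp D X X X e e = e" by auto
   have "hom_surj Q Q X a" by (rule proj_surj[OF step(2) t'(1,2,4) step(4)])
   then obtain r where r: "r : mors D Q Q" "cmp D Q X X e a = cmp D Q Q X a r"
    using t' e by (auto simp: hom_surj_def)
   obtain p where p: "p : mors D Q Q" "cmp D Q Q Q p p = p" "cmp D Q Q X a p = cmp D Q X X e a"
    using intertwined_idempotent[OF t'(1) D_hom_fl[OF t'(1,1)] r(1)] t'(2,4) e r(2) by metis
   obtain s where s: "s : mors D Y Y" "cmp D X Y Y s b = cmp D X X Y b e"
    "cmp D Y (sh Q) (sh Q) (shm Q Q p) c = cmp D Y Y (sh Q) c s"
    by (rule TR3E[OF step(3,3) p(1) e(1) p(3)[symmetric]])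
   obtain z where z: "z : mors D Y Y" "cmp D Y Y Y z z = z" "cmp D X Y Y z b = cmp D X X Y b e"
    "cmp D Y Y (sh Q) c z = cmp D Y (sh Q) (sh Q) (shm Q Q p) c"
   proof (rule intertwined_idempotent[OF t'(3) D_hom_fl[OF t'(3,3)] s(1)])
    fix z assume z: "z : mors D Y Y" "cmp D Y Y Y z z = z"
     "!!W e g. [|W : Ob D; e : mors D W W; g : mors D W Y; cmp D W W W e e = e; cmp D W Y Y s g = cmp D W W Y g e|]
      ==> cmp D W Y Y z g = cmp D W W Y g e"
     "!!W e g. [|W : Ob D; e : mors D W W; g : mors D Y W; cmp D W W W e e = e; cmp D Y Y W g s = cmp D Y W W e g|]
      ==> cmp D Y Y W g z = cmp D Y W W e g"
    show thesis
     by (rule that[OF z(1,2) z(3)[OF t'(2) e(1) t'(5) e(2) s(2)] z(4)[OF sh_ob[OF t'(1)] _ t'(6) _ s(3)[symmetric]]])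
      (use p t' in \<open>simp_all add: sh_cmp[symmetric]\<close>)
   qed
   show "splits D X e"
    by (rule splits_middle[OF step(3) e p(1,3) base[OF step(2) p(1,2)] z(1,3) _ z(4)]) (use step(5) z in blast)
  qed
 qed (use base in blast)
 then show ?thesis using e by blast
qed

lemma hom_zero_tri:
 assumes t: "(Q, X, Y, a, b, c) : \<Delta>" and Z: "Z : Ob D" "hom_zero D Q Z" "hom_zero D Y Z" shows "hom_zero D X Z"
proof (rule hom_zeroI[OF triD(2)[OF t] Z(1)])
 note t' = triD[OF t]
 fix f assume f: "f : mors D X Z"
 then have "cmp D Q X Z f a = zr (Mor D Q Z)" using hom_zeroD[OF Z(2)] t' Z(1) by simp
 then obtain g where "g : mors D Y Z" "f = cmp D X Y Z g b" by (rule tri_extend[OF t Z(1) f])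
 moreover from this(1) have "g = zr (Mor D Y Z)" by (rule hom_zeroD[OF Z(3)])
 ultimately show "f = zr (Mor D X Z)" using t' Z(1) by simp
qed

text \<open>\<open>X\<close> is built from projective objects in degrees at most \<open>n\<close>,
  none of which maps to \<open>Z\<close>.\<close>

lemma hom_zero_degrees:
 assumes X: "X : Ob D" and n: "ALL m>n. hom_zero D (P m) X"
  and Z: "Z : Ob D" "!!m. m <= n ==> hom_zero D (P m) Z"
 shows "hom_zero D X Z"
proof (rule devissage[OF X n, where R = "%X. hom_zero D X Z"])
 show "hom_zero D Q Z" if "k <= n" "proj k Q" for k Q using proj_vanish Z that by blast
 fix k Q X Y a b c
 assume step: "k <= n" "proj k Q" "(Q, X, Y, a, b, c) : \<Delta>" "hom_surj (P k) Q X a" "hom_zero D Y Z"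
 show "hom_zero D X Z" by (rule hom_zero_tri[OF step(3) Z(1) proj_vanish[OF step(2) Z(1) Z(2)[OF step(1)]] step(5)])
qed

text \<open>Every object is built from local ones: split idempotents until all endomorphisms are invertible or nilpotent.\<close>

lemma D_local_decomposition:
 assumes X: "X : Ob D"
 shows "EX S<=Ob D. in_add D S X & (ALL Y:S. local_object D Y & retract D Y X)"
 using X
proof (induction "len K (Mor D X X) (mors D X X)" arbitrary: X rule: less_induct)
 case less
 note X = less.prems
 interpret R: ring "End D X" by (rule End[OF X])
 consider "zero_object D X" | "local_object D X" | "~ zero_object D X" "~ local_object D X" by blast
 then show ?case
 proof cases
  case 1
  then have "in_add D {} X" using X thru.thru_zero[of D X X "{}"] by (simp add: in_add_def zero_object_def)
  then show ?thesis by blast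
 next
  case 2
  then have "retract D X X" using X by (intro isomorphic_retract isomorphic_refl)
  then show ?thesis using 2 X in_add_self[of "{X}" X] by (intro exI[of _ "{X}"]) auto
 next
  case 3
  then obtain r where r: "r : mors D X X" "r ~: Units (End D X)" "!!n::nat. r ^[End D X] n ~= zr (Mor D X X)"
   using X by (auto simp: local_object_def unit_or_nilpotent_def zero_object_def)
  obtain k v where k: "k >= (1::nat)" "v : mors D X X"
   "cmp D X X X v (r ^[End D X] k) = cmp D X X X (r ^[End D X] k) v"
   "cmp D X X X (r ^[End D X] k) (cmp D X X X (r ^[End D X] k) v) = r ^[End D X] k"
   by (rule End_fitting[OF X D_hom_fl[OF X X] r(1)])
  obtain l where l: "k = Suc l" using k(1) by (cases k) auto
  define u w where "u = r ^[End D X] k" and "w = r ^[End D X] l"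
  have u: "u : mors D X X" "w : mors D X X" "u = cmp D X X X w r" "u = cmp D X X X r w"
   using R.nat_pow_closed[of r] R.nat_pow_Suc2[of r l] r(1) X by (auto simp: u_def w_def l)
  note k' = k(3,4)[folded u_def]
  let ?e = "cmp D X X X u v"
  have e: "?e : mors D X X" "cmp D X X X ?e ?e = ?e"
  proof -
   show "?e : mors D X X" using u(1) k(2) X by simp
   show "cmp D X X X ?e ?e = ?e" using u(1) k(2) k' X by (metis cmp_assoc cmp_closed)
  qed
  \<comment> \<open>The idempotent is neither 0 nor 1: the former would make \<open>r^k\<close>
    zero, the latter would make \<open>r\<close> invertible.\<close>
  have e0: "?e ~= zr (Mor D X X)" using k'(2) r(3)[of k] u(1) X by (auto simp: u_def[symmetric])
  have e1: "?e ~= idm D X"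
  proof
   assume e1: "?e = idm D X"
   have "cmp D X X X (cmp D X X X v w) r = idm D X" "cmp D X X X r (cmp D X X X w v) = idm D X"
    using e1 k'(1) u k(2) r(1) X by (metis cmp_assoc)+
   moreover from this have "cmp D X X X v w = cmp D X X X w v" using u k(2) r(1) X by (metis cmp_assoc cmp_closed cmp_id_left cmp_id_right)
   ultimately have "is_inverse D X X r (cmp D X X X w v)" using u k(2) r(1) X by (simp add: is_inverse_def)
   then show False using r(2) Units_End[OF X] by (auto simp: is_iso_def)
  qed
  obtain V j q where V: "retraction D V X j q" "cmp D X V X j q = ?e" using D_splits[OF X e] by (auto simp: splits_def)
  note V' = retractionD[OF V(1)]
  obtain Y m n where Y: "Y : Ob D" "m : mors D Y X" "n : mors D X Y" "cmp D Y X Y n m = idm D Y"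
   "cmp D V X Y n j = zr (Mor D V Y)" "cmp D Y X V q m = zr (Mor D Y V)"
   "cmp D X V X j q +[Mor D X X] cmp D X Y X m n = idm D X" by (rule retraction_complement[OF V(1)])
  have Vz: "~ zero_object D V" using zero_object_hom(1)[OF _ X, of V j] V' V(2) e0 X by auto
  have Yz: "~ zero_object D Y" using zero_object_hom(1)[OF _ X, of Y m] Y V(2) e e1 X by auto
  have d: "direct_sum2 D X V Y" using V' Y by (intro direct_sum2I[of X V Y j q m n]) auto
  obtain S where S: "S <= Ob D" "in_add D S V" "ALL Y:S. local_object D Y & retract D Y V"
   using less.hyps[OF len_End_less[OF Y(1) X V'(1) Y(2,3) V'(3,4) Y(4) V'(5) Y(6) Yz D_hom_fl[OF X X]] V'(1)] by blast
  obtain S' where S': "S' <= Ob D" "in_add D S' Y" "ALL W:S'. local_object D W & retract D W Y"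
   using less.hyps[OF len_End_less[OF V'(1) X Y(1) V'(3,4) Y(2,3) V'(5) Y(4,5) Vz D_hom_fl[OF X X]] Y(1)] by blast
  have "in_add D (S \<union> S') X"
   by (rule in_add_trans[OF direct_sum2_in_add[OF d]]) (use in_add_mono[OF S(2)] in_add_mono[OF S'(2)] V' Y(1) S(1) S'(1) in auto)
  then show ?thesis using S S' direct_sum2_retract[OF d] retract_trans by (intro exI[of _ "S \<union> S'"]) blast
 qed
qed

end

section \<open>Serre duality and the cluster functor\<close>

lemma linear_functor_thru:
 assumes F: "linear_functor K C C' F" "linear_category K C" "linear_category K C'" and Ob: "S <= Ob C" "X : Ob C" "Y : Ob C"
  and f: "f : thru C S X Y"
 shows "fmor F X Y f : thru C' (fob F ` S) (fob F X) (fob F Y)"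
 using f
proof (induction rule: thru.induct)
 interpret F: linear_functor K C C' F by (rule F)
 interpret C: linear_category K C by (rule F)
 { case thru_zero show ?case unfolding linear_functor_zero[OF F Ob(2,3)] by (rule thru.thru_zero) }
 { case (thru_cmp W b a) then show ?case using Ob by (subst F.fmor_cmp) (auto intro!: thru.thru_cmp F.fmor_closed) }
 { case (thru_add f g) then show ?case using Ob C.thru_closed[OF Ob(1)] by (subst F.fmor_add) (auto intro: thru.thru_add) }
qed

lemma linear_functor_retract:
 assumes "linear_functor K C C' F" "retract C X Y" shows "retract C' (fob F X) (fob F Y)"
proof -
 interpret F: linear_functor K C C' F by fact
 obtain j p where r: "X : Ob C" "Y : Ob C" "j : mors C X Y" "p : mors C Y X" "cmp C X Y X p j = idm C X"
  using assms(2) by (auto simp: retract_def retraction_def)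
 then have "retraction C' (fob F X) (fob F Y) (fmor F X Y j) (fmor F Y X p)"
  by (simp add: retraction_def F.fob_closed F.fmor_closed F.fmor_cmp[symmetric] F.fmor_id)
 then show ?thesis by (auto simp: retract_def)
qed

lemma linear_functor_isomorphic:
 assumes "linear_functor K C C' F" "isomorphic C X Y" shows "isomorphic C' (fob F X) (fob F Y)"
proof -
 interpret F: linear_functor K C C' F by fact
 obtain f g where "X : Ob C" "Y : Ob C" "is_inverse C X Y f g" using assms(2) by (auto simp: isomorphic_def is_iso_def)
 then have "fob F X : Ob C'" "fob F Y : Ob C'" "is_inverse C' (fob F X) (fob F Y) (fmor F X Y f) (fmor F Y X g)"
  by (auto simp: is_inverse_def F.fob_closed F.fmor_closed F.fmor_cmp[symmetric] F.fmor_id)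
 then show ?thesis by (auto simp: isomorphic_def is_iso_def)
qed

lemma hom_zero_ff:
 assumes F: "linear_functor K C C' F" "fully_faithful C C' F" "linear_category K C" "linear_category K C'" and Ob: "X : Ob C" "Y : Ob C"
 shows "hom_zero C' (fob F X) (fob F Y) \<longleftrightarrow> hom_zero C X Y"
proof -
 interpret C: linear_category K C by (rule F)
 have b: "inj_on (fmor F X Y) (mors C X Y)" "fmor F X Y ` mors C X Y = mors C' (fob F X) (fob F Y)"
  using F(2) Ob by (simp_all add: fully_faithful_def bij_betw_def)
 note z = linear_functor_zero[OF F(1,3,4) Ob] C.hom_zero_closed[OF Ob]
 have "hom_zero C X Y" if "hom_zero C' (fob F X) (fob F Y)"
  using C.hom_zeroI[OF Ob] that b z unfolding hom_zero_def inj_on_def by (metis imageI singletonD)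
 then show ?thesis unfolding hom_zero_def b(2)[symmetric] using z(1) by auto
qed

lemma (in linear_category) local_isomorphic:
 assumes Y: "local_object C Y" and X: "X : Ob C" and jp: "j : mors C Y X" "p : mors C X Y"
  and e: "cmp C Y X Y p j = idm C Y" "cmp C X Y X j p = idm C X"
 shows "local_object C X"
proof -
 have Yo: "Y : Ob C" and loc: "unit_or_nilpotent (End C Y)" using Y by (auto simp: local_object_def)
 interpret R: ring "End C X" by (rule End[OF X])
 interpret S: ring "End C Y" by (rule End[OF Yo])
 have "f : Units (End C X) \<or> (EX n::nat. f ^[End C X] n = zr (Mor C X X))" if f: "f : mors C X X" for f
 proof -
  define g where "g = cmp C Y X Y p (cmp C Y X X f j)"
  have g: "g : mors C Y Y" using f jp X Yo by (simp add: g_def)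
  have fg: "f = cmp C X Y X j (cmp C X Y Y g p)"
   unfolding g_def using f jp X Yo by (simp add: cmp_assoc cmp_rule[OF e(2)] e(2))
  have pow: "f ^[End C X] n = cmp C X Y X j (cmp C X Y Y (g ^[End C Y] n) p)" for n :: nat
  proof (induction n)
   case (Suc n)
   have "g ^[End C Y] n : mors C Y Y" using S.nat_pow_closed[of g n] g by simp
   then show ?case using Suc fg g jp X Yo by (simp add: cmp_assoc cmp_rule[OF e(1)])
  qed (use X Yo jp e in simp)
  have i: "is_iso C Y X j" "is_iso C X Y p" using jp e by (auto simp: is_iso_def is_inverse_def)
  consider "is_iso C Y Y g" | n :: nat where "g ^[End C Y] n = zr (Mor C Y Y)"
   using loc g Units_End[OF Yo] unfolding unit_or_nilpotent_def by auto
  then show ?thesis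
  proof cases
   case 1
   have "is_iso C X X f" unfolding fg by (intro is_iso_cmp[OF X Yo X] is_iso_cmp[OF X Yo Yo] i 1)
   then show ?thesis using Units_End[OF X] by simp
  next
   case 2
   then show ?thesis using pow[of n] jp X Yo by auto
  qed
 qed
 moreover have "idm C X ~= zr (Mor C X X)"
 proof
  assume "idm C X = zr (Mor C X X)"
  then have "zero_object C X" using X by (simp add: zero_object_def)
  then have "p = zr (Mor C X Y)" using zero_object_hom(1) jp Yo by blast
  then show False using e(1) jp X Yo local_not_zero[OF Y] by (simp add: zero_object_def)
 qed
 ultimately show ?thesis using X by (simp add: local_object_def unit_or_nilpotent_def)
qed

lemma (in linear_category) automorphism_hom_zero:
 assumes "automorphism K C F" "X : Ob C" "Y : Ob C" shows "hom_zero C (fob F X) (fob F Y) \<longleftrightarrow> hom_zero C X Y"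
 using hom_zero_ff[of K C C F X Y] assms linear_category_axioms by (simp add: automorphism_def)

locale cluster_model = derived_model K H D \<Sigma> \<Delta> E \<eta>
 for K :: "'k ring" and H :: "('k, 'h) module" and D :: "('k, 'o, 'm) lincat" and \<Sigma> \<Delta>
  and E :: "('o, 'm, 'h cplx, 'h dmor) cfunctor" and \<eta> +
 fixes \<tau> F :: "('o, 'm, 'o, 'm) cfunctor" and ph :: "'o => 'm" and C :: "('k, 'o, int => 'm) lincat"
  and \<Sigma>' :: "('o, int => 'm, 'o, int => 'm) cfunctor" and \<Delta>'
 assumes \<tau>: "ar_translation K D \<Sigma> \<tau>" and F_def: "F = cluster_functor D \<Sigma> \<tau>"
  and ph: "natural_iso D D (fcomp F \<Sigma>) (fcomp \<Sigma> F) ph"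
  and C_def: "C = orbit_category D F" and sh'_ob: "fob \<Sigma>' = fob \<Sigma>"
  and C_triangulated: "triangulated_category K C \<Sigma>' \<Delta>'"
  and \<pi>: "linear_functor K D C (orbit_projection D F)"
begin

section \<open>Serre duality and degrees under F\<close>

definition "S = fcomp \<Sigma> \<tau>"

interpretation T: category_automorphism K D \<tau>
 by unfold_locales (use \<tau> in \<open>simp add: ar_translation_def\<close>)

lemma F_aut: "automorphism K D F"
 unfolding F_def cluster_functor_def by (rule automorphism_comp[OF shift_automorphism T.finv_automorphism])

sublocale F: category_automorphism K D F
 by unfold_locales (rule F_aut)

abbreviation Fp where "Fp i == fob (fpow D F i)"

lemma S_ff: "linear_functor K D D S" "fully_faithful D D S"
 using \<tau> by (auto simp: S_def ar_translation_def serre_functor_def equivalence_def)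

lemma S_ob [simp]: "X : Ob D ==> fob S X : Ob D"
 by (rule linear_functor.fob_closed[OF S_ff(1)])

lemma Fp_ob [simp]: "X : Ob D ==> Fp i X : Ob D" and F_ob [simp]: "X : Ob D ==> fob F X : Ob D"
 by (rule F.P(2), assumption) (rule F.F(2))

lemma SF: "X : Ob D ==> fob S (fob F X) = sh (sh X)"
 by (simp add: S_def F_def cluster_functor_def T.finv_ob)

text \<open>A zero space has only the zero form, so the duality bijection leaves no room for a
  nonzero map. The converse applies this to \<open>Y\<close> and \<open>S X\<close> and cancels the
  fully faithful \<open>S\<close>.\<close>

lemma serre_zero: assumes Ob: "X : Ob D" "Y : Ob D" shows "hom_zero D X Y \<longleftrightarrow> hom_zero D Y (fob S X)"
proof -
 obtain \<theta> where \<theta>: "!!X Y. [|X : Ob D; Y : Ob D|] ==> bij_betw (\<theta> X Y) (mors D X Y) (linear_forms K (Mor D Y (fob S X)))"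
  using \<tau> by (auto simp: S_def ar_translation_def serre_functor_def serre_duality_def)
 have *: "hom_zero D X Y" if Ob: "X : Ob D" "Y : Ob D" and z: "hom_zero D Y (fob S X)" for X Y
 proof (rule hom_zeroI[OF Ob])
  fix f assume f: "f : mors D X Y"
  interpret K: field K by (rule K_field)
  have e: "carrier (Mor D Y (fob S X)) = {zr (Mor D Y (fob S X))}" using z by (simp add: hom_zero_def)
  have "l = (\<lambda>x\<in>{zr (Mor D Y (fob S X))}. zr K)" if l: "l : linear_forms K (Mor D Y (fob S X))" for l
  proof -
   have l': "l : {zr (Mor D Y (fob S X))} \<rightarrow>\<^sub>E carrier K" using l by (simp add: linear_forms_def e)
   have "zr (Mor D Y (fob S X)) +[Mor D Y (fob S X)] zr (Mor D Y (fob S X)) = zr (Mor D Y (fob S X))" using Ob by simp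
   then have "l (zr (Mor D Y (fob S X))) = l (zr (Mor D Y (fob S X))) +[K] l (zr (Mor D Y (fob S X)))"
    using l by (auto simp: linear_forms_def e)
   moreover have "l (zr (Mor D Y (fob S X))) : carrier K" using l' by auto
   ultimately have "l (zr (Mor D Y (fob S X))) = zr K" by (metis K.add.l_cancel_one')
   then show ?thesis using l' by (auto simp: fun_eq_iff PiE_def extensional_def)
  qed
  note this[OF bij_betw_apply[OF \<theta>[OF Ob] f]] this[OF bij_betw_apply[OF \<theta>[OF Ob] hom_zero_closed[OF Ob]]]
  then have "\<theta> X Y f = \<theta> X Y (zr (Mor D X Y))" by simp
  then show "f = zr (Mor D X Y)" using \<theta>[OF Ob] f Ob by (auto simp: bij_betw_def inj_on_def)
 qed
 have "hom_zero D (fob S X) (fob S Y) \<longleftrightarrow> hom_zero D X Y"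
  by (rule hom_zero_ff[OF S_ff linear_category_axioms linear_category_axioms Ob])
 then show ?thesis using *[OF Ob] *[OF Ob(2) S_ob[OF Ob(1)]] by blast
qed

text \<open>\<open>S (P k)\<close> is the injective cogenerator in degree \<open>k\<close>; duality
  shows directly that it has no other cohomology.\<close>

lemma hom_zero_PS: assumes "k ~= m" shows "hom_zero D (P m) (fob S (P k))"
 using proj_concentrated[OF P_proj[of m] assms] serre_zero[of "P k" "P m"] by simp

lemma P_suspension_zero:
 assumes Z: "Z : Ob D" shows "hom_zero D (P m) (sh (sh Z)) \<longleftrightarrow> hom_zero D (P (m + 2)) Z"
 using hom_zero_sh[of "P (m + 1)" "sh Z"] hom_zero_sh[of "P (m + 2)" Z] P_suspension[of m] P_suspension[of "m + 1"] Z
 by (simp add: algebra_simps)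

text \<open>Duality moves the test on \<open>F X\<close> to Hom(S (P k), \<Sigma>\<Sigma>X). The
  double shift lowers degrees by two, the projective resolution of \<open>S (P k)\<close> has length
  one and costs one of them, and the net gain is the \<open>- 1\<close>.\<close>

lemma F_degree:
 assumes X: "X : Ob D" and n: "ALL m>n. hom_zero D (P m) X" shows "ALL m>n - 1. hom_zero D (P m) (fob F X)"
proof (intro allI impI)
 fix k assume k: "n - 1 < k"
 let ?Z = "sh (sh X)"
 have Z: "?Z : Ob D" using X by simp
 obtain Q Y a b c where c: "proj k Q" "(Q, fob S (P k), Y, a, b, c) : \<Delta>"
  "(!!m. m ~= k ==> hom_zero D (P m) (fob S (P k))) ==> proj (k - 1) Y" by (rule P_cover[OF S_ob[OF P_ob]]) blast
 have Y: "proj (k - 1) Y" by (rule c(3)) (use hom_zero_PS in auto)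
 have "hom_zero D (fob S (P k)) ?Z"
  by (rule hom_zero_tri[OF c(2) Z proj_vanish[OF c(1) Z] proj_vanish[OF Y Z]]) (use P_suspension_zero[OF X] n k in auto)
 then have "hom_zero D (fob F X) (fob S (P k))" using serre_zero[of "fob F X" "fob S (P k)"] SF[OF X] X by simp
 then show "hom_zero D (P k) (fob F X)" using serre_zero[of "P k" "fob F X"] X by simp
qed

lemma F_degrees:
 assumes X: "X : Ob D" and n: "ALL m>n. hom_zero D (P m) X" shows "ALL m>n - int i. hom_zero D (P m) (Fp (int i) X)"
proof (induction i)
 case (Suc i)
 have "Fp (int (Suc i)) X = fob F (Fp (int i) X)" using F.fpow_Suc_ob[OF X, of "int i"] by (simp add: add.commute)
 then show ?case using F_degree[OF Fp_ob[OF X] Suc.IH] by (simp add: algebra_simps)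
qed (use n in simp)

text \<open>High powers of \<open>F\<close> push \<open>X\<close> below all degrees of
  \<open>Y\<close>, and no maps go from lower to higher degrees. For very negative powers duality
  exchanges the roles, with \<open>S X\<close> as the target.\<close>

lemma F_vanish: assumes X: "X : Ob D" and Y: "Y : Ob D" shows "finite {i. ~ hom_zero D (Fp i X) Y}"
proof -
 have *: "EX N. ALL i>=N. hom_zero D (Fp i X) Y" if X: "X : Ob D" and Y: "Y : Ob D" for X Y
 proof -
  obtain n where n: "ALL m>n. hom_zero D (P m) X" using bounded_above[OF X] by blast
  obtain l where l: "ALL m<l. hom_zero D (P m) Y" using bounded_below[OF Y] by blast
  have "hom_zero D (Fp i X) Y" if i: "i >= max 0 (n - l + 1)" for i
   by (rule hom_zero_degrees[OF Fp_ob[OF X] _ Y, of "n - i"]) (use F_degrees[OF X n, of "nat i"] i l in auto)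
  then show ?thesis by blast
 qed
 obtain N where N: "!!i. i >= N ==> hom_zero D (Fp i X) Y" using *[OF X Y] by blast
 obtain M where M: "!!i. i >= M ==> hom_zero D (Fp i Y) (fob S X)" using *[OF Y S_ob[OF X]] by blast
 have "hom_zero D (Fp i X) Y" if "i <= - M" for i
 proof -
  have "hom_zero D X (Fp (- i) Y)" using M[of "- i"] that serre_zero[OF X Fp_ob[OF Y]] by simp
  then show ?thesis
   using automorphism_hom_zero[OF F.fpow_automorphism X Fp_ob[OF Y], of i "- i"] F.fpow_inverse(1)[OF Y] by simp
 qed
 then have "{i. ~ hom_zero D (Fp i X) Y} <= {- M..N}" using N by (auto simp: not_le) (metis less_imp_le not_le)+
 then show ?thesis by (rule finite_subset) simp
qed

lemma Fsh: assumes X: "X : Ob D" shows "isomorphic D (Fp i (sh X)) (sh (Fp i X))"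
proof -
 have ph': "isomorphic D (fob F (sh Z)) (sh (fob F Z))" if "Z : Ob D" for Z
  using ph that by (auto simp: natural_iso_def isomorphic_def)
 show ?thesis
 proof (induction i rule: int_induct[where k = 0])
  case base show ?case using X isomorphic_refl by simp
 next
  case (step1 i)
  show ?case using isomorphic_trans[OF linear_functor_isomorphic[OF F.F(1) step1(2)] ph'[of "Fp i X"]] X by (simp add: F.fpow_Suc_ob)
 next
  case (step2 i)
  have e: "Fp i Z = fob F (Fp (i - 1) Z)" if "Z : Ob D" for Z using F.fpow_Suc_ob[OF that, of "i - 1"] by simp
  have "isomorphic D (fob F (sh (Fp (i - 1) X))) (fob F (Fp (i - 1) (sh X)))"
   using isomorphic_trans[OF ph'[of "Fp (i - 1) X"] isomorphic_sym[OF step2(2)[unfolded e[OF X] e[OF sh_ob[OF X]]]]] X by simp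
  from linear_functor_isomorphic[OF automorphismD(1)[OF F.finv_automorphism] this] isomorphic_sym
  show ?case using X by (simp add: F.finv_ob)
 qed
qed

lemma D_ext_sym:
 assumes X: "X : Ob D" and Y: "Y : Ob D" and h: "!!i. hom_zero D (Fp i X) (sh Y)" shows "hom_zero D (Fp i Y) (sh X)"
proof -
 \<comment> \<open>The hypothesis is taken at \<open>- i + 1\<close>, one power of \<open>F\<close>
   ahead, so that an \<open>F\<close> is present to turn \<open>S\<close> into the double
   shift.\<close>
 have "hom_zero D (sh Y) (fob S (fob F (Fp (- i) X)))"
  using h[of "- i + 1"] serre_zero[OF F_ob[OF Fp_ob[OF X]] sh_ob[OF Y]] F.fpow_Suc_ob[OF X, of "- i"] by simp
 then have "hom_zero D Y (sh (Fp (- i) X))" using X Y SF[of "Fp (- i) X"] hom_zero_sh[OF Y, of "sh (Fp (- i) X)"] by simp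
 then have "hom_zero D Y (Fp (- i) (sh X))" using hom_zero_right isomorphic_retract[OF Fsh[OF X]] Y by blast
 then show ?thesis
  using automorphism_hom_zero[OF F.fpow_automorphism Y Fp_ob[OF sh_ob[OF X]], of i "- i"] F.fpow_inverse(1)[OF sh_ob[OF X]] by simp
qed

section \<open>The orbit category\<close>

sublocale C: triangulated_category K C \<Sigma>' \<Delta>'
 by (rule C_triangulated)

lemma C_simps [simp]:
 "Ob C = Ob D"
 "f : mors C X Y \<longleftrightarrow> (ALL i. f i : mors D (Fp i X) Y) & finite {i. f i ~= zr (Mor D (Fp i X) Y)}"
 "zr (Mor C X Y) = (%i. zr (Mor D (Fp i X) Y))"
 "f +[Mor C X Y] g = (%i. f i +[Mor D (Fp i X) Y] g i)"
 "c *[Mor C X Y] f = (%i. c *[Mor D (Fp i X) Y] f i)"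
 by (simp_all add: C_def orbit_category_def)

definition hg :: "'o => 'o => int => 'm => int => 'm" where
 "hg X Y i a = (%j. if j = i then a else zr (Mor D (Fp j X) Y))"

lemma hg_mor: "[|X : Ob D; Y : Ob D; a : mors D (Fp i X) Y|] ==> hg X Y i a : mors C X Y"
 by (auto simp: hg_def intro: finite_subset[of _ "{i}"])

lemma idm_C: "idm C X = hg X X 0 (idm D X)"
 by (simp add: C_def orbit_category_def hg_def fun_eq_iff)

lemma cmp_hg_component:
 assumes X: "X : Ob D" "Y : Ob D" "Z : Ob D" and a: "a : mors D (Fp i X) Y" and r: "r : mors C Y Z"
 shows "cmp C X Y Z r (hg X Y i a) n =
  cmp D (Fp n X) (Fp (n - i) Y) Z (r (n - i)) (fmor (fpow D F (n - i)) (Fp i X) Y a)"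
proof -
 interpret V: abelian_group "Mor D (Fp n X) Z" by (rule hom_group) (use X in auto)
 have e: "Fp (n - i) (Fp i X) = Fp n X" using F.fpow_add_ob[OF X(1), of "n - i" i] by simp
 have m: "r (n - i) : mors D (Fp (n - i) Y) Z" "fmor (fpow D F (n - i)) (Fp i X) Y a : mors D (Fp n X) (Fp (n - i) Y)"
  using r F.P(5)[OF Fp_ob[OF X(1)] X(2) a, of "n - i"] e by auto
 have "{j. hg X Y i a j ~= zr (Mor D (Fp j X) Y)} = (if a = zr (Mor D (Fp i X) Y) then {} else {i})" by (auto simp: hg_def)
 moreover have "fmor (fpow D F (n - i)) (Fp i X) Y (zr (Mor D (Fp i X) Y)) = zr (Mor D (Fp n X) (Fp (n - i) Y))"
  using linear_functor_zero[OF F.P(1) linear_category_axioms linear_category_axioms Fp_ob[OF X(1)] X(2)] e by metis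
 ultimately show ?thesis using m X by (simp add: C_def orbit_category_def hg_def)
qed

lemma cmp_hg:
 assumes X: "X : Ob D" "Y : Ob D" "Z : Ob D" and a: "a : mors D (Fp i X) Y" and b: "b : mors D (Fp j Y) Z"
 obtains c where "c : mors D (Fp (j + i) X) Z" "cmp C X Y Z (hg Y Z j b) (hg X Y i a) = hg X Z (j + i) c"
  "c = cmp D (Fp (j + i) X) (Fp j Y) Z b (fmor (fpow D F j) (Fp i X) Y a)"
proof -
 have e: "Fp j (Fp i X) = Fp (j + i) X" for j using F.fpow_add_ob[OF X(1)] by simp
 have m: "fmor (fpow D F j) (Fp i X) Y a : mors D (Fp (j + i) X) (Fp j Y)" for j
  using F.P(5)[OF Fp_ob[OF X(1)] X(2) a, of j] e by simp
 show thesis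
 proof (rule that)
  show "cmp D (Fp (j + i) X) (Fp j Y) Z b (fmor (fpow D F j) (Fp i X) Y a) : mors D (Fp (j + i) X) Z"
   using X b m by simp
  have "cmp C X Y Z (hg Y Z j b) (hg X Y i a) n = hg X Z (j + i) (cmp D (Fp (j + i) X) (Fp j Y) Z b (fmor (fpow D F j) (Fp i X) Y a)) n" for n
   using cmp_hg_component[OF X a hg_mor[OF X(2,3) b], of n] m[of "n - i"] X by (cases "n = j + i") (auto simp: hg_def)
  then show "cmp C X Y Z (hg Y Z j b) (hg X Y i a) = hg X Z (j + i) (cmp D (Fp (j + i) X) (Fp j Y) Z b (fmor (fpow D F j) (Fp i X) Y a))" ..
 qed simp
qed

text \<open>Finite support: a morphism is rebuilt by adding its homogeneous components one at a
  time.\<close>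

lemma C_induct:
 assumes X: "X : Ob D" "Y : Ob D" and g: "g : mors C X Y" and zero: "R (zr (Mor C X Y))"
  and step: "!!i h. [|h : mors C X Y; R h|] ==> R (hg X Y i (g i) +[Mor C X Y] h)"
 shows "R g"
proof -
 have gm: "g i : mors D (Fp i X) Y" for i using g by simp
 let ?r = "%I i. if i : I then g i else zr (Mor D (Fp i X) Y)"
 have "?r I : mors C X Y & R (?r I)" if "finite I" for I
  using that
 proof (induction I rule: finite_induct)
  case empty then show ?case using zero X by simp
 next
  case (insert i I)
  have e: "?r (insert i I) = hg X Y i (g i) +[Mor C X Y] ?r I"
   using insert(2) gm X by (auto simp: fun_eq_iff hg_def)
  show ?case unfolding e
   using step[of "?r I" i] insert.IH C.hom_add_closed[of X Y "hg X Y i (g i)" "?r I"] hg_mor[OF X gm] X by (auto simp del: C_simps(2-))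
 qed
 from this[of "{i. g i ~= zr (Mor D (Fp i X) Y)}"] g have "R (?r {i. g i ~= zr (Mor D (Fp i X) Y)})" by simp
 moreover have "?r {i. g i ~= zr (Mor D (Fp i X) Y)} = g" by auto
 ultimately show ?thesis by simp
qed

lemma C_hom_zero:
 assumes X: "X : Ob D" "Y : Ob D" shows "hom_zero C X Y \<longleftrightarrow> (ALL i. hom_zero D (Fp i X) Y)"
proof
 assume h: "hom_zero C X Y"
 show "ALL i. hom_zero D (Fp i X) Y"
 proof (intro allI hom_zeroI)
  fix i a assume "a : mors D (Fp i X) Y"
  then have "hg X Y i a = zr (Mor C X Y)" using C.hom_zeroD[OF h] hg_mor[OF X] by blast
  from fun_cong[OF this, of i] show "a = zr (Mor D (Fp i X) Y)" by (simp add: hg_def)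
 qed (use X in auto)
next
 assume "ALL i. hom_zero D (Fp i X) Y"
 then show "hom_zero C X Y" using X by (intro C.hom_zeroI) (auto simp: fun_eq_iff hom_zero_def)
qed

lemma C_hom_fl: assumes X: "X : Ob D" "Y : Ob D" shows "fl K (Mor C X Y)"
proof (rule finlen_separated[of _ _ "{i. ~ hom_zero D (Fp i X) Y}" "%i. Mor D (Fp i X) Y" "%i f. f i"])
 show "module K (Mor C X Y)" using C.mor_module X by simp
 fix f assume f: "f : carrier (Mor C X Y)" and z: "!!i. i : {i. ~ hom_zero D (Fp i X) Y} ==> f i = zr (Mor D (Fp i X) Y)"
 have "f i = zr (Mor D (Fp i X) Y)" for i using z[of i] f hom_zeroD[of "Fp i X" Y "f i"] by auto
 then show "f = zr (Mor C X Y)" by auto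
qed (use X F_vanish[OF X] mor_module D_hom_fl in \<open>auto simp: lin_map_def\<close>)

text \<open>\<open>x\<close> is homogeneous and each homogeneous component of \<open>f\<close> strictly shrinks the left ideal generated by \<open>x\<close>,
 since otherwise \<open>x = h x\<close> with \<open>h\<close> a nilpotent endomorphism of degree 0.\<close>

lemma homogeneous_shrink:
 assumes Y: "local_object D Y" and f: "a : mors D (Fp i Y) Y" "i = 0 ==> a ~: Units (End D Y)"
  and x: "x : mors D (Fp d Y) Y" and r: "r : mors C Y Y"
  and e: "hg Y Y d x = cmp C Y Y Y r (cmp C Y Y Y (hg Y Y i a) (hg Y Y d x))"
 shows "hg Y Y d x = zr (Mor C Y Y)"
proof -
 have Yo: "Y : Ob D" and loc: "unit_or_nilpotent (End D Y)" using Y by (auto simp: local_object_def)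
 interpret R: ring "End D Y" by (rule End[OF Yo])
 have ri: "r (- i) : mors D (Fp (- i) Y) Y" using r by simp
 obtain y where y: "y : mors D (Fp (i + d) Y) Y" "cmp C Y Y Y (hg Y Y i a) (hg Y Y d x) = hg Y Y (i + d) y"
  using cmp_hg[OF Yo Yo Yo x f(1)] by metis
 obtain c where c: "c : mors D (Fp (- i + (i + d)) Y) Y" "cmp C Y Y Y (hg Y Y (- i) (r (- i))) (hg Y Y (i + d) y) = hg Y Y (- i + (i + d)) c"
  "c = cmp D (Fp (- i + (i + d)) Y) (Fp (- i) Y) Y (r (- i)) (fmor (fpow D F (- i)) (Fp (i + d) Y) Y y)"
  by (rule cmp_hg[OF Yo Yo Yo y(1) ri])
 \<comment> \<open>Comparison in degree \<open>d\<close> leaves only the component of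
   \<open>r\<close> in degree \<open>- i\<close>, so \<open>r\<close> may be replaced by a
   homogeneous morphism.\<close>
 have "x = cmp C Y Y Y r (hg Y Y (i + d) y) d" using fun_cong[OF e, of d] y(2) by (simp add: hg_def)
 then have "x = c" using cmp_hg_component[OF Yo Yo Yo y(1) r, of d] c(3) by simp
 then have x1: "hg Y Y d x = cmp C Y Y Y (hg Y Y (- i) (r (- i))) (cmp C Y Y Y (hg Y Y i a) (hg Y Y d x))"
  using c(2) y(2) by simp
 obtain h where h: "h : mors D (Fp (- i + i) Y) Y" "cmp C Y Y Y (hg Y Y (- i) (r (- i))) (hg Y Y i a) = hg Y Y (- i + i) h"
  "h = cmp D (Fp (- i + i) Y) (Fp (- i) Y) Y (r (- i)) (fmor (fpow D F (- i)) (Fp i Y) Y a)"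
  by (rule cmp_hg[OF Yo Yo Yo f(1) ri])
 have h': "h : mors D Y Y" "cmp C Y Y Y (hg Y Y (- i) (r (- i))) (hg Y Y i a) = hg Y Y 0 h"
  "h = cmp D Y (Fp (- i) Y) Y (r (- i)) (fmor (fpow D F (- i)) (Fp i Y) Y a)" using h by auto
 have am: "fmor (fpow D F (- i)) (Fp i Y) Y a : mors D Y (Fp (- i) Y)"
  using F.P(5)[OF Fp_ob[OF Yo] Yo f(1), of "- i"] F.fpow_inverse(2)[OF Yo] by simp
 have "h ~: Units (End D Y)"
 proof
  assume u: "h : Units (End D Y)"
  show False
  proof (cases "i = 0")
   case True
   then have "a : Units (End D Y)" using R.Unit_factors[OF loc, of "r 0" a] u h'(3) ri f(1) Yo by simp
   then show False using f(2) True by simp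
  next
   case False
   obtain g where g: "g : mors D Y Y" "cmp D Y Y Y g h = idm D Y" using u Units_End[OF Yo] by (auto simp: is_iso_def is_inverse_def)
   \<comment> \<open>In nonzero degree, a unit \<open>h\<close> would make \<open>Y\<close> a
     retract of its \<open>F\<close>-translates by all nonnegative multiples of \<open>- i\<close>,
     giving nonzero maps in infinitely many degrees.\<close>
   have "retraction D Y (Fp (- i) Y) (fmor (fpow D F (- i)) (Fp i Y) Y a) (cmp D (Fp (- i) Y) Y Y g (r (- i)))"
    using g h' am ri Yo by (simp add: retraction_def cmp_assoc)
   then have r1: "retract D Y (Fp (- i) Y)" by (auto simp: retract_def)
   have rn: "retract D Y (Fp (- i * int n) Y)" for n
   proof (induction n)
    case 0 show ?case using isomorphic_retract[OF isomorphic_refl[OF Yo]] by simp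
   next
    case (Suc n)
    have "retract D (Fp (- i) Y) (Fp (- i) (Fp (- i * int n) Y))" by (rule linear_functor_retract[OF F.P(1) Suc])
    moreover have "Fp (- i) (Fp (- i * int n) Y) = Fp (- i * int (Suc n)) Y"
     using F.fpow_add_ob[OF Yo, of "- i" "- i * int n"] by (simp add: algebra_simps)
    ultimately show ?case using retract_trans[OF r1] by simp
   qed
   have "~ hom_zero D Y Y" using local_not_zero[OF Y] hom_zeroD[of Y Y "idm D Y"] Yo by (auto simp: zero_object_def)
   then have "range (%n. - i * int n) <= {j. ~ hom_zero D (Fp j Y) Y}" using hom_zero_left[OF _ rn Yo] by auto
   moreover have "infinite (range (%n. - i * int n))" 
    using False finite_imageD[of "%n. - i * int n" UNIV] infinite_UNIV_nat by (auto simp: inj_on_def)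
   ultimately show False using F_vanish[OF Yo Yo] finite_subset by blast
  qed
 qed
 then obtain m :: nat where m: "h ^[End D Y] m = zr (Mor D Y Y)" using loc h'(1) by (auto simp: unit_or_nilpotent_def)
 note C = hg_mor[OF Yo Yo]
 have hx: "cmp C Y Y Y (hg Y Y 0 h) (hg Y Y d x) = hg Y Y d x"
  using x1 C.cmp_assoc[of Y Y Y Y "hg Y Y d x" "hg Y Y i a" "hg Y Y (- i) (r (- i))"] h'(2) C[OF x] C[OF f(1)] C[OF ri] Yo by simp
 have "cmp C Y Y Y (hg Y Y 0 (h ^[End D Y] n)) (hg Y Y d x) = hg Y Y d x" for n :: nat
 proof (induction n)
  case 0
  show ?case using C.cmp_id_left[of Y Y "hg Y Y d x"] C[OF x] Yo by (simp add: idm_C del: C_simps(2-))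
 next
  case (Suc n)
  have p: "h ^[End D Y] n : mors D (Fp 0 Y) Y" "h : mors D (Fp 0 Y) Y" using R.nat_pow_closed[of h n] h'(1) by auto
  have "cmp C Y Y Y (hg Y Y 0 (h ^[End D Y] n)) (hg Y Y 0 h) = hg Y Y 0 (h ^[End D Y] Suc n)"
   by (rule cmp_hg[OF Yo Yo Yo p(2,1)]) simp
  then show ?case using Suc hx C[OF p(1)] C[OF p(2)] C[OF x] Yo C.cmp_assoc[of Y Y Y Y "hg Y Y d x"] by (metis C_simps(1))
 qed
 moreover have "hg Y Y 0 (zr (Mor D Y Y)) = zr (Mor C Y Y)" by (auto simp: hg_def)
 ultimately show ?thesis using C.cmp_zero_left[of Y Y Y "hg Y Y d x"] C[OF x] Yo m by (metis C_simps(1))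
qed

text \<open>Invertibility is decided in degree zero. If the degree-zero part of \<open>f\<close> is
  no unit, a power of \<open>f\<close> kills each homogeneous morphism, by induction on the length
  of the left ideal it generates, which every component of \<open>f\<close> makes smaller. If it is
  a unit, it is normalised to the identity and \<open>f\<close> becomes 1 minus a nilpotent
  element.\<close>

lemma C_local:
 assumes Y: "local_object D Y" shows "local_object C Y"
proof -
 have Yo: "Y : Ob D" and loc: "unit_or_nilpotent (End D Y)" using Y by (auto simp: local_object_def)
 have YC: "Y : Ob C" using Yo by simp
 interpret R: ring "End C Y" by (rule C.End[OF YC])
 interpret RD: ring "End D Y" by (rule End[OF Yo])
 note V = C.mor_module[OF YC YC] and hg = hg_mor[OF Yo Yo]
 have nz: "zr (Mor D Y Y) ~: Units (End D Y)" "idm D Y ~= zr (Mor D Y Y)"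
  using loc RD.Units_r_inv[of "zr (Mor D Y Y)"] RD.Units_inv_closed[of "zr (Mor D Y Y)"] Yo by (auto simp: unit_or_nilpotent_def)
 have nil: "EX N::nat. f ^[End C Y] N = zr (Mor C Y Y)" if f: "f : mors C Y Y" "f 0 ~: Units (End D Y)" for f
 proof -
  have pow: "f ^[End C Y] N : mors C Y Y" for N :: nat using R.nat_pow_closed[of f N] f(1) by simp
  have "EX N::nat. cmp C Y Y Y (f ^[End C Y] N) (hg Y Y d x) = zr (Mor C Y Y)" if "x : mors D (Fp d Y) Y" for d x
   using that
  proof (induction "len K (Mor C Y Y) ((%r. cmp C Y Y Y r (hg Y Y d x)) ` mors C Y Y)" arbitrary: d x rule: less_induct)
   case less
   note xm = hg[OF less.prems]
   let ?I = "%x. (%r. cmp C Y Y Y r x) ` mors C Y Y"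
   have sub: "submodule (?I z) K (Mor C Y Y)" if "z : mors C Y Y" for z
    by (rule lin_map_image[OF V V C.lin_map_cmp_right[OF YC YC YC that] submodule_carrier[OF V]])
   show ?case
   proof (cases "hg Y Y d x = zr (Mor C Y Y)")
    case True
    then show ?thesis unfolding True using C.cmp_zero_right[OF YC YC YC pow[of 0]] by blast
   next
    case False
    have comp: "EX N::nat. cmp C Y Y Y (f ^[End C Y] N) (cmp C Y Y Y (hg Y Y i (f i)) (hg Y Y d x)) = zr (Mor C Y Y)" for i
    proof -
     have fi: "f i : mors D (Fp i Y) Y" using f(1) by simp
     obtain y where y: "y : mors D (Fp (i + d) Y) Y" "cmp C Y Y Y (hg Y Y i (f i)) (hg Y Y d x) = hg Y Y (i + d) y"
      using cmp_hg[OF Yo Yo Yo less.prems fi] by metis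
     have "hg Y Y d x ~: ?I (hg Y Y (i + d) y)"
      using homogeneous_shrink[OF Y fi _ less.prems] y(2) f(2) False by auto
     moreover have "hg Y Y d x : ?I (hg Y Y d x)" using C.cmp_id_left[OF YC YC xm] C.idm_closed[OF YC] by (metis imageI)
     moreover have "?I (hg Y Y (i + d) y) <= ?I (hg Y Y d x)"
     proof clarify
      fix r assume r: "r : mors C Y Y"
      have "cmp C Y Y Y r (hg Y Y (i + d) y) = cmp C Y Y Y (cmp C Y Y Y r (hg Y Y i (f i))) (hg Y Y d x)"
       unfolding y(2)[symmetric] by (rule C.cmp_assoc[OF YC YC YC YC xm hg[OF fi] r, symmetric])
      then show "cmp C Y Y Y r (hg Y Y (i + d) y) : ?I (hg Y Y d x)" using C.cmp_closed[OF YC YC YC hg[OF fi] r] by blast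
     qed
     ultimately have "?I (hg Y Y (i + d) y) < ?I (hg Y Y d x)" by blast
     from len_strict[OF finlen_mono[OF C_hom_fl[OF Yo Yo]] this sub[OF hg[OF y(1)]] sub[OF xm]]
     show ?thesis unfolding y(2) using less.hyps[OF _ y(1)] C.cmp_closed[OF YC YC YC xm] by blast
    qed
    let ?R = "%h. EX N::nat. cmp C Y Y Y (f ^[End C Y] N) (cmp C Y Y Y h (hg Y Y d x)) = zr (Mor C Y Y)"
    have "?R f"
    proof (rule C_induct[OF Yo Yo f(1), where R = ?R])
     show "?R (zr (Mor C Y Y))" using C.cmp_zero_left[OF YC YC YC xm] C.cmp_zero_right[OF YC YC YC pow] by auto
     fix i h assume h: "h : mors C Y Y" "?R h"
     obtain N :: nat where N: "cmp C Y Y Y (f ^[End C Y] N) (cmp C Y Y Y (hg Y Y i (f i)) (hg Y Y d x)) = zr (Mor C Y Y)" using comp by blast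
     obtain M :: nat where M: "cmp C Y Y Y (f ^[End C Y] M) (cmp C Y Y Y h (hg Y Y d x)) = zr (Mor C Y Y)" using h(2) by blast
     have g: "hg Y Y i (f i) : mors C Y Y" by (rule hg) (use f(1) in simp)
     note m = C.cmp_closed[OF YC YC YC xm g] C.cmp_closed[OF YC YC YC xm h(1)]
     \<comment> \<open>Powers killing the two summands are merged into one; as powers of
       \<open>f\<close> commute, either factor may act first.\<close>
     have nm: "f ^[End C Y] (N + M) = cmp C Y Y Y (f ^[End C Y] N) (f ^[End C Y] M)"
      "f ^[End C Y] (N + M) = cmp C Y Y Y (f ^[End C Y] M) (f ^[End C Y] N)"
      using R.nat_pow_mult[of f N M] R.nat_pow_mult[of f M N] f(1) by (simp_all del: C_simps add: add.commute)
     have z1: "cmp C Y Y Y (f ^[End C Y] (N + M)) (cmp C Y Y Y (hg Y Y i (f i)) (hg Y Y d x)) = zr (Mor C Y Y)"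
      unfolding nm(2) C.cmp_assoc[OF YC YC YC YC m(1) pow pow] N by (rule C.cmp_zero_right[OF YC YC YC pow])
     have z2: "cmp C Y Y Y (f ^[End C Y] (N + M)) (cmp C Y Y Y h (hg Y Y d x)) = zr (Mor C Y Y)"
      unfolding nm(1) C.cmp_assoc[OF YC YC YC YC m(2) pow pow] M by (rule C.cmp_zero_right[OF YC YC YC pow])
     show "?R (hg Y Y i (f i) +[Mor C Y Y] h)"
      unfolding C.cmp_add_left[OF YC YC YC xm g h(1)]
      by (rule exI[of _ "N + M"]) (simp only: C.cmp_add_right[OF YC YC YC m pow] z1 z2 C.hom_l_zero[OF YC YC C.hom_zero_closed[OF YC YC]])
    qed
    then obtain N :: nat where N: "cmp C Y Y Y (f ^[End C Y] N) (cmp C Y Y Y f (hg Y Y d x)) = zr (Mor C Y Y)" by blast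
    have "cmp C Y Y Y (f ^[End C Y] Suc N) (hg Y Y d x) = zr (Mor C Y Y)"
     using N C.cmp_assoc[OF YC YC YC YC xm f(1) pow] by (simp del: C_simps)
    then show ?thesis by blast
   qed
  qed
  \<comment> \<open>The identity is homogeneous of degree zero, and killing it means
    nilpotency.\<close>
  from this[of "idm D Y" 0] obtain N :: nat where "cmp C Y Y Y (f ^[End C Y] N) (idm C Y) = zr (Mor C Y Y)"
   using Yo unfolding idm_C by auto
  then show ?thesis using C.cmp_id_right[OF YC YC pow] by auto
 qed
 have "f : Units (End C Y)" if f: "f : mors C Y Y" "f 0 : Units (End D Y)" for f
 proof -
  obtain b where b: "b : mors D Y Y" "cmp D Y Y Y (f 0) b = idm D Y" "cmp D Y Y Y b (f 0) = idm D Y"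
   using f(2) Units_End[OF Yo] by (auto simp: is_iso_def is_inverse_def)
  have f0: "f 0 : mors D Y Y" using f(1) spec[of "%i. f i : mors D (Fp i Y) Y" 0] by simp
  let ?u = "hg Y Y 0 b" and ?v = "hg Y Y 0 (f 0)"
  have uv: "?u : mors C Y Y" "?v : mors C Y Y" using hg[of b 0] hg[of "f 0" 0] b f0 by auto
  have "cmp C Y Y Y ?u ?v = idm C Y" "cmp C Y Y Y ?v ?u = idm C Y"
   by (rule cmp_hg[OF Yo Yo Yo, of "f 0" 0 b 0], use b f0 in \<open>simp_all add: idm_C\<close>)
    (rule cmp_hg[OF Yo Yo Yo, of b 0 "f 0" 0], use b f0 in \<open>simp_all add: idm_C\<close>)
  then have u: "?u : Units (End C Y)" using uv C.Units_End[OF YC] by (auto simp: is_iso_def is_inverse_def simp del: C_simps)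
  define t where "t = cmp C Y Y Y f ?u"
  have t: "t : mors C Y Y" unfolding t_def by (rule C.cmp_closed[OF YC YC YC uv(1) f(1)])
  have t0: "t 0 = idm D Y" unfolding t_def using cmp_hg_component[OF Yo Yo Yo, of b 0 f 0] b f(1) by simp
  define g where "g = idm C Y -[End C Y] t"
  have g: "g : mors C Y Y" using R.minus_closed[of "idm C Y" t] t C.idm_closed[OF YC] by (simp add: g_def del: C_simps)
  have tc: "t : carrier (End C Y)" using t by (simp del: C_simps)
  have "idm C Y -[End C Y] g = t" using R.one_minus_one_minus[OF tc] by (simp add: g_def del: C_simps)
  have "t +[Mor C Y Y] g = idm C Y" unfolding g_def C.End_minus[OF YC C.idm_closed[OF YC] t] by (rule C.hom_add_diff[OF YC YC C.idm_closed[OF YC] t])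
  from fun_cong[OF this, of 0] have "idm D Y +[Mor D Y Y] g 0 = idm D Y" using t0 by (simp add: idm_C hg_def)
  moreover have g0: "g 0 : mors D Y Y" using g spec[of "%i. g i : mors D (Fp i Y) Y" 0] by simp
  ultimately have "g 0 = zr (Mor D Y Y)" using RD.add.l_cancel_one'[of "idm D Y" "g 0"] Yo by simp
  then obtain N :: nat where "g ^[End C Y] N = zr (Mor C Y Y)" using nil[OF g] nz(1) by auto
  then have "t : Units (End C Y)"
   using R.one_minus_nilpotent_Unit[of g N] g \<open>idm C Y -[End C Y] g = t\<close> by (simp del: C_simps)
  then have "t **[End C Y] inv\<^bsub>End C Y\<^esub> ?u : Units (End C Y)"
   by (rule R.Units_m_closed[OF _ R.Units_inv_Units[OF u]])
  moreover have "t **[End C Y] inv\<^bsub>End C Y\<^esub> ?u = f"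
   using R.m_assoc[of f ?u "inv\<^bsub>End C Y\<^esub> ?u"] u f(1) R.Units_inv_closed[OF u] R.Units_r_inv[OF u] R.r_one[of f] uv by (simp add: t_def del: C_simps)
  ultimately show ?thesis by simp
 qed
 moreover have "idm C Y ~= zr (Mor C Y Y)"
 proof
  assume "idm C Y = zr (Mor C Y Y)"
  from fun_cong[OF this, of 0] nz(2) show False by (simp add: idm_C hg_def)
 qed
 ultimately show ?thesis unfolding local_object_def unit_or_nilpotent_def End_simps using nil YC by blast
qed

section \<open>Decompositions and symmetry in the orbit category\<close>

lemma C_local_decomposition:
 assumes X: "X : Ob C" shows "EX S<=Ob C. in_add C S X & (ALL Y:S. local_object C Y & retract C Y X)"
proof -
 let ?\<pi> = "orbit_projection D F"
 have o: "fob ?\<pi> Z = Z" for Z by (simp add: orbit_projection_def)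
 note l = linear_functor_thru[OF \<pi> linear_category_axioms C.is_linear_category, unfolded o]
 obtain S where S: "S <= Ob D" "in_add D S X" "ALL Y:S. local_object D Y & retract D Y X"
  using D_local_decomposition[of X] X unfolding C_simps(1) by blast
 have "fmor ?\<pi> X X (idm D X) = idm C X" using linear_functor.fmor_id[OF \<pi>, of X] X o by simp
 then have "in_add C S X" using l[OF S(1), of X X "idm D X"] S(2) X by (simp add: in_add_def)
 moreover have "retract C Y X" if "retract D Y X" for Y using linear_functor_retract[OF \<pi> that] o by simp
 ultimately show ?thesis using S C_local by (intro exI[of _ S]) auto
qed

lemma ext_symmetric: "ext_symmetric_category K C \<Sigma>' \<Delta>'"
proof
 show "fl K (Mor C X Y)" if "X : Ob C" "Y : Ob C" for X Y using C_hom_fl that by simp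
 show "EX S<=Ob C. in_add C S X & (ALL Y:S. local_object C Y & retract C Y X)" if "X : Ob C" for X
  by (rule C_local_decomposition[OF that])
 show "hom_zero C Y (fob \<Sigma>' X)" if "X : Ob C" "Y : Ob C" "hom_zero C X (fob \<Sigma>' Y)" for X Y
  using that D_ext_sym[of X Y] C_hom_zero[of X "sh Y"] C_hom_zero[of Y "sh X"] by (simp add: sh'_ob)
 show "local_object C X" if X: "indecomposable C X" for X
 proof -
  have Xo: "X : Ob C" and nz: "~ zero_object C X" using X by (auto simp: indecomposable_def)
  obtain S where S: "S <= Ob C" "in_add C S X" "ALL Y:S. local_object C Y & retract C Y X"
   using C_local_decomposition[OF Xo] by blast
  have "S ~= {}"
   using C.in_add_hom_zero_left[OF S(1,2) _ Xo] C.hom_zeroD[of X X "idm C X"] C.idm_closed[OF Xo] nz Xo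
   by (auto simp: zero_object_def)
  \<comment> \<open>A local retract of an indecomposable object has a zero complement, so it is
    isomorphic to the whole and hands over its locality.\<close>
  then obtain Y where Y: "local_object C Y" "retract C Y X" using S(3) by blast
  obtain Z where Z: "direct_sum2 C X Y Z" using Y(2) C.retract_summand by (auto simp: summand_def)
  then have z: "zero_object C Z" using X C.local_not_zero[OF Y(1)] by (auto simp: indecomposable_def)
  obtain j1 p1 j2 p2 where d: "X : Ob C" "Y : Ob C" "Z : Ob C"
   "j1 : mors C Y X" "p1 : mors C X Y" "j2 : mors C Z X" "p2 : mors C X Z"
   "cmp C Y X Y p1 j1 = idm C Y" "cmp C Z X Z p2 j2 = idm C Z"
   "cmp C Y X Z p2 j1 = zr (Mor C Y Z)" "cmp C Z X Y p1 j2 = zr (Mor C Z Y)"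
   "cmp C X Y X j1 p1 +[Mor C X X] cmp C X Z X j2 p2 = idm C X" using Z by (rule C.direct_sum2E) blast
  have "cmp C X Y X j1 p1 = idm C X"
   using d(12) C.zero_object_hom(1)[OF z d(1,6)] C.cmp_zero_left[OF d(1,3,1,7)] C.hom_r_zero[OF d(1,1) C.cmp_closed[OF d(1,2,1,5,4)]] by simp
  then show ?thesis by (rule C.local_isomorphic[OF Y(1) d(1,4,5,8)])
 qed
qed

end

section \<open>Mutation in the cluster category\<close>

theorem proposition6p9:
  fixes K :: "'k ring" and H :: "('k, 'h) module"
    and D :: "('k, 'o, 'm) lincat"
    and \<Sigma>\<^sub>D \<tau> F :: "('o, 'm, 'o, 'm) cfunctor"
    and \<Delta>\<^sub>D :: "('o, 'm) tri set"
    and \<phi> :: "'o \<Rightarrow> 'm"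
    and C :: "('k, 'o, int \<Rightarrow> 'm) lincat"
    and \<Sigma> :: "('o, int \<Rightarrow> 'm, 'o, int \<Rightarrow> 'm) cfunctor"
    and \<Delta> :: "('o, int \<Rightarrow> 'm) tri set"
    and T M B B' M\<^sub>1 M\<^sub>2 :: 'o
    and f u a b c d :: "int \<Rightarrow> 'm"
  assumes H: "fd_algebra K H" "hereditary H"
    and D: "bounded_derived_category K H D \<Sigma>\<^sub>D \<Delta>\<^sub>D"
    and \<tau>: "ar_translation K D \<Sigma>\<^sub>D \<tau>"
    and F: "F = cluster_functor D \<Sigma>\<^sub>D \<tau>"
    and \<phi>: "triangle_functor K D \<Sigma>\<^sub>D \<Delta>\<^sub>D D \<Sigma>\<^sub>D \<Delta>\<^sub>D F \<phi>"
    and C: "C = orbit_category D F"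
    and \<Sigma>: "\<Sigma> = orbit_shift D \<Sigma>\<^sub>D F \<phi>"
    and \<Delta>: "triangulated_category K C \<Sigma> \<Delta>"
    and \<pi>: "triangle_functor K D \<Sigma>\<^sub>D \<Delta>\<^sub>D C \<Sigma> \<Delta> (orbit_projection D F) (\<lambda>X. idm C (fob \<Sigma> X))"
    and T: "almost_complete_tilting C \<Sigma> T"
    and M: "complement C \<Sigma> T M"
    and f: "minimal_right_approximation C (add_closure C T) B M f"
    and u: "minimal_left_approximation C (add_closure C T) M B' u"
    and tri1: "(M\<^sub>1, B, M, a, f, b) \<in> \<Delta>"
    and tri2: "(M, B', M\<^sub>2, u, c, d) \<in> \<Delta>"
  shows "isomorphic C M\<^sub>1 M\<^sub>2 \<and>
         complement C \<Sigma> T M\<^sub>1 \<and> \<not> isomorphic C M\<^sub>1 M \<and>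
         (\<forall>N. complement C \<Sigma> T N \<and> \<not> isomorphic C N M \<longrightarrow> isomorphic C N M\<^sub>1)"
proof -
 obtain E \<eta> where E: "triangle_functor K D \<Sigma>\<^sub>D \<Delta>\<^sub>D (derived_category H) (derived_shift H) (derived_triangles H) E \<eta>"
  "equivalence K D (derived_category H) E" and DT: "triangulated_category K D \<Sigma>\<^sub>D \<Delta>\<^sub>D"
  using D by (auto simp: bounded_derived_category_def)
 interpret cluster_model K H D \<Sigma>\<^sub>D \<Delta>\<^sub>D E \<eta> \<tau> F \<phi> C \<Sigma> \<Delta>
  using H \<tau> F \<phi> C \<Delta> \<pi> E DT
  by (simp add: cluster_model_def derived_model_def fd_algebra_over_def derived_model_axioms_def
   cluster_model_axioms_def triangle_functor_def \<Sigma> orbit_shift_def)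
 show ?thesis
  by (rule ext_symmetric_category.mutation[OF ext_symmetric T M f u tri1 tri2])
qed

end
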